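(* Let $d\ge1$ and $0<\alpha<\min\{d,2\}$, and consider Riesz potentials (the isotropic $\alpha$-stable process) on $\mathbb R^d$. (1) Let $\phi$ be a measure function. Then the following statements are equivalent: (i) $\liminf_{t\to0}\phi(t)\,t^{\alpha-d}=0$. (ii) There exists a closed set $A$ in $\mathbb R^d$ such that $\mathbb R^d\setminus A$ is connected, $m_\phi(A)=0$, and $\|\varepsilon_x^A\|=1$ for every $x\in\mathbb R^d$. (2) There exists a closed set $A$ in $\mathbb R^d$ such that $\mathbb R^d\setminus A$ is connected, the Hausdorff dimension of $A$ is $d-\alpha$, and $\|\varepsilon_x^A\|=1$ for every $x\in\mathbb R^d$.
   Context: $\mathcal W$ is the set of all increasing limits of Riesz potentials $G\mu\colon x\mapsto\int|x-y|^{\alpha-d}\,d\mu(y)$, $\mu$ a finite measure on $\mathbb R^d$ with compact support. For $A\subset\mathbb R^d$ and $u\in\mathcal W$, $R_u^A:=\inf\{v\in\mathcal W\colon v\ge u\text{ on }A\}$; $\varepsilon_x^A$ is the unique measure on $\mathbb R^d$ such that $\int u\,d\varepsilon_x^A=R_u^A(x)$ for every $u\in\mathcal W$, and $\|\varepsilon_x^A\|=R_1^A(x)$ is its total mass. (For Borel $A$, $\varepsilon_x^A$ is the distribution, at the time $T_A=\inf\{t\ge0\colon X_t\in A\}$ of first entry into $A$, of the isotropic $\alpha$-stable process $(X_t)$ started at $x$, so $\|\varepsilon_x^A\|=P^x[T_A<\infty]$.) A measure function is an increasing function $\phi\colon(0,\infty)\to(0,\infty]$ with $\lim_{t\to0}\phi(t)=0$.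 For $E\subset\mathbb R^d$ and $\rho>0$, $$M_\phi^{(\rho)}(E):=\inf\Big\{\sum_{n\in\mathbb N}\phi(r_n)\colon E\subset\bigcup_{n\in\mathbb N}B(x_n,r_n),\ r_n<\rho\text{ for each }n\Big\},\qquad m_\phi(E):=\lim_{\rho\to0}M_\phi^{(\rho)}(E),$$ with open Euclidean balls $B(x,r)$. The Hausdorff dimension of $E$ is the infimum of all $\gamma>0$ such that $m_{t^\gamma}(E)<\infty$, where $m_{t^\gamma}$ is $m_\phi$ for $\phi(t)=t^\gamma$.
   Formalization: For d = 1 a closed set with connected complement is empty, all of R or contains a half-line, so (2) fails, and (1) fails for φ(t) = t; connectedness of R^d \ A is therefore required only for d ≥ 2. *)

theory Defs
  imports "HOL-Analysis.Analysis"
begin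

section \<open>Riesz potentials and balayage\<close>

definition riesz_kernel :: "real \<Rightarrow> 'a::euclidean_space \<Rightarrow> 'a \<Rightarrow> ennreal" where
  "riesz_kernel \<alpha> x y =
     (if x = y then \<infinity> else ennreal (dist x y powr (\<alpha> - real DIM('a))))"

definition riesz_potential :: "real \<Rightarrow> 'a::euclidean_space measure \<Rightarrow> 'a \<Rightarrow> ennreal" where
  "riesz_potential \<alpha> \<mu> x = (\<integral>\<^sup>+ y. riesz_kernel \<alpha> x y \<partial>\<mu>)"

definition compactly_supported_measure :: "'a::euclidean_space measure \<Rightarrow> bool" where
  "compactly_supported_measure \<mu> \<longleftrightarrow>
     sets \<mu> = sets borel \<and> finite_measure \<mu> \<and> (\<exists>K. compact K \<and> emeasure \<mu> (- K) = 0)"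

definition potential_limits :: "real \<Rightarrow> ('a::euclidean_space \<Rightarrow> ennreal) set" where
  "potential_limits \<alpha> =
     {u. \<exists>\<mu>. (\<forall>n::nat. compactly_supported_measure (\<mu> n)) \<and>
             incseq (\<lambda>n. riesz_potential \<alpha> (\<mu> n)) \<and>
             u = (\<lambda>x. SUP n. riesz_potential \<alpha> (\<mu> n) x)}"

definition reduced ::
    "real \<Rightarrow> ('a::euclidean_space \<Rightarrow> ennreal) \<Rightarrow> 'a set \<Rightarrow> 'a \<Rightarrow> ennreal" where
  "reduced \<alpha> u A x = (INF v \<in> {v \<in> potential_limits \<alpha>. \<forall>y\<in>A. u y \<le> v y}. v x)"

definition swept_measure ::
    "real \<Rightarrow> 'a::euclidean_space \<Rightarrow> 'a set \<Rightarrow> 'a measure" where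
  "swept_measure \<alpha> x A =
     (THE \<nu>. sets \<nu> = sets borel \<and>
             (\<forall>u \<in> potential_limits \<alpha>. (\<integral>\<^sup>+ y. u y \<partial>\<nu>) = reduced \<alpha> u A x))"


section \<open>Hausdorff measures and dimension\<close>

text \<open>Only the values of a measure function on the positive reals are relevant;
  ``increasing'' is understood in the weak sense.\<close>

definition measure_function :: "(real \<Rightarrow> ennreal) \<Rightarrow> bool" where
  "measure_function \<phi> \<longleftrightarrow>
     mono_on {0<..} \<phi> \<and> (\<forall>t>0. 0 < \<phi> t) \<and> (\<phi> \<longlongrightarrow> 0) (at_right 0)"

definition hausdorff_content ::
    "(real \<Rightarrow> ennreal) \<Rightarrow> real \<Rightarrow> 'a::euclidean_space set \<Rightarrow> ennreal" where
  "hausdorff_content \<phi> \<rho> E =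
     Inf {(\<Sum>n. \<phi> (r n)) | (x :: nat \<Rightarrow> 'a) r.
            (\<forall>n. 0 < r n \<and> r n < \<rho>) \<and> E \<subseteq> (\<Union>n. ball (x n) (r n))}"

definition hausdorff_measure ::
    "(real \<Rightarrow> ennreal) \<Rightarrow> 'a::euclidean_space set \<Rightarrow> ennreal" where
  "hausdorff_measure \<phi> E = Lim (at_right 0) (\<lambda>\<rho>. hausdorff_content \<phi> \<rho> E)"

text \<open>The infimum is taken in the reals: the set is bounded below by 0 and contains
  every exponent exceeding the dimension of the space, so it is never empty.\<close>

definition hausdorff_dimension :: "'a::euclidean_space set \<Rightarrow> real" where
  "hausdorff_dimension E =
     Inf {\<gamma>. 0 < \<gamma> \<and> hausdorff_measure (\<lambda>t. ennreal (t powr \<gamma>)) E < \<infinity>}"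


section \<open>Connectedness of the complement\<close>

text \<open>On the real line, a closed set with connected complement is empty or contains a
  half-line. The empty set has swept measure 0, and a half-line has dimension
  1 and infinite length, so no closed subset of the line with connected complement
  has total swept mass 1 everywhere and dimension \<open>1 - \<alpha>\<close> (or length 0, as would be
  required for \<open>\<phi> t = t\<close>). Connectedness of the complement is therefore
  only meaningful as a requirement in dimension at least 2, and it is imposed only there.\<close>

end

theory Submission
  imports Defs "HOL-Probability.Probability"
begin

text \<open>
Write `d` for the dimension, `\<beta> = \<alpha> / 2` and `|x - y|^(\<alpha> - d)` for the Riesz kernel.

If the lower limit in (i) is positive, a set of `\<phi>`-measure 0 is null for the Hausdorff measure of
dimension `d - \<alpha>`. Point masses `r^(d - \<alpha>)` at the centres of covering balls of radius `r` have
potential at least 1 on the set and arbitrarily small total mass, so the swept measure of a point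
outside the set vanishes (`unavoidable_imp_not_null`). The same argument bounds the dimension in (2)
from below.

For the converse, the set is a product of `d` copies of a periodic Cantor set in the line (locale
`cantor`). At each level a cell is divided into `N^d` blocks with one smaller cell in each, where
lengths shrink by the factor `R = N M`. If `N^d` is at least `2 R^(d - \<alpha>)`, uniform measures on
cells have potentials bounded as for balls of the same size (`uniform_potential`); if it is also at
most a constant multiple of `R^(d - \<alpha>)`, the cells of that level form a cover whose `\<phi>`-content is
small as soon as `\<phi>(r) r^(\<alpha> - d)` is small for the radius `r` of these cells. Both can be achieved
with arbitrarily large `R` (`branching_numbers`), and condition (i) provides the radii
(`scale_step`). The complement is connected in dimension at least 2, because coordinates can be
moved to 0 one after another (`connected_complement_A`).

This set is unavoidable: the bound on potentials shows that equilibrium measures of single cells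
have mass bounded below, so by periodicity their potentials at a point `x` in the same block are at
least a constant `\<delta> > 0` that is independent of `x` (`cell_equilibrium`). Therefore the limit `w` of
the equilibrium potentials of bounded parts of the set is at least `\<delta>` everywhere, and the maximum
principle improves this to `(1 - \<delta>) w + \<delta> \<le> w`, that is `w = 1`. Since `w` is the reduced function
of 1, the swept mass is 1 (`swept_mass_one`).

The potential theory behind these arguments starts from the observation that the kernel is the
mixture of the heat kernels at times `s` with density proportional to `s^(\<beta> - 1)`. The overshoot
density of the `\<beta>`-stable subordinator above level `a` yields a probability kernel whose convolution
with the Riesz kernel removes exactly the times below `a` (`sweep_conv_kernel`). Averaging with
these kernels replaces the generator of the process, and it gives the domination principle, as small
times contribute `O(a^(\<beta> + 1))` away from the diagonal while far jumps have probability of order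
`a^\<beta>`. Balayage on compact sets with enough mass near each point is obtained by minimising the
energy (`balayage_exists`), using vague compactness and the continuity theorem of Evans and
Vasilesco; on the whole set the swept measure is a vague limit. Finally, a measure with the defining
property of the swept measure is unique (`measure_uniqueness`), so the definite description in its
definition denotes the measure that was constructed.
\<close>

lemma nn_integral_nonzero:
  fixes f :: "'a::euclidean_space \<Rightarrow> ennreal"
  assumes [measurable]: "f \<in> borel_measurable borel" and G: "open G" "G \<noteq> {}" and pos: "\<And>x. x \<in> G \<Longrightarrow> f x \<noteq> 0"
  shows "(\<integral>\<^sup>+ x. f x \<partial>lborel) \<noteq> 0"
proof
  assume "(\<integral>\<^sup>+ x. f x \<partial>lborel) = 0"
  then have "AE x in lborel. f x = 0" by (subst (asm) nn_integral_0_iff_AE) auto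
  then have "AE x in lborel. x \<notin> G" by eventually_elim (use pos in auto)
  then have "G \<in> null_sets lborel" using G(1) by (subst (asm) AE_iff_null_sets[symmetric]) auto
  then have "negligible G" by (simp add: negligible_iff_null_sets null_sets_completionI)
  then show False using open_not_negligible[OF G] by simp
qed

section \<open>Mixtures of Gaussian kernels\<close>

definition gauss :: "real \<Rightarrow> 'a::euclidean_space \<Rightarrow> real" where
  "gauss s x = (2 * pi * s) powr (- real DIM('a) / 2) * exp (- (norm x)\<^sup>2 / (2 * s))"

text \<open>In probabilistic terms, `mix h` is the density at `z` of Brownian motion integrated against `h(s)
  ds`. All kernels below have this form, so that identities between kernels on the space reduce to
  identities between functions of one time variable.\<close>

definition mix :: "(real \<Rightarrow> ennreal) \<Rightarrow> 'a::euclidean_space \<Rightarrow> ennreal" where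
  "mix h z = (\<integral>\<^sup>+ s. h s * ennreal (gauss s z) * indicator {0<..} s \<partial>lborel)"

definition time_conv :: "(real \<Rightarrow> ennreal) \<Rightarrow> (real \<Rightarrow> ennreal) \<Rightarrow> real \<Rightarrow> ennreal" where
  "time_conv h1 h2 r = (\<integral>\<^sup>+ s. h1 s * h2 (r - s) * indicator {0<..<r} s \<partial>lborel)"

lemma gauss_nonneg[simp]: "0 \<le> gauss s x"
  by (simp add: gauss_def)

lemma gauss_pos: "0 < s \<Longrightarrow> 0 < gauss s x"
  by (simp add: gauss_def)

lemma gauss_commute: "gauss s (x - y) = gauss s (y - x)"
  by (simp add: gauss_def norm_minus_commute)

lemma gauss_measurable[measurable]:
  "(\<lambda>(s, x). gauss s (x::'a::euclidean_space)) \<in> borel_measurable (borel \<Otimes>\<^sub>M borel)"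
  unfolding gauss_def by measurable

lemma gauss_measurable'[measurable (raw)]:
  assumes [measurable]: "f \<in> borel_measurable M" "g \<in> borel_measurable M"
  shows "(\<lambda>w. gauss (f w) (g w :: 'a::euclidean_space)) \<in> borel_measurable M"
  unfolding gauss_def by measurable

lemma gauss_prod:
  fixes x :: "'a::euclidean_space"
  assumes s: "0 < s"
  shows "gauss s x = (\<Prod>b\<in>Basis. normal_density 0 (sqrt s) (x \<bullet> b))"
proof -
  have "(\<Prod>b\<in>(Basis::'a set). normal_density 0 (sqrt s) (x \<bullet> b))
      = (1 / sqrt (2 * pi * s)) ^ DIM('a) * exp (\<Sum>b\<in>Basis. - (x \<bullet> b)\<^sup>2 / (2 * s))"
    using s by (simp add: normal_density_def prod.distrib prod_dividef exp_sum power_one_over)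
  also have "(1 / sqrt (2 * pi * s)) ^ DIM('a) = (2 * pi * s) powr (- real DIM('a) / 2)"
    using s by (simp add: powr_half_sqrt[symmetric] powr_minus_divide[symmetric] powr_realpow[symmetric] powr_powr)
  also have "(\<Sum>b\<in>Basis. - (x \<bullet> b)\<^sup>2 / (2 * s)) = - (norm x)\<^sup>2 / (2 * s)"
    
  proof -
    have "(norm x)\<^sup>2 = (\<Sum>b\<in>Basis. (x \<bullet> b)\<^sup>2)"
      by (subst power2_norm_eq_inner, subst euclidean_inner) (simp add: power2_eq_square)
    then show ?thesis by (simp add: sum_divide_distrib sum_negf)
  qed
  finally show ?thesis by (simp add: gauss_def)
qed

lemma normal_density_conv:
  assumes "0 < s" "0 < t"
  shows "(\<integral>\<^sup>+ y. ennreal (normal_density 0 (sqrt s) (x - y) * normal_density 0 (sqrt t) (y - z)) \<partial>lborel)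
     = ennreal (normal_density 0 (sqrt (s + t)) (x - z))"
proof -
  have "(\<integral>\<^sup>+ y. ennreal (normal_density 0 (sqrt s) (x - y) * normal_density 0 (sqrt t) (y - z)) \<partial>lborel)
     = (\<integral>\<^sup>+ y. ennreal (normal_density 0 (sqrt s) ((x - z) - y) * normal_density 0 (sqrt t) y) \<partial>lborel)"
    by (subst nn_integral_real_affine[of _ 1 z]) (auto simp: algebra_simps)
  then show ?thesis
    using conv_normal_density_zero_mean[of "sqrt s" "sqrt t"] assms by (simp add: fun_eq_iff)
qed

lemma gauss_conv:
  fixes x z :: "'a::euclidean_space"
  assumes "0 < s" "0 < t"
  shows "(\<integral>\<^sup>+ y. ennreal (gauss s (x - y)) * ennreal (gauss t (y - z)) \<partial>lborel) = ennreal (gauss (s + t) (x - z))"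
proof -
  have "(\<integral>\<^sup>+ y. ennreal (gauss s (x - y)) * ennreal (gauss t (y - z)) \<partial>lborel) =
    (\<integral>\<^sup>+ y. (\<Prod>b\<in>Basis. ennreal (normal_density 0 (sqrt s) (x \<bullet> b - y \<bullet> b) * normal_density 0 (sqrt t) (y \<bullet> b - z \<bullet> b))) \<partial>(lborel :: 'a measure))"
    using assms by (intro nn_integral_cong)
      (simp add: gauss_prod prod.distrib[symmetric] prod_ennreal inner_diff_left ennreal_mult[symmetric] prod_nonneg)
  also have "\<dots> = (\<Prod>b\<in>(Basis::'a set). ennreal (normal_density 0 (sqrt (s + t)) (x \<bullet> b - z \<bullet> b)))"
    by (subst nn_integral_lborel_prod) (simp_all add: normal_density_conv[OF assms])
  also have "\<dots> = ennreal (gauss (s + t) (x - z))"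
    using assms by (simp add: gauss_prod prod_ennreal inner_diff_left)
  finally show ?thesis .
qed

lemma gauss_integral:
  assumes "0 < s" shows "(\<integral>\<^sup>+ x. ennreal (gauss s (x::'a::euclidean_space)) \<partial>lborel) = 1"
proof -
  have "(\<integral>\<^sup>+ x. ennreal (gauss s (x::'a)) \<partial>lborel) = (\<integral>\<^sup>+ x. (\<Prod>b\<in>Basis. ennreal (normal_density 0 (sqrt s) (x \<bullet> b))) \<partial>(lborel::'a measure))"
    using assms by (simp add: gauss_prod prod_ennreal)
  also have "\<dots> = 1"
    using assms by (subst nn_integral_lborel_prod) (auto simp: nn_integral_eq_integral integral_normal_density)
  finally show ?thesis .
qed

lemma mix_measurable[measurable]:
  assumes [measurable]: "h \<in> borel_measurable borel"
  shows "mix h \<in> borel_measurable (borel :: 'a::euclidean_space measure)"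
  unfolding mix_def by measurable

lemma time_conv_measurable[measurable]:
  assumes [measurable]: "h1 \<in> borel_measurable borel" "h2 \<in> borel_measurable borel"
  shows "time_conv h1 h2 \<in> borel_measurable borel"
proof -
  have "(\<lambda>r. \<integral>\<^sup>+ s. h1 s * h2 (r - s) * indicator {0<..<r} s \<partial>lborel) = (\<lambda>r. \<integral>\<^sup>+ s. h1 s * h2 (r - s) * (if 0 < s \<and> s < r then 1 else 0) \<partial>lborel)"
    by (auto simp: indicator_def fun_eq_iff intro!: nn_integral_cong)
  also have "\<dots> \<in> borel_measurable borel"
    by measurable
  finally show ?thesis
    by (simp add: time_conv_def[abs_def])
qed

lemma mix_commute: "mix h (x - y) = mix h (y - x)"
  by (simp add: mix_def gauss_commute)

lemma mix_mono: "(\<And>s. 0 < s \<Longrightarrow> h s \<le> h' s) \<Longrightarrow> mix h z \<le> mix h' z"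
  unfolding mix_def by (intro nn_integral_mono) (auto simp: indicator_def intro: mult_right_mono)

lemma mix_cong: "(\<And>s. 0 < s \<Longrightarrow> h s = h' s) \<Longrightarrow> mix h z = mix h' z"
  unfolding mix_def by (intro nn_integral_cong) (auto simp: indicator_def)

lemma mix_add:
  assumes [measurable]: "h \<in> borel_measurable borel" "h' \<in> borel_measurable borel"
  shows "mix (\<lambda>s. h s + h' s) (z::'a::euclidean_space) = mix h z + mix h' z"
  unfolding mix_def by (subst nn_integral_add[symmetric]) (auto simp: distrib_right)

lemma mix_integral:
  assumes [measurable]: "h \<in> borel_measurable borel"
  shows "(\<integral>\<^sup>+ z. mix h (z::'a::euclidean_space) \<partial>lborel) = (\<integral>\<^sup>+ s. h s * indicator {0<..} s \<partial>lborel)"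
proof -
  have "(\<integral>\<^sup>+ z. mix h (z::'a) \<partial>lborel) = (\<integral>\<^sup>+ s. (\<integral>\<^sup>+ z. h s * ennreal (gauss s (z::'a)) * indicator {0<..} s \<partial>lborel) \<partial>lborel)"
    unfolding mix_def by (rule lborel_pair.Fubini') measurable
  also have "\<dots> = (\<integral>\<^sup>+ s. h s * indicator {0<..} s \<partial>lborel)"
  proof (intro nn_integral_cong)
    fix s :: real
    have "(\<integral>\<^sup>+ z. h s * ennreal (gauss s (z::'a)) * indicator {0<..} s \<partial>lborel) = (\<integral>\<^sup>+ z. (h s * indicator {0<..} s) * ennreal (gauss s (z::'a)) \<partial>lborel)"
      by (simp add: ac_simps)
    also have "\<dots> = h s * indicator {0<..} s"
      by (subst nn_integral_cmult) (auto simp: gauss_integral indicator_def)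
    finally show "(\<integral>\<^sup>+ z. h s * ennreal (gauss s (z::'a)) * indicator {0<..} s \<partial>lborel) = h s * indicator {0<..} s" .
  qed
  finally show ?thesis .
qed

text \<open>Spatial convolution of mixtures is convolution in time, by the semigroup property `gauss_conv`.\<close>

lemma mix_conv:
  fixes x z :: "'a::euclidean_space"
  assumes [measurable]: "h1 \<in> borel_measurable borel" "h2 \<in> borel_measurable borel"
  shows "(\<integral>\<^sup>+ y. mix h1 (x - y) * mix h2 (y - z) \<partial>lborel) = mix (time_conv h1 h2) (x - z)"
proof -
  let ?i = "\<lambda>s::real. indicator {0<..} s :: ennreal"
  have "(\<integral>\<^sup>+ y. mix h1 (x - y) * mix h2 (y - z) \<partial>lborel)
     = (\<integral>\<^sup>+ y. (\<integral>\<^sup>+ s. (\<integral>\<^sup>+ t. (h1 s * ?i s * (h2 t * ?i t)) * (ennreal (gauss s (x - y)) * ennreal (gauss t (y - z))) \<partial>lborel) \<partial>lborel) \<partial>lborel)"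
    unfolding mix_def
    by (subst nn_integral_multc[symmetric], measurable, intro nn_integral_cong, subst nn_integral_cmult[symmetric], measurable)
       (simp add: ac_simps)
  also have "\<dots> = (\<integral>\<^sup>+ s. (\<integral>\<^sup>+ y. (\<integral>\<^sup>+ t. (h1 s * ?i s * (h2 t * ?i t)) * (ennreal (gauss s (x - y)) * ennreal (gauss t (y - z))) \<partial>lborel) \<partial>lborel) \<partial>lborel)"
    by (rule lborel_pair.Fubini') measurable
  also have "\<dots> = (\<integral>\<^sup>+ s. (\<integral>\<^sup>+ t. (\<integral>\<^sup>+ y. (h1 s * ?i s * (h2 t * ?i t)) * (ennreal (gauss s (x - y)) * ennreal (gauss t (y - z))) \<partial>lborel) \<partial>lborel) \<partial>lborel)"
    by (intro nn_integral_cong lborel_pair.Fubini') measurable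
  also have "\<dots> = (\<integral>\<^sup>+ s. (\<integral>\<^sup>+ t. (h1 s * ?i s * (h2 t * ?i t)) * ennreal (gauss (s + t) (x - z)) \<partial>lborel) \<partial>lborel)"
    by (intro nn_integral_cong, subst nn_integral_cmult) (auto simp: indicator_def gauss_conv)
  also have "\<dots> = (\<integral>\<^sup>+ s. (\<integral>\<^sup>+ r. (h1 s * ?i s * (h2 (r - s) * ?i (r - s))) * ennreal (gauss r (x - z)) \<partial>lborel) \<partial>lborel)"
  proof (rule nn_integral_cong)
    fix s :: real
    show "(\<integral>\<^sup>+ t. (h1 s * ?i s * (h2 t * ?i t)) * ennreal (gauss (s + t) (x - z)) \<partial>lborel)
      = (\<integral>\<^sup>+ r. (h1 s * ?i s * (h2 (r - s) * ?i (r - s))) * ennreal (gauss r (x - z)) \<partial>lborel)"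
      by (subst (2) nn_integral_real_affine[of _ 1 s]) (auto simp: algebra_simps)
  qed
  also have "\<dots> = (\<integral>\<^sup>+ r. (\<integral>\<^sup>+ s. (h1 s * ?i s * (h2 (r - s) * ?i (r - s))) * ennreal (gauss r (x - z)) \<partial>lborel) \<partial>lborel)"
    by (rule lborel_pair.Fubini') measurable
  also have "\<dots> = mix (time_conv h1 h2) (x - z)"
    unfolding mix_def time_conv_def
  proof (rule nn_integral_cong)
    fix r :: real
    have "(\<integral>\<^sup>+ s. (h1 s * ?i s * (h2 (r - s) * ?i (r - s))) * ennreal (gauss r (x - z)) \<partial>lborel)
       = (\<integral>\<^sup>+ s. (h1 s * h2 (r - s) * indicator {0<..<r} s) * (ennreal (gauss r (x - z)) * ?i r) \<partial>lborel)"
      by (intro nn_integral_cong) (auto simp: indicator_def)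
    also have "\<dots> = (\<integral>\<^sup>+ s. (h1 s * h2 (r - s) * indicator {0<..<r} s) \<partial>lborel) * (ennreal (gauss r (x - z)) * ?i r)"
      by (rule nn_integral_multc) measurable
    finally show "(\<integral>\<^sup>+ s. (h1 s * ?i s * (h2 (r - s) * ?i (r - s))) * ennreal (gauss r (x - z)) \<partial>lborel)
      = (\<integral>\<^sup>+ s. (h1 s * h2 (r - s) * indicator {0<..<r} s) \<partial>lborel) * ennreal (gauss r (x - z)) * ?i r"
      by (simp add: ac_simps)
  qed
  finally show ?thesis .
qed

section \<open>The Riesz kernel as a mixture, and the overshoot density\<close>

lemma powr_exp_bound:
  fixes p x :: real
  assumes "0 < p" "0 \<le> x"
  shows "x powr p * exp (- x) \<le> p powr p"
proof -
  have "x / p \<le> exp (x / p)"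
    using exp_ge_add_one_self[of "x / p"] by linarith
  then have "x \<le> p * exp (x / p)"
    using assms by (simp add: field_simps)
  then have "x powr p \<le> (p * exp (x / p)) powr p"
    using assms by (intro powr_mono2) auto
  also have "\<dots> = p powr p * exp x"
    using assms by (simp add: powr_mult exp_powr_real)
  finally show ?thesis
    by (simp add: exp_minus field_simps)
qed

lemma nn_integral_powr_head:
  fixes p c :: real
  assumes "- 1 < p" "0 \<le> c"
  shows "(\<integral>\<^sup>+ s. ennreal (s powr p) * indicator {0..c} s \<partial>lborel) = ennreal (c powr (p + 1) / (p + 1))"
  by (rule nn_integral_has_integral_lebesgue'[OF _ has_integral_powr_from_0[OF assms]]) auto

lemma nn_integral_powr_tail:
  fixes p c :: real
  assumes "p < - 1" "0 < c"
  shows "(\<integral>\<^sup>+ s. ennreal (s powr p) * indicator {c..} s \<partial>lborel) = ennreal (- (c powr (p + 1)) / (p + 1))"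
  by (rule nn_integral_has_integral_lebesgue'[OF _ has_integral_powr_to_inf[OF assms]]) auto

lemma nn_integral_scale_pos:
  fixes f :: "real \<Rightarrow> ennreal" and c :: real
  assumes [measurable]: "f \<in> borel_measurable borel" and c: "0 < c"
  shows "(\<integral>\<^sup>+ s. f s * indicator {0<..} s \<partial>lborel) = ennreal c * (\<integral>\<^sup>+ s. f (c * s) * indicator {0<..} s \<partial>lborel)"
  using c by (subst nn_integral_real_affine[of _ c 0])
    (auto simp: indicator_def zero_less_mult_iff intro!: arg_cong2[of _ _ _ _ "(*)"] nn_integral_cong)

lemma nn_integral_substitution_set:
  fixes f g g' :: "real \<Rightarrow> real"
  assumes S: "S \<in> sets borel" and gS: "g ` S \<in> sets borel"
    and der: "\<And>x. x \<in> S \<Longrightarrow> (g has_field_derivative g' x) (at x)"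
    and inj: "inj_on g S" and [measurable]: "f \<in> borel_measurable borel"
    and f0: "\<And>x. x \<in> g ` S \<Longrightarrow> 0 \<le> f x" and g0: "\<And>x. x \<in> S \<Longrightarrow> 0 \<le> g' x"
    and fin: "(\<integral>\<^sup>+ x. ennreal (f x) * indicator (g ` S) x \<partial>lborel) < \<infinity>"
  shows "(\<integral>\<^sup>+ x. ennreal (g' x * f (g x)) * indicator S x \<partial>lborel) = (\<integral>\<^sup>+ x. ennreal (f x) * indicator (g ` S) x \<partial>lborel)"
proof -
  note [measurable] = S gS
  have "set_integrable lborel (g ` S) f"
    unfolding set_integrable_def
  proof (rule integrableI_nonneg)
    show "AE x in lborel. 0 \<le> indicator (g ` S) x *\<^sub>R f x" using f0 by (auto simp: indicator_def)
    have "(\<integral>\<^sup>+ x. ennreal (indicator (g ` S) x *\<^sub>R f x) \<partial>lborel) = (\<integral>\<^sup>+ x. ennreal (f x) * indicator (g ` S) x \<partial>lborel)"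
      by (intro nn_integral_cong) (auto simp: indicator_def)
    with fin show "(\<integral>\<^sup>+ x. ennreal (indicator (g ` S) x *\<^sub>R f x) \<partial>lborel) < \<infinity>" by simp
  qed measurable
  then have ai: "f absolutely_integrable_on (g ` S)"
    unfolding set_integrable_def by (subst integrable_completion) auto
  then have hi: "(f has_integral integral (g ` S) f) (g ` S)"
    using absolutely_integrable_on_def by blast
  have "(\<lambda>x. \<bar>g' x\<bar> * f (g x)) absolutely_integrable_on S \<and> integral S (\<lambda>x. \<bar>g' x\<bar> * f (g x)) = integral (g ` S) f"
    using has_absolute_integral_change_of_variables_1'[of S g g' f "integral (g ` S) f"] ai S inj
    by (auto intro: DERIV_subset[OF der])
  then have "((\<lambda>x. \<bar>g' x\<bar> * f (g x)) has_integral integral (g ` S) f) S"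
    using absolutely_integrable_on_def by (metis integrable_integral)
  then have "((\<lambda>x. g' x * f (g x)) has_integral integral (g ` S) f) S"
    by (rule has_integral_eq[rotated]) (auto simp: g0)
  then have "(\<integral>\<^sup>+ x. ennreal (g' x * f (g x)) * indicator S x \<partial>lborel) = ennreal (integral (g ` S) f)"
    by (rule nn_integral_has_integral_lebesgue'[rotated]) (auto simp: g0 f0)
  also have "\<dots> = (\<integral>\<^sup>+ x. ennreal (f x) * indicator (g ` S) x \<partial>lborel)"
    by (rule nn_integral_has_integral_lebesgue'[OF _ hi, symmetric]) (auto simp: f0)
  finally show ?thesis .
qed

locale riesz =
  fixes \<alpha> :: real and TA :: "'a::euclidean_space itself"
  assumes alpha_pos: "0 < \<alpha>" and alpha_dim: "\<alpha> < real DIM('a)" and alpha_less_2: "\<alpha> < 2"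
begin

abbreviation pot :: "'a measure \<Rightarrow> 'a \<Rightarrow> ennreal" where "pot \<equiv> riesz_potential \<alpha>"

abbreviation kern :: "'a \<Rightarrow> 'a \<Rightarrow> ennreal" where "kern \<equiv> riesz_kernel \<alpha>"

definition \<beta> :: real where "\<beta> = \<alpha> / 2"

lemma beta_pos: "0 < \<beta>" and beta_less_1: "\<beta> < 1" and beta_dim: "\<beta> < real DIM('a) / 2"
  using alpha_pos alpha_dim alpha_less_2 by (auto simp: \<beta>_def)

definition norm_const :: real where
  "norm_const = enn2real (\<integral>\<^sup>+ s. ennreal (s powr (\<beta> - 1) * ((2 * pi * s) powr (- real DIM('a) / 2) * exp (- 1 / (2 * s)))) * indicator {0<..} s \<partial>lborel)"

text \<open>The integrand is bounded near 0, where the exponential beats every power, and it is dominated by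
  `s powr (- q)` with `q > 1` at infinity.\<close>

lemma norm_const_pos: "0 < norm_const"
  and norm_const_eq: "(\<integral>\<^sup>+ s. ennreal (s powr (\<beta> - 1) * ((2 * pi * s) powr (- real DIM('a) / 2) * exp (- 1 / (2 * s)))) * indicator {0<..} s \<partial>lborel) = ennreal norm_const"
proof -
  let ?d = "real DIM('a)"
  let ?f = "\<lambda>s::real. s powr (\<beta> - 1) * ((2 * pi * s) powr (- ?d / 2) * exp (- 1 / (2 * s)))"
  define q where "q = ?d / 2 + 1 - \<beta>"
  have q: "1 < q" using beta_dim by (simp add: q_def)
  define c where "c = (2 * pi) powr (- ?d / 2)"
  have c: "0 < c" by (simp add: c_def)
  have f: "?f s = c * s powr (- q) * exp (- 1 / (2 * s))" if "0 < s" for s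
  proof -
    have "s powr (\<beta> - 1) * s powr (- ?d / 2) = s powr (- q)"
      by (subst powr_add[symmetric]) (auto simp: q_def algebra_simps)
    then show ?thesis
      using that by (simp add: powr_mult c_def ac_simps)
  qed
  have le1: "?f s \<le> c * (2 powr q * q powr q)" if s: "0 < s" for s
  proof -
    have "s powr (- q) * exp (- 1 / (2 * s)) = 2 powr q * ((1 / (2 * s)) powr q * exp (- (1 / (2 * s))))"
      using s by (simp add: powr_divide powr_mult powr_minus field_simps)
    also have "\<dots> \<le> 2 powr q * q powr q"
      using powr_exp_bound[of q "1 / (2 * s)"] s q by (intro mult_left_mono) auto
    finally have *: "s powr (- q) * exp (- 1 / (2 * s)) \<le> 2 powr q * q powr q" .
    have "?f s = c * (s powr (- q) * exp (- 1 / (2 * s)))"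
      using f[OF s] by (simp only: mult.assoc)
    also have "\<dots> \<le> c * (2 powr q * q powr q)"
      using c * by (intro mult_left_mono) auto
    finally show ?thesis .
  qed
  have le2: "?f s \<le> c * s powr (- q)" if s: "0 < s" for s
    using s c unfolding f[OF s] by (auto intro!: mult_left_le)
  let ?I = "\<integral>\<^sup>+ s. ennreal (?f s) * indicator {0<..} s \<partial>lborel"
  have "?I \<le> (\<integral>\<^sup>+ s. ennreal (c * (2 powr q * q powr q)) * indicator {0..1} s + ennreal c * (ennreal (s powr (- q)) * indicator {1..} s) \<partial>lborel)"
  proof (rule nn_integral_mono)
    fix s :: real
    consider "s \<le> 0" | "0 < s" "s \<le> 1" | "1 < s" by linarith
    then show "ennreal (?f s) * indicator {0<..} s
      \<le> ennreal (c * (2 powr q * q powr q)) * indicator {0..1} s + ennreal c * (ennreal (s powr (- q)) * indicator {1..} s)"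
    proof cases
      case 2
      then show ?thesis using ennreal_leI[OF le1[of s]] by (simp add: add_increasing2)
    next
      case 3
      then show ?thesis using ennreal_leI[OF le2[of s]] c by (simp add: ennreal_mult[symmetric])
    qed auto
  qed
  also have "\<dots> = ennreal (c * (2 powr q * q powr q)) + ennreal c * (\<integral>\<^sup>+ s. (ennreal (s powr (- q)) * indicator {1..} s) \<partial>lborel)"
    by (subst nn_integral_add) (auto simp: nn_integral_cmult nn_integral_cmult_indicator)
  also have "\<dots> < \<infinity>"
    using q by (subst nn_integral_powr_tail) (auto simp: ennreal_mult[symmetric] ennreal_mult_less_top)
  finally have fin: "?I < \<infinity>" .
  then show eq: "?I = ennreal norm_const"
    unfolding norm_const_def by simp
  have "?I \<noteq> 0"
    by (rule nn_integral_nonzero[of _ "{0<..<1}"]) auto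
  with eq show "0 < norm_const"
    by (metis ennreal_neg not_le_imp_less)
qed

definition \<kappa> :: "real \<Rightarrow> ennreal" where
  "\<kappa> s = ennreal (s powr (\<beta> - 1) / norm_const)"

lemma kappa_measurable[measurable]: "\<kappa> \<in> borel_measurable borel"
  unfolding \<kappa>_def[abs_def] by measurable

text \<open>Substituting `s = r^2 u` pulls out the power of `r` and leaves the constant by which `\<kappa>` is
  normalised.\<close>

lemma mix_kappa_scaled:
  assumes r: "0 < r" and x: "norm (x::'a) = r"
  shows "mix \<kappa> x = ennreal (r powr (\<alpha> - real DIM('a)))"
proof -
  let ?d = "real DIM('a)"
  let ?f = "\<lambda>s::real. s powr (\<beta> - 1) * ((2 * pi * s) powr (- ?d / 2) * exp (- 1 / (2 * s)))"
  have "mix \<kappa> x = ennreal (r\<^sup>2) * (\<integral>\<^sup>+ s. \<kappa> (r\<^sup>2 * s) * ennreal (gauss (r\<^sup>2 * s) x) * indicator {0<..} s \<partial>lborel)"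
  proof -
    have m: "(\<lambda>s. \<kappa> s * ennreal (gauss s x)) \<in> borel_measurable borel" by measurable
    have "0 < r\<^sup>2" using r by simp
    from nn_integral_scale_pos[OF m this] show ?thesis unfolding mix_def .
  qed
  also have "(\<integral>\<^sup>+ s. \<kappa> (r\<^sup>2 * s) * ennreal (gauss (r\<^sup>2 * s) x) * indicator {0<..} s \<partial>lborel)
     = (\<integral>\<^sup>+ s. ennreal (r powr (\<alpha> - 2 - ?d) / norm_const) * (ennreal (?f s) * indicator {0<..} s) \<partial>lborel)"
  proof (intro nn_integral_cong)
    fix s :: real
    have "\<kappa> (r\<^sup>2 * s) * ennreal (gauss (r\<^sup>2 * s) x) = ennreal (r powr (\<alpha> - 2 - ?d) / norm_const) * ennreal (?f s)" if s: "0 < s"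
    proof -
      have r2: "(r\<^sup>2) powr p = r powr (2 * p)" for p
      proof -
        have "r\<^sup>2 = r powr 2" using r by simp
        then show ?thesis by (simp only: powr_powr)
      qed
      have "(r\<^sup>2 * s) powr (\<beta> - 1) * gauss (r\<^sup>2 * s) x = r powr (\<alpha> - 2) * (r powr (- ?d)) * ?f s"
        using r s by (simp add: gauss_def x powr_mult r2 mult.left_commute[of _ "r\<^sup>2"] \<beta>_def)
      also have "r powr (\<alpha> - 2) * (r powr (- ?d)) = r powr (\<alpha> - 2 - ?d)"
        by (subst powr_add[symmetric]) simp
      finally have eq: "(r\<^sup>2 * s) powr (\<beta> - 1) * gauss (r\<^sup>2 * s) x = r powr (\<alpha> - 2 - ?d) * ?f s" .
      have "\<kappa> (r\<^sup>2 * s) * ennreal (gauss (r\<^sup>2 * s) x) = ennreal (((r\<^sup>2 * s) powr (\<beta> - 1) * gauss (r\<^sup>2 * s) x) / norm_const)"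
        using norm_const_pos by (simp add: \<kappa>_def ennreal_mult[symmetric])
      also have "\<dots> = ennreal (r powr (\<alpha> - 2 - ?d) / norm_const * ?f s)"
        unfolding eq by simp
      also have "\<dots> = ennreal (r powr (\<alpha> - 2 - ?d) / norm_const) * ennreal (?f s)"
        using norm_const_pos by (subst ennreal_mult) auto
      finally show ?thesis .
    qed
    then show "\<kappa> (r\<^sup>2 * s) * ennreal (gauss (r\<^sup>2 * s) x) * indicator {0<..} s
      = ennreal (r powr (\<alpha> - 2 - ?d) / norm_const) * (ennreal (?f s) * indicator {0<..} s)"
      by (auto simp: indicator_def)
  qed
  also have "\<dots> = ennreal (r powr (\<alpha> - 2 - ?d) / norm_const) * ennreal norm_const"
    unfolding norm_const_eq[symmetric] by (rule nn_integral_cmult) measurable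
  also have "ennreal (r\<^sup>2) * \<dots> = ennreal (r\<^sup>2 * r powr (\<alpha> - 2 - ?d))"
    using norm_const_pos by (simp add: ennreal_mult[symmetric])
  also have "r\<^sup>2 * r powr (\<alpha> - 2 - ?d) = r powr (\<alpha> - ?d)"
  proof -
    have "r\<^sup>2 = r powr 2" using r by (simp add: powr_numeral)
    then show ?thesis by (simp add: powr_add[symmetric])
  qed
  finally show ?thesis .
qed

lemma mix_kappa_0: "mix \<kappa> (0::'a) = \<infinity>"
proof -
  have "of_nat n \<le> mix \<kappa> (0::'a)" for n :: nat
  proof -
    let ?p = "\<alpha> - real DIM('a)"
    define r where "r = (real n + 1) powr (1 / ?p)"
    have r: "0 < r" "r powr ?p = real n + 1" using alpha_dim by (auto simp: r_def powr_powr)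
    obtain x :: 'a where x: "norm x = r" using r(1) vector_choose_size[of r] by auto
    have "ennreal (real n) \<le> ennreal (r powr ?p)" by (simp add: r)
    also have "\<dots> = mix \<kappa> x" using mix_kappa_scaled[OF r(1) x] by simp
    also have "\<dots> \<le> mix \<kappa> (0::'a)"
      unfolding mix_def by (intro nn_integral_mono)
        (auto simp: gauss_def indicator_def intro!: mult_left_mono ennreal_leI)
    finally show ?thesis by (simp add: ennreal_of_nat_eq_real_of_nat)
  qed
  then show ?thesis
    by (metis ennreal_Ex_less_of_nat infinity_ennreal_def leD not_less_iff_gr_or_eq top.not_eq_extremum)
qed

lemma riesz_kernel_eq_mix: "kern x y = mix \<kappa> (x - y)"
  by (auto simp: riesz_kernel_def mix_kappa_0 mix_kappa_scaled[of "dist x y"] dist_norm)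

definition beta_const :: real where
  "beta_const = enn2real (\<integral>\<^sup>+ z. ennreal (z powr (- \<beta>) / (1 + z)) * indicator {0<..} z \<partial>lborel)"

lemma beta_const_pos: "0 < beta_const"
  and beta_const_eq: "(\<integral>\<^sup>+ z. ennreal (z powr (- \<beta>) / (1 + z)) * indicator {0<..} z \<partial>lborel) = ennreal beta_const"
proof -
  let ?f = "\<lambda>z::real. z powr (- \<beta>) / (1 + z)"
  let ?I = "\<integral>\<^sup>+ z. ennreal (?f z) * indicator {0<..} z \<partial>lborel"
  have "?I \<le> (\<integral>\<^sup>+ z. ennreal (z powr (- \<beta>)) * indicator {0..1} z + ennreal (z powr (- \<beta> - 1)) * indicator {1..} z \<partial>lborel)"
  proof (intro nn_integral_mono)
    fix z :: real
    have "?f z \<le> z powr (- \<beta>)" if "0 < z"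
      using that by (simp add: divide_le_eq)
    moreover have "?f z \<le> z powr (- \<beta> - 1)" if "0 < z"
    proof -
      have "?f z \<le> z powr (- \<beta>) / z" using that by (intro divide_left_mono) auto
      also have "\<dots> = z powr (- \<beta> - 1)" using that by (simp add: powr_diff)
      finally show ?thesis .
    qed
    ultimately show "ennreal (?f z) * indicator {0<..} z \<le> ennreal (z powr (- \<beta>)) * indicator {0..1} z + ennreal (z powr (- \<beta> - 1)) * indicator {1..} z"
      by (cases "z < 1"; cases "0 < z") (auto simp: not_less intro!: add_increasing ennreal_leI)
  qed
  also have "\<dots> < \<infinity>"
    using beta_pos beta_less_1 by (subst nn_integral_add) (auto simp: nn_integral_powr_tail nn_integral_powr_head)
  finally have fin: "?I < \<infinity>" .
  then show eq: "?I = ennreal beta_const"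
    unfolding beta_const_def by simp
  have "?I \<noteq> 0"
    by (rule nn_integral_nonzero[of _ "{0<..<1}"]) auto
  with eq show "0 < beta_const"
    by (metis ennreal_neg not_le_imp_less)
qed

text \<open>The substitution `z = s (t - a) / (a (s - t))` maps `(a, s)` onto the positive half-line and turns
  the integral into the constant `\<integral> z^(-\<beta>) / (1 + z) dz`.\<close>

lemma moebius_integral:
  fixes a s :: real
  assumes a: "0 < a" and as: "a < s"
  shows "(\<integral>\<^sup>+ t. ennreal ((t - a) powr (- \<beta>) * (s - t) powr (\<beta> - 1) / t) * indicator {a<..<s} t \<partial>lborel)
     = ennreal (beta_const * a powr (- \<beta>) * s powr (\<beta> - 1))"
proof -
  define g where "g t = s * (t - a) / (a * (s - t))" for t
  define g' where "g' t = s * (s - a) / (a * (s - t)\<^sup>2)" for t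
  define f where "f z = z powr (- \<beta>) / (1 + z)" for z :: real
  have img: "g ` {a<..<s} = {0<..}"
  proof (intro equalityI subsetI; (elim imageE, hypsubst)?)
    fix t assume "t \<in> {a<..<s}" then show "g t \<in> {0<..}" using a by (simp add: g_def)
  next
    fix z :: real assume z: "z \<in> {0<..}"
    define t where "t = (a * s * z + s * a) / (s + a * z)"
    have p: "0 < s + a * z" using z a as by (simp add: add_pos_pos)
    have t1: "t - a = a * z * (s - a) / (s + a * z)" using p by (simp add: t_def field_simps)
    have t2: "s - t = s * (s - a) / (s + a * z)" using p by (simp add: t_def field_simps)
    have "0 < t - a" unfolding t1 using z a as p by (intro divide_pos_pos mult_pos_pos) auto
    moreover have "0 < s - t" unfolding t2 using z a as p by (intro divide_pos_pos mult_pos_pos) auto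
    moreover have "g t = z"
    proof -
      have "s - a \<noteq> 0" "s \<noteq> 0" "a \<noteq> 0" "s + a * z \<noteq> 0" using p a as by auto
      then show ?thesis unfolding g_def t1 t2 by (simp add: divide_simps)
    qed
    ultimately show "z \<in> g ` {a<..<s}" by (intro image_eqI[of _ _ t]) auto
  qed
  have inj: "inj_on g {a<..<s}"
  proof (rule inj_onI)
    fix t u assume tu: "t \<in> {a<..<s}" "u \<in> {a<..<s}" and eq: "g t = g u"
    then have "s * (t - a) * (a * (s - u)) = s * (u - a) * (a * (s - t))"
      using a by (simp add: g_def field_simps)
    then have "(t - a) * (s - u) = (u - a) * (s - t)"
      using a as by simp
    then have "(t - u) * (s - a) = 0" by (simp add: algebra_simps)
    then show "t = u" using as by simp
  qed
  have der: "(g has_field_derivative g' t) (at t)" if "t \<in> {a<..<s}" for t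
  proof -
    have nz: "a \<noteq> 0" "s - t \<noteq> 0" using that a by auto
    have "((\<lambda>t. s * (t - a)) has_field_derivative s) (at t)" "((\<lambda>t. a * (s - t)) has_field_derivative - a) (at t)"
      by (auto intro!: derivative_eq_intros)
    from DERIV_divide[OF this] nz
    have "(g has_field_derivative (s * (a * (s - t)) - s * (t - a) * (- a)) / (a * (s - t) * (a * (s - t)))) (at t)"
      by (simp add: g_def[abs_def])
    moreover have "(s * (a * (s - t)) - s * (t - a) * (- a)) = a * (s * (s - a))" by (simp add: algebra_simps)
    ultimately show ?thesis using nz by (simp add: g'_def power2_eq_square ac_simps)
  qed
  have point: "g' t * f (g t) = (a powr \<beta> * s powr (1 - \<beta>)) * ((t - a) powr (- \<beta>) * (s - t) powr (\<beta> - 1) / t)" if t: "t \<in> {a<..<s}" for t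
  proof -
    have pos: "0 < t - a" "0 < s - t" "0 < t" "0 < s" using t a by auto
    have one: "1 + g t = t * (s - a) / (a * (s - t))"
      using pos a by (simp add: g_def field_simps)
    have "g t powr (- \<beta>) = s powr (- \<beta>) * (t - a) powr (- \<beta>) * (a powr \<beta> * (s - t) powr \<beta>)"
      using pos a by (simp add: g_def powr_mult powr_divide powr_minus divide_simps)
    then have "g' t * f (g t) = s * (s - a) / (a * (s - t)\<^sup>2) * (s powr (- \<beta>) * (t - a) powr (- \<beta>) * (a powr \<beta> * (s - t) powr \<beta>)) / (t * (s - a) / (a * (s - t)))"
      by (simp add: f_def one g'_def)
    also have "\<dots> = a powr \<beta> * (s * s powr (- \<beta>)) * ((t - a) powr (- \<beta>) * ((s - t) powr \<beta> / (s - t)) / t)"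
    proof -
      have gen: "s * u / (a * v\<^sup>2) * (P * Q * (R * W)) / (t * u / (a * v)) = R * (s * P) * (Q * (W / v) / t)"
        if "u \<noteq> 0" "v \<noteq> 0" for u v P Q R W :: real
        using that a pos by (simp add: field_simps power2_eq_square)
      show ?thesis by (rule gen) (use pos as in auto)
    qed
    also have "s * s powr (- \<beta>) = s powr (1 - \<beta>)"
      using pos by (simp add: powr_diff powr_minus field_simps)
    also have "(s - t) powr \<beta> / (s - t) = (s - t) powr (\<beta> - 1)"
      using pos by (simp add: powr_diff)
    finally show ?thesis .
  qed
  define C where "C = a powr \<beta> * s powr (1 - \<beta>)"
  have C: "0 < C" using a as by (simp add: C_def)
  have "(\<integral>\<^sup>+ x. ennreal (g' x * f (g x)) * indicator {a<..<s} x \<partial>lborel) = (\<integral>\<^sup>+ x. ennreal (f x) * indicator (g ` {a<..<s}) x \<partial>lborel)"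
    by (rule nn_integral_substitution_set)
       (use der inj a as in \<open>auto simp: img f_def[abs_def] beta_const_eq g'_def\<close>)
  also have "\<dots> = ennreal beta_const"
    by (simp add: img f_def beta_const_eq)
  also have "(\<integral>\<^sup>+ x. ennreal (g' x * f (g x)) * indicator {a<..<s} x \<partial>lborel)
     = (\<integral>\<^sup>+ t. ennreal C * (ennreal ((t - a) powr (- \<beta>) * (s - t) powr (\<beta> - 1) / t) * indicator {a<..<s} t) \<partial>lborel)"
    using C a by (intro nn_integral_cong) (auto simp: indicator_def point C_def[symmetric] ennreal_mult[symmetric])
  also have "\<dots> = ennreal C * (\<integral>\<^sup>+ t. ennreal ((t - a) powr (- \<beta>) * (s - t) powr (\<beta> - 1) / t) * indicator {a<..<s} t \<partial>lborel)"
    by (rule nn_integral_cmult) measurable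
  finally have "ennreal (1 / C) * (ennreal C * (\<integral>\<^sup>+ t. ennreal ((t - a) powr (- \<beta>) * (s - t) powr (\<beta> - 1) / t) * indicator {a<..<s} t \<partial>lborel)) = ennreal (1 / C) * ennreal beta_const"
    by simp
  then have "(\<integral>\<^sup>+ t. ennreal ((t - a) powr (- \<beta>) * (s - t) powr (\<beta> - 1) / t) * indicator {a<..<s} t \<partial>lborel) = ennreal (beta_const / C)"
    using C beta_const_pos by (simp add: mult.assoc[symmetric] ennreal_mult[symmetric])
  also have "beta_const / C = beta_const * a powr (- \<beta>) * s powr (\<beta> - 1)"
  proof -
    have "C * (a powr (- \<beta>) * s powr (\<beta> - 1)) = (a powr \<beta> * a powr (- \<beta>)) * (s powr (1 - \<beta>) * s powr (\<beta> - 1))"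
      by (simp add: C_def ac_simps)
    also have "\<dots> = 1" using a as by (simp add: powr_add[symmetric])
    finally have "a powr (- \<beta>) * s powr (\<beta> - 1) = 1 / C" using C by (simp add: eq_divide_eq mult.commute)
    then show ?thesis by (simp add: mult.assoc)
  qed
  finally show ?thesis .
qed

lemma overshoot_mass:
  fixes a :: real
  assumes a: "0 < a"
  shows "(\<integral>\<^sup>+ t. ennreal ((t - a) powr (- \<beta>) / t) * indicator {a<..} t \<partial>lborel) = ennreal (beta_const * a powr (- \<beta>))"
proof -
  have "(\<integral>\<^sup>+ t. ennreal ((t - a) powr (- \<beta>) / t) * indicator {a<..} t \<partial>lborel)
     = ennreal a * (\<integral>\<^sup>+ z. ennreal ((a * z) powr (- \<beta>) / (a + a * z)) * indicator {a<..} (a + a * z) \<partial>lborel)"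
    using a by (subst nn_integral_real_affine[of _ a a]) auto
  also have "(\<integral>\<^sup>+ z. ennreal ((a * z) powr (- \<beta>) / (a + a * z)) * indicator {a<..} (a + a * z) \<partial>lborel)
     = (\<integral>\<^sup>+ z. ennreal (a powr (- \<beta>) / a) * (ennreal (z powr (- \<beta>) / (1 + z)) * indicator {0<..} z) \<partial>lborel)"
  proof (intro nn_integral_cong)
    fix z :: real
    have "(a * z) powr (- \<beta>) / (a + a * z) = a powr (- \<beta>) / a * (z powr (- \<beta>) / (1 + z))" if "0 < z"
    proof -
      have "a + a * z = a * (1 + z)" by (simp add: algebra_simps)
      then show ?thesis using that a by (simp add: powr_mult)
    qed
    then show "ennreal ((a * z) powr (- \<beta>) / (a + a * z)) * indicator {a<..} (a + a * z) = ennreal (a powr (- \<beta>) / a) * (ennreal (z powr (- \<beta>) / (1 + z)) * indicator {0<..} z)"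
      using a by (auto simp: indicator_def ennreal_mult[symmetric] zero_less_mult_iff)
  qed
  also have "\<dots> = ennreal (a powr (- \<beta>) / a) * ennreal beta_const"
    by (subst nn_integral_cmult) (auto simp: beta_const_eq)
  finally show ?thesis
    using a beta_const_pos by (simp add: ennreal_mult[symmetric] mult.commute)
qed

text \<open>This is the Dynkin--Lamperti law: the `\<beta>`-stable subordinator, whose potential density is
  proportional to `\<kappa>`, first exceeds level `a` at a point with this density. This explains
  `overshoot_conv_kappa`: restarting after the overshoot leaves exactly the part of the potential
  density beyond `a`.\<close>

definition overshoot :: "real \<Rightarrow> real \<Rightarrow> ennreal" where
  "overshoot a t = ennreal (a powr \<beta> / beta_const * ((t - a) powr (- \<beta>) / t)) * indicator {a<..} t"

lemma overshoot_measurable[measurable]: "overshoot a \<in> borel_measurable borel"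
  unfolding overshoot_def[abs_def] by measurable

lemma overshoot_integral:
  assumes a: "0 < a"
  shows "(\<integral>\<^sup>+ t. overshoot a t * indicator {0<..} t \<partial>lborel) = 1"
proof -
  have "(\<integral>\<^sup>+ t. overshoot a t * indicator {0<..} t \<partial>lborel)
     = (\<integral>\<^sup>+ t. ennreal (a powr \<beta> / beta_const) * (ennreal ((t - a) powr (- \<beta>) / t) * indicator {a<..} t) \<partial>lborel)"
    using a beta_const_pos by (intro nn_integral_cong) (auto simp: overshoot_def indicator_def ennreal_mult[symmetric])
  also have "\<dots> = ennreal (a powr \<beta> / beta_const) * ennreal (beta_const * a powr (- \<beta>))"
    by (subst nn_integral_cmult) (auto simp: overshoot_mass[OF a])
  also have "\<dots> = 1"
    using a beta_const_pos by (simp add: ennreal_mult[symmetric] powr_minus)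
  finally show ?thesis .
qed

lemma overshoot_conv_kappa:
  assumes a: "0 < a" and s: "0 < s"
  shows "time_conv (overshoot a) \<kappa> s = \<kappa> s * indicator {a<..} s"
proof (cases "a < s")
  case True
  have "time_conv (overshoot a) \<kappa> s = (\<integral>\<^sup>+ t. ennreal (a powr \<beta> / (beta_const * norm_const)) * (ennreal ((t - a) powr (- \<beta>) * (s - t) powr (\<beta> - 1) / t) * indicator {a<..<s} t) \<partial>lborel)"
    unfolding time_conv_def using a beta_const_pos norm_const_pos
    by (intro nn_integral_cong) (auto simp: overshoot_def \<kappa>_def indicator_def ennreal_mult[symmetric] ac_simps)
  also have "\<dots> = ennreal (a powr \<beta> / (beta_const * norm_const)) * ennreal (beta_const * a powr (- \<beta>) * s powr (\<beta> - 1))"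
    by (subst nn_integral_cmult) (auto simp: moebius_integral[OF a True])
  also have "\<dots> = \<kappa> s"
  proof -
    have "a powr \<beta> * a powr (- \<beta>) = 1" using a by (simp add: powr_add[symmetric])
    then have "a powr \<beta> / (beta_const * norm_const) * (beta_const * a powr (- \<beta>) * s powr (\<beta> - 1)) = s powr (\<beta> - 1) / norm_const"
      using beta_const_pos by (simp add: divide_simps)
    then show ?thesis using beta_const_pos norm_const_pos by (simp add: \<kappa>_def ennreal_mult[symmetric])
  qed
  finally show ?thesis using True by simp
next
  case False
  then have "time_conv (overshoot a) \<kappa> s = (\<integral>\<^sup>+ t. 0 \<partial>(lborel :: real measure))"
    unfolding time_conv_def by (intro nn_integral_cong) (auto simp: overshoot_def indicator_def)
  with False show ?thesis by simp
qed

end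

section \<open>Truncated kernels and lower semicontinuity\<close>

lemma nn_integral_lborel_reflect:
  fixes x :: "'a::euclidean_space"
  assumes [measurable]: "f \<in> borel_measurable borel"
  shows "(\<integral>\<^sup>+ y. f (x - y) \<partial>lborel) = (\<integral>\<^sup>+ y. f y \<partial>lborel)"
proof -
  have "(\<integral>\<^sup>+ y. f y \<partial>lborel) = (\<integral>\<^sup>+ y. f y \<partial>density (distr lborel borel (\<lambda>y. x + (-1) *\<^sub>R y)) (\<lambda>_. ennreal (\<bar>-1\<bar> ^ DIM('a))))"
    by (subst lborel_affine[of "-1" x]) auto
  also have "\<dots> = (\<integral>\<^sup>+ y. f (x - y) \<partial>lborel)"
    by (subst nn_integral_density) (auto simp: nn_integral_distr)
  finally show ?thesis ..
qed

text \<open>Sequences suffice, since the space is metrisable.\<close>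

definition lsc :: "('a::euclidean_space \<Rightarrow> ennreal) \<Rightarrow> bool" where
  "lsc u \<longleftrightarrow> (\<forall>X x. X \<longlonglongrightarrow> x \<longrightarrow> u x \<le> liminf (\<lambda>n::nat. u (X n)))"

lemma lscD: "lsc u \<Longrightarrow> X \<longlonglongrightarrow> x \<Longrightarrow> u x \<le> liminf (\<lambda>n. u (X n))"
  by (auto simp: lsc_def)

lemma lsc_continuous:
  fixes u :: "'a::euclidean_space \<Rightarrow> ennreal"
  shows "continuous_on UNIV u \<Longrightarrow> lsc u"
  unfolding lsc_def
proof (intro allI impI)
  fix X x assume "continuous_on UNIV u" "(X::nat \<Rightarrow> 'a) \<longlonglongrightarrow> x"
  then have "(\<lambda>n. u (X n)) \<longlonglongrightarrow> u x"
    using continuous_on_tendsto_compose by fastforce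
  then show "u x \<le> liminf (\<lambda>n. u (X n))" by (simp add: lim_imp_Liminf)
qed

lemma lsc_SUP:
  fixes u :: "'i \<Rightarrow> 'a::euclidean_space \<Rightarrow> ennreal"
  shows "(\<And>i. i \<in> I \<Longrightarrow> lsc (u i)) \<Longrightarrow> lsc (\<lambda>x. SUP i\<in>I. u i x)"
  unfolding lsc_def
proof (intro allI impI SUP_least)
  fix X x i assume *: "\<And>i. i \<in> I \<Longrightarrow> \<forall>X x. X \<longlonglongrightarrow> x \<longrightarrow> u i x \<le> liminf (\<lambda>n. u i (X n))" "(X::nat \<Rightarrow> 'a) \<longlonglongrightarrow> x" "i \<in> I"
  then have "u i x \<le> liminf (\<lambda>n. u i (X n))" by blast
  also have "\<dots> \<le> liminf (\<lambda>n. SUP i\<in>I. u i (X n))"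
    using *(3) by (intro Liminf_mono always_eventually allI SUP_upper)
  finally show "u i x \<le> liminf (\<lambda>n. SUP i\<in>I. u i (X n))" .
qed

context riesz
begin

lemma riesz_kernel_inverse: "kern x y = inverse (ennreal (dist x y powr (real DIM('a) - \<alpha>)))"
proof (cases "x = y")
  case False
  then have "inverse (ennreal (dist x y powr (real DIM('a) - \<alpha>))) = ennreal (inverse (dist x y powr (real DIM('a) - \<alpha>)))"
    by (intro inverse_ennreal) simp
  also have "inverse (dist x y powr (real DIM('a) - \<alpha>)) = dist x y powr (\<alpha> - real DIM('a))"
    by (simp flip: powr_minus)
  finally show ?thesis using False by (simp add: riesz_kernel_def)
qed (simp add: riesz_kernel_def)

lemma riesz_kernel_continuous: "continuous_on UNIV (\<lambda>y::'a. kern x y)"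
  unfolding riesz_kernel_inverse using alpha_dim
  by (intro continuous_on_inverse_ennreal continuous_on_ennreal continuous_on_powr' continuous_intros) auto

lemma riesz_kernel_measurable[measurable (raw)]:
  assumes [measurable]: "f \<in> borel_measurable M" "g \<in> borel_measurable M"
  shows "(\<lambda>w. kern (f w) (g w :: 'a)) \<in> borel_measurable M"
  unfolding riesz_kernel_inverse by measurable

lemma riesz_kernel_commute: "kern x y = kern y x"
  by (simp add: riesz_kernel_inverse dist_commute)

lemma riesz_kernel_far: "0 < r \<Longrightarrow> r \<le> dist x y \<Longrightarrow> kern x y \<le> ennreal (r powr (\<alpha> - real DIM('a)))"
  using alpha_dim by (auto simp: riesz_kernel_def intro!: ennreal_leI powr_mono2')

lemma riesz_potential_measurable[measurable]:
  assumes "sets \<mu> = sets (borel :: 'a measure)" "finite_measure \<mu>"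
  shows "pot \<mu> \<in> borel_measurable borel"
proof -
  interpret finite_measure \<mu> by fact
  have [measurable_cong]: "sets \<mu> = sets (borel :: 'a measure)" by fact
  show ?thesis unfolding riesz_potential_def[abs_def] by measurable
qed

lemma riesz_potential_lsc:
  assumes [measurable_cong]: "sets \<mu> = sets (borel :: 'a measure)"
  shows "lsc (pot \<mu>)"
  unfolding lsc_def
proof (intro allI impI)
  fix X and x :: 'a assume X: "X \<longlonglongrightarrow> x"
  have "pot \<mu> x = (\<integral>\<^sup>+ y. liminf (\<lambda>n. kern (X n) y) \<partial>\<mu>)"
    unfolding riesz_potential_def
  proof (intro nn_integral_cong)
    fix y
    have "(\<lambda>n. kern y (X n)) \<longlonglongrightarrow> kern y x"
      using riesz_kernel_continuous[of y] X by (auto intro: continuous_on_tendsto_compose)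
    then show "kern x y = liminf (\<lambda>n. kern (X n) y)"
      by (simp add: riesz_kernel_commute[of _ y] lim_imp_Liminf)
  qed
  also have "\<dots> \<le> liminf (\<lambda>n. pot \<mu> (X n))"
    unfolding riesz_potential_def by (rule nn_integral_liminf) measurable
  finally show "pot \<mu> x \<le> liminf (\<lambda>n. pot \<mu> (X n))" .
qed

lemma riesz_potential_symmetric:
  assumes [measurable_cong]: "sets \<mu> = sets (borel :: 'a measure)" "sets \<nu> = sets (borel :: 'a measure)"
    and "sigma_finite_measure \<mu>" "sigma_finite_measure \<nu>"
  shows "(\<integral>\<^sup>+ x. pot \<mu> x \<partial>\<nu>) = (\<integral>\<^sup>+ x. pot \<nu> x \<partial>\<mu>)"
proof -
  interpret pair_sigma_finite \<mu> \<nu> using assms by (simp add: pair_sigma_finite_def)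
  have "(\<integral>\<^sup>+ x. pot \<mu> x \<partial>\<nu>) = (\<integral>\<^sup>+ x. (\<integral>\<^sup>+ y. kern x y \<partial>\<mu>) \<partial>\<nu>)"
    by (simp add: riesz_potential_def)
  also have "\<dots> = (\<integral>\<^sup>+ y. (\<integral>\<^sup>+ x. kern x y \<partial>\<nu>) \<partial>\<mu>)"
    by (rule Fubini') measurable
  finally show ?thesis by (simp add: riesz_potential_def riesz_kernel_commute)
qed

text \<open>Small times carry the singularity of the kernel and large times its bulk: `ktr a` is a bounded
  continuous kernel that increases to the Riesz kernel as `a \<rightarrow> 0`, `krem a` is the remainder, and
  convolution with the probability density `sweep a` maps the full kernel to `ktr a`.\<close>

definition ktr :: "real \<Rightarrow> 'a \<Rightarrow> ennreal" where
  "ktr a = mix (\<lambda>s. \<kappa> s * indicator {a<..} s)"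

definition krem :: "real \<Rightarrow> 'a \<Rightarrow> ennreal" where
  "krem a = mix (\<lambda>s. \<kappa> s * indicator {..a} s)"

definition sweep :: "real \<Rightarrow> 'a \<Rightarrow> ennreal" where
  "sweep a = mix (overshoot a)"

lemma ktr_measurable[measurable]: "ktr a \<in> borel_measurable borel"
  and krem_measurable[measurable]: "krem a \<in> borel_measurable borel"
  and sweep_measurable[measurable]: "sweep a \<in> borel_measurable borel"
  unfolding ktr_def krem_def sweep_def by measurable

lemma ktr_commute: "ktr a (x - y) = ktr a (y - x)"
  and sweep_commute: "sweep a (x - y) = sweep a (y - x)"
  unfolding ktr_def sweep_def by (rule mix_commute)+

lemma riesz_kernel_split: "kern x y = ktr a (x - y) + krem a (x - y)"
  unfolding riesz_kernel_eq_mix ktr_def krem_def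
  by (subst mix_add[symmetric]) (auto intro!: mix_cong simp: indicator_def)

lemma ktr_le_kernel: "ktr a (x - y) \<le> kern x y"
  unfolding riesz_kernel_split[of x y a] by simp

lemma ktr_antimono: "a \<le> b \<Longrightarrow> ktr b z \<le> ktr a z"
  unfolding ktr_def by (rule mix_mono) (auto simp: indicator_def)

lemma sweep_integral: "0 < a \<Longrightarrow> (\<integral>\<^sup>+ y. sweep a y \<partial>lborel) = 1"
  unfolding sweep_def by (simp add: mix_integral overshoot_integral)

lemma sweep_integral': "0 < a \<Longrightarrow> (\<integral>\<^sup>+ y. sweep a (x - y) \<partial>lborel) = 1"
  by (simp add: nn_integral_lborel_reflect sweep_integral)

lemma sweep_conv_kernel:
  assumes "0 < a"
  shows "(\<integral>\<^sup>+ y. sweep a (x - y) * kern y z \<partial>lborel) = ktr a (x - z)"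
  unfolding sweep_def riesz_kernel_eq_mix ktr_def mix_conv[OF overshoot_measurable kappa_measurable]
  using assms by (intro mix_cong) (simp add: overshoot_conv_kappa)

lemma sweep_conv_ktr:
  assumes "0 < a" 
  shows "(\<integral>\<^sup>+ y. sweep a (x - y) * ktr b (y - z) \<partial>lborel) \<le> ktr b (x - z)"
proof -
  have [measurable]: "(\<lambda>s. \<kappa> s * indicator {b<..} s) \<in> borel_measurable borel" by measurable
  have "time_conv (overshoot a) (\<lambda>s. \<kappa> s * indicator {b<..} s) r \<le> \<kappa> r * indicator {b<..} r" if r: "0 < r" for r
  proof (cases "b < r")
    case True
    have "time_conv (overshoot a) (\<lambda>s. \<kappa> s * indicator {b<..} s) r \<le> time_conv (overshoot a) \<kappa> r"
      unfolding time_conv_def by (intro nn_integral_mono) (auto simp: indicator_def)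
    also have "\<dots> \<le> \<kappa> r" using overshoot_conv_kappa[OF assms r] by (auto simp: indicator_def)
    finally show ?thesis using True by simp
  next
    case False
    then have "time_conv (overshoot a) (\<lambda>s. \<kappa> s * indicator {b<..} s) r = (\<integral>\<^sup>+ t. 0 \<partial>(lborel::real measure))"
      unfolding time_conv_def by (intro nn_integral_cong) (auto simp: indicator_def)
    then show ?thesis by simp
  qed
  then show ?thesis
    unfolding sweep_def ktr_def by (subst mix_conv) (auto intro!: mix_mono)
qed

lemma ktr_SUP: "(SUP n. ktr (1 / real (Suc n)) (x - y)) = kern x y"
proof -
  let ?h = "\<lambda>n s. \<kappa> s * indicator {1 / real (Suc n)<..} s * ennreal (gauss s (x - y)) * indicator {0<..} s"
  have "(SUP n. ktr (1 / real (Suc n)) (x - y)) = (\<integral>\<^sup>+ s. (SUP n. ?h n s) \<partial>lborel)"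
    unfolding ktr_def mix_def
  proof (rule nn_integral_monotone_convergence_SUP[symmetric])
    show "incseq ?h"
    proof (rule incseq_SucI, rule le_funI)
      fix n s
      have "1 / real (Suc (Suc n)) \<le> 1 / real (Suc n)" by (simp add: frac_le)
      then show "?h n s \<le> ?h (Suc n) s" by (auto simp: indicator_def)
    qed
  qed measurable
  also have "\<dots> = mix \<kappa> (x - y)"
    unfolding mix_def
  proof (rule nn_integral_cong)
    fix s :: real
    show "(SUP n. ?h n s) = \<kappa> s * ennreal (gauss s (x - y)) * indicator {0<..} s"
    proof (cases "0 < s")
      case True
      then obtain n where n: "1 / real (Suc n) < s" using reals_Archimedean[OF True] by (auto simp: inverse_eq_divide)
      show ?thesis
      proof (rule antisym)
        show "(SUP n. ?h n s) \<le> \<kappa> s * ennreal (gauss s (x - y)) * indicator {0<..} s"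
          by (rule SUP_least) (auto simp: indicator_def)
        show "\<kappa> s * ennreal (gauss s (x - y)) * indicator {0<..} s \<le> (SUP n. ?h n s)"
          using n by (intro SUP_upper2[of n]) auto
      qed
    qed simp
  qed
  finally show ?thesis by (simp add: riesz_kernel_eq_mix)
qed

lemma ktr_0_finite: assumes a: "0 < a" shows "ktr a 0 < \<infinity>"
proof -
  let ?p = "\<beta> - 1 - real DIM('a) / 2"
  have "ktr a 0 \<le> (\<integral>\<^sup>+ s. ennreal ((2 * pi) powr (- real DIM('a) / 2) / norm_const) * (ennreal (s powr ?p) * indicator {a..} s) \<partial>lborel)"
    unfolding ktr_def mix_def
  proof (rule nn_integral_mono)
    fix s :: real
    have "s powr (\<beta> - 1) / norm_const * (2 * pi * s) powr (- real DIM('a) / 2) = (2 * pi) powr (- real DIM('a) / 2) / norm_const * s powr ?p" if "0 < s"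
    proof -
      have "s powr (\<beta> - 1) * s powr (- real DIM('a) / 2) = s powr ?p" by (simp add: powr_add[symmetric])
      then show ?thesis using that by (simp add: powr_mult)
    qed
    then show "\<kappa> s * indicator {a<..} s * ennreal (gauss s (0::'a)) * indicator {0<..} s \<le> ennreal ((2 * pi) powr (- real DIM('a) / 2) / norm_const) * (ennreal (s powr ?p) * indicator {a..} s)"
      using a norm_const_pos by (auto simp: indicator_def \<kappa>_def gauss_def ennreal_mult[symmetric] simp del: times_divide_eq_left times_divide_eq_right)
  qed
  also have "\<dots> < \<infinity>"
    using beta_dim a by (subst nn_integral_cmult) (auto simp: nn_integral_powr_tail ennreal_mult_less_top)
  finally show ?thesis .
qed

lemma ktr_le_0: "ktr a z \<le> ktr a 0"
  unfolding ktr_def mix_def by (intro nn_integral_mono) (auto simp: gauss_def indicator_def intro!: mult_left_mono ennreal_leI)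

lemma ktr_continuous: assumes a: "0 < a" shows "continuous_on UNIV (ktr a)"
proof (rule continuous_on_sequentiallyI)
  fix X and x :: 'a assume X: "X \<longlonglongrightarrow> x"
  show "(\<lambda>n. ktr a (X n)) \<longlonglongrightarrow> ktr a x"
    unfolding ktr_def mix_def
  proof (rule nn_integral_dominated_convergence[where w="\<lambda>s. \<kappa> s * indicator {a<..} s * ennreal (gauss s (0::'a)) * indicator {0<..} s"])
    show "(\<integral>\<^sup>+ s. \<kappa> s * indicator {a<..} s * ennreal (gauss s (0::'a)) * indicator {0<..} s \<partial>lborel) < \<infinity>"
      using ktr_0_finite[OF a] by (simp add: ktr_def mix_def)
    show "AE s in lborel. (\<lambda>i. \<kappa> s * indicator {a<..} s * ennreal (gauss s (X i)) * indicator {0<..} s) \<longlonglongrightarrow> \<kappa> s * indicator {a<..} s * ennreal (gauss s x) * indicator {0<..} s"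
    proof (rule AE_I2)
      fix s :: real
      have "(\<lambda>i. \<kappa> s * ennreal (gauss s (X i))) \<longlonglongrightarrow> \<kappa> s * ennreal (gauss s x)" if "0 < s"
        unfolding \<kappa>_def gauss_def using norm_const_pos that
        by (subst (1 2) ennreal_mult[symmetric]) (auto intro!: tendsto_intros X)
      then show "(\<lambda>i. \<kappa> s * indicator {a<..} s * ennreal (gauss s (X i)) * indicator {0<..} s) \<longlonglongrightarrow> \<kappa> s * indicator {a<..} s * ennreal (gauss s x) * indicator {0<..} s"
        by (auto simp: indicator_def)
    qed
    show "AE s in lborel. \<kappa> s * indicator {a<..} s * ennreal (gauss s (X j)) * indicator {0<..} s \<le> \<kappa> s * indicator {a<..} s * ennreal (gauss s (0::'a)) * indicator {0<..} s" for j
      by (auto simp: gauss_def indicator_def intro!: mult_left_mono ennreal_leI)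
  qed measurable
qed

text \<open>Away from the origin `gauss s z` is `O(s)` as `s \<rightarrow> 0`, which adds one power of `a` to `\<integral> \<kappa>` over
  `[0, a]`, namely `a^\<beta>`. The exponent `\<beta> + 1` against `\<beta>` in `sweep_tail` decides the domination
  principle.\<close>

lemma krem_far:
  assumes r: "0 < r"
  shows "\<exists>C>0. \<forall>a>0. \<forall>z. r \<le> norm z \<longrightarrow> krem a z \<le> ennreal (C * a powr (\<beta> + 1))"
proof -
  let ?d = "real DIM('a)"
  define q where "q = ?d / 2 + 1"
  define D where "D = (2 * pi) powr (- ?d / 2) * (2 / r\<^sup>2) powr q * q powr q"
  have q: "0 < q" by (simp add: q_def)
  have g: "gauss s z \<le> D * s" if s: "0 < s" and z: "r \<le> norm z" for s :: real and z :: 'a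
  proof -
    have "gauss s z \<le> (2 * pi * s) powr (- ?d / 2) * exp (- r\<^sup>2 / (2 * s))"
      using s z r unfolding gauss_def by (intro mult_left_mono) (auto intro!: divide_right_mono power_mono)
    also have "\<dots> = (2 * pi) powr (- ?d / 2) * s * (s powr (- q) * exp (- (r\<^sup>2 / (2 * s))))"
    proof -
      have "s * s powr (- q) = s powr (- ?d / 2)"
        using s by (simp add: q_def powr_mult_base)
      then show ?thesis using s by (simp add: powr_mult)
    qed
    also have "s powr (- q) = (2 / r\<^sup>2) powr q * (r\<^sup>2 / (2 * s)) powr q"
    proof -
      have "(2 / r\<^sup>2) * (r\<^sup>2 / (2 * s)) = 1 / s" using r by simp
      then have "(2 / r\<^sup>2) powr q * (r\<^sup>2 / (2 * s)) powr q = (1 / s) powr q"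
        using s by (subst powr_mult[symmetric]) auto
      then show ?thesis using s by (simp add: powr_minus powr_divide inverse_eq_divide)
    qed
    also have "(2 * pi) powr (- ?d / 2) * s * ((2 / r\<^sup>2) powr q * (r\<^sup>2 / (2 * s)) powr q * exp (- (r\<^sup>2 / (2 * s))))
      = (2 * pi) powr (- ?d / 2) * s * (2 / r\<^sup>2) powr q * ((r\<^sup>2 / (2 * s)) powr q * exp (- (r\<^sup>2 / (2 * s))))"
      by (simp only: mult.assoc)
    also have "\<dots> \<le> (2 * pi) powr (- ?d / 2) * s * (2 / r\<^sup>2) powr q * q powr q"
      using s r q powr_exp_bound[of q "r\<^sup>2 / (2 * s)"] by (intro mult_left_mono) auto
    finally show ?thesis by (simp add: D_def ac_simps)
  qed
  have D: "0 < D" using r q by (simp add: D_def)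
  define C where "C = D / (norm_const * \<beta>)"
  have C: "0 < C" using D norm_const_pos beta_pos by (simp add: C_def)
  have "krem a z \<le> ennreal (C * a powr (\<beta> + 1))" if a: "0 < a" and z: "r \<le> norm z" for a z
  proof -
    have "krem a z \<le> (\<integral>\<^sup>+ s. ennreal (D * a / norm_const) * (ennreal (s powr (\<beta> - 1)) * indicator {0..a} s) \<partial>lborel)"
      unfolding krem_def mix_def
    proof (rule nn_integral_mono)
      fix s :: real
      show "\<kappa> s * indicator {..a} s * ennreal (gauss s z) * indicator {0<..} s \<le> ennreal (D * a / norm_const) * (ennreal (s powr (\<beta> - 1)) * indicator {0..a} s)"
      proof (cases "0 < s \<and> s \<le> a")
        case True
        have "s powr (\<beta> - 1) / norm_const * gauss s z \<le> s powr (\<beta> - 1) / norm_const * (D * a)"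
          using True g[of s z] z D norm_const_pos by (intro mult_left_mono order.trans[OF g]) auto
        also have "\<dots> = D * a / norm_const * s powr (\<beta> - 1)" by simp
        finally show ?thesis
          using True D norm_const_pos a unfolding \<kappa>_def by (simp add: ennreal_mult[symmetric] ennreal_leI)
      qed (auto simp: indicator_def)
    qed
    also have "\<dots> = ennreal (D * a / norm_const) * ennreal (a powr \<beta> / \<beta>)"
      using nn_integral_powr_head[of "\<beta> - 1" a] a beta_pos by (subst nn_integral_cmult) auto
    also have "\<dots> = ennreal (C * a powr (\<beta> + 1))"
      using D a norm_const_pos beta_pos by (simp add: ennreal_mult[symmetric] C_def powr_add)
    finally show ?thesis .
  qed
  with C show ?thesis by blast
qed

text \<open>The overshoot density is at least a multiple of `a^\<beta>` at times between 1 and 2, uniformly in `a \<le>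
  1`: even for tiny `a` the averaging kernel jumps far away with probability of order `a^\<beta>`.\<close>

lemma sweep_tail:
  assumes R: "0 \<le> R"
  shows "\<exists>c>0. \<forall>a\<in>{0<..1}. \<forall>x. ennreal (c * a powr \<beta>) \<le> (\<integral>\<^sup>+ y. sweep a (x - y) * indicator {y. R < dist x y} y \<partial>lborel)"
proof -
  define m :: "'a \<Rightarrow> ennreal" where "m = mix (indicator {1<..2})"
  have [measurable]: "m \<in> borel_measurable borel" unfolding m_def by measurable
  define I where "I = (\<integral>\<^sup>+ z. m z * indicator {z. R < norm z} z \<partial>lborel)"
  have "I \<le> (\<integral>\<^sup>+ z. m z \<partial>lborel)" unfolding I_def by (intro nn_integral_mono) (auto simp: indicator_def)
  also have "\<dots> = (\<integral>\<^sup>+ s. indicator {1<..2::real} s \<partial>lborel)"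
  proof -
    have "(\<integral>\<^sup>+ z. m z \<partial>lborel) = (\<integral>\<^sup>+ s. indicator {1<..2} s * indicator {0<..} (s::real) \<partial>lborel)"
      unfolding m_def by (rule mix_integral) measurable
    also have "(\<lambda>s::real. indicator {1<..2} s * indicator {0<..} s :: ennreal) = indicator {1<..2}"
      by (auto simp: indicator_def fun_eq_iff)
    finally show ?thesis .
  qed
  also have "\<dots> = 1" by simp
  finally have I1: "I \<le> 1" .
  have mpos: "m z \<noteq> 0" for z
    unfolding m_def mix_def by (rule nn_integral_nonzero[of _ "{1<..<2}"]) (auto simp: gauss_pos ennreal_eq_0_iff not_le)
  have I0: "I \<noteq> 0"
    unfolding I_def
  proof (rule nn_integral_nonzero[of _ "- cball 0 R"])
    obtain v :: 'a where "norm v = R + 1" using vector_choose_size[of "R + 1"] R by auto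
    then show "- cball (0::'a) R \<noteq> {}" by (auto simp: set_eq_iff intro!: exI[of _ v])
  qed (use mpos in auto)
  define c where "c = 2 powr (- \<beta>) / (2 * beta_const) * enn2real I"
  have "I < top" using I1 le_less_trans[OF I1 ennreal_one_less_top] by simp
  then have Ir: "I = ennreal (enn2real I)" "0 < enn2real I"
    using I0 by (auto simp: enn2real_positive_iff zero_less_iff_neq_zero)
  have c: "0 < c" using Ir beta_const_pos by (simp add: c_def)
  have "ennreal (c * a powr \<beta>) \<le> (\<integral>\<^sup>+ y. sweep a (x - y) * indicator {y. R < dist x y} y \<partial>lborel)" if a: "a \<in> {0<..1}" for a x
  proof -
    let ?k = "a powr \<beta> * (2 powr (- \<beta>) / (2 * beta_const))"
    have le: "ennreal ?k * m z \<le> sweep a z" for z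
    proof -
      have "ennreal ?k * m z = (\<integral>\<^sup>+ s. ennreal ?k * (indicator {1<..2} s * ennreal (gauss s z) * indicator {0<..} s) \<partial>lborel)"
        unfolding m_def mix_def by (rule nn_integral_cmult[symmetric]) measurable
      also have "\<dots> \<le> sweep a z"
        unfolding sweep_def mix_def
      proof (rule nn_integral_mono)
        fix s :: real
        show "ennreal ?k * (indicator {1<..2} s * ennreal (gauss s z) * indicator {0<..} s) \<le> overshoot a s * ennreal (gauss s z) * indicator {0<..} s"
        proof (cases "s \<in> {1<..2}")
          case True
          have "2 powr (- \<beta>) / 2 \<le> (s - a) powr (- \<beta>) / s"
            using True a beta_pos by (intro frac_le powr_mono2') auto
          then have "a powr \<beta> / beta_const * (2 powr (- \<beta>) / 2) \<le> a powr \<beta> / beta_const * ((s - a) powr (- \<beta>) / s)"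
            using beta_const_pos by (intro mult_left_mono) auto
          then have "?k \<le> a powr \<beta> / beta_const * ((s - a) powr (- \<beta>) / s)" by (simp add: ac_simps)
          then have "ennreal ?k \<le> overshoot a s" using True a by (simp add: overshoot_def ennreal_leI)
          then show ?thesis using True by (simp add: mult_right_mono)
        qed auto
      qed
      finally show ?thesis .
    qed
    have "ennreal (c * a powr \<beta>) = ennreal ?k * I"
      using beta_const_pos by (subst Ir(1)) (simp add: c_def ennreal_mult[symmetric])
    also have "\<dots> = (\<integral>\<^sup>+ z. ennreal ?k * (m z * indicator {z. R < norm z} z) \<partial>lborel)"
      unfolding I_def by (rule nn_integral_cmult[symmetric]) measurable
    also have "\<dots> \<le> (\<integral>\<^sup>+ z. sweep a z * indicator {z. R < norm z} z \<partial>lborel)"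
      using le by (intro nn_integral_mono) (auto simp: indicator_def)
    also have "\<dots> = (\<integral>\<^sup>+ y. sweep a (x - y) * indicator {z. R < norm z} (x - y) \<partial>lborel)"
      by (rule nn_integral_lborel_reflect[symmetric]) measurable
    also have "\<dots> = (\<integral>\<^sup>+ y. sweep a (x - y) * indicator {y. R < dist x y} y \<partial>lborel)"
      by (intro nn_integral_cong) (auto simp: indicator_def dist_norm)
    finally show ?thesis .
  qed
  with c show ?thesis by blast
qed


section \<open>Supermedian functions and the domination principle\<close>

text \<open>The averaging operators `sweep a` take the role of the ball means in the definition of
  superharmonic functions.\<close>

definition supermedian :: "('a \<Rightarrow> ennreal) \<Rightarrow> bool" where
  "supermedian u \<longleftrightarrow> u \<in> borel_measurable borel \<and>
     (\<forall>a>0. \<forall>x. (\<integral>\<^sup>+ y. sweep a (x - y) * u y \<partial>lborel) \<le> u x)"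

lemma supermedian_measurable: "supermedian u \<Longrightarrow> u \<in> borel_measurable borel"
  by (simp add: supermedian_def)

lemma supermedianD: "supermedian u \<Longrightarrow> 0 < a \<Longrightarrow> (\<integral>\<^sup>+ y. sweep a (x - y) * u y \<partial>lborel) \<le> u x"
  by (simp add: supermedian_def)

lemma supermedian_const: "supermedian (\<lambda>_. c)"
  by (auto simp: supermedian_def nn_integral_multc sweep_integral')

lemma supermedian_SUP:
  assumes "\<And>n::nat. supermedian (u n)" "incseq u"
  shows "supermedian (\<lambda>x. SUP n. u n x)"
  unfolding supermedian_def
proof (intro conjI allI impI)
  have [measurable]: "u n \<in> borel_measurable borel" for n using assms(1) by (rule supermedian_measurable)
  show "(\<lambda>x. SUP n. u n x) \<in> borel_measurable borel" by measurable
  fix a :: real and x assume a: "0 < a"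
  have "(\<integral>\<^sup>+ y. sweep a (x - y) * (SUP n. u n y) \<partial>lborel) = (\<integral>\<^sup>+ y. (SUP n. sweep a (x - y) * u n y) \<partial>lborel)"
    by (simp add: SUP_mult_left_ennreal)
  also have "\<dots> = (SUP n. \<integral>\<^sup>+ y. sweep a (x - y) * u n y \<partial>lborel)"
    using assms(2) by (intro nn_integral_monotone_convergence_SUP) (auto simp: incseq_def le_fun_def intro!: mult_left_mono)
  also have "\<dots> \<le> (SUP n. u n x)"
    by (intro SUP_mono) (auto intro!: supermedianD[OF assms(1) a])
  finally show "(\<integral>\<^sup>+ y. sweep a (x - y) * (SUP n. u n y) \<partial>lborel) \<le> (SUP n. u n x)" .
qed

lemma sweep_potential:
  assumes [measurable_cong]: "sets \<mu> = sets (borel :: 'a measure)" and "finite_measure \<mu>" and a: "0 < a"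
  shows "(\<integral>\<^sup>+ y. sweep a (x - y) * pot \<mu> y \<partial>lborel) = (\<integral>\<^sup>+ z. ktr a (x - z) \<partial>\<mu>)"
proof -
  interpret finite_measure \<mu> by fact
  interpret pair_sigma_finite \<mu> lborel by unfold_locales
  have "(\<integral>\<^sup>+ y. sweep a (x - y) * pot \<mu> y \<partial>lborel) = (\<integral>\<^sup>+ y. (\<integral>\<^sup>+ z. sweep a (x - y) * kern y z \<partial>\<mu>) \<partial>lborel)"
    unfolding riesz_potential_def by (intro nn_integral_cong nn_integral_cmult[symmetric]) measurable
  also have "\<dots> = (\<integral>\<^sup>+ z. (\<integral>\<^sup>+ y. sweep a (x - y) * kern y z \<partial>lborel) \<partial>\<mu>)"
    by (rule Fubini') measurable
  finally show ?thesis using sweep_conv_kernel[OF a] by simp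
qed

lemma supermedian_potential:
  assumes "sets \<mu> = sets (borel :: 'a measure)" "finite_measure \<mu>"
  shows "supermedian (pot \<mu>)"
  unfolding supermedian_def
proof (intro conjI allI impI)
  show "pot \<mu> \<in> borel_measurable borel" using assms by simp
  fix a :: real and x assume a: "0 < a"
  show "(\<integral>\<^sup>+ y. sweep a (x - y) * pot \<mu> y \<partial>lborel) \<le> pot \<mu> x"
    unfolding sweep_potential[OF assms a] unfolding riesz_potential_def
    by (intro nn_integral_mono ktr_le_kernel)
qed

definition ktr_potential :: "real \<Rightarrow> 'a measure \<Rightarrow> 'a \<Rightarrow> ennreal" where
  "ktr_potential a \<mu> x = (\<integral>\<^sup>+ z. ktr a (x - z) \<partial>\<mu>)"

lemma supermedian_ktr_potential:
  assumes [measurable_cong]: "sets \<mu> = sets (borel :: 'a measure)" and "finite_measure \<mu>"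
  shows "supermedian (ktr_potential b \<mu>)"
  unfolding supermedian_def
proof (intro conjI allI impI)
  interpret finite_measure \<mu> by fact
  interpret pair_sigma_finite \<mu> lborel by unfold_locales
  show m[measurable]: "ktr_potential b \<mu> \<in> borel_measurable borel"
    unfolding ktr_potential_def[abs_def] by measurable
  fix a :: real and x assume a: "0 < a"
  have "(\<integral>\<^sup>+ y. sweep a (x - y) * ktr_potential b \<mu> y \<partial>lborel) = (\<integral>\<^sup>+ y. (\<integral>\<^sup>+ z. sweep a (x - y) * ktr b (y - z) \<partial>\<mu>) \<partial>lborel)"
    unfolding ktr_potential_def by (intro nn_integral_cong nn_integral_cmult[symmetric]) measurable
  also have "\<dots> = (\<integral>\<^sup>+ z. (\<integral>\<^sup>+ y. sweep a (x - y) * ktr b (y - z) \<partial>lborel) \<partial>\<mu>)"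
    by (rule Fubini') measurable
  also have "\<dots> \<le> ktr_potential b \<mu> x"
    unfolding ktr_potential_def by (intro nn_integral_mono sweep_conv_ktr a)
  finally show "(\<integral>\<^sup>+ y. sweep a (x - y) * ktr_potential b \<mu> y \<partial>lborel) \<le> ktr_potential b \<mu> x" .
qed

lemma potential_split:
  assumes [measurable_cong]: "sets \<mu> = sets (borel :: 'a measure)"
  shows "pot \<mu> x = ktr_potential a \<mu> x + (\<integral>\<^sup>+ z. krem a (x - z) \<partial>\<mu>)"
  unfolding riesz_potential_def ktr_potential_def
  by (subst nn_integral_add[symmetric]) (auto simp: riesz_kernel_split[symmetric])

lemma potential_far:
  assumes [measurable_cong]: "sets \<mu> = sets (borel :: 'a measure)" and S: "emeasure \<mu> (- S) = 0" "S \<in> sets borel"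
    and r: "0 < r" and far: "\<And>z. z \<in> S \<Longrightarrow> r \<le> dist x z"
  shows "pot \<mu> x \<le> ennreal (r powr (\<alpha> - real DIM('a))) * emeasure \<mu> UNIV"
proof -
  have "AE z in \<mu>. z \<in> S" using S by (intro AE_I[of _ _ "- S"]) (auto simp: assms(1))
  then have "pot \<mu> x \<le> (\<integral>\<^sup>+ z. ennreal (r powr (\<alpha> - real DIM('a))) \<partial>\<mu>)"
    unfolding riesz_potential_def
    by (intro nn_integral_mono_AE) (auto intro!: riesz_kernel_far[OF r] far)
  also have "\<dots> = ennreal (r powr (\<alpha> - real DIM('a))) * emeasure \<mu> UNIV"
    using sets_eq_imp_space_eq[OF assms(1)] by simp
  finally show ?thesis .
qed

lemma potential_vanishes:
  assumes [measurable_cong]: "sets \<mu> = sets (borel :: 'a measure)" and "finite_measure \<mu>"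
    and S: "emeasure \<mu> (- S) = 0" "compact S" and e: "0 < e"
  shows "\<exists>R. \<forall>x. R < norm x \<longrightarrow> pot \<mu> x < ennreal e"
proof -
  interpret finite_measure \<mu> by fact
  obtain B where B: "\<And>z. z \<in> S \<Longrightarrow> norm z \<le> B" "0 < B"
    using compact_imp_bounded[OF S(2)] bounded_pos by blast
  define M where "M = measure \<mu> UNIV"
  have M0: "0 \<le> M" by (simp add: M_def)
  have M: "emeasure \<mu> UNIV = ennreal M" by (simp add: M_def emeasure_eq_measure)
  let ?p = "\<alpha> - real DIM('a)"
  define r where "r = (e / (M + 1)) powr (1 / ?p)"
  have r: "0 < r" "r powr ?p = e / (M + 1)" using alpha_dim e M0 by (auto simp: r_def powr_powr)
  have "pot \<mu> x < ennreal e" if x: "B + r < norm x" for x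
  proof -
    have "r \<le> dist x z" if "z \<in> S" for z
      using B(1)[OF that] x norm_triangle_ineq2[of x z] by (simp add: dist_norm)
    then have "pot \<mu> x \<le> ennreal (r powr ?p) * ennreal M"
      using potential_far[OF assms(1) S(1) _ r(1)] compact_imp_closed[OF S(2)] by (auto simp: M)
    also have "\<dots> = ennreal (e / (M + 1) * M)" using e M0 by (simp add: r ennreal_mult[symmetric])
    also have "\<dots> < ennreal e" using e M0 by (intro ennreal_lessI) (auto simp: field_simps)
    finally show ?thesis .
  qed
  then show ?thesis by blast
qed

text \<open>Upper semicontinuity is stated for sequences along which the values converge; this form follows
  directly for the functions to which it is applied.\<close>

lemma usc_attains_max:
  fixes f :: "'b::metric_space \<Rightarrow> real"
  assumes K: "compact K" "K \<noteq> {}" and bdd: "\<And>x. x \<in> K \<Longrightarrow> f x \<le> B"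
    and usc: "\<And>X x c. (\<And>n::nat. X n \<in> K) \<Longrightarrow> X \<longlonglongrightarrow> x \<Longrightarrow> (\<lambda>n. f (X n)) \<longlonglongrightarrow> c \<Longrightarrow> c \<le> f x"
  shows "\<exists>x\<in>K. \<forall>y\<in>K. f y \<le> f x"
proof -
  define m where "m = Sup (f ` K)"
  have bd: "bdd_above (f ` K)" using bdd by (intro bdd_aboveI[of _ B]) auto
  have "\<exists>x\<in>K. m - 1 / real (Suc n) < f x" for n
    using less_cSup_iff[of "f ` K" "m - 1 / real (Suc n)"] K(2) bd by (auto simp: m_def)
  then obtain X where X: "\<And>n. X n \<in> K" "\<And>n. m - 1 / real (Suc n) < f (X n)" by metis
  have fm: "f x \<le> m" if "x \<in> K" for x using bd that by (auto simp: m_def intro: cSup_upper)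
  have "(\<lambda>n. m - 1 / real (Suc n)) \<longlonglongrightarrow> m - 0"
    by (intro tendsto_diff tendsto_const LIMSEQ_Suc lim_1_over_n)
  then have lo: "(\<lambda>n. m - 1 / real (Suc n)) \<longlonglongrightarrow> m" by simp
  have lim: "(\<lambda>n. f (X n)) \<longlonglongrightarrow> m"
  proof (rule tendsto_sandwich[OF _ _ lo tendsto_const])
    show "\<forall>\<^sub>F n in sequentially. m - 1 / real (Suc n) \<le> f (X n)"
      by (intro always_eventually allI less_imp_le X(2))
    show "\<forall>\<^sub>F n in sequentially. f (X n) \<le> m"
      by (intro always_eventually allI fm X(1))
  qed
  obtain x s where x: "x \<in> K" "strict_mono s" "(X \<circ> s) \<longlonglongrightarrow> x"
    using K(1) X(1) unfolding compact_def by metis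
  have "m \<le> f x"
    using usc[of "X \<circ> s" x m] X x LIMSEQ_subseq_LIMSEQ[OF lim x(2)] by (auto simp: o_def)
  then show ?thesis using x(1) fm by (meson order.trans)
qed

text \<open>Suppose the inequality fails somewhere, and let `m > 0` be the maximal excess of `V + \<delta>` over `u`,
  attained at `x0` outside the support `S`. Averaging with `sweep a` at `x0` does not increase
  `u`. It decreases `V` only by the remainder `krem a`, which is `O(a^(\<beta>+1))` because `x0` is off
  `S`. But far out the excess is at most `m / 2`, and the average sees that region with
  probability of order `a^\<beta>`. Thus `m a^\<beta> \<le> const a^(\<beta>+1)` for all small `a`, which is absurd.\<close>

lemma domination_principle:
  assumes sets_nu[measurable_cong]: "sets \<nu> = sets (borel :: 'a measure)" and fin: "finite_measure \<nu>"
    and S: "compact S" "emeasure \<nu> (- S) = 0"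
    and V: "continuous_on UNIV V" "\<And>y. 0 \<le> V y" "\<And>y. pot \<nu> y = ennreal (V y)"
    and u: "supermedian u" "lsc u" and delta: "0 \<le> \<delta>" "\<And>y. ennreal \<delta> \<le> u y"
    and le: "\<And>y. y \<in> S \<Longrightarrow> ennreal (V y + \<delta>) \<le> u y"
  shows "ennreal (V x + \<delta>) \<le> u x"
proof (rule ccontr)
  assume neg: "\<not> ennreal (V x + \<delta>) \<le> u x"
  interpret finite_measure \<nu> by fact
  have [measurable]: "u \<in> borel_measurable borel" using u(1) by (rule supermedian_measurable)
  have [measurable]: "V \<in> borel_measurable borel" using V(1) by (rule borel_measurable_continuous_onI)
  \<comment> \<open>The minimum keeps the comparison real valued, although `u` may be infinite.\<close>
  define W where "W y = enn2real (min (u y) (ennreal (V y + \<delta>)))" for y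
  have W: "ennreal (W y) = min (u y) (ennreal (V y + \<delta>))" for y
    unfolding W_def by (intro ennreal_enn2real) (rule le_less_trans[OF min.cobounded2 ennreal_less_top])
  have W0: "0 \<le> W y" for y by (simp add: W_def)
  have W1: "W y \<le> V y + \<delta>" for y
  proof -
    have "ennreal (W y) \<le> ennreal (V y + \<delta>)" unfolding W by simp
    then show ?thesis using V(2)[of y] delta(1) by (subst (asm) ennreal_le_iff) auto
  qed
  have W2: "\<delta> \<le> W y" for y
  proof -
    have "ennreal \<delta> \<le> ennreal (W y)" unfolding W using delta V(2)[of y] by (auto intro!: ennreal_leI)
    then show ?thesis using W0 by (simp add: ennreal_le_iff)
  qed
  define f where "f y = V y + \<delta> - W y" for y
  have f0: "0 \<le> f y" "f y \<le> V y" for y using W1[of y] W2[of y] by (auto simp: f_def)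
  have fx: "0 < f x"
  proof -
    have "ennreal (W x) < ennreal (V x + \<delta>)" using neg unfolding W by (auto simp: min_def)
    then have "W x < V x + \<delta>" using W0[of x] by (simp add: ennreal_less_iff)
    then show ?thesis by (simp add: f_def)
  qed
  obtain R0 where R0: "\<And>y. R0 < norm y \<Longrightarrow> pot \<nu> y < ennreal (f x / 2)"
    using potential_vanishes[OF sets_nu fin S(2,1), of "f x / 2"] fx by auto
  \<comment> \<open>Beyond radius `R` the potential is below half of the excess at `x`.\<close>
  define R where "R = max R0 (norm x)"
  have R: "V y < f x / 2" if "R < norm y" for y
    using R0[of y] that V by (simp add: R_def ennreal_less_iff)
  have "compact (V ` cball 0 R)"
    by (intro compact_continuous_image continuous_on_subset[OF V(1)]) auto
  then obtain B where B: "\<And>y. y \<in> cball 0 R \<Longrightarrow> V y \<le> B"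
    using compact_imp_bounded bounded_real by (metis abs_le_D1 imageI)
  have "\<exists>x0\<in>cball 0 R. \<forall>y\<in>cball 0 R. f y \<le> f x0"
  proof (rule usc_attains_max[where B=B])
    show "compact (cball (0::'a) R)" "cball (0::'a) R \<noteq> {}" by (auto simp: R_def le_max_iff_disj)
    show "f y \<le> B" if "y \<in> cball 0 R" for y using B[OF that] f0[of y] by linarith
    fix X and y :: 'a and c assume X: "X \<longlonglongrightarrow> y" and lim: "(\<lambda>n. f (X n)) \<longlonglongrightarrow> c"
    have limV: "(\<lambda>n. V (X n)) \<longlonglongrightarrow> V y"
      using V(1) X by (auto intro: continuous_on_tendsto_compose)
    have "(\<lambda>n. V (X n) + \<delta> - f (X n)) \<longlonglongrightarrow> V y + \<delta> - c" by (intro tendsto_intros limV lim)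
    then have limW: "(\<lambda>n. W (X n)) \<longlonglongrightarrow> V y + \<delta> - c" by (simp add: f_def)
    have "ennreal (W y) \<le> liminf (\<lambda>n. ennreal (W (X n)))"
    proof -
      have "u y \<le> liminf (\<lambda>n. u (X n))" by (rule lscD[OF u(2) X])
      moreover have "(\<lambda>n. ennreal (V (X n) + \<delta>)) \<longlonglongrightarrow> ennreal (V y + \<delta>)"
        by (intro tendsto_intros limV)
      then have "liminf (\<lambda>n. ennreal (V (X n) + \<delta>)) = ennreal (V y + \<delta>)" by (simp add: lim_imp_Liminf)
      ultimately have "ennreal (W y) \<le> min (liminf (\<lambda>n. u (X n))) (liminf (\<lambda>n. ennreal (V (X n) + \<delta>)))"
        unfolding W by (intro min.mono) auto
      also have "\<dots> \<le> liminf (\<lambda>n. min (u (X n)) (ennreal (V (X n) + \<delta>)))"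
      proof (rule le_Liminf_iff[THEN iffD2], intro allI impI)
        fix z assume "z < min (liminf (\<lambda>n. u (X n))) (liminf (\<lambda>n. ennreal (V (X n) + \<delta>)))"
        then have "eventually (\<lambda>n. z < u (X n)) sequentially" "eventually (\<lambda>n. z < ennreal (V (X n) + \<delta>)) sequentially"
          by (auto dest: less_LiminfD)
        then show "eventually (\<lambda>n. z < min (u (X n)) (ennreal (V (X n) + \<delta>))) sequentially"
          by eventually_elim simp
      qed
      finally show ?thesis by (simp add: W)
    qed
    also have "\<dots> = ennreal (V y + \<delta> - c)"
      using limW by (intro lim_imp_Liminf tendsto_ennrealI) auto
    finally have *: "ennreal (W y) \<le> ennreal (V y + \<delta> - c)" .
    have "0 \<le> V y + \<delta> - c" by (rule LIMSEQ_le_const[OF limW]) (auto simp: W0)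
    with * have "W y \<le> V y + \<delta> - c" by (subst (asm) ennreal_le_iff) auto
    then show "c \<le> f y" by (simp add: f_def)
  qed
  then obtain x0 where x0: "x0 \<in> cball 0 R" "\<And>y. y \<in> cball 0 R \<Longrightarrow> f y \<le> f x0" by blast
  define m where "m = f x0"
  have m: "f x \<le> m" using x0(2)[of x] by (simp add: m_def R_def)
  have m0: "0 < m" using m fx by simp
  have bound: "ennreal (V y) + ennreal \<delta> + ennreal (m / 2) * indicator {y. R < norm y} y \<le> u y + ennreal m" for y
  proof (cases "R < norm y")
    case True
    have "V y + \<delta> + m / 2 \<le> \<delta> + m" using R[OF True] m by simp
    then have "ennreal (V y) + ennreal \<delta> + ennreal (m / 2) \<le> ennreal \<delta> + ennreal m"
      using V(2)[of y] delta m0 by (simp add: ennreal_plus[symmetric] ennreal_leI del: ennreal_plus)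
    also have "\<dots> \<le> u y + ennreal m" by (intro add_right_mono delta)
    finally show ?thesis using True by simp
  next
    case False
    have "V y + \<delta> \<le> W y + m" using x0(2)[of y] False by (simp add: f_def m_def)
    then have "ennreal (V y) + ennreal \<delta> \<le> ennreal (W y) + ennreal m"
      using V(2)[of y] delta m0 W0[of y] by (simp add: ennreal_plus[symmetric] ennreal_leI del: ennreal_plus)
    also have "\<dots> \<le> u y + ennreal m" unfolding W by (intro add_right_mono) simp
    finally show ?thesis using False by simp
  qed
  have Wx0: "ennreal (V x0) + ennreal \<delta> = u x0 + ennreal m"
  proof -
    have "W x0 < V x0 + \<delta>" using m0 by (simp add: m_def f_def)
    then have "ennreal (W x0) < ennreal (V x0 + \<delta>)" using W0[of x0] by (simp add: ennreal_less_iff)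
    then have "ennreal (W x0) = u x0" unfolding W by (auto simp: min_def split: if_splits)
    moreover have "V x0 + \<delta> = W x0 + m" by (simp add: m_def f_def)
    ultimately have "ennreal (V x0 + \<delta>) = u x0 + ennreal m"
      using m0 W0[of x0] by simp
    then show ?thesis using V(2)[of x0] delta(1) by simp
  qed
  have x0S: "x0 \<notin> S"
  proof
    assume "x0 \<in> S"
    then have "ennreal (W x0) = ennreal (V x0 + \<delta>)"
      unfolding W by (intro min_absorb2 le)
    then have "W x0 = V x0 + \<delta>" using V(2)[of x0] delta(1) W0[of x0] by (subst (asm) ennreal_inj) auto
    then show False using m0 by (simp add: m_def f_def)
  qed
  have "\<exists>r>0. \<forall>z\<in>S. r \<le> dist x0 z"
  proof (cases "S = {}")
    case False
    have "0 < infdist x0 S"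
      using x0S S(1) False compact_imp_closed infdist_pos_not_in_closed by blast
    then show ?thesis using infdist_le by blast
  qed (auto intro!: exI[of _ 1])
  then obtain r where r: "0 < r" "\<And>z. z \<in> S \<Longrightarrow> r \<le> dist x0 z" by blast
  obtain C where C: "0 < C" "\<And>a z. 0 < a \<Longrightarrow> r \<le> norm z \<Longrightarrow> krem a z \<le> ennreal (C * a powr (\<beta> + 1))"
    using krem_far[OF r(1)] by blast
  have "0 \<le> R + norm x0" by (simp add: R_def le_max_iff_disj)
  from sweep_tail[OF this]
  obtain c where c: "0 < c" "\<And>a. a \<in> {0<..1} \<Longrightarrow> ennreal (c * a powr \<beta>) \<le> (\<integral>\<^sup>+ y. sweep a (x0 - y) * indicator {y. R + norm x0 < dist x0 y} y \<partial>lborel)"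
    by blast
  define M where "M = measure \<nu> UNIV"
  have M: "0 \<le> M" "emeasure \<nu> UNIV = ennreal M" by (simp_all add: M_def emeasure_eq_measure)
  \<comment> \<open>The two orders in `a` confront each other here.\<close>
  have main: "m / 2 * (c * a powr \<beta>) \<le> C * a powr (\<beta> + 1) * M" if a: "a \<in> {0<..1}" for a
  proof -
    have a0: "0 < a" using a by simp
    have AES: "AE z in \<nu>. z \<in> S" using S by (intro AE_I[of _ _ "- S"]) (auto simp: sets_nu compact_imp_closed)
    let ?q = "\<lambda>y. sweep a (x0 - y)"
    let ?o = "indicator {y. R < norm y} :: 'a \<Rightarrow> ennreal"
    have rem: "(\<integral>\<^sup>+ z. krem a (x0 - z) \<partial>\<nu>) \<le> ennreal (C * a powr (\<beta> + 1) * M)"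
    proof -
      have "(\<integral>\<^sup>+ z. krem a (x0 - z) \<partial>\<nu>) \<le> (\<integral>\<^sup>+ z. ennreal (C * a powr (\<beta> + 1)) \<partial>\<nu>)"
        using AES by (intro nn_integral_mono_AE, eventually_elim) (use r(2) a0 in \<open>auto intro!: C(2) simp: dist_norm\<close>)
      also have "\<dots> = ennreal (C * a powr (\<beta> + 1) * M)"
        using sets_eq_imp_space_eq[OF sets_nu] C(1) M by (simp add: ennreal_mult)
      finally show ?thesis .
    qed
    have qV: "(\<integral>\<^sup>+ y. ?q y * ennreal (V y) \<partial>lborel) = ktr_potential a \<nu> x0"
      using sweep_potential[OF sets_nu fin a0, of x0] by (simp add: V(3) ktr_potential_def)
    have "ktr_potential a \<nu> x0 + ennreal \<delta> + ennreal (m / 2) * (\<integral>\<^sup>+ y. ?q y * ?o y \<partial>lborel)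
       = (\<integral>\<^sup>+ y. ?q y * (ennreal (V y) + ennreal \<delta> + ennreal (m / 2) * ?o y) \<partial>lborel)"
      using sweep_integral'[OF a0, of x0]
      by (simp add: distrib_left nn_integral_add nn_integral_multc nn_integral_cmult qV mult.left_commute[of _ "ennreal (m / 2)"])
    also have "\<dots> \<le> (\<integral>\<^sup>+ y. ?q y * (u y + ennreal m) \<partial>lborel)"
      by (intro nn_integral_mono mult_left_mono bound) auto
    also have "\<dots> = (\<integral>\<^sup>+ y. ?q y * u y \<partial>lborel) + ennreal m"
      using sweep_integral'[OF a0, of x0] by (simp add: distrib_left nn_integral_add nn_integral_multc)
    also have "\<dots> \<le> u x0 + ennreal m"
      by (intro add_right_mono supermedianD[OF u(1) a0])
    also have "\<dots> = ktr_potential a \<nu> x0 + ennreal \<delta> + (\<integral>\<^sup>+ z. krem a (x0 - z) \<partial>\<nu>)"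
      using Wx0 V(3)[of x0] potential_split[OF sets_nu, of x0 a] by (simp add: ac_simps)
    finally have "ennreal (m / 2) * (\<integral>\<^sup>+ y. ?q y * ?o y \<partial>lborel) \<le> (\<integral>\<^sup>+ z. krem a (x0 - z) \<partial>\<nu>)"
    proof (rule ennreal_add_left_cancel_le[THEN iffD1, THEN disjE])
      assume "ktr_potential a \<nu> x0 + ennreal \<delta> = \<infinity>"
      moreover have "ktr_potential a \<nu> x0 \<le> pot \<nu> x0" unfolding potential_split[OF sets_nu, of x0 a] by simp
      ultimately show ?thesis by (auto simp: V(3) top_unique)
    qed
    moreover have "ennreal (c * a powr \<beta>) \<le> (\<integral>\<^sup>+ y. ?q y * ?o y \<partial>lborel)"
    proof -
      have "R < norm y" if "R + norm x0 < dist x0 y" for y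
        using that norm_triangle_ineq4[of x0 y] by (simp add: dist_norm)
      then show ?thesis
        by (intro order.trans[OF c(2)[OF a]] nn_integral_mono) (auto simp: indicator_def)
    qed
    ultimately have "ennreal (m / 2) * ennreal (c * a powr \<beta>) \<le> ennreal (C * a powr (\<beta> + 1) * M)"
      using rem by (meson mult_left_mono order.trans zero_le)
    then have "ennreal (m / 2 * (c * a powr \<beta>)) \<le> ennreal (C * a powr (\<beta> + 1) * M)"
      using m0 c(1) by (subst ennreal_mult) auto
    then show ?thesis using C(1) M by (subst (asm) ennreal_le_iff) auto
  qed
  define a where "a = min 1 (m * c / (4 * (C * M + 1)))"
  have CM: "0 < C * M + 1" using C(1) M by (simp add: add_nonneg_pos)
  have a: "a \<in> {0<..1}" using CM m0 c(1) by (simp add: a_def)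
  have "m / 2 * c * a powr \<beta> \<le> C * M * a * a powr \<beta>"
    using main[OF a] a by (simp add: powr_add ac_simps)
  then have "m / 2 * c \<le> C * M * a" using a by simp
  also have "\<dots> \<le> (C * M + 1) * a" using a by simp
  also have "\<dots> \<le> (C * M + 1) * (m * c / (4 * (C * M + 1)))" using CM by (intro mult_left_mono) (auto simp: a_def)
  also have "\<dots> = m * c / 4"
  proof -
    have "D * (m * c / (4 * D)) = m * c / 4" if "D \<noteq> 0" for D using that by simp
    from this[of "C * M + 1"] CM show ?thesis by simp
  qed
  finally show False using m0 c(1) by simp
qed

end

section \<open>A space-filling curve with a Borel section\<close>

text \<open>A continuous function of period 2 that is 0 on `[0, 1/3]` and 1 on `[2/3, 1]`, as in Schoenberg's
  construction: it reads off a digit of a ternary expansion without digits 1, see `wave_ternary`.\<close>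

definition wave :: "real \<Rightarrow> real" where
  "wave t = max 0 (min 1 (1 / 2 - cos (pi * t)))"

lemma wave_range: "0 \<le> wave t" "wave t \<le> 1"
  by (auto simp: wave_def)

lemma wave_continuous: "continuous_on A wave"
  unfolding wave_def[abs_def] by (intro continuous_intros)

lemma wave_periodic: "wave (2 * real n + t) = wave t"
proof -
  have "cos (pi * (2 * real n + t)) = cos (2 * real n * pi + pi * t)" by (simp add: algebra_simps)
  also have "\<dots> = cos (pi * t)" by (simp only: cos_add cos_2npi sin_2npi)
  finally show ?thesis by (simp add: wave_def)
qed

lemma wave_low: assumes "0 \<le> t" "t \<le> 1 / 3" shows "wave t = 0"
proof -
  have "cos (pi / 3) \<le> cos (pi * t)"
    using assms by (intro cos_monotone_0_pi_le) auto
  then show ?thesis by (simp add: wave_def cos_60)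
qed

lemma wave_high: assumes "2 / 3 \<le> t" "t \<le> 1" shows "wave t = 1"
proof -
  have "cos (pi * t) \<le> cos (2 * pi / 3)"
    using assms by (intro cos_monotone_0_pi_le) (auto simp: field_simps)
  then show ?thesis by (simp add: wave_def cos_120)
qed

definition ternary :: "(nat \<Rightarrow> nat) \<Rightarrow> real" where
  "ternary c = (\<Sum>n. 2 * real (c n) / 3 ^ Suc n)"

lemma geometric_third: "(\<lambda>n. 2 / 3 ^ Suc n :: real) sums 1"
proof -
  have "(\<lambda>n. 2 / 3 * (1 / 3) ^ n :: real) sums (2 / 3 * (1 / (1 - 1 / 3)))"
    by (intro sums_mult geometric_sums) auto
  then show ?thesis by (simp add: power_divide)
qed

lemma ternary_summable:
  assumes "\<And>n. c n \<le> 1" shows "summable (\<lambda>n. 2 * real (c n) / 3 ^ Suc n)"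
proof (rule summable_comparison_test'[OF sums_summable[OF geometric_third]])
  show "norm (2 * real (c n) / 3 ^ Suc n) \<le> 2 / 3 ^ Suc n" for n
    using assms[of n] by (simp add: divide_right_mono)
qed

lemma ternary_range:
  assumes "\<And>n. c n \<le> 1" shows "0 \<le> ternary c" "ternary c \<le> 1"
proof -
  show "0 \<le> ternary c" unfolding ternary_def by (intro suminf_nonneg ternary_summable assms) auto
  have "ternary c \<le> (\<Sum>n. 2 / 3 ^ Suc n)"
    unfolding ternary_def using assms
    by (intro suminf_le ternary_summable sums_summable[OF geometric_third]) (auto intro!: divide_right_mono)
  then show "ternary c \<le> 1" using sums_unique[OF geometric_third] by simp
qed

lemma ternary_shift:
  assumes "\<And>n. c n \<le> 1" shows "3 * ternary c = 2 * real (c 0) + ternary (\<lambda>n. c (Suc n))"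
proof -
  have "ternary c = 2 * real (c 0) / 3 + (\<Sum>n. 2 * real (c (Suc n)) / 3 ^ Suc (Suc n))"
    unfolding ternary_def using suminf_split_head[OF ternary_summable[of c]] assms by simp
  also have "(\<Sum>n. 2 * real (c (Suc n)) / 3 ^ Suc (Suc n)) = (\<Sum>n. (1 / 3) * (2 * real (c (Suc n)) / 3 ^ Suc n))"
    by simp
  also have "\<dots> = 1 / 3 * ternary (\<lambda>n. c (Suc n))"
    unfolding ternary_def by (intro suminf_mult ternary_summable assms)
  finally show ?thesis by simp
qed

lemma wave_ternary:
  assumes "\<And>n. c n \<le> 1" shows "wave (3 ^ k * ternary c) = real (c k)"
  using assms
proof (induction k arbitrary: c)
  case 0
  let ?r = "ternary (\<lambda>n. c (Suc n))"
  have r: "0 \<le> ?r" "?r \<le> 1" using ternary_range[of "\<lambda>n. c (Suc n)"] 0 by auto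
  have t: "ternary c = (2 * real (c 0) + ?r) / 3" using ternary_shift[of c] 0 by simp
  have "c 0 = 0 \<or> c 0 = 1" using 0[of 0] by linarith
  then show ?case
  proof
    assume "c 0 = 0"
    then show ?thesis using r by (simp add: t wave_low)
  next
    assume "c 0 = 1"
    then show ?thesis using r by (simp add: t wave_high)
  qed
next
  case (Suc k)
  have "3 ^ Suc k * ternary c = 3 ^ k * (3 * ternary c)" by simp
  also have "\<dots> = 3 ^ k * (2 * real (c 0) + ternary (\<lambda>n. c (Suc n)))"
    by (subst ternary_shift) (use Suc.prems in auto)
  also have "\<dots> = 2 * real (3 ^ k * c 0) + 3 ^ k * ternary (\<lambda>n. c (Suc n))"
    by (simp add: algebra_simps)
  finally have "wave (3 ^ Suc k * ternary c) = wave (3 ^ k * ternary (\<lambda>n. c (Suc n)))"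
    by (simp only: wave_periodic)
  also have "\<dots> = real (c (Suc k))" using Suc.IH[of "\<lambda>n. c (Suc n)"] Suc.prems by simp
  finally show ?case .
qed

lemma binary_expansion:
  assumes y: "0 \<le> y" "y \<le> (1::real)"
  shows "\<exists>b::nat \<Rightarrow> nat. (\<forall>n. b n \<le> 1) \<and> (\<lambda>n. real (b n) / 2 ^ Suc n) sums y"
proof -
  define r where "r = rec_nat y (\<lambda>_ u. if 1 / 2 \<le> u then 2 * u - 1 else 2 * u)"
  have r0: "r 0 = y" and rS: "\<And>n. r (Suc n) = (if 1 / 2 \<le> r n then 2 * r n - 1 else 2 * r n)"
    by (simp_all add: r_def)
  define b where "b n = (if 1 / 2 \<le> r n then 1 else 0 :: nat)" for n
  have rb: "0 \<le> r n \<and> r n \<le> 1" for n by (induction n) (use y in \<open>auto simp: r0 rS\<close>)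
  have step: "r n = (real (b n) + r (Suc n)) / 2" for n by (simp add: rS b_def)
  have part: "(\<Sum>k<n. real (b k) / 2 ^ Suc k) = y - r n / 2 ^ n" for n
  proof (induction n)
    case (Suc n)
    then show ?case by (simp add: step[of n] field_simps)
  qed (simp add: r0)
  have "(\<lambda>n. r n / 2 ^ n) \<longlonglongrightarrow> 0"
  proof (rule Lim_null_comparison)
    show "\<forall>\<^sub>F n in sequentially. norm (r n / 2 ^ n) \<le> (1 / 2) ^ n"
      using rb by (intro always_eventually) (auto simp: power_divide divide_right_mono)
    show "(\<lambda>n. (1 / 2 :: real) ^ n) \<longlonglongrightarrow> 0" by (rule LIMSEQ_power_zero) simp
  qed
  then have "(\<lambda>n. y - r n / 2 ^ n) \<longlonglongrightarrow> y - 0" by (intro tendsto_intros)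
  then have "(\<lambda>n. real (b n) / 2 ^ Suc n) sums y"
    unfolding sums_def part by simp
  moreover have "\<forall>n. b n \<le> 1" by (simp add: b_def)
  ultimately show ?thesis by blast
qed

text \<open>A Cantor point in ternary expansion carries a sequence of binary digits. Splitting it into
  `DIM('a)` interleaved subsequences gives the binary expansions of the coordinates of any
  prescribed point of the cube.\<close>

lemma schoenberg_curve:
  "\<exists>\<Psi>::real \<Rightarrow> 'a::euclidean_space. continuous_on UNIV \<Psi> \<and> (\<forall>t. \<Psi> t \<in> cbox 0 One) \<and> cbox 0 One \<subseteq> \<Psi> ` {0..1}"
proof -
  let ?d = "DIM('a)"
  obtain e where e: "bij_betw e (Basis::'a set) {0..<?d}"
    using ex_bij_betw_finite_nat[OF finite_Basis] by blast
  have ed: "e b < ?d" if "b \<in> Basis" for b using e that by (auto simp: bij_betw_def)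
  define F where "F i t = (\<Sum>k. wave (3 ^ (?d * k + i) * t) / 2 ^ Suc k)" for i t
  have bnd: "norm (wave (3 ^ (?d * k + i) * t) / 2 ^ Suc k) \<le> (1 / 2) ^ Suc k" for k i t
    using wave_range[of "3 ^ (?d * k + i) * t"] by (simp add: power_divide divide_right_mono)
  have geo: "(\<lambda>k. (1 / 2 :: real) ^ Suc k) sums 1" by (rule power_half_series)
  have summ: "summable (\<lambda>k. wave (3 ^ (?d * k + i) * t) / 2 ^ Suc k)" for i t
    by (rule summable_comparison_test'[OF sums_summable[OF geo] bnd])
  have Fcont: "continuous_on UNIV (F i)" for i
  proof (rule uniform_limit_theorem)
    show "uniform_limit UNIV (\<lambda>n t. \<Sum>k<n. wave (3 ^ (?d * k + i) * t) / 2 ^ Suc k) (F i) sequentially"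
      unfolding F_def by (rule Weierstrass_m_test[OF bnd sums_summable[OF geo]])
    show "\<forall>\<^sub>F n in sequentially. continuous_on UNIV (\<lambda>t. \<Sum>k<n. wave (3 ^ (?d * k + i) * t) / 2 ^ Suc k)"
      by (intro always_eventually allI continuous_intros continuous_on_compose2[OF wave_continuous[of UNIV]]) auto
  qed simp
  have F0: "0 \<le> F i t" for i t unfolding F_def using wave_range by (intro suminf_nonneg summ) auto
  have F1: "F i t \<le> 1" for i t
  proof -
    have "F i t \<le> (\<Sum>k. (1 / 2) ^ Suc k)"
      unfolding F_def
    proof (rule suminf_le[OF _ summ sums_summable[OF geo]])
      fix k
      have "wave (3 ^ (?d * k + i) * t) / 2 ^ Suc k \<le> norm (wave (3 ^ (?d * k + i) * t) / 2 ^ Suc k)"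
        unfolding real_norm_def by (rule abs_ge_self)
      also note bnd
      finally show "wave (3 ^ (?d * k + i) * t) / 2 ^ Suc k \<le> (1 / 2) ^ Suc k" .
    qed
    then show ?thesis using sums_unique[OF geo] by simp
  qed
  define \<Psi> :: "real \<Rightarrow> 'a" where "\<Psi> t = (\<Sum>b\<in>Basis. F (e b) t *\<^sub>R b)" for t
  have comp: "\<Psi> t \<bullet> b = F (e b) t" if "b \<in> Basis" for t b
    using that by (simp add: \<Psi>_def inner_sum_left inner_Basis if_distrib[of "(*) _"] cong: if_cong)
  have "cbox 0 One \<subseteq> \<Psi> ` {0..1}"
  proof
    fix x :: 'a assume x: "x \<in> cbox 0 One"
    have "\<exists>c::nat \<Rightarrow> nat. (\<forall>n. c n \<le> 1) \<and> (\<lambda>n. real (c n) / 2 ^ Suc n) sums (x \<bullet> b)" if "b \<in> Basis" for b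
      using x that by (intro binary_expansion) (auto simp: mem_box)
    then obtain c :: "'a \<Rightarrow> nat \<Rightarrow> nat" where c: "\<And>b n. b \<in> Basis \<Longrightarrow> c b n \<le> 1"
      "\<And>b. b \<in> Basis \<Longrightarrow> (\<lambda>n. real (c b n) / 2 ^ Suc n) sums (x \<bullet> b)"
      by metis
    define e' where "e' = the_inv_into (Basis::'a set) e"
    \<comment> \<open>Digit `n` of the parameter is digit `n div d` of the coordinate with index `n mod d`.\<close>
    define C where "C n = c (e' (n mod ?d)) (n div ?d)" for n
    have e': "e' i \<in> Basis" if "i < ?d" for i
      using e that unfolding e'_def by (intro the_inv_into_into) (auto simp: bij_betw_def)
    have e'e: "e' (e b) = b" if "b \<in> Basis" for b
      using e that by (simp add: e'_def the_inv_into_f_f bij_betw_def)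
    have C1: "C n \<le> 1" for n unfolding C_def by (intro c(1) e') simp
    have "\<Psi> (ternary C) \<bullet> b = x \<bullet> b" if b: "b \<in> Basis" for b
    proof -
      have "C (?d * k + e b) = c b k" for k
        using ed[OF b] e'e[OF b] by (simp add: C_def)
      then have "F (e b) (ternary C) = (\<Sum>k. real (c b k) / 2 ^ Suc k)"
        unfolding F_def by (simp add: wave_ternary[OF C1])
      then show ?thesis using sums_unique[OF c(2)[OF b]] comp[OF b] by simp
    qed
    then have "\<Psi> (ternary C) = x" by (rule euclidean_eqI)
    then show "x \<in> \<Psi> ` {0..1}" using ternary_range[OF C1] by auto
  qed
  moreover have "continuous_on UNIV \<Psi>"
    unfolding \<Psi>_def by (intro continuous_intros continuous_on_compose2[OF Fcont]) auto
  moreover have "\<Psi> t \<in> cbox 0 One" for t using F0 F1 by (auto simp: mem_box comp)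
  ultimately show ?thesis by blast
qed

text \<open>The least preimage is a measurable choice: its sublevel sets are continuous images of compact
  sets.\<close>

lemma borel_section:
  fixes \<Psi> :: "real \<Rightarrow> 'b::t2_space"
  assumes cont: "continuous_on UNIV \<Psi>" and K: "K \<subseteq> \<Psi> ` {0..1}" "closed K"
  shows "\<exists>\<sigma>. \<sigma> \<in> borel_measurable borel \<and> (\<forall>x\<in>K. \<sigma> x \<in> {0..1} \<and> \<Psi> (\<sigma> x) = x)"
proof -
  \<comment> \<open>Any value above 1 serves outside `K`.\<close>
  define \<sigma> where "\<sigma> x = (if x \<in> K then Inf {t \<in> {0..1}. \<Psi> t = x} else 2)" for x
  have cl: "compact {t \<in> {0..1}. \<Psi> t = x}" for x
  proof -
    have "compact ({0..1} \<inter> \<Psi> -` {x})"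
      by (intro compact_Int_closed continuous_closed_vimage) (use cont in \<open>auto simp: continuous_on_eq_continuous_at\<close>)
    moreover have "{0..1} \<inter> \<Psi> -` {x} = {t \<in> {0..1}. \<Psi> t = x}" by auto
    ultimately show ?thesis by simp
  qed
  have s: "\<sigma> x \<in> {t \<in> {0..1}. \<Psi> t = x}" if x: "x \<in> K" for x
  proof -
    obtain t where "t \<in> {0..1}" "x = \<Psi> t" using x K(1) by blast
    then have "{t \<in> {0..1}. \<Psi> t = x} \<noteq> {}" by auto
    then have "Inf {t \<in> {0..1}. \<Psi> t = x} \<in> {t \<in> {0..1}. \<Psi> t = x}"
      by (intro closed_contains_Inf compact_imp_closed cl) (auto intro!: bdd_belowI[of _ 0])
    then show ?thesis using x by (simp add: \<sigma>_def)
  qed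
  have "\<sigma> \<in> borel_measurable borel"
    unfolding borel_measurable_iff_le
  proof
    fix c :: real
    show "{w \<in> space borel. \<sigma> w \<le> c} \<in> sets borel"
    proof (cases "2 \<le> c")
      case True
      have "\<sigma> x \<le> 2" for x using s[of x] by (cases "x \<in> K") (auto simp: \<sigma>_def)
      then have "{w \<in> space borel. \<sigma> w \<le> c} = UNIV" using True by (auto intro: order.trans)
      then show ?thesis by simp
    next
      case False
      have "{w \<in> space borel. \<sigma> w \<le> c} = K \<inter> \<Psi> ` ({0..1} \<inter> {..c})"
      proof safe
        fix x assume x: "\<sigma> x \<le> c"
        then show xK: "x \<in> K" using False by (auto simp: \<sigma>_def split: if_splits)
        show "x \<in> \<Psi> ` ({0..1} \<inter> {..c})" using s[OF xK] x by (intro image_eqI[of _ _ "\<sigma> x"]) auto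
      next
        fix t assume t: "\<Psi> t \<in> K" "t \<in> {0..1}" "t \<le> c"
        have "Inf {u \<in> {0..1}. \<Psi> u = \<Psi> t} \<le> t"
          using t by (intro cInf_lower) (auto intro!: bdd_belowI[of _ 0])
        then show "\<sigma> (\<Psi> t) \<le> c" using t by (simp add: \<sigma>_def)
      qed auto
      moreover have "compact (\<Psi> ` ({0..1} \<inter> {..c}))"
        by (intro compact_continuous_image continuous_on_subset[OF cont] compact_Int_closed) auto
      ultimately show ?thesis
        using K(2) by (simp add: compact_imp_closed)
    qed
  qed
  with s show ?thesis by (intro exI[of _ \<sigma>]) auto
qed

section \<open>Vague compactness\<close>

definition add_measure :: "'b measure \<Rightarrow> 'b measure \<Rightarrow> 'b measure" where
  "add_measure \<mu> \<nu> = measure_of (space \<mu>) (sets \<mu>) (\<lambda>A. emeasure \<mu> A + emeasure \<nu> A)"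

lemma sets_add_measure[simp, measurable_cong]: "sets (add_measure \<mu> \<nu>) = sets \<mu>"
  by (simp add: add_measure_def)

lemma space_add_measure[simp]: "space (add_measure \<mu> \<nu>) = space \<mu>"
  by (simp add: add_measure_def)

lemma emeasure_add_measure:
  assumes "sets \<nu> = sets \<mu>" "A \<in> sets \<mu>"
  shows "emeasure (add_measure \<mu> \<nu>) A = emeasure \<mu> A + emeasure \<nu> A"
proof (rule emeasure_measure_of[OF add_measure_def])
  show "sets \<mu> \<subseteq> Pow (space \<mu>)" by (rule sets.space_closed)
  show "A \<in> sets (add_measure \<mu> \<nu>)" using assms by simp
  show "positive (sets (add_measure \<mu> \<nu>)) (\<lambda>A. emeasure \<mu> A + emeasure \<nu> A)"
    by (simp add: positive_def)
  show "countably_additive (sets (add_measure \<mu> \<nu>)) (\<lambda>A. emeasure \<mu> A + emeasure \<nu> A)"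
  proof (rule countably_additiveI)
    fix F :: "nat \<Rightarrow> _" assume F: "range F \<subseteq> sets (add_measure \<mu> \<nu>)" "disjoint_family F"
    have "(\<Sum>i. emeasure \<mu> (F i) + emeasure \<nu> (F i)) = (\<Sum>i. emeasure \<mu> (F i)) + (\<Sum>i. emeasure \<nu> (F i))"
      by (intro suminf_add[symmetric]) auto
    also have "\<dots> = emeasure \<mu> (\<Union>i. F i) + emeasure \<nu> (\<Union>i. F i)"
      using F assms(1) by (intro arg_cong2[of _ _ _ _ "(+)"] suminf_emeasure) auto
    finally show "(\<Sum>i. emeasure \<mu> (F i) + emeasure \<nu> (F i)) = emeasure \<mu> (\<Union>i. F i) + emeasure \<nu> (\<Union>i. F i)" .
  qed
qed

lemma nn_integral_add_measure:
  assumes sets: "sets \<nu> = sets \<mu>" and f: "f \<in> borel_measurable \<mu>"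
  shows "(\<integral>\<^sup>+ x. f x \<partial>add_measure \<mu> \<nu>) = (\<integral>\<^sup>+ x. f x \<partial>\<mu>) + (\<integral>\<^sup>+ x. f x \<partial>\<nu>)"
  using f
proof (induction rule: borel_measurable_induct)
  case (cong f g)
  have "space \<nu> = space \<mu>" using sets by (rule sets_eq_imp_space_eq)
  then show ?case
    using cong(3,4) nn_integral_cong[of \<mu> f g] nn_integral_cong[of \<nu> f g] nn_integral_cong[of "add_measure \<mu> \<nu>" f g] by simp
next
  case (set A)
  then show ?case using sets by (simp add: emeasure_add_measure)
next
  case (mult u c)
  have "u \<in> borel_measurable \<nu>" "u \<in> borel_measurable (add_measure \<mu> \<nu>)"
    using mult(2) by (simp_all add: measurable_cong_sets[OF sets refl] cong: measurable_cong_sets)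
  then show ?case using mult by (simp add: nn_integral_cmult distrib_left)
next
  case (add u v)
  have "u \<in> borel_measurable \<nu>" "u \<in> borel_measurable (add_measure \<mu> \<nu>)" "v \<in> borel_measurable \<nu>" "v \<in> borel_measurable (add_measure \<mu> \<nu>)"
    using add(1,3) by (simp_all add: measurable_cong_sets[OF sets refl] cong: measurable_cong_sets)
  then show ?case using add by (simp add: nn_integral_add ac_simps)
next
  case (seq U)
  have "U i \<in> borel_measurable \<nu>" "U i \<in> borel_measurable (add_measure \<mu> \<nu>)" for i
    using seq(1) by (simp_all add: measurable_cong_sets[OF sets refl] cong: measurable_cong_sets)
  then have "(\<integral>\<^sup>+ x. (SUP i. U i x) \<partial>add_measure \<mu> \<nu>) = (SUP i. (\<integral>\<^sup>+ x. U i x \<partial>\<mu>) + (\<integral>\<^sup>+ x. U i x \<partial>\<nu>))"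
    "(\<integral>\<^sup>+ x. (SUP i. U i x) \<partial>\<mu>) = (SUP i. \<integral>\<^sup>+ x. U i x \<partial>\<mu>)" "(\<integral>\<^sup>+ x. (SUP i. U i x) \<partial>\<nu>) = (SUP i. \<integral>\<^sup>+ x. U i x \<partial>\<nu>)"
    using seq by (simp_all add: nn_integral_monotone_convergence_SUP)
  moreover have "(SUP i. (\<integral>\<^sup>+ x. U i x \<partial>\<mu>) + (\<integral>\<^sup>+ x. U i x \<partial>\<nu>)) = (SUP i. \<integral>\<^sup>+ x. U i x \<partial>\<mu>) + (SUP i. \<integral>\<^sup>+ x. U i x \<partial>\<nu>)"
    using seq(3) by (intro ennreal_SUP_add) (auto simp: incseq_def le_fun_def intro!: nn_integral_mono)
  ultimately show ?case by (simp add: image_comp)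
qed

text \<open>A homeomorphism of the line onto `(0, 1)` that, applied to each coordinate, compactifies the space
  to a cube.\<close>

definition squash :: "real \<Rightarrow> real" where
  "squash x = 1 / 2 + x / (2 * (1 + \<bar>x\<bar>))"

definition unsquash :: "real \<Rightarrow> real" where
  "unsquash y = (2 * y - 1) / (1 - \<bar>2 * y - 1\<bar>)"

lemma squash_range: "0 < squash x" "squash x < 1"
proof -
  have "\<bar>x / (2 * (1 + \<bar>x\<bar>))\<bar> < 1 / 2" by (simp add: abs_mult)
  then show "0 < squash x" "squash x < 1" unfolding squash_def by linarith+
qed

lemma unsquash_squash: "unsquash (squash x) = x"
proof -
  have "2 * (1 / 2 + x / (2 * D)) - 1 = x / D" for D by simp
  then have "2 * squash x - 1 = x / (1 + \<bar>x\<bar>)" unfolding squash_def .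
  moreover have "1 - \<bar>x / (1 + \<bar>x\<bar>)\<bar> = 1 / (1 + \<bar>x\<bar>)" by (simp add: abs_divide field_simps)
  ultimately show ?thesis by (simp add: unsquash_def)
qed

lemma squash_measurable[measurable]: "squash \<in> borel_measurable borel"
  unfolding squash_def[abs_def] by measurable

lemma unsquash_measurable[measurable]: "unsquash \<in> borel_measurable borel"
  unfolding unsquash_def[abs_def] by measurable

lemma unsquash_tendsto:
  assumes "(f \<longlongrightarrow> y) F" "0 < y" "y < 1"
  shows "((\<lambda>n. unsquash (f n)) \<longlongrightarrow> unsquash y) F"
  unfolding unsquash_def using assms(2,3) by (intro tendsto_intros assms(1)) auto

lemma unsquash_large:
  assumes "0 < R" "0 < y" "y < 1" "R / (1 + R) < \<bar>2 * y - 1\<bar>"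
  shows "R < \<bar>unsquash y\<bar>"
proof -
  have p: "0 < 1 - \<bar>2 * y - 1\<bar>" using assms by auto
  have "R < \<bar>2 * y - 1\<bar> * (1 + R)" using assms by (simp add: divide_less_eq)
  then have "R * (1 - \<bar>2 * y - 1\<bar>) < \<bar>2 * y - 1\<bar>" by (simp add: algebra_simps)
  then show ?thesis using p by (simp add: unsquash_def abs_divide less_divide_eq)
qed

definition squash_vec :: "'a::euclidean_space \<Rightarrow> 'a" where
  "squash_vec x = (\<Sum>b\<in>Basis. squash (x \<bullet> b) *\<^sub>R b)"

definition unsquash_vec :: "'a::euclidean_space \<Rightarrow> 'a" where
  "unsquash_vec x = (\<Sum>b\<in>Basis. unsquash (x \<bullet> b) *\<^sub>R b)"

lemma squash_vec_component: "b \<in> Basis \<Longrightarrow> squash_vec x \<bullet> b = squash (x \<bullet> b)"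
  by (simp add: squash_vec_def inner_sum_left inner_Basis if_distrib[of "(*) _"] cong: if_cong)

lemma unsquash_vec_component: "b \<in> Basis \<Longrightarrow> unsquash_vec x \<bullet> b = unsquash (x \<bullet> b)"
  by (simp add: unsquash_vec_def inner_sum_left inner_Basis if_distrib[of "(*) _"] cong: if_cong)

lemma unsquash_vec_squash_vec: "unsquash_vec (squash_vec x) = x"
  by (rule euclidean_eqI) (simp add: unsquash_vec_component squash_vec_component unsquash_squash)

lemma squash_vec_range: "squash_vec x \<in> box 0 One"
  by (auto simp: mem_box squash_vec_component squash_range)

lemma squash_vec_measurable[measurable]: "squash_vec \<in> borel_measurable borel"
  unfolding squash_vec_def[abs_def] by measurable

lemma unsquash_vec_measurable[measurable]: "unsquash_vec \<in> borel_measurable borel"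
  unfolding unsquash_vec_def[abs_def] by measurable

text \<open>A continuous function that vanishes at infinity extends continuously by zero to the boundary of
  the cube.\<close>

lemma extension_by_zero_continuous:
  fixes f :: "'a::euclidean_space \<Rightarrow> real" and Y :: "nat \<Rightarrow> 'a"
  assumes f: "continuous_on UNIV f" "(f \<longlongrightarrow> 0) at_infinity"
    and Y: "\<And>n. Y n \<in> cbox 0 One" "Y \<longlonglongrightarrow> y"
  defines "g \<equiv> \<lambda>y. if y \<in> box 0 One then f (unsquash_vec y) else 0"
  shows "(\<lambda>n. g (Y n)) \<longlonglongrightarrow> g y"
proof (cases "y \<in> box 0 One")
  case True
  have ev: "eventually (\<lambda>n. Y n \<in> box 0 One) sequentially"
    by (rule topological_tendstoD[OF Y(2) open_box True])
  have "(\<lambda>n. unsquash_vec (Y n)) \<longlonglongrightarrow> unsquash_vec y"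
    unfolding unsquash_vec_def using True
    by (intro tendsto_intros unsquash_tendsto Y(2)) (auto simp: mem_box)
  then have "(\<lambda>n. f (unsquash_vec (Y n))) \<longlonglongrightarrow> f (unsquash_vec y)"
    using f(1) by (auto intro: continuous_on_tendsto_compose)
  moreover have "eventually (\<lambda>n. f (unsquash_vec (Y n)) = g (Y n)) sequentially"
    using ev by eventually_elim (simp add: g_def)
  ultimately show ?thesis using True by (auto simp: g_def intro: Lim_transform_eventually)
next
  case False
  have yc: "y \<in> cbox 0 One"
    by (rule closed_sequentially[OF closed_cbox _ Y(2)]) (rule Y(1))
  obtain b where b: "b \<in> Basis" "\<not> (0 < y \<bullet> b \<and> y \<bullet> b < 1)"
    using False by (auto simp: mem_box)
  then have b2: "y \<bullet> b = 0 \<or> y \<bullet> b = 1"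
    using yc by (auto simp: mem_box not_less intro: antisym)
  show ?thesis
  proof (rule tendstoI)
    fix e :: real assume e: "0 < e"
    have "eventually (\<lambda>x. dist (f x) 0 < e) at_infinity" using f(2) e by (rule tendstoD)
    then obtain R where R: "\<And>x. R \<le> norm x \<Longrightarrow> \<bar>f x\<bar> < e" by (auto simp: eventually_at_infinity)
    define R' where "R' = max R 1"
    have R': "0 < R'" by (simp add: R'_def)
    have "(\<lambda>n. \<bar>2 * (Y n \<bullet> b) - 1\<bar>) \<longlonglongrightarrow> \<bar>2 * (y \<bullet> b) - 1\<bar>"
      by (intro tendsto_intros Y(2))
    then have "(\<lambda>n. \<bar>2 * (Y n \<bullet> b) - 1\<bar>) \<longlonglongrightarrow> 1" using b2 by auto
    moreover have "R' / (1 + R') < 1" using R' by simp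
    ultimately have "eventually (\<lambda>n. R' / (1 + R') < \<bar>2 * (Y n \<bullet> b) - 1\<bar>) sequentially"
      by (rule order_tendstoD(1))
    then show "eventually (\<lambda>n. dist (g (Y n)) (g y) < e) sequentially"
    proof eventually_elim
      case (elim n)
      show ?case
      proof (cases "Y n \<in> box 0 One")
        case True
        then have "R' < \<bar>unsquash (Y n \<bullet> b)\<bar>"
          using elim b(1) R' by (intro unsquash_large) (auto simp: mem_box)
        also have "\<dots> = \<bar>unsquash_vec (Y n) \<bullet> b\<bar>" using b(1) by (simp add: unsquash_vec_component)
        also have "\<dots> \<le> norm (unsquash_vec (Y n))" using b(1) by (rule Basis_le_norm)
        finally have "\<bar>f (unsquash_vec (Y n))\<bar> < e" by (intro R) (simp add: R'_def)
        then show ?thesis using True False by (simp add: g_def)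
      qed (use e False in \<open>simp add: g_def\<close>)
    qed
  qed
qed

lemma finite_measure_of_bound: "emeasure M (space M) \<le> ennreal r \<Longrightarrow> finite_measure M"
  by (intro finite_measureI) (auto simp: top_unique)

text \<open>On the line this is Helly's theorem. In general, the space is squashed into the unit cube, and a
  Borel section of a space-filling curve transports the measures to `[0, 1]`. There a weakly
  convergent subsequence exists, and the curve, being continuous, carries its limit back. Mass at
  the boundary of the cube is mass lost at infinity, which test functions vanishing there do not
  see.\<close>

theorem vague_compactness:
  fixes \<nu> :: "nat \<Rightarrow> 'a::euclidean_space measure"
  assumes sets_nu[measurable_cong]: "\<And>n. sets (\<nu> n) = sets borel" and mass: "\<And>n. emeasure (\<nu> n) UNIV \<le> ennreal M"
  shows "\<exists>r \<mu>. strict_mono (r :: nat \<Rightarrow> nat) \<and> sets \<mu> = sets borel \<and> emeasure \<mu> UNIV \<le> ennreal (max M 1) \<and>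
    (\<forall>f :: 'a \<Rightarrow> real. continuous_on UNIV f \<longrightarrow> (f \<longlongrightarrow> 0) at_infinity \<longrightarrow>
       (\<lambda>n. \<integral>x. f x \<partial>\<nu> (r n)) \<longlonglongrightarrow> (\<integral>x. f x \<partial>\<mu>))"
proof -
  define L where "L = max M 1"
  have L: "0 < L" "1 \<le> L" by (auto simp: L_def)
  have space_nu[simp]: "space (\<nu> n) = UNIV" for n using sets_eq_imp_space_eq[OF sets_nu[of n]] by simp
  have massL: "emeasure (\<nu> n) UNIV \<le> ennreal L" for n
    by (rule order.trans[OF mass]) (auto simp: L_def intro!: ennreal_leI)
  interpret nu: finite_measure "\<nu> n" for n using massL[of n] by (intro finite_measure_of_bound[of _ L]) simp
  obtain \<Psi> :: "real \<Rightarrow> 'a" where Psi: "continuous_on UNIV \<Psi>" "\<And>t. \<Psi> t \<in> cbox 0 One" "cbox 0 One \<subseteq> \<Psi> ` {0..1}"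
    using schoenberg_curve by blast
  obtain \<sigma> where sigma[measurable]: "\<sigma> \<in> borel_measurable borel" and sg: "\<And>x. x \<in> cbox 0 One \<Longrightarrow> \<sigma> x \<in> {0..1} \<and> \<Psi> (\<sigma> x) = x"
    using borel_section[OF Psi(1,3) closed_cbox] by blast
  have [measurable]: "\<Psi> \<in> borel_measurable borel" using Psi(1) by (rule borel_measurable_continuous_onI)
  define T where "T x = \<sigma> (squash_vec x)" for x
  have [measurable]: "T \<in> borel_measurable borel" unfolding T_def[abs_def] by measurable
  have T: "T x \<in> {0..1}" "\<Psi> (T x) = squash_vec x" for x
    using sg[of "squash_vec x"] squash_vec_range[of x] box_subset_cbox[of 0 One] by (auto simp: T_def)
  define w where "w n = measure (\<nu> n) UNIV / L" for n
  have w: "0 \<le> w n" "w n \<le> 1" for n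
    using massL[of n] L by (auto simp: w_def nu.emeasure_eq_measure divide_le_eq ennreal_le_iff)
  \<comment> \<open>A point mass at 2, away from `[0, 1]`, completes the measures to probability measures.\<close>
  define P where "P n = add_measure (scale_measure (ennreal (1 / L)) (distr (\<nu> n) borel T)) (scale_measure (ennreal (1 - w n)) (return borel (2::real)))" for n
  have sets_P[measurable_cong]: "sets (P n) = sets borel" for n by (simp add: P_def)
  have emP: "emeasure (P n) A = ennreal (1 / L) * emeasure (\<nu> n) (T -` A) + ennreal (1 - w n) * indicator A 2" if [measurable]: "A \<in> sets borel" for n A
    unfolding P_def by (subst emeasure_add_measure) (auto simp: emeasure_distr)
  have em1: "emeasure (P n) A = 1" if A: "A \<in> sets borel" "{0..2} \<subseteq> A" for A n
  proof -
    have "T -` A = UNIV" "2 \<in> A" using T(1) A(2) by force+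
    then have "emeasure (P n) A = ennreal (1 / L * measure (\<nu> n) UNIV) + ennreal (1 - w n)"
      using A L by (subst emP) (auto simp: nu.emeasure_eq_measure ennreal_mult[symmetric])
    also have "\<dots> = ennreal 1" using w[of n] by (simp add: w_def flip: ennreal_plus)
    finally show ?thesis by simp
  qed
  have rd: "real_distribution (P n)" for n
  proof -
    have "prob_space (P n)"
      using em1[of UNIV n] sets_eq_imp_space_eq[OF sets_P[of n]] by (intro prob_spaceI) simp
    then show ?thesis by (simp add: real_distribution_def real_distribution_axioms_def sets_P)
  qed
  have "tight P"
    unfolding tight_def
  proof (intro conjI allI impI rd)
    fix e :: real assume "0 < e"
    show "\<exists>a b. a < b \<and> (\<forall>n. 1 - e < measure (P n) {a<..b})"
    proof (rule exI[of _ "-1"], rule exI[of _ 2], intro conjI allI)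
      fix n
      interpret real_distribution "P n" by (rule rd)
      have "emeasure (P n) {-1<..2} = 1" by (intro em1) auto
      then show "1 - e < measure (P n) {-1<..2}" using \<open>0 < e\<close> by (simp add: emeasure_eq_measure)
    qed simp
  qed
  from tight_imp_convergent_subsubsequence[OF this, of "\<lambda>n. n"]
  have "\<exists>r Q. strict_mono (r :: nat \<Rightarrow> nat) \<and> real_distribution Q \<and> weak_conv_m (P \<circ> (\<lambda>n. n) \<circ> r) Q"
    by (simp add: strict_mono_def)
  then obtain r :: "nat \<Rightarrow> nat" and Q where r: "strict_mono r" and Q: "real_distribution Q" and conv': "weak_conv_m (P \<circ> (\<lambda>n. n) \<circ> r) Q"
    by blast
  have conv: "weak_conv_m (\<lambda>n. P (r n)) Q" using conv' unfolding comp_def .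
  interpret Q: real_distribution Q by (rule Q)
  \<comment> \<open>The weight `\<phi>` removes the auxiliary point mass again.\<close>
  define \<phi> where "\<phi> t = max 0 (min 1 (2 - t))" for t :: real
  have phi: "\<phi> 2 = 0" "\<And>t. t \<le> 1 \<Longrightarrow> \<phi> t = 1" "\<And>t. 0 \<le> \<phi> t" "\<And>t. \<phi> t \<le> 1" by (auto simp: \<phi>_def)
  have [measurable]: "\<phi> \<in> borel_measurable borel" unfolding \<phi>_def[abs_def] by measurable
  define \<mu> where "\<mu> = distr (density Q (\<lambda>t. ennreal (L * \<phi> t * indicator (box 0 One) (\<Psi> t)))) borel (\<lambda>t. unsquash_vec (\<Psi> t))"
  have "(\<lambda>n. \<integral>x. f x \<partial>\<nu> (r n)) \<longlonglongrightarrow> (\<integral>x. f x \<partial>\<mu>)"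
    if f: "continuous_on UNIV f" "(f \<longlongrightarrow> 0) at_infinity" for f :: "'a \<Rightarrow> real"
  proof -
    have [measurable]: "f \<in> borel_measurable borel" using f(1) by (rule borel_measurable_continuous_onI)
    define g where "g y = (if y \<in> box 0 One then f (unsquash_vec y) else 0)" for y
    have [measurable]: "g \<in> borel_measurable borel" unfolding g_def[abs_def] by measurable
    define F where "F t = \<phi> t * g (\<Psi> t)" for t
    have Fc: "isCont F t" for t
      unfolding continuous_at_sequentially o_def
    proof (intro allI impI)
      fix t :: "nat \<Rightarrow> real" and s assume ts: "t \<longlonglongrightarrow> s"
      have "(\<lambda>n. \<Psi> (t n)) \<longlonglongrightarrow> \<Psi> s" using Psi(1) ts by (auto intro: continuous_on_tendsto_compose)
      then have "(\<lambda>n. g (\<Psi> (t n))) \<longlonglongrightarrow> g (\<Psi> s)"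
        unfolding g_def by (intro extension_by_zero_continuous f Psi(2))
      moreover have "(\<lambda>n. \<phi> (t n)) \<longlonglongrightarrow> \<phi> s" unfolding \<phi>_def by (intro tendsto_intros ts)
      ultimately show "(\<lambda>n. F (t n)) \<longlonglongrightarrow> F s" unfolding F_def by (intro tendsto_mult)
    qed
    have "\<exists>B. \<forall>x. \<bar>f x\<bar> \<le> B"
    proof -
      have "eventually (\<lambda>x. dist (f x) 0 < 1) at_infinity" using f(2) by (rule tendstoD) simp
      then obtain R where R: "\<And>x. R \<le> norm x \<Longrightarrow> \<bar>f x\<bar> < 1" by (auto simp: eventually_at_infinity)
      have "compact (f ` cball 0 R)" by (intro compact_continuous_image continuous_on_subset[OF f(1)]) auto
      then obtain B where B: "\<And>x. norm x \<le> R \<Longrightarrow> \<bar>f x\<bar> \<le> B"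
        using compact_imp_bounded bounded_real by (metis imageI mem_cball_0)
      have "\<bar>f x\<bar> \<le> max 1 B" for x using R[of x] B[of x] by (cases "norm x \<le> R") auto
      then show ?thesis by blast
    qed
    then obtain B where B: "\<And>x. \<bar>f x\<bar> \<le> B" by blast
    have B0: "0 \<le> B" using B[of 0] by simp
    have gB: "\<bar>g y\<bar> \<le> B" for y using B B0 by (simp add: g_def)
    have FB: "norm (F t) \<le> B" for t
    proof -
      have "\<bar>\<phi> t\<bar> * \<bar>g (\<Psi> t)\<bar> \<le> 1 * B" using phi gB B0 by (intro mult_mono) auto
      then show ?thesis by (simp add: F_def abs_mult)
    qed
    have [measurable]: "F \<in> borel_measurable borel" unfolding F_def by measurable
    have "(\<lambda>n. \<integral>t. F t \<partial>P (r n)) \<longlonglongrightarrow> (\<integral>t. F t \<partial>Q)"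
      using weak_conv_imp_integral_bdd_continuous_conv[OF rd Q conv, of F B] Fc FB by simp
    moreover have "(\<integral>t. F t \<partial>P n) = (\<integral>x. f x \<partial>\<nu> n) / L" for n
    proof -
      have FT: "F (T x) = f x" for x
        using T[of x] squash_vec_range[of x] phi(2)[of "T x"] by (simp add: F_def g_def unsquash_vec_squash_vec)
      have F2: "F 2 = 0" by (simp add: F_def phi)
      interpret real_distribution "P n" by (rule rd)
      have nn: "(\<integral>\<^sup>+ t. h (F t) \<partial>P n) = ennreal (1 / L) * (\<integral>\<^sup>+ x. h (f x) \<partial>\<nu> n)" if [measurable]: "h \<in> borel_measurable borel" and "h 0 = 0" for h :: "real \<Rightarrow> ennreal"
        unfolding P_def using that
        by (subst nn_integral_add_measure) (auto simp: nn_integral_scale_measure nn_integral_distr nn_integral_return FT F2)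
      have iP: "integrable (P n) F" using FB by (intro integrable_const_bound[of _ B]) auto
      have inu: "integrable (\<nu> n) f" using B by (intro nu.integrable_const_bound[of _ B]) auto
      have "(\<integral>t. F t \<partial>P n) = enn2real (\<integral>\<^sup>+ t. ennreal (F t) \<partial>P n) - enn2real (\<integral>\<^sup>+ t. ennreal (- F t) \<partial>P n)"
        by (rule real_lebesgue_integral_def[OF iP])
      also have "\<dots> = enn2real (\<integral>\<^sup>+ x. ennreal (f x) \<partial>\<nu> n) / L - enn2real (\<integral>\<^sup>+ x. ennreal (- f x) \<partial>\<nu> n) / L"
        using nn[of "\<lambda>y. ennreal y"] nn[of "\<lambda>y. ennreal (- y)"] L by (simp add: enn2real_mult)
      also have "\<dots> = (\<integral>x. f x \<partial>\<nu> n) / L"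
        by (simp add: real_lebesgue_integral_def[OF inu] diff_divide_distrib)
      finally show ?thesis .
    qed
    ultimately have "(\<lambda>n. L * ((\<integral>x. f x \<partial>\<nu> (r n)) / L)) \<longlonglongrightarrow> L * (\<integral>t. F t \<partial>Q)"
      by (intro tendsto_mult tendsto_const) simp
    moreover have "(\<integral>x. f x \<partial>\<mu>) = L * (\<integral>t. F t \<partial>Q)"
    proof -
      have "(\<integral>x. f x \<partial>\<mu>) = (\<integral>t. f (unsquash_vec (\<Psi> t)) \<partial>density Q (\<lambda>t. ennreal (L * \<phi> t * indicator (box 0 One) (\<Psi> t))))"
        unfolding \<mu>_def by (rule integral_distr) measurable
      also have "\<dots> = (\<integral>t. (L * \<phi> t * indicator (box 0 One) (\<Psi> t)) *\<^sub>R f (unsquash_vec (\<Psi> t)) \<partial>Q)"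
        by (rule integral_density) (use L phi in auto)
      also have "\<dots> = (\<integral>t. L * F t \<partial>Q)"
        by (intro Bochner_Integration.integral_cong) (auto simp: F_def g_def indicator_def)
      finally show ?thesis by simp
    qed
    ultimately show ?thesis using L by simp
  qed
  moreover have "emeasure \<mu> UNIV \<le> ennreal L"
  proof -
    have "emeasure \<mu> UNIV = (\<integral>\<^sup>+ t. ennreal (L * \<phi> t * indicator (box 0 One) (\<Psi> t)) \<partial>Q)"
      unfolding \<mu>_def by (simp add: emeasure_distr emeasure_density)
    also have "\<dots> \<le> (\<integral>\<^sup>+ t. ennreal L \<partial>Q)"
      using L phi by (intro nn_integral_mono ennreal_leI) (auto simp: indicator_def mult_left_le)
    also have "\<dots> = ennreal L" using Q.emeasure_space_1 by simp
    finally show ?thesis .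
  qed
  moreover have "sets \<mu> = sets borel" by (simp add: \<mu>_def)
  ultimately show ?thesis using r unfolding L_def by blast
qed

section \<open>Continuity of potentials and fat sets\<close>

context riesz
begin

lemma potential_scale:
  assumes "sets \<mu> = sets (borel :: 'a measure)"
  shows "pot (scale_measure c \<mu>) x = c * pot \<mu> x"
  unfolding riesz_potential_def using assms
  by (intro nn_integral_scale_measure) (auto simp: measurable_cong_sets[OF assms refl])

text \<open>The potential is the sum of the continuous part `h N`, from the kernel cut off at height `N`, and
  the remainder `rem N`. On the support the remainder tends to 0 uniformly by a Dini argument,
  since the sum is continuous there. Off the support the kernel at `y` is at most `2^(d - \<alpha>)`
  times the kernel at the point of the support nearest to `y`, so the convergence is uniform on
  the whole space.\<close>

lemma evans_vasilesco:
  assumes sets_nu[measurable_cong]: "sets \<nu> = sets (borel :: 'a measure)" and fin: "finite_measure \<nu>"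
    and S: "compact S" "emeasure \<nu> (- S) = 0"
    and U: "continuous_on S U" "\<And>y. y \<in> S \<Longrightarrow> 0 \<le> U y" "\<And>y. y \<in> S \<Longrightarrow> pot \<nu> y = ennreal (U y)"
  shows "\<exists>V. continuous_on UNIV V \<and> (\<forall>y. 0 \<le> V y \<and> pot \<nu> y = ennreal (V y))"
proof (cases "S = {}")
  case True
  then have "emeasure \<nu> UNIV = 0" using S by simp
  then have "AE z in \<nu>. False" using sets_eq_imp_space_eq[OF sets_nu] by (intro AE_I[of _ _ UNIV]) (auto simp: sets_nu)
  then have "pot \<nu> y = 0" for y
    unfolding riesz_potential_def by (subst nn_integral_0_iff_AE) auto
  then show ?thesis by (intro exI[of _ "\<lambda>_. 0"]) auto
next
  case S_ne: False
  interpret finite_measure \<nu> by fact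
  have sp: "space \<nu> = UNIV" using sets_eq_imp_space_eq[OF sets_nu] by simp
  have AES: "AE z in \<nu>. z \<in> S" using S by (intro AE_I[of _ _ "- S"]) (auto simp: sets_nu compact_imp_closed)
  \<comment> \<open>Passing to a nearest point at most doubles distances, which costs the factor `c`.\<close>
  define c where "c = 2 powr (real DIM('a) - \<alpha>)"
  have c: "1 \<le> c" using alpha_dim by (simp add: c_def ge_one_powr_ge_zero)
  define h where "h N y = (\<integral>\<^sup>+ z. min (kern y z) (ennreal N) \<partial>\<nu>)" for N y
  define rem where "rem N y = (\<integral>\<^sup>+ z. (kern y z - ennreal N) \<partial>\<nu>)" for N y
  have split: "pot \<nu> y = h N y + rem N y" for N y
  proof -
    have "min k (ennreal N) + (k - ennreal N) = k" for k :: ennreal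
    proof (cases "k \<le> ennreal N")
      case True
      then have "k - ennreal N = 0" by (intro diff_eq_0_ennreal le_less_trans[OF True ennreal_less_top])
      then show ?thesis using True by (simp add: min_absorb1)
    next
      case False
      then show ?thesis by (simp add: min_absorb2 add_diff_inverse_ennreal)
    qed
    then show ?thesis
      unfolding riesz_potential_def h_def rem_def by (subst nn_integral_add[symmetric]) auto
  qed
  have rem_mono: "rem N' y \<le> rem N y" if "N \<le> N'" for N N' y
    unfolding rem_def using that by (intro nn_integral_mono ennreal_minus_mono ennreal_leI) auto
  have h_fin: "h N y < \<infinity>" for N y
  proof -
    have "h N y \<le> (\<integral>\<^sup>+ z. ennreal N \<partial>\<nu>)" unfolding h_def by (intro nn_integral_mono) simp
    also have "\<dots> < \<infinity>" by (simp add: emeasure_eq_measure ennreal_mult[symmetric] ennreal_mult_less_top)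
    finally show ?thesis .
  qed
  have h_cont: "(\<lambda>n. h N (Y n)) \<longlonglongrightarrow> h N y" if Y: "Y \<longlonglongrightarrow> y" for N Y y
    unfolding h_def
  proof (rule nn_integral_dominated_convergence[where w="\<lambda>_. ennreal N"])
    show "(\<integral>\<^sup>+ z. ennreal N \<partial>\<nu>) < \<infinity>" by (simp add: emeasure_eq_measure ennreal_mult[symmetric] ennreal_mult_less_top)
    show "AE z in \<nu>. (\<lambda>i. min (kern (Y i) z) (ennreal N)) \<longlonglongrightarrow> min (kern y z) (ennreal N)"
    proof (rule AE_I2)
      fix z
      have "(\<lambda>i. kern z (Y i)) \<longlonglongrightarrow> kern z y"
        using riesz_kernel_continuous[of z] Y by (auto intro: continuous_on_tendsto_compose)
      then show "(\<lambda>i. min (kern (Y i) z) (ennreal N)) \<longlonglongrightarrow> min (kern y z) (ennreal N)"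
        by (simp add: riesz_kernel_commute[of _ z] tendsto_min)
    qed
  qed auto
  \<comment> \<open>Dini: points of `S` where the remainder stays large would accumulate at a point of `S` where `h
    N` stays away from its limit.\<close>
  have small: "\<exists>N::nat. \<forall>y\<in>S. rem (real N) y \<le> ennreal e" if e: "0 < e" for e
  proof (rule ccontr)
    assume "\<not> ?thesis"
    then have "\<forall>N::nat. \<exists>y\<in>S. ennreal e < rem (real N) y" by (simp add: not_le)
    then obtain Y where Y: "\<And>N::nat. Y N \<in> S" "\<And>N::nat. ennreal e < rem (real N) (Y N)" by metis
    obtain y s where y: "y \<in> S" "strict_mono s" "(Y \<circ> s) \<longlonglongrightarrow> y"
      using S(1) Y(1) unfolding compact_def by metis
    have lim: "(\<lambda>n. Y (s n)) \<longlonglongrightarrow> y" using y(3) by (simp add: o_def)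
    have "h (real m) y + ennreal e \<le> ennreal (U y)" for m :: nat
    proof (rule LIMSEQ_le)
      show "(\<lambda>n. h (real m) (Y (s n)) + ennreal e) \<longlonglongrightarrow> h (real m) y + ennreal e"
        by (intro tendsto_intros h_cont lim)
      have "(\<lambda>n. U (Y (s n))) \<longlonglongrightarrow> U y"
        by (rule continuous_on_tendsto_compose[OF U(1) lim y(1)]) (simp add: Y(1))
      then show "(\<lambda>n. ennreal (U (Y (s n)))) \<longlonglongrightarrow> ennreal (U y)" by (intro tendsto_intros)
      show "\<exists>N. \<forall>n\<ge>N. h (real m) (Y (s n)) + ennreal e \<le> ennreal (U (Y (s n)))"
      proof (intro exI allI impI)
        fix n assume "m \<le> n"
        then have "m \<le> s n" using seq_suble[OF y(2), of n] by simp
        then have "ennreal e \<le> rem (real m) (Y (s n))"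
          using Y(2)[of "s n"] rem_mono[of "real m" "real (s n)" "Y (s n)"] by (simp add: less_imp_le order.trans)
        then show "h (real m) (Y (s n)) + ennreal e \<le> ennreal (U (Y (s n)))"
          using split[of "Y (s n)" "real m"] U(3)[OF Y(1)[of "s n"]] by (metis add_left_mono)
      qed
    qed
    then have "(SUP m::nat. h (real m) y) + ennreal e \<le> ennreal (U y)"
      by (subst ennreal_SUP_add_left[symmetric]) (auto intro!: SUP_least)
    moreover have "(SUP m::nat. h (real m) y) = pot \<nu> y"
    proof -
      have "(SUP m::nat. h (real m) y) = (\<integral>\<^sup>+ z. (SUP m::nat. min (kern y z) (ennreal (real m))) \<partial>\<nu>)"
        unfolding h_def
        by (intro nn_integral_monotone_convergence_SUP[symmetric]) (auto simp: incseq_def le_fun_def intro!: min.coboundedI2 ennreal_leI)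
      also have "(\<lambda>z. SUP m::nat. min (kern y z) (ennreal (real m))) = kern y"
      proof
        fix z
        have "(SUP m::nat. min (kern y z) (ennreal (real m))) = inf (kern y z) (SUP m::nat. ennreal (real m))"
          unfolding inf_min[symmetric] by (rule inf_SUP[symmetric])
        also have "(SUP m::nat. ennreal (real m)) = top"
          by (simp add: ennreal_SUP_of_nat_eq_top flip: ennreal_of_nat_eq_real_of_nat)
        finally show "(SUP m::nat. min (kern y z) (ennreal (real m))) = kern y z" by simp
      qed
      finally show ?thesis by (simp add: riesz_potential_def)
    qed
    ultimately have "ennreal (U y) + ennreal e \<le> ennreal (U y)" using U(3)[OF y(1)] by simp
    then show False using e U(2)[OF y(1)] by (simp flip: ennreal_plus)
  qed
  have far: "rem (c * N) y \<le> ennreal c * e" if N: "0 \<le> N" and e: "\<And>y. y \<in> S \<Longrightarrow> rem N y \<le> e" for N y e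
  proof -
    obtain y' where y': "y' \<in> S" "\<And>z. z \<in> S \<Longrightarrow> dist y y' \<le> dist y z"
      using distance_attains_inf[OF compact_imp_closed[OF S(1)] S_ne] by blast
    have "rem (c * N) y \<le> (\<integral>\<^sup>+ z. ennreal c * (kern y' z - ennreal N) \<partial>\<nu>)"
      unfolding rem_def using AES
    proof (intro nn_integral_mono_AE, eventually_elim)
      fix z assume z: "z \<in> S"
      have d: "dist y' z \<le> 2 * dist y z" using y'(2)[OF z] dist_triangle[of y' z y] by (simp add: dist_commute)
      have "kern y z \<le> ennreal c * kern y' z"
      proof (cases "y' = z \<or> y = z")
        case True
        then have "y' = z" using d by auto
        then show ?thesis using c by (simp add: riesz_kernel_def ennreal_mult_top)
      next
        case False
        have "(2 * dist y z) powr (\<alpha> - real DIM('a)) \<le> dist y' z powr (\<alpha> - real DIM('a))"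
          using d False alpha_dim by (intro powr_mono2') auto
        then have "2 powr (\<alpha> - real DIM('a)) * dist y z powr (\<alpha> - real DIM('a)) \<le> dist y' z powr (\<alpha> - real DIM('a))"
          by (simp add: powr_mult)
        then have "c * (2 powr (\<alpha> - real DIM('a)) * dist y z powr (\<alpha> - real DIM('a))) \<le> c * dist y' z powr (\<alpha> - real DIM('a))"
          using c by (intro mult_left_mono) auto
        moreover have "c * 2 powr (\<alpha> - real DIM('a)) = 1" by (simp add: c_def powr_add[symmetric])
        ultimately have "dist y z powr (\<alpha> - real DIM('a)) \<le> c * dist y' z powr (\<alpha> - real DIM('a))"
          by (simp add: mult.assoc[symmetric])
        then show ?thesis using False c by (simp add: riesz_kernel_def ennreal_mult[symmetric] ennreal_leI)
      qed
      then have "kern y z - ennreal (c * N) \<le> ennreal c * kern y' z - ennreal (c * N)"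
        by (intro ennreal_minus_mono) auto
      also have "\<dots> = ennreal c * (kern y' z - ennreal N)"
        using c N by (simp add: ennreal_mult ennreal_right_diff_distrib)
      finally show "kern y z - ennreal (c * N) \<le> ennreal c * (kern y' z - ennreal N)" .
    qed
    also have "\<dots> = ennreal c * rem N y'" unfolding rem_def by (rule nn_integral_cmult) measurable
    also have "\<dots> \<le> ennreal c * e" by (intro mult_left_mono e y') simp
    finally show ?thesis .
  qed
  have unif: "\<exists>N0. \<forall>N\<ge>N0. \<forall>y. rem (real N) y \<le> ennreal e" if e: "0 < e" for e
  proof -
    obtain N where N: "\<And>y. y \<in> S \<Longrightarrow> rem (real N) y \<le> ennreal (e / c)" using small[of "e / c"] e c by auto
    show ?thesis
    proof (intro exI allI impI)
      fix N' y assume "nat \<lceil>c * real N\<rceil> \<le> N'"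
      then have "c * real N \<le> real N'" by linarith
      then have "rem (real N') y \<le> rem (c * real N) y" by (rule rem_mono)
      also have "\<dots> \<le> ennreal c * ennreal (e / c)" by (intro far N) auto
      also have "\<dots> = ennreal e" using c e by (simp add: ennreal_mult[symmetric])
      finally show "rem (real N') y \<le> ennreal e" .
    qed
  qed
  define V where "V y = enn2real (pot \<nu> y)" for y
  have Vfin: "pot \<nu> y = ennreal (V y)" for y
  proof -
    obtain N where "rem (real N) y \<le> ennreal 1" using unif[of 1] by auto
    then have "pot \<nu> y < top"
      using h_fin[of "real N" y] by (subst split[of _ "real N"]) (auto intro: le_less_trans)
    then show ?thesis by (simp add: V_def)
  qed
  have "uniform_limit UNIV (\<lambda>N y. enn2real (h (real N) y)) V sequentially"
  proof (rule uniform_limitI)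
    fix e :: real assume e: "0 < e"
    obtain N0 where N0: "\<And>N y. N0 \<le> N \<Longrightarrow> rem (real N) y \<le> ennreal (e / 2)" using unif[of "e / 2"] e by auto
    show "\<forall>\<^sub>F N in sequentially. \<forall>y\<in>UNIV. dist (enn2real (h (real N) y)) (V y) < e"
      using eventually_ge_at_top[of N0]
    proof eventually_elim
      fix N assume N: "N0 \<le> N"
      show "\<forall>y\<in>UNIV. dist (enn2real (h (real N) y)) (V y) < e"
      proof
        fix y
        have r: "rem (real N) y \<le> ennreal (e / 2)" using N0[OF N] .
        then have rr: "rem (real N) y = ennreal (enn2real (rem (real N) y))" by (metis ennreal_enn2real ennreal_less_top le_less_trans)
        have hh: "h (real N) y = ennreal (enn2real (h (real N) y))" using h_fin[of "real N" y] by simp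
        have "ennreal (V y) = ennreal (enn2real (h (real N) y) + enn2real (rem (real N) y))"
          using split[of y "real N"] Vfin[of y] hh rr by (metis enn2real_nonneg ennreal_plus)
        then have "V y = enn2real (h (real N) y) + enn2real (rem (real N) y)"
          by (subst (asm) ennreal_inj) (auto simp: V_def)
        moreover have "enn2real (rem (real N) y) \<le> e / 2" using r e by (intro enn2real_leI) auto
        ultimately show "dist (enn2real (h (real N) y)) (V y) < e" using e by (simp add: dist_real_def)
      qed
    qed
  qed
  moreover have "continuous_on UNIV (\<lambda>y. enn2real (h N y))" for N
  proof (rule continuous_on_sequentiallyI)
    fix Y and y :: 'a assume "Y \<longlonglongrightarrow> y"
    then show "(\<lambda>n. enn2real (h N (Y n))) \<longlonglongrightarrow> enn2real (h N y)"
      using h_cont[of Y y N] h_fin[of N y] by (intro tendsto_enn2real) auto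
  qed
  ultimately have "continuous_on UNIV V"
    by (intro uniform_limit_theorem[where F=sequentially]) auto
  moreover have "0 \<le> V y" for y by (simp add: V_def)
  ultimately show ?thesis using Vfin by blast
qed

text \<open>Fatness asks that arbitrarily close to each of its points, in balls of some radii `r \<rightarrow> 0`, the set
  has capacity comparable to that of the ball. It is the only regularity of a set that is used,
  and it turns statements about energies into statements at every point.\<close>

definition fat :: "'a set \<Rightarrow> bool" where
  "fat K \<longleftrightarrow> (\<forall>a\<in>K. \<exists>C. \<forall>e>0. \<exists>r \<sigma>. 0 < r \<and> r < e \<and> sets \<sigma> = sets borel \<and> emeasure \<sigma> UNIV = 1 \<and>
     emeasure \<sigma> (- (K \<inter> cball a r)) = 0 \<and> (\<forall>y. pot \<sigma> y \<le> ennreal (C * r powr (\<alpha> - real DIM('a)))))"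

text \<open>The test measures `\<sigma> n` provided by fatness concentrate at `a`, and their potentials converge to
  the kernel at `a`, dominated by a multiple of it: so their `\<nu>`-integrals converge to the
  potential of `\<nu>` at `a`. The inequality `ge`, known only against measures of finite energy, thus
  passes to the point `a`.\<close>

lemma fat_point_bound:
  assumes sets_nu[measurable_cong]: "sets \<nu> = sets (borel :: 'a measure)" and fin: "finite_measure \<nu>"
    and K: "compact K" "fat K" "a \<in> K"
    and U: "continuous_on UNIV U" "\<And>y. 0 \<le> U y"
    and ge: "\<And>\<sigma>. sets \<sigma> = sets (borel :: 'a measure) \<Longrightarrow> finite_measure \<sigma> \<Longrightarrow> emeasure \<sigma> (- K) = 0 \<Longrightarrow>
       (\<integral>\<^sup>+ x. pot \<sigma> x \<partial>\<sigma>) < \<infinity> \<Longrightarrow> (\<integral>\<^sup>+ x. ennreal (U x) \<partial>\<sigma>) \<le> (\<integral>\<^sup>+ x. pot \<nu> x \<partial>\<sigma>)"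
  shows "ennreal (U a) \<le> pot \<nu> a"
proof (cases "pot \<nu> a = \<infinity>")
  case False
  interpret finite_measure \<nu> by fact
  let ?p = "\<alpha> - real DIM('a)"
  obtain C where C: "\<And>e. 0 < e \<Longrightarrow> \<exists>r \<sigma>. 0 < r \<and> r < e \<and> sets \<sigma> = sets borel \<and> emeasure \<sigma> UNIV = 1 \<and>
     emeasure \<sigma> (- (K \<inter> cball a r)) = 0 \<and> (\<forall>y. pot \<sigma> y \<le> ennreal (C * r powr ?p))"
    using K(2,3) unfolding fat_def by blast
  have "\<exists>r \<sigma>. 0 < r \<and> r < 1 / real (Suc n) \<and> sets \<sigma> = sets borel \<and> emeasure \<sigma> UNIV = 1 \<and>
     emeasure \<sigma> (- (K \<inter> cball a r)) = 0 \<and> (\<forall>y. pot \<sigma> y \<le> ennreal (C * r powr ?p))" for n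
    by (rule C) simp
  then obtain r \<sigma> where r: "\<And>n. 0 < r n" "\<And>n. r n < 1 / real (Suc n)"
    and sets_s[measurable_cong]: "\<And>n. sets (\<sigma> n) = sets borel" and s1: "\<And>n. emeasure (\<sigma> n) UNIV = 1"
    and supp: "\<And>n. emeasure (\<sigma> n) (- (K \<inter> cball a (r n))) = 0"
    and pot: "\<And>n y. pot (\<sigma> n) y \<le> ennreal (C * r n powr ?p)"
    by metis
  have sp: "space (\<sigma> n) = UNIV" for n using sets_eq_imp_space_eq[OF sets_s[of n]] by simp
  have ps: "prob_space (\<sigma> n)" for n by (rule prob_spaceI) (simp add: sp s1)
  interpret s: prob_space "\<sigma> n" for n by (rule ps)
  have rlim: "r \<longlonglongrightarrow> 0"
  proof (rule tendsto_sandwich[OF _ _ tendsto_const LIMSEQ_Suc[OF lim_1_over_n]])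
    show "\<forall>\<^sub>F n in sequentially. 0 \<le> r n" by (intro always_eventually allI less_imp_le r(1))
    show "\<forall>\<^sub>F n in sequentially. r n \<le> 1 / real (Suc n)" by (intro always_eventually allI less_imp_le r(2))
  qed
  have AEs: "AE w in \<sigma> n. w \<in> K \<inter> cball a (r n)" for n
    using supp[of n] K(1) by (intro AE_I[of _ _ "- (K \<inter> cball a (r n))"]) (auto simp: sets_s compact_imp_closed)
  define c where "c = 2 powr (real DIM('a) - \<alpha>)"
  have c: "1 \<le> c" using alpha_dim by (simp add: c_def ge_one_powr_ge_zero)
  have c2: "(t / 2) powr ?p = c * t powr ?p" if "0 \<le> t" for t
    using that by (simp add: c_def powr_divide powr_diff)
  define D where "D = c * max 1 C"
  have D: "1 \<le> D" using c mult_mono[of 1 c 1 "max 1 C"] by (simp add: D_def)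
  \<comment> \<open>At distance at least `2 r` from `a`, halving distances is enough; closer to `a`, the bound from
    fatness applies.\<close>
  have dom: "pot (\<sigma> n) y \<le> ennreal D * kern a y" for n y
  proof (cases "y = a")
    case True
    then show ?thesis using D by (simp add: riesz_kernel_def ennreal_mult_top)
  next
    case neq: False
    show ?thesis
    proof (cases "dist a y < 2 * r n")
      case True
      have "C * r n powr ?p \<le> max 1 C * r n powr ?p" by (intro mult_right_mono) auto
      also have "\<dots> \<le> max 1 C * (dist a y / 2) powr ?p"
        using True neq alpha_dim by (intro mult_left_mono powr_mono2') auto
      also have "\<dots> = D * dist a y powr ?p" by (simp add: c2 D_def)
      finally have "ennreal (C * r n powr ?p) \<le> ennreal (D * dist a y powr ?p)" by (rule ennreal_leI)
      also have "\<dots> = ennreal D * kern a y" using neq D by (simp add: riesz_kernel_def ennreal_mult)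
      finally show ?thesis using pot[of n y] by (rule order.trans[rotated])
    next
      case False
      have "pot (\<sigma> n) y \<le> (\<integral>\<^sup>+ w. ennreal ((dist a y / 2) powr ?p) \<partial>\<sigma> n)"
        unfolding riesz_potential_def using AEs[of n]
      proof (intro nn_integral_mono_AE, eventually_elim)
        fix w assume "w \<in> K \<inter> cball a (r n)"
        then have "dist a y / 2 \<le> dist y w" using False dist_triangle[of a y w] by (simp add: dist_commute)
        then show "kern y w \<le> ennreal ((dist a y / 2) powr ?p)" using neq by (intro riesz_kernel_far) auto
      qed
      also have "\<dots> = ennreal (c * dist a y powr ?p)" by (simp add: sp s1 c2)
      also have "\<dots> \<le> ennreal (D * dist a y powr ?p)"
        using c by (intro ennreal_leI mult_right_mono) (auto simp: D_def mult_le_cancel_left1)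
      also have "\<dots> = ennreal D * kern a y" using neq D by (simp add: riesz_kernel_def ennreal_mult)
      finally show ?thesis .
    qed
  qed
  have ptw: "(\<lambda>n. pot (\<sigma> n) y) \<longlonglongrightarrow> kern a y" if neq: "y \<noteq> a" for y
  proof -
    have d0: "0 < dist a y" using neq by simp
    have ev: "eventually (\<lambda>n. r n < dist a y) sequentially" using order_tendstoD(2)[OF rlim d0] .
    have k: "kern a y = ennreal (dist a y powr ?p)" using neq by (simp add: riesz_kernel_def)
    show ?thesis
      unfolding k
    proof (rule tendsto_sandwich)
      have "(\<lambda>n. (dist a y + r n) powr ?p) \<longlonglongrightarrow> (dist a y + 0) powr ?p"
        using d0 by (intro tendsto_intros rlim) auto
      then show "(\<lambda>n. ennreal ((dist a y + r n) powr ?p)) \<longlonglongrightarrow> ennreal (dist a y powr ?p)"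
        by (intro tendsto_ennrealI) simp
      have "(\<lambda>n. (dist a y - r n) powr ?p) \<longlonglongrightarrow> (dist a y - 0) powr ?p"
        using d0 by (intro tendsto_intros rlim) auto
      then show "(\<lambda>n. ennreal ((dist a y - r n) powr ?p)) \<longlonglongrightarrow> ennreal (dist a y powr ?p)"
        by (intro tendsto_ennrealI) simp
      show "\<forall>\<^sub>F n in sequentially. pot (\<sigma> n) y \<le> ennreal ((dist a y - r n) powr ?p)"
        using ev
      proof eventually_elim
        case (elim n)
        have "pot (\<sigma> n) y \<le> (\<integral>\<^sup>+ w. ennreal ((dist a y - r n) powr ?p) \<partial>\<sigma> n)"
          unfolding riesz_potential_def using AEs[of n]
        proof (intro nn_integral_mono_AE, eventually_elim)
          fix w assume "w \<in> K \<inter> cball a (r n)"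
          then have "dist a y - r n \<le> dist y w" using dist_triangle[of a y w] by (simp add: dist_commute)
          then show "kern y w \<le> ennreal ((dist a y - r n) powr ?p)" using elim by (intro riesz_kernel_far) auto
        qed
        then show ?case by (simp add: sp s1)
      qed
      show "\<forall>\<^sub>F n in sequentially. ennreal ((dist a y + r n) powr ?p) \<le> pot (\<sigma> n) y"
      proof (rule always_eventually, rule allI)
        fix n
        have "(\<integral>\<^sup>+ w. ennreal ((dist a y + r n) powr ?p) \<partial>\<sigma> n) \<le> pot (\<sigma> n) y"
          unfolding riesz_potential_def using AEs[of n]
        proof (intro nn_integral_mono_AE, eventually_elim)
          fix w assume "w \<in> K \<inter> cball a (r n)"
          then have "dist y w \<le> dist a y + r n" using dist_triangle[of y w a] by (simp add: dist_commute)
          then show "ennreal ((dist a y + r n) powr ?p) \<le> kern y w"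
            using alpha_dim by (auto simp: riesz_kernel_def intro!: ennreal_leI powr_mono2')
        qed
        then show "ennreal ((dist a y + r n) powr ?p) \<le> pot (\<sigma> n) y" by (simp add: sp s1)
      qed
    qed
  qed
  have AEa: "AE y in \<nu>. y \<noteq> a"
  proof -
    have "AE y in \<nu>. kern a y \<noteq> \<infinity>"
      using False by (intro nn_integral_PInf_AE) (auto simp: riesz_potential_def)
    then show ?thesis by eventually_elim (auto simp: riesz_kernel_def)
  qed
  have "(\<lambda>n. \<integral>\<^sup>+ y. pot (\<sigma> n) y \<partial>\<nu>) \<longlonglongrightarrow> (\<integral>\<^sup>+ y. kern a y \<partial>\<nu>)"
  proof (rule nn_integral_dominated_convergence[where w="\<lambda>y. ennreal D * kern a y"])
    show "(\<integral>\<^sup>+ y. ennreal D * kern a y \<partial>\<nu>) < \<infinity>"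
      using False by (subst nn_integral_cmult) (auto simp: riesz_potential_def ennreal_mult_less_top less_top)
    show "AE y in \<nu>. (\<lambda>n. pot (\<sigma> n) y) \<longlonglongrightarrow> kern a y"
      using AEa by eventually_elim (rule ptw)
    show "pot (\<sigma> n) \<in> borel_measurable \<nu>" for n
      using riesz_potential_measurable[OF sets_s s.finite_measure_axioms] by (simp add: measurable_cong_sets[OF sets_nu refl])
  qed (use dom in auto)
  then have lim: "(\<lambda>n. \<integral>\<^sup>+ y. pot (\<sigma> n) y \<partial>\<nu>) \<longlonglongrightarrow> pot \<nu> a" by (simp add: riesz_potential_def)
  have [measurable]: "U \<in> borel_measurable borel" using U(1) by (rule borel_measurable_continuous_onI)
  have main: "(\<integral>\<^sup>+ x. ennreal (U x) \<partial>\<sigma> n) \<le> (\<integral>\<^sup>+ y. pot (\<sigma> n) y \<partial>\<nu>)" for n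
  proof -
    have "emeasure (\<sigma> n) (- K) \<le> emeasure (\<sigma> n) (- (K \<inter> cball a (r n)))"
      using K(1) by (intro emeasure_mono) (auto simp: sets_s compact_imp_closed)
    then have z: "emeasure (\<sigma> n) (- K) = 0" using supp[of n] by simp
    have "(\<integral>\<^sup>+ x. pot (\<sigma> n) x \<partial>\<sigma> n) \<le> (\<integral>\<^sup>+ x. ennreal (C * r n powr ?p) \<partial>\<sigma> n)"
      by (intro nn_integral_mono pot)
    also have "\<dots> < \<infinity>" by (simp add: sp s1)
    finally have "(\<integral>\<^sup>+ x. ennreal (U x) \<partial>\<sigma> n) \<le> (\<integral>\<^sup>+ x. pot \<nu> x \<partial>\<sigma> n)"
      using z by (intro ge sets_s s.finite_measure_axioms) auto
    also have "\<dots> = (\<integral>\<^sup>+ y. pot (\<sigma> n) y \<partial>\<nu>)"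
      by (intro riesz_potential_symmetric sets_nu sets_s) (unfold_locales)
    finally show ?thesis .
  qed
  have eps: "ennreal (U a) \<le> pot \<nu> a + ennreal e" if e: "0 < e" for e
  proof -
    have "isCont U a" using U(1) by (simp add: continuous_on_eq_continuous_at)
    then obtain dl where dl: "0 < dl" "\<And>y. dist y a < dl \<Longrightarrow> dist (U y) (U a) < e"
      unfolding continuous_at_eps_delta using e by blast
    have "ennreal (U a - e) \<le> pot \<nu> a"
    proof (rule LIMSEQ_le_const[OF lim])
      obtain N where N: "\<And>n. N \<le> n \<Longrightarrow> r n < dl"
        using order_tendstoD(2)[OF rlim dl(1)] by (auto simp: eventually_sequentially)
      show "\<exists>N. \<forall>n\<ge>N. ennreal (U a - e) \<le> (\<integral>\<^sup>+ y. pot (\<sigma> n) y \<partial>\<nu>)"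
      proof (intro exI allI impI)
        fix n assume "N \<le> n"
        have "(\<integral>\<^sup>+ x. ennreal (U a - e) \<partial>\<sigma> n) \<le> (\<integral>\<^sup>+ x. ennreal (U x) \<partial>\<sigma> n)"
          using AEs[of n]
        proof (intro nn_integral_mono_AE, eventually_elim)
          fix w assume "w \<in> K \<inter> cball a (r n)"
          then have "dist w a < dl" using N[OF \<open>N \<le> n\<close>] by (simp add: dist_commute)
          from dl(2)[OF this] show "ennreal (U a - e) \<le> ennreal (U w)" by (intro ennreal_leI) (simp add: dist_real_def)
        qed
        then show "ennreal (U a - e) \<le> (\<integral>\<^sup>+ y. pot (\<sigma> n) y \<partial>\<nu>)"
          using main[of n] by (simp add: sp s1)
      qed
    qed
    moreover have "ennreal (U a) \<le> ennreal (U a - e) + ennreal e"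
      using e by (cases "U a \<le> e") (auto simp: ennreal_neg ennreal_leI simp flip: ennreal_plus)
    ultimately show ?thesis by (meson add_right_mono order.trans)
  qed
  show ?thesis by (rule ennreal_le_epsilon) (rule eps)
qed simp

end

section \<open>Vague limits and energy\<close>

definition cutoff :: "real \<Rightarrow> 'a::euclidean_space \<Rightarrow> real" where
  "cutoff R x = max 0 (min 1 (R + 1 - norm x))"

lemma cutoff_range: "0 \<le> cutoff R x" "cutoff R x \<le> 1"
  by (auto simp: cutoff_def)

lemma cutoff_one: "norm x \<le> R \<Longrightarrow> cutoff R x = 1"
  by (simp add: cutoff_def)

lemma cutoff_continuous: "continuous_on A (cutoff R)"
  unfolding cutoff_def[abs_def] by (intro continuous_intros)

lemma cutoff_vanishes: "((\<lambda>x. g x * cutoff R (x::'a::euclidean_space)) \<longlongrightarrow> (0::real)) at_infinity"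
proof (rule tendsto_eventually)
  show "\<forall>\<^sub>F x in at_infinity. g x * cutoff R (x::'a) = 0"
    unfolding eventually_at_infinity by (intro exI[of _ "R + 1"]) (auto simp: cutoff_def)
qed

lemma finite_measure_integrable_bounded:
  fixes f :: "'a::euclidean_space \<Rightarrow> real"
  assumes "finite_measure M" "sets M = sets borel" "f \<in> borel_measurable borel" "\<And>x. \<bar>f x\<bar> \<le> B"
  shows "integrable M f"
  using assms by (intro finite_measure.integrable_const_bound[of _ _ B]) (auto simp: measurable_cong_sets[OF assms(2) refl])

text \<open>Testing with the distance from `A`, cut off at large radii, shows that the limit does not charge
  the complement of `A`.\<close>

lemma vague_limit_support:
  fixes \<nu> :: "nat \<Rightarrow> 'a::euclidean_space measure"
  assumes sets_nu[measurable_cong]: "\<And>n. sets (\<nu> n) = sets borel" and sets_mu[measurable_cong]: "sets \<mu> = sets borel" and fin: "finite_measure \<mu>"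
    and conv: "\<And>f :: 'a \<Rightarrow> real. continuous_on UNIV f \<Longrightarrow> (f \<longlongrightarrow> 0) at_infinity \<Longrightarrow> (\<lambda>n. \<integral>x. f x \<partial>\<nu> n) \<longlonglongrightarrow> (\<integral>x. f x \<partial>\<mu>)"
    and A: "closed A" "\<And>n. emeasure (\<nu> n) (- A) = 0"
  shows "emeasure \<mu> (- A) = 0"
proof -
  define g :: "'a \<Rightarrow> real" where "g x = (if A = {} then 1 else min 1 (infdist x A))" for x
  have gc: "continuous_on UNIV g" unfolding g_def by (cases "A = {}") (auto intro!: continuous_intros)
  have gr: "0 \<le> g x" "g x \<le> 1" for x by (auto simp: g_def infdist_nonneg)
  have gA: "g x = 0" if "x \<in> A" for x using that by (auto simp: g_def)
  have gnA: "0 < g x" if "x \<notin> A" for x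
    using that A(1) by (auto simp: g_def infdist_pos_not_in_closed)
  have AEj: "AE x in \<mu>. g x * cutoff (real j) x = 0" for j
  proof -
    let ?f = "\<lambda>x. g x * cutoff (real j) x"
    have fc: "continuous_on UNIV ?f" by (intro continuous_intros gc cutoff_continuous)
    have [measurable]: "?f \<in> borel_measurable borel" using fc by (rule borel_measurable_continuous_onI)
    have "(\<integral>x. ?f x \<partial>\<nu> n) = 0" for n
    proof -
      have "AE x in \<nu> n. x \<in> A" using A by (intro AE_I[of _ _ "- A"]) (auto simp: sets_nu)
      then have "AE x in \<nu> n. ?f x = 0" by eventually_elim (simp add: gA)
      then show ?thesis by (rule integral_eq_zero_AE)
    qed
    then have "(\<integral>x. ?f x \<partial>\<mu>) = 0"
      using conv[OF fc cutoff_vanishes] by (simp add: LIMSEQ_const_iff)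
    moreover have "\<bar>?f x\<bar> \<le> 1" for x using gr[of x] cutoff_range[of "real j" x] by (simp add: abs_mult mult_le_one)
    then have "integrable \<mu> ?f" by (intro finite_measure_integrable_bounded[of _ _ 1] fin sets_mu) auto
    ultimately show ?thesis
      by (subst (asm) integral_nonneg_eq_0_iff_AE) (auto intro!: AE_I2 mult_nonneg_nonneg gr cutoff_range)
  qed
  then have "AE x in \<mu>. \<forall>j. g x * cutoff (real j) x = 0" unfolding AE_all_countable by blast
  then have "AE x in \<mu>. x \<in> A"
  proof eventually_elim
    fix x assume *: "\<forall>j. g x * cutoff (real j) x = 0"
    obtain j where "norm x \<le> real j" using real_arch_simple by blast
    then have "g x = 0" using *[rule_format, of j] cutoff_one[of x "real j"] by simp
    then show "x \<in> A" using gnA[of x] by fastforce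
  qed
  then have "- A \<in> null_sets \<mu>"
    using A(1) by (subst AE_iff_null_sets) (auto simp: sets_mu)
  then show ?thesis by blast
qed

lemma gauss_continuous: "0 < s \<Longrightarrow> continuous_on A (\<lambda>x. gauss s (z - x))"
  unfolding gauss_def by (intro continuous_intros) auto

lemma gauss_vanishes:
  assumes "0 < s" shows "((\<lambda>x. gauss s (z - x)) \<longlongrightarrow> 0) at_infinity"
proof -
  let ?c = "(2 * pi * s) powr (- real DIM('a) / 2)"
  have "filterlim (\<lambda>x::'a. z - x) at_infinity at_infinity"
    unfolding filterlim_at_infinity[OF order.refl] eventually_at_infinity
  proof (intro allI impI)
    fix r :: real
    show "\<exists>b. \<forall>x. b \<le> norm x \<longrightarrow> r \<le> norm (z - x)"
      using norm_triangle_ineq2 by (intro exI[of _ "r + norm z"]) (smt (verit) norm_minus_commute norm_triangle_ineq2)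
  qed
  then have "filterlim (\<lambda>x::'a. norm (z - x)) at_top at_infinity"
    by (rule filterlim_at_infinity_imp_norm_at_top)
  then have "filterlim (\<lambda>x::'a. (norm (z - x))\<^sup>2 / (2 * s)) at_top at_infinity"
    using assms by (intro filterlim_tendsto_pos_mult_at_top[of "\<lambda>_. 1 / (2 * s)", OF tendsto_const, simplified] filterlim_pow_at_top) auto
  then have "filterlim (\<lambda>x::'a. - ((norm (z - x))\<^sup>2 / (2 * s))) at_bot at_infinity"
    by (simp add: filterlim_uminus_at_bot)
  then have "((\<lambda>x::'a. exp (- ((norm (z - x))\<^sup>2 / (2 * s)))) \<longlongrightarrow> 0) at_infinity"
    by (rule filterlim_compose[OF exp_at_bot])
  then have "((\<lambda>x::'a. ?c * exp (- ((norm (z - x))\<^sup>2 / (2 * s)))) \<longlongrightarrow> ?c * 0) at_infinity"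
    by (intro tendsto_mult tendsto_const)
  then show ?thesis by (simp add: gauss_def)
qed

lemma gauss_le: "0 < s \<Longrightarrow> gauss s (x::'a::euclidean_space) \<le> (2 * pi * s) powr (- real DIM('a) / 2)"
  unfolding gauss_def by (auto intro!: mult_left_le)

context riesz
begin

definition energy :: "'a measure \<Rightarrow> ennreal" where
  "energy \<nu> = (\<integral>\<^sup>+ x. pot \<nu> x \<partial>\<nu>)"

text \<open>The Gaussian kernel at time `s` is the convolution square of the one at time `s / 2`. So the
  energy is an integral of squares, the source of lower semicontinuity.\<close>

lemma energy_eq_gauss:
  assumes sets_nu[measurable_cong]: "sets \<nu> = sets (borel :: 'a measure)" and fin: "finite_measure \<nu>"
  shows "energy \<nu> = (\<integral>\<^sup>+ s. \<kappa> s * indicator {0<..} s * (\<integral>\<^sup>+ z. (\<integral>\<^sup>+ x. ennreal (gauss (s / 2) (z - x)) \<partial>\<nu>) * (\<integral>\<^sup>+ x. ennreal (gauss (s / 2) (z - x)) \<partial>\<nu>) \<partial>lborel) \<partial>lborel)"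
proof -
  interpret finite_measure \<nu> by fact
  interpret pl: pair_sigma_finite \<nu> "lborel :: real measure" by unfold_locales
  interpret pa: pair_sigma_finite \<nu> "lborel :: 'a measure" by unfold_locales
  have "energy \<nu> = (\<integral>\<^sup>+ x. (\<integral>\<^sup>+ y. (\<integral>\<^sup>+ s. \<kappa> s * ennreal (gauss s (x - y)) * indicator {0<..} s \<partial>lborel) \<partial>\<nu>) \<partial>\<nu>)"
    by (simp add: energy_def riesz_potential_def riesz_kernel_eq_mix mix_def)
  also have "\<dots> = (\<integral>\<^sup>+ x. (\<integral>\<^sup>+ s. (\<integral>\<^sup>+ y. \<kappa> s * ennreal (gauss s (x - y)) * indicator {0<..} s \<partial>\<nu>) \<partial>lborel) \<partial>\<nu>)"
    by (intro nn_integral_cong pl.Fubini'[symmetric]) measurable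
  also have "\<dots> = (\<integral>\<^sup>+ s. (\<integral>\<^sup>+ x. (\<integral>\<^sup>+ y. \<kappa> s * ennreal (gauss s (x - y)) * indicator {0<..} s \<partial>\<nu>) \<partial>\<nu>) \<partial>lborel)"
    by (intro pl.Fubini'[symmetric]) measurable
  also have "\<dots> = (\<integral>\<^sup>+ s. \<kappa> s * indicator {0<..} s * (\<integral>\<^sup>+ z. (\<integral>\<^sup>+ x. ennreal (gauss (s / 2) (z - x)) \<partial>\<nu>) * (\<integral>\<^sup>+ x. ennreal (gauss (s / 2) (z - x)) \<partial>\<nu>) \<partial>lborel) \<partial>lborel)"
  proof (rule nn_integral_cong)
    fix s :: real
    let ?c = "\<kappa> s * indicator {0<..} s"
    let ?g = "\<lambda>z x. ennreal (gauss (s / 2) (z - x))"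
    show "(\<integral>\<^sup>+ x. (\<integral>\<^sup>+ y. \<kappa> s * ennreal (gauss s (x - y)) * indicator {0<..} s \<partial>\<nu>) \<partial>\<nu>)
      = ?c * (\<integral>\<^sup>+ z. (\<integral>\<^sup>+ x. ?g z x \<partial>\<nu>) * (\<integral>\<^sup>+ x. ?g z x \<partial>\<nu>) \<partial>lborel)"
    proof (cases "0 < s")
      case True
      have "(\<integral>\<^sup>+ x. (\<integral>\<^sup>+ y. \<kappa> s * ennreal (gauss s (x - y)) * indicator {0<..} s \<partial>\<nu>) \<partial>\<nu>)
        = (\<integral>\<^sup>+ x. (\<integral>\<^sup>+ y. ?c * ennreal (gauss s (x - y)) \<partial>\<nu>) \<partial>\<nu>)"
        by (simp add: ac_simps)
      also have "\<dots> = ?c * (\<integral>\<^sup>+ x. (\<integral>\<^sup>+ y. ennreal (gauss s (x - y)) \<partial>\<nu>) \<partial>\<nu>)"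
        by (simp add: nn_integral_cmult)
      also have "(\<integral>\<^sup>+ x. (\<integral>\<^sup>+ y. ennreal (gauss s (x - y)) \<partial>\<nu>) \<partial>\<nu>)
        = (\<integral>\<^sup>+ x. (\<integral>\<^sup>+ y. (\<integral>\<^sup>+ z. ?g z x * ?g z y \<partial>lborel) \<partial>\<nu>) \<partial>\<nu>)"
      proof (intro nn_integral_cong)
        fix x y :: 'a
        have "gauss (s / 2) (z - x) = gauss (s / 2) (x - z)" for z by (rule gauss_commute)
        then show "ennreal (gauss s (x - y)) = (\<integral>\<^sup>+ z. ?g z x * ?g z y \<partial>lborel)"
          using gauss_conv[of "s / 2" "s / 2" x y] True by simp
      qed
      also have "\<dots> = (\<integral>\<^sup>+ x. (\<integral>\<^sup>+ z. (\<integral>\<^sup>+ y. ?g z x * ?g z y \<partial>\<nu>) \<partial>lborel) \<partial>\<nu>)"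
        by (intro nn_integral_cong pa.Fubini'[symmetric]) measurable
      also have "\<dots> = (\<integral>\<^sup>+ z. (\<integral>\<^sup>+ x. (\<integral>\<^sup>+ y. ?g z x * ?g z y \<partial>\<nu>) \<partial>\<nu>) \<partial>lborel)"
        by (intro pa.Fubini'[symmetric]) measurable
      also have "\<dots> = (\<integral>\<^sup>+ z. (\<integral>\<^sup>+ x. ?g z x \<partial>\<nu>) * (\<integral>\<^sup>+ x. ?g z x \<partial>\<nu>) \<partial>lborel)"
        by (simp add: nn_integral_cmult nn_integral_multc)
      finally show ?thesis .
    qed simp
  qed
  finally show ?thesis .
qed

text \<open>The Gaussian averages converge pointwise, and Fatou's lemma is applied to the representation by
  squares.\<close>

lemma energy_lower_semicontinuous:
  fixes \<nu> :: "nat \<Rightarrow> 'a measure"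
  assumes sets_nu[measurable_cong]: "\<And>n. sets (\<nu> n) = sets borel" and finn: "\<And>n. finite_measure (\<nu> n)"
    and sets_mu[measurable_cong]: "sets \<mu> = sets borel" and fin: "finite_measure \<mu>"
    and conv: "\<And>f :: 'a \<Rightarrow> real. continuous_on UNIV f \<Longrightarrow> (f \<longlongrightarrow> 0) at_infinity \<Longrightarrow> (\<lambda>n. \<integral>x. f x \<partial>\<nu> n) \<longlonglongrightarrow> (\<integral>x. f x \<partial>\<mu>)"
  shows "energy \<mu> \<le> liminf (\<lambda>n. energy (\<nu> n))"
proof -
  interpret n: finite_measure "\<nu> n" for n by (rule finn)
  interpret m: finite_measure \<mu> by (rule fin)
  let ?g = "\<lambda>M s z. (\<integral>\<^sup>+ x. ennreal (gauss (s / 2) (z - x)) \<partial>M)"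
  have lim: "(\<lambda>n. ?g (\<nu> n) s z) \<longlonglongrightarrow> ?g \<mu> s z" if s: "0 < s" for s :: real and z :: 'a
  proof -
    have s2: "0 < s / 2" using s by simp
    have int: "integrable M (\<lambda>x. gauss (s / 2) (z - x))" if "finite_measure M" "sets M = sets borel" for M
      using that gauss_le[OF s2] by (intro finite_measure_integrable_bounded[where B="(2 * pi * (s / 2)) powr (- real DIM('a) / 2)"]) auto
    have eq: "?g M s z = ennreal (\<integral>x. gauss (s / 2) (z - x) \<partial>M)" if "finite_measure M" "sets M = sets borel" for M
      using int[OF that] by (intro nn_integral_eq_integral) auto
    show ?thesis
      unfolding eq[OF finn sets_nu] eq[OF fin sets_mu]
      by (intro tendsto_ennrealI conv gauss_continuous gauss_vanishes s2)
  qed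
  have "energy \<mu> = (\<integral>\<^sup>+ s. \<kappa> s * indicator {0<..} s * (\<integral>\<^sup>+ z. liminf (\<lambda>n. ?g (\<nu> n) s z * ?g (\<nu> n) s z) \<partial>lborel) \<partial>lborel)"
    unfolding energy_eq_gauss[OF sets_mu fin]
  proof (rule nn_integral_cong)
    fix s :: real
    have "?g \<mu> s z * ?g \<mu> s z = liminf (\<lambda>n. ?g (\<nu> n) s z * ?g (\<nu> n) s z)" if s: "0 < s" for z
    proof -
      have "?g \<mu> s z < top"
      proof -
        have "?g \<mu> s z \<le> (\<integral>\<^sup>+ x. ennreal ((2 * pi * (s / 2)) powr (- real DIM('a) / 2)) \<partial>\<mu>)"
          using s by (intro nn_integral_mono ennreal_leI gauss_le) auto
        also have "\<dots> < top" by (simp add: m.emeasure_eq_measure ennreal_mult_less_top)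
        finally show ?thesis .
      qed
      then have "(\<lambda>n. ?g (\<nu> n) s z * ?g (\<nu> n) s z) \<longlonglongrightarrow> ?g \<mu> s z * ?g \<mu> s z"
        by (intro tendsto_mult_ennreal lim[OF s]) auto
      then show ?thesis by (simp add: lim_imp_Liminf)
    qed
    then show "\<kappa> s * indicator {0<..} s * (\<integral>\<^sup>+ z. ?g \<mu> s z * ?g \<mu> s z \<partial>lborel) = \<kappa> s * indicator {0<..} s * (\<integral>\<^sup>+ z. liminf (\<lambda>n. ?g (\<nu> n) s z * ?g (\<nu> n) s z) \<partial>lborel)"
      by (cases "0 < s") auto
  qed
  also have "\<dots> \<le> (\<integral>\<^sup>+ s. liminf (\<lambda>n. \<kappa> s * indicator {0<..} s * (\<integral>\<^sup>+ z. ?g (\<nu> n) s z * ?g (\<nu> n) s z \<partial>lborel)) \<partial>lborel)"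
  proof (rule nn_integral_mono)
    fix s :: real
    have "\<kappa> s * indicator {0<..} s * (\<integral>\<^sup>+ z. liminf (\<lambda>n. ?g (\<nu> n) s z * ?g (\<nu> n) s z) \<partial>lborel)
      \<le> \<kappa> s * indicator {0<..} s * liminf (\<lambda>n. (\<integral>\<^sup>+ z. ?g (\<nu> n) s z * ?g (\<nu> n) s z \<partial>lborel))"
      by (intro mult_left_mono nn_integral_liminf) auto
    also have "\<dots> = liminf (\<lambda>n. \<kappa> s * indicator {0<..} s * (\<integral>\<^sup>+ z. ?g (\<nu> n) s z * ?g (\<nu> n) s z \<partial>lborel))"
    proof -
      obtain c where c: "\<kappa> s * indicator {0<..} s = ennreal c" "0 \<le> c"
        using norm_const_pos by (cases "0 < s") (auto simp: \<kappa>_def intro: that[of 0])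
      have "continuous_on UNIV (\<lambda>y. ennreal c * y)" by (intro ennreal_continuous_on_cmult continuous_intros) auto
      then show ?thesis
        unfolding c(1)
        by (intro Liminf_compose_continuous_mono[symmetric]) (auto simp: mono_def intro!: mult_left_mono)
    qed
    finally show "\<kappa> s * indicator {0<..} s * (\<integral>\<^sup>+ z. liminf (\<lambda>n. ?g (\<nu> n) s z * ?g (\<nu> n) s z) \<partial>lborel)
       \<le> liminf (\<lambda>n. \<kappa> s * indicator {0<..} s * (\<integral>\<^sup>+ z. ?g (\<nu> n) s z * ?g (\<nu> n) s z \<partial>lborel))" .
  qed
  also have "\<dots> \<le> liminf (\<lambda>n. \<integral>\<^sup>+ s. \<kappa> s * indicator {0<..} s * (\<integral>\<^sup>+ z. ?g (\<nu> n) s z * ?g (\<nu> n) s z \<partial>lborel) \<partial>lborel)"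
    by (rule nn_integral_liminf) measurable
  also have "\<dots> = liminf (\<lambda>n. energy (\<nu> n))"
    by (simp add: energy_eq_gauss[OF sets_nu finn])
  finally show ?thesis .
qed


section \<open>Balayage on compact fat sets by energy minimisation\<close>

definition carried :: "'a set \<Rightarrow> 'a measure set" where
  "carried K = {\<nu>. sets \<nu> = sets borel \<and> finite_measure \<nu> \<and> emeasure \<nu> (- K) = 0}"

lemma carriedD:
  assumes "\<nu> \<in> carried K"
  shows "sets \<nu> = sets borel" "finite_measure \<nu>" "emeasure \<nu> (- K) = 0" "space \<nu> = UNIV"
  using assms sets_eq_imp_space_eq[of \<nu> borel] by (auto simp: carried_def)

lemma carried_AE: "\<nu> \<in> carried K \<Longrightarrow> closed K \<Longrightarrow> AE x in \<nu>. x \<in> K"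
  by (intro AE_I[of _ _ "- K"]) (auto simp: carried_def)

lemma carried_subset: "\<nu> \<in> carried K \<Longrightarrow> K \<subseteq> L \<Longrightarrow> closed K \<Longrightarrow> closed L \<Longrightarrow> \<nu> \<in> carried L"
proof -
  assume *: "\<nu> \<in> carried K" "K \<subseteq> L" "closed K" "closed L"
  then have "emeasure \<nu> (- L) \<le> emeasure \<nu> (- K)" by (intro emeasure_mono) (auto simp: carried_def)
  with * show ?thesis by (auto simp: carried_def)
qed

lemma finite_measure_add:
  assumes "sets \<nu> = sets \<mu>" "finite_measure \<mu>" "finite_measure \<nu>"
  shows "finite_measure (add_measure \<mu> \<nu>)"
proof (rule finite_measureI)
  have "space \<mu> \<in> sets \<mu>" by simp
  moreover have "space \<nu> = space \<mu>" using assms(1) by (rule sets_eq_imp_space_eq)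
  ultimately show "emeasure (add_measure \<mu> \<nu>) (space (add_measure \<mu> \<nu>)) \<noteq> \<infinity>"
    using assms finite_measure.emeasure_finite[OF assms(2), of "space \<mu>"] finite_measure.emeasure_finite[OF assms(3), of "space \<nu>"]
    by (simp add: emeasure_add_measure ennreal_add_eq_top)
qed

lemma finite_measure_scale:
  assumes "finite_measure \<mu>" "c < top"
  shows "finite_measure (scale_measure c \<mu>)"
  using assms finite_measure.emeasure_finite[OF assms(1)]
  by (intro finite_measureI) (auto simp: ennreal_mult_eq_top_iff space_scale_measure)

lemma carried_add: "\<mu> \<in> carried K \<Longrightarrow> \<nu> \<in> carried K \<Longrightarrow> closed K \<Longrightarrow> add_measure \<mu> \<nu> \<in> carried K"
  by (auto simp: carried_def emeasure_add_measure intro!: finite_measure_add)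

lemma carried_scale: "\<mu> \<in> carried K \<Longrightarrow> c < top \<Longrightarrow> scale_measure c \<mu> \<in> carried K"
  by (auto simp: carried_def intro!: finite_measure_scale)

lemma carried_sigma_finite: "\<mu> \<in> carried K \<Longrightarrow> sigma_finite_measure \<mu>"
  by (auto simp: carried_def finite_measure_def)

definition mutual_energy :: "'a measure \<Rightarrow> 'a measure \<Rightarrow> ennreal" where
  "mutual_energy \<nu> \<sigma> = (\<integral>\<^sup>+ x. pot \<nu> x \<partial>\<sigma>)"

lemma mutual_energy_self: "mutual_energy \<nu> \<nu> = energy \<nu>"
  by (simp add: mutual_energy_def energy_def)

lemma mutual_energy_commute:
  assumes "\<mu> \<in> carried K" "\<nu> \<in> carried L"
  shows "mutual_energy \<mu> \<nu> = mutual_energy \<nu> \<mu>"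
  unfolding mutual_energy_def
  using assms by (intro riesz_potential_symmetric carried_sigma_finite) (auto dest: carriedD)

lemma mutual_energy_add_right:
  assumes "\<mu> \<in> carried K" "\<nu> \<in> carried K" "\<sigma> \<in> carried K"
  shows "mutual_energy \<sigma> (add_measure \<mu> \<nu>) = mutual_energy \<sigma> \<mu> + mutual_energy \<sigma> \<nu>"
  unfolding mutual_energy_def
  using assms riesz_potential_measurable[of \<sigma>]
  by (intro nn_integral_add_measure) (auto simp: carriedD measurable_cong_sets[OF carriedD(1)[OF assms(1)] refl])

lemma mutual_energy_scale_right:
  assumes "\<mu> \<in> carried K" "\<sigma> \<in> carried K"
  shows "mutual_energy \<sigma> (scale_measure c \<mu>) = c * mutual_energy \<sigma> \<mu>"
  unfolding mutual_energy_def
  using assms riesz_potential_measurable[of \<sigma>]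
  by (intro nn_integral_scale_measure) (auto simp: carriedD measurable_cong_sets[OF carriedD(1)[OF assms(1)] refl])

lemma energy_perturb:
  assumes K: "closed K" "\<nu> \<in> carried K" "\<sigma> \<in> carried K" and t: "0 \<le> t"
  shows "energy (add_measure \<nu> (scale_measure (ennreal t) \<sigma>)) = energy \<nu> + 2 * ennreal t * mutual_energy \<nu> \<sigma> + ennreal t * ennreal t * energy \<sigma>"
proof -
  let ?s = "scale_measure (ennreal t) \<sigma>"
  let ?a = "add_measure \<nu> ?s"
  have s: "?s \<in> carried K" using K by (intro carried_scale) auto
  have a: "?a \<in> carried K" using K s by (intro carried_add) auto
  have "energy ?a = mutual_energy ?a \<nu> + ennreal t * mutual_energy ?a \<sigma>"
    using K a s by (simp add: mutual_energy_self[symmetric] mutual_energy_add_right mutual_energy_scale_right)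
  also have "mutual_energy ?a \<nu> = energy \<nu> + ennreal t * mutual_energy \<nu> \<sigma>"
    using K a s by (simp add: mutual_energy_commute[OF a K(2)] mutual_energy_add_right mutual_energy_scale_right mutual_energy_self)
  also have "mutual_energy ?a \<sigma> = mutual_energy \<nu> \<sigma> + ennreal t * energy \<sigma>"
    using K a s by (simp add: mutual_energy_commute[OF a K(3)] mutual_energy_add_right mutual_energy_scale_right mutual_energy_self mutual_energy_commute[OF K(3) K(2)])
  finally show ?thesis by (simp add: algebra_simps mult_2)
qed

lemma energy_scale:
  assumes "\<nu> \<in> carried K"
  shows "energy (scale_measure (ennreal t) \<nu>) = ennreal t * ennreal t * energy \<nu>"
proof -
  have s: "scale_measure (ennreal t) \<nu> \<in> carried K" using assms by (intro carried_scale) auto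
  show ?thesis
    using assms s by (simp add: mutual_energy_self[symmetric] mutual_energy_scale_right mutual_energy_commute[OF s assms] mult.assoc)
qed

text \<open>Minimise `J = energy / 2 - \<integral> U` over the measures on `K`. A minimiser exists by vague compactness
  and lower semicontinuity, since the energy controls the square of the mass. The two conclusions
  are the first-order conditions for adding `t \<sigma>` and for scaling by `1 - t`.\<close>

lemma energy_minimizer:
  assumes K: "compact K" and U: "continuous_on UNIV U" "\<And>y. 0 \<le> (U y :: real)"
  shows "\<exists>\<nu>\<in>carried K. (\<forall>\<sigma>\<in>carried K. energy \<sigma> < \<infinity> \<longrightarrow> (\<integral>\<^sup>+ x. ennreal (U x) \<partial>\<sigma>) \<le> mutual_energy \<nu> \<sigma>) \<and>
     energy \<nu> \<le> (\<integral>\<^sup>+ x. ennreal (U x) \<partial>\<nu>) \<and> energy \<nu> < \<infinity>"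
proof -
  have clK: "closed K" using K by (rule compact_imp_closed)
  have [measurable]: "U \<in> borel_measurable borel" using U(1) by (rule borel_measurable_continuous_onI)
  obtain B where B: "\<And>x. x \<in> K \<Longrightarrow> norm x \<le> B" "0 < B"
    using compact_imp_bounded[OF K] bounded_pos by blast
  have "compact (U ` K)" by (intro compact_continuous_image continuous_on_subset[OF U(1)] K) auto
  then obtain u0 where u0: "\<And>x. x \<in> K \<Longrightarrow> U x \<le> u0" "0 < u0"
    using compact_imp_bounded bounded_pos by (metis abs_le_D1 imageI real_norm_def)
  define L where "L \<nu> = (\<integral>\<^sup>+ x. ennreal (U x) \<partial>\<nu>)" for \<nu>
  define lr where "lr \<nu> = enn2real (L \<nu>)" for \<nu>
  define er where "er \<nu> = enn2real (energy \<nu>)" for \<nu>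
  define ms where "ms \<nu> = measure \<nu> UNIV" for \<nu> :: "'a measure"
  have ms: "emeasure \<nu> UNIV = ennreal (ms \<nu>)" if "\<nu> \<in> carried K" for \<nu>
    using finite_measure.emeasure_eq_measure[OF carriedD(2)[OF that]] by (simp add: ms_def)
  have ms0: "0 \<le> ms \<nu>" for \<nu> by (simp add: ms_def)
  have Lle: "L \<nu> \<le> ennreal (u0 * ms \<nu>)" if nu: "\<nu> \<in> carried K" for \<nu>
  proof -
    have "L \<nu> \<le> (\<integral>\<^sup>+ x. ennreal u0 \<partial>\<nu>)"
      unfolding L_def using carried_AE[OF nu clK] by (intro nn_integral_mono_AE, eventually_elim) (auto intro!: ennreal_leI u0)
    also have "\<dots> = ennreal (u0 * ms \<nu>)"
      using nu u0 by (simp add: carriedD ms ennreal_mult ms0)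
    finally show ?thesis .
  qed
  have Lfin: "L \<nu> = ennreal (lr \<nu>)" if "\<nu> \<in> carried K" for \<nu>
    using le_less_trans[OF Lle[OF that] ennreal_less_top] by (simp add: lr_def)
  have lr0: "0 \<le> lr \<nu>" for \<nu> by (simp add: lr_def)
  have lrle: "lr \<nu> \<le> u0 * ms \<nu>" if "\<nu> \<in> carried K" for \<nu>
    using Lle[OF that] Lfin[OF that] u0 ms0[of \<nu>] by (simp add: ennreal_le_iff)
  define Fs where "Fs = {\<nu> \<in> carried K. energy \<nu> < \<infinity>}"
  have er: "energy \<nu> = ennreal (er \<nu>)" if "\<nu> \<in> Fs" for \<nu> using that by (simp add: Fs_def er_def)
  have er0: "0 \<le> er \<nu>" for \<nu> by (simp add: er_def)
  define J where "J \<nu> = er \<nu> / 2 - lr \<nu>" for \<nu>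
  \<comment> \<open>Points of `K` have distance at most `2 B`, so `m` is a lower bound of the kernel on `K`.\<close>
  define m where "m = (2 * B) powr (\<alpha> - real DIM('a))"
  have m: "0 < m" using B by (simp add: m_def)
  have Ele: "m * ms \<nu> * ms \<nu> \<le> er \<nu>" if nu: "\<nu> \<in> Fs" for \<nu>
  proof -
    have nc: "\<nu> \<in> carried K" using nu by (simp add: Fs_def)
    have "(\<integral>\<^sup>+ x. (\<integral>\<^sup>+ y. ennreal m \<partial>\<nu>) \<partial>\<nu>) \<le> energy \<nu>"
      unfolding energy_def riesz_potential_def using carried_AE[OF nc clK]
    proof (intro nn_integral_mono_AE, eventually_elim)
      fix x assume x: "x \<in> K"
      show "(\<integral>\<^sup>+ y. ennreal m \<partial>\<nu>) \<le> (\<integral>\<^sup>+ y. kern x y \<partial>\<nu>)"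
        using carried_AE[OF nc clK]
      proof (intro nn_integral_mono_AE, eventually_elim)
        fix y assume y: "y \<in> K"
        have "dist x y \<le> 2 * B" using norm_triangle_ineq4[of x y] B(1)[OF x] B(1)[OF y] by (simp add: dist_norm)
        then show "ennreal m \<le> kern x y"
          using alpha_dim by (auto simp: riesz_kernel_def m_def intro!: ennreal_leI powr_mono2')
      qed
    qed
    also have "(\<integral>\<^sup>+ x. (\<integral>\<^sup>+ y. ennreal m \<partial>\<nu>) \<partial>\<nu>) = ennreal (m * ms \<nu> * ms \<nu>)"
      using m by (simp add: carriedD[OF nc] ms[OF nc] ennreal_mult ms0)
    finally show ?thesis using er[OF nu] m er0[of \<nu>] by (simp add: ennreal_le_iff)
  qed
  define M0 where "M0 = (2 * u0 + 2) / m + 1"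
  have M0: "1 \<le> M0" using u0 m by (simp add: M0_def)
  have bound: "ms \<nu> \<le> M0" if nu: "\<nu> \<in> Fs" and J: "J \<nu> \<le> 1" for \<nu>
  proof (rule ccontr)
    assume "\<not> ms \<nu> \<le> M0"
    then have big: "M0 < ms \<nu>" by simp
    have "m * M0 \<le> m * ms \<nu>" using big m by simp
    then have "2 * u0 + 2 \<le> m * ms \<nu>" 
    proof -
      have "m * M0 = 2 * u0 + 2 + m" 
      proof -
        have "m * (c / m + 1) = c + m" for c using m by (simp add: distrib_left)
        then show ?thesis unfolding M0_def .
      qed
      with \<open>m * M0 \<le> m * ms \<nu>\<close> m show ?thesis by linarith
    qed
    then have "(2 * u0 + 2) * ms \<nu> \<le> m * ms \<nu> * ms \<nu>" using ms0[of \<nu>] by (intro mult_right_mono)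
    then have "2 * (u0 * ms \<nu>) + 2 * ms \<nu> \<le> m * ms \<nu> * ms \<nu>" by (simp add: algebra_simps)
    moreover have "lr \<nu> \<le> u0 * ms \<nu>" using nu by (intro lrle) (simp add: Fs_def)
    ultimately have "ms \<nu> \<le> J \<nu>" using Ele[OF nu] unfolding J_def by linarith
    then show False using big M0 J by simp
  qed
  have Jge: "- (u0 * M0) \<le> J \<nu>" if nu: "\<nu> \<in> Fs" for \<nu>
  proof (cases "J \<nu> \<le> 1")
    case True
    have "lr \<nu> \<le> u0 * ms \<nu>" using nu by (intro lrle) (simp add: Fs_def)
    also have "\<dots> \<le> u0 * M0" using bound[OF nu True] u0 by (intro mult_left_mono) auto
    finally show ?thesis using er0[of \<nu>] by (simp add: J_def)
  next
    case False
    have "0 \<le> u0 * M0" using u0 M0 by simp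
    with False show ?thesis by linarith
  qed
  have zero: "null_measure borel \<in> Fs" "J (null_measure borel) = 0"
    by (auto simp: Fs_def carried_def energy_def J_def er_def lr_def L_def intro!: finite_measureI)
  define I where "I = Inf (J ` Fs)"
  have bdd: "bdd_below (J ` Fs)" using Jge by (intro bdd_belowI[of _ "- (u0 * M0)"]) auto
  have I_le: "I \<le> J \<nu>" if "\<nu> \<in> Fs" for \<nu> unfolding I_def using that bdd by (intro cInf_lower) auto
  have "\<exists>\<nu>\<in>Fs. J \<nu> < I + 1 / real (Suc n)" for n
    using cInf_less_iff[of "J ` Fs" "I + 1 / real (Suc n)"] bdd zero(1) by (auto simp: I_def)
  then obtain \<nu> where nu: "\<And>n. \<nu> n \<in> Fs" "\<And>n. J (\<nu> n) < I + 1 / real (Suc n)" by metis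
  have nuc: "\<nu> n \<in> carried K" for n using nu(1)[of n] by (simp add: Fs_def)
  have "J (\<nu> n) \<le> 1" for n
  proof -
    have "I \<le> 0" using I_le[OF zero(1)] zero(2) by simp
    moreover have "1 / real (Suc n) \<le> 1" by simp
    ultimately show ?thesis using nu(2)[of n] by linarith
  qed
  then have mb: "emeasure (\<nu> n) UNIV \<le> ennreal M0" for n
    using bound[OF nu(1)] by (simp add: ms[OF nuc] ennreal_leI)
  obtain r \<mu> where vc: "strict_mono (r :: nat \<Rightarrow> nat) \<and> sets \<mu> = sets borel \<and> emeasure \<mu> UNIV \<le> ennreal (max M0 1) \<and>
    (\<forall>f :: 'a \<Rightarrow> real. continuous_on UNIV f \<longrightarrow> (f \<longlongrightarrow> 0) at_infinity \<longrightarrow> (\<lambda>n. \<integral>x. f x \<partial>\<nu> (r n)) \<longlonglongrightarrow> (\<integral>x. f x \<partial>\<mu>))"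
    using vague_compactness[of \<nu> M0, OF carriedD(1)[OF nuc] mb] by (elim exE) (rule that)
  have r: "strict_mono r" and sets_mu[measurable_cong]: "sets \<mu> = sets borel" and mu_mass: "emeasure \<mu> UNIV \<le> ennreal (max M0 1)"
    using vc by simp_all
  have conv: "(\<lambda>n. \<integral>x. f x \<partial>\<nu> (r n)) \<longlonglongrightarrow> (\<integral>x. f x \<partial>\<mu>)"
    if "continuous_on UNIV f" "(f \<longlongrightarrow> 0) at_infinity" for f :: "'a \<Rightarrow> real"
    using vc that by simp
  have fin_mu: "finite_measure \<mu>"
    using mu_mass sets_eq_imp_space_eq[OF sets_mu] by (intro finite_measure_of_bound[of _ "max M0 1"]) simp
  have mu: "\<mu> \<in> carried K"
    using vague_limit_support[of "\<lambda>n. \<nu> (r n)" \<mu> K] conv fin_mu sets_mu clK carriedD[OF nuc] by (auto simp: carried_def)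
  have Llim: "(\<lambda>n. lr (\<nu> (r n))) \<longlonglongrightarrow> lr \<mu>"
  proof -
    let ?f = "\<lambda>x. U x * cutoff B x"
    have fc: "continuous_on UNIV ?f" by (intro continuous_intros U cutoff_continuous)
    have [measurable]: "?f \<in> borel_measurable borel" using fc by (rule borel_measurable_continuous_onI)
    have eq: "(\<integral>x. ?f x \<partial>\<tau>) = lr \<tau>" if t: "\<tau> \<in> carried K" for \<tau>
    proof -
      have [measurable_cong]: "sets \<tau> = sets borel" using t by (rule carriedD)
      have "(\<integral>x. ?f x \<partial>\<tau>) = enn2real (\<integral>\<^sup>+ x. ennreal (?f x) \<partial>\<tau>)"
        by (intro integral_eq_nn_integral AE_I2 mult_nonneg_nonneg U(2) cutoff_range) measurable
      also have "(\<integral>\<^sup>+ x. ennreal (?f x) \<partial>\<tau>) = L \<tau>"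
        unfolding L_def using carried_AE[OF t clK]
        by (intro nn_integral_cong_AE, eventually_elim) (simp add: cutoff_one B)
      finally show ?thesis by (simp add: lr_def)
    qed
    show ?thesis using conv[OF fc cutoff_vanishes] by (simp add: eq[OF nuc] eq[OF mu])
  qed
  have Jlim: "(\<lambda>n. J (\<nu> (r n))) \<longlonglongrightarrow> I"
  proof -
    have "(\<lambda>n. J (\<nu> n)) \<longlonglongrightarrow> I"
    proof (rule tendsto_sandwich)
      show "\<forall>\<^sub>F n in sequentially. I \<le> J (\<nu> n)" by (intro always_eventually allI I_le nu)
      show "\<forall>\<^sub>F n in sequentially. J (\<nu> n) \<le> I + 1 / real (Suc n)" by (intro always_eventually allI less_imp_le nu)
      have "(\<lambda>n. I + 1 / real (Suc n)) \<longlonglongrightarrow> I + 0" by (intro tendsto_add tendsto_const LIMSEQ_Suc[OF lim_1_over_n])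
      then show "(\<lambda>n. I + 1 / real (Suc n)) \<longlonglongrightarrow> I" by simp
    qed simp
    from LIMSEQ_subseq_LIMSEQ[OF this r] show ?thesis by (simp add: o_def)
  qed
  have "(\<lambda>n. 2 * (J (\<nu> (r n)) + lr (\<nu> (r n)))) \<longlonglongrightarrow> 2 * (I + lr \<mu>)"
    by (intro tendsto_intros Jlim Llim)
  then have elim: "(\<lambda>n. er (\<nu> (r n))) \<longlonglongrightarrow> 2 * (I + lr \<mu>)" by (simp add: J_def)
  have e_nn: "0 \<le> 2 * (I + lr \<mu>)" by (rule LIMSEQ_le_const[OF elim]) (auto simp: er0)
  have "energy \<mu> \<le> liminf (\<lambda>n. energy (\<nu> (r n)))"
    using conv by (intro energy_lower_semicontinuous sets_mu fin_mu carriedD[OF nuc]) auto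
  also have "\<dots> = liminf (\<lambda>n. ennreal (er (\<nu> (r n))))" by (simp add: er[OF nu(1)])
  also have "\<dots> = ennreal (2 * (I + lr \<mu>))" by (intro lim_imp_Liminf tendsto_ennrealI elim) simp
  finally have e_mu: "energy \<mu> \<le> ennreal (2 * (I + lr \<mu>))" .
  then have muF: "\<mu> \<in> Fs" using mu by (auto simp: Fs_def intro: le_less_trans)
  then have "er \<mu> \<le> 2 * (I + lr \<mu>)" using e_mu e_nn by (simp add: er ennreal_le_iff)
  then have J_mu: "J \<mu> \<le> J \<sigma>" if "\<sigma> \<in> Fs" for \<sigma> using I_le[OF that] by (simp add: J_def)
  have Ladd: "L (add_measure \<mu> (scale_measure (ennreal t) \<sigma>)) = L \<mu> + ennreal t * L \<sigma>" if s: "\<sigma> \<in> carried K" for \<sigma> t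
  proof -
    have sets: "sets \<sigma> = sets borel" using s by (rule carriedD)
    have m1: "(\<lambda>x. ennreal (U x)) \<in> borel_measurable \<mu>" by measurable
    have m2: "(\<lambda>x. ennreal (U x)) \<in> borel_measurable \<sigma>" by (simp add: measurable_cong_sets[OF sets refl])
    show ?thesis
      unfolding L_def using sets sets_mu m1 m2 by (simp add: nn_integral_add_measure nn_integral_scale_measure)
  qed
  have first: "L \<sigma> \<le> mutual_energy \<mu> \<sigma>" if s: "\<sigma> \<in> carried K" and es: "energy \<sigma> < \<infinity>" for \<sigma>
  proof (cases "mutual_energy \<mu> \<sigma> = \<infinity>")
    case False
    define x where "x = enn2real (mutual_energy \<mu> \<sigma>)"
    have x: "mutual_energy \<mu> \<sigma> = ennreal x" "0 \<le> x" using False by (auto simp: x_def less_top)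
    have sF: "\<sigma> \<in> Fs" using s es by (simp add: Fs_def)
    \<comment> \<open>Dividing `J(\<mu>) \<le> J(\<mu> + t \<sigma>)` by `t` leaves the error `t er \<sigma> / 2`.\<close>
    have ineq: "lr \<sigma> \<le> x + t * er \<sigma> / 2" if t: "0 < t" for t
    proof -
      let ?a = "add_measure \<mu> (scale_measure (ennreal t) \<sigma>)"
      have ac: "?a \<in> carried K" using s mu clK by (intro carried_add carried_scale) auto
      have e: "energy ?a = ennreal (er \<mu> + 2 * t * x + t * t * er \<sigma>)"
      proof -
        have "energy ?a = ennreal (er \<mu>) + 2 * ennreal t * ennreal x + ennreal t * ennreal t * ennreal (er \<sigma>)"
          using energy_perturb[OF clK mu s, of t] t by (simp add: x(1) er[OF muF] er[OF sF])
        also have "\<dots> = ennreal (er \<mu> + 2 * t * x + t * t * er \<sigma>)"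
        proof -
          have "2 * ennreal t * ennreal x = ennreal (2 * t * x)"
            using t x(2) by (simp add: ennreal_mult)
          moreover have "ennreal t * ennreal t * ennreal (er \<sigma>) = ennreal (t * t * er \<sigma>)"
            using t er0 by (simp add: ennreal_mult)
          ultimately show ?thesis using t x(2) er0 by (simp flip: ennreal_plus)
        qed
        finally show ?thesis .
      qed
      have aF: "?a \<in> Fs" using ac e by (simp add: Fs_def)
      have ea: "er ?a = er \<mu> + 2 * t * x + t * t * er \<sigma>"
        using e er[OF aF] t x(2) er0 by (metis (no_types, lifting) add_nonneg_nonneg enn2real_ennreal less_imp_le mult_nonneg_nonneg zero_le_numeral)
      have la: "lr ?a = lr \<mu> + t * lr \<sigma>"
      proof -
        have "ennreal (lr ?a) = ennreal (lr \<mu>) + ennreal t * ennreal (lr \<sigma>)"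
          using Ladd[OF s, of t] by (simp add: Lfin ac mu s)
        also have "\<dots> = ennreal (lr \<mu> + t * lr \<sigma>)" using t lr0 by (simp add: ennreal_mult)
        finally show ?thesis using t lr0 by (subst (asm) ennreal_inj) auto
      qed
      have "t * lr \<sigma> \<le> t * (x + t * er \<sigma> / 2)"
        using J_mu[OF aF] by (simp add: J_def ea la field_simps)
      then show ?thesis using t by simp
    qed
    have "lr \<sigma> \<le> x"
    proof (rule field_le_epsilon)
      fix e :: real assume e: "0 < e"
      define t where "t = e / (er \<sigma> + 1)"
      have d: "0 < er \<sigma> + 1" using er0[of \<sigma>] by simp
      have t: "0 < t" using e d by (simp add: t_def)
      have "t * er \<sigma> / 2 \<le> t * (er \<sigma> + 1)" using t er0[of \<sigma>] by (simp add: field_simps)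
      also have "\<dots> = e" using d by (simp add: t_def)
      finally show "lr \<sigma> \<le> x + e" using ineq[OF t] by linarith
    qed
    then show ?thesis by (simp add: x(1) Lfin[OF s] ennreal_leI)
  qed simp
  have second: "energy \<mu> \<le> L \<mu>"
  proof -
    have ineq: "er \<mu> \<le> lr \<mu> + t * er \<mu>" if t: "0 < t" "t < 1" for t
    proof -
      let ?a = "scale_measure (ennreal (1 - t)) \<mu>"
      have ac: "?a \<in> carried K" using mu by (intro carried_scale) auto
      have e: "energy ?a = ennreal ((1 - t) * (1 - t) * er \<mu>)"
        using energy_scale[OF mu, of "1 - t"] t er0 by (simp add: er[OF muF] ennreal_mult)
      have aF: "?a \<in> Fs" using ac e by (simp add: Fs_def)
      have ea: "er ?a = (1 - t) * (1 - t) * er \<mu>" using e er0[of \<mu>] t by (simp add: er_def)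
      have la: "lr ?a = (1 - t) * lr \<mu>"
        unfolding lr_def L_def using t by (subst nn_integral_scale_measure) (auto simp: enn2real_mult)
      have "t * (er \<mu>) \<le> t * (lr \<mu> + t * er \<mu> / 2)"
        using J_mu[OF aF] by (simp add: J_def ea la algebra_simps add_divide_distrib diff_divide_distrib)
      then have "er \<mu> \<le> lr \<mu> + t * er \<mu> / 2" using t by simp
      then show ?thesis using t er0[of \<mu>] by (smt (verit) mult_nonneg_nonneg field_sum_of_halves)
    qed
    have "er \<mu> \<le> lr \<mu>"
    proof (rule field_le_epsilon)
      fix e :: real assume e: "0 < e"
      define t where "t = min (1 / 2) (e / (er \<mu> + 1))"
      have d: "0 < er \<mu> + 1" using er0[of \<mu>] by simp
      have t: "0 < t" "t < 1" using e d by (auto simp: t_def)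
      have "t * er \<mu> \<le> t * (er \<mu> + 1)" using t by simp
      also have "\<dots> \<le> e / (er \<mu> + 1) * (er \<mu> + 1)" using d by (intro mult_right_mono) (auto simp: t_def)
      also have "\<dots> = e" using d by simp
      finally show "er \<mu> \<le> lr \<mu> + e" using ineq[OF t] by linarith
    qed
    then show ?thesis by (simp add: er[OF muF] Lfin[OF mu] ennreal_leI)
  qed
  show ?thesis
    using mu first second muF by (intro bexI[of _ \<mu>]) (auto simp: L_def Fs_def)
qed

text \<open>For the minimiser of energy, the first-order condition gives `pot \<nu> \<ge> U` at every point of `K`
  because `K` is fat. Comparison with the energy gives `pot \<nu> = U` almost everywhere for `\<nu>`.
  Hence `\<nu>` lives on the compact set `S` of equality, on which its potential is continuous,
  therefore continuous everywhere. The domination principle gives `pot \<nu> \<le> u`.\<close>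

theorem balayage_exists:
  assumes K: "compact K" "fat K" and u: "supermedian u" "lsc u"
    and U: "continuous_on UNIV U" "\<And>y. 0 \<le> (U y :: real)" "\<And>y. y \<in> K \<Longrightarrow> u y = ennreal (U y)"
  shows "\<exists>\<nu>\<in>carried K. (\<forall>y\<in>K. pot \<nu> y = u y) \<and> (\<forall>y. pot \<nu> y \<le> u y) \<and>
     (\<exists>V. continuous_on UNIV V \<and> (\<forall>y. 0 \<le> V y \<and> pot \<nu> y = ennreal (V y)))"
proof -
  obtain \<nu> where nu: "\<nu> \<in> carried K" and
    ge: "\<And>\<sigma>. \<sigma> \<in> carried K \<Longrightarrow> energy \<sigma> < \<infinity> \<Longrightarrow> (\<integral>\<^sup>+ x. ennreal (U x) \<partial>\<sigma>) \<le> mutual_energy \<nu> \<sigma>" and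
    le: "energy \<nu> \<le> (\<integral>\<^sup>+ x. ennreal (U x) \<partial>\<nu>)" and efin: "energy \<nu> < \<infinity>"
    using energy_minimizer[OF K(1) U(1,2)] by blast
  note nuD = carriedD[OF nu]
  have clK: "closed K" using K(1) by (rule compact_imp_closed)
  have [measurable_cong]: "sets \<nu> = sets borel" by (rule nuD)
  have [measurable]: "U \<in> borel_measurable borel" using U(1) by (rule borel_measurable_continuous_onI)
  have pm: "pot \<nu> \<in> borel_measurable borel" using nuD by simp
  have pm'[measurable]: "pot \<nu> \<in> borel_measurable \<nu>" using pm by (simp add: measurable_cong_sets[OF nuD(1) refl])
  have lower: "ennreal (U a) \<le> pot \<nu> a" if a: "a \<in> K" for a
  proof (rule fat_point_bound[OF nuD(1,2) K a U(1,2)])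
    fix \<sigma> assume "sets \<sigma> = sets (borel :: 'a measure)" "finite_measure \<sigma>" "emeasure \<sigma> (- K) = 0" "(\<integral>\<^sup>+ x. pot \<sigma> x \<partial>\<sigma>) < \<infinity>"
    then show "(\<integral>\<^sup>+ x. ennreal (U x) \<partial>\<sigma>) \<le> (\<integral>\<^sup>+ x. pot \<nu> x \<partial>\<sigma>)"
      using ge[of \<sigma>] by (simp add: carried_def energy_def mutual_energy_def)
  qed
  have AEK: "AE x in \<nu>. x \<in> K" by (rule carried_AE[OF nu clK])
  have AEeq: "AE x in \<nu>. pot \<nu> x \<le> ennreal (U x)"
  proof -
    have AEge: "AE x in \<nu>. ennreal (U x) \<le> pot \<nu> x" using AEK by eventually_elim (rule lower)
    have "(\<integral>\<^sup>+ x. ennreal (U x) \<partial>\<nu>) \<le> energy \<nu>" unfolding energy_def by (intro nn_integral_mono_AE AEge)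
    then have fin: "(\<integral>\<^sup>+ x. ennreal (U x) \<partial>\<nu>) \<noteq> \<infinity>" using efin by auto
    have "(\<integral>\<^sup>+ x. pot \<nu> x - ennreal (U x) \<partial>\<nu>) = energy \<nu> - (\<integral>\<^sup>+ x. ennreal (U x) \<partial>\<nu>)"
      unfolding energy_def using fin AEge by (intro nn_integral_diff) auto
    also have "\<dots> = 0" using le efin by (intro diff_eq_0_ennreal) auto
    finally have "AE x in \<nu>. pot \<nu> x - ennreal (U x) = 0"
      by (subst (asm) nn_integral_0_iff_AE) auto
    then show ?thesis
      by eventually_elim (simp add: diff_eq_0_iff_ennreal)
  qed
  define S where "S = {x \<in> K. pot \<nu> x \<le> ennreal (U x)}"
  have "closed S"
    unfolding closed_sequential_limits
  proof (intro allI impI)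
    fix X x assume X: "(\<forall>n. X n \<in> S) \<and> X \<longlonglongrightarrow> x"
    have "x \<in> K" using X clK by (auto simp: S_def closed_sequential_limits)
    have "(\<lambda>n. U (X n)) \<longlonglongrightarrow> U x" using U(1) X by (auto intro: continuous_on_tendsto_compose)
    then have Ul: "(\<lambda>n. ennreal (U (X n))) \<longlonglongrightarrow> ennreal (U x)" by (rule tendsto_ennrealI)
    have "pot \<nu> x \<le> liminf (\<lambda>n. pot \<nu> (X n))"
      using lscD[OF riesz_potential_lsc[OF nuD(1)]] X by blast
    also have "\<dots> \<le> liminf (\<lambda>n. ennreal (U (X n)))"
      using X by (intro Liminf_mono always_eventually) (auto simp: S_def)
    also have "\<dots> = ennreal (U x)" using Ul by (simp add: lim_imp_Liminf)
    finally show "x \<in> S" using \<open>x \<in> K\<close> by (simp add: S_def)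
  qed
  then have S: "compact S" using compact_Int_closed[OF K(1), of S] by (simp add: S_def Int_absorb1 inf.absorb2 Collect_conj_eq)
  have "AE x in \<nu>. x \<in> S" using AEK AEeq by eventually_elim (simp add: S_def)
  then have S0: "emeasure \<nu> (- S) = 0"
    using \<open>closed S\<close> AE_iff_null_sets[of "- S" \<nu>] by (auto simp: nuD(1))
  have SU: "pot \<nu> y = ennreal (U y)" if "y \<in> S" for y
    using that lower[of y] by (auto simp: S_def intro: antisym)
  obtain V where V: "continuous_on UNIV V" "\<And>y. 0 \<le> V y" "\<And>y. pot \<nu> y = ennreal (V y)"
    using evans_vasilesco[OF nuD(1,2) S S0 continuous_on_subset[OF U(1) subset_UNIV] U(2) SU] by blast
  have upper: "pot \<nu> y \<le> u y" for y
  proof -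
    have "ennreal (V y + 0) \<le> u y"
    proof (rule domination_principle[OF nuD(1,2) S S0 V u])
      fix y assume "y \<in> S"
      then show "ennreal (V y + 0) \<le> u y" using SU[of y] V(3)[of y] U(3)[of y] by (simp add: S_def)
    qed auto
    then show ?thesis by (simp add: V(3))
  qed
  have "pot \<nu> y = u y" if "y \<in> K" for y
    using upper[of y] lower[OF that] U(3)[OF that] by simp
  then show ?thesis using nu upper V by blast
qed


section \<open>Measures are determined by the limits of potentials\<close>

lemma compactly_supported_carried:
  assumes "compactly_supported_measure (\<mu> :: 'a measure)"
  obtains K where "compact K" "\<mu> \<in> carried K"
  using assms by (auto simp: compactly_supported_measure_def carried_def)

lemma carried_compactly_supported: "compact K \<Longrightarrow> \<mu> \<in> carried K \<Longrightarrow> compactly_supported_measure (\<mu> :: 'a measure)"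
  by (auto simp: compactly_supported_measure_def carried_def)

lemma potential_limitsE:
  assumes "u \<in> potential_limits \<alpha>"
  obtains \<mu> where "\<And>n::nat. compactly_supported_measure (\<mu> n :: 'a measure)" "incseq (\<lambda>n. pot (\<mu> n))"
    "u = (\<lambda>x. SUP n. pot (\<mu> n) x)"
  using assms by (auto simp: potential_limits_def)

lemma potential_limitsI:
  assumes "\<And>n::nat. compactly_supported_measure (\<mu> n :: 'a measure)" "incseq (\<lambda>n. pot (\<mu> n))"
  shows "(\<lambda>x. SUP n. pot (\<mu> n) x) \<in> potential_limits \<alpha>"
  using assms by (auto simp: potential_limits_def)

lemma potential_limits_supermedian:
  assumes "u \<in> potential_limits \<alpha>" shows "supermedian (u :: 'a \<Rightarrow> ennreal)"
  using assms by (elim potential_limitsE)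
    (auto simp: compactly_supported_measure_def intro!: supermedian_SUP supermedian_potential)

lemma potential_limits_lsc:
  assumes "u \<in> potential_limits \<alpha>" shows "lsc (u :: 'a \<Rightarrow> ennreal)"
  using assms by (elim potential_limitsE)
    (auto simp: compactly_supported_measure_def intro!: lsc_SUP riesz_potential_lsc)

lemma potential_limits_measurable: "u \<in> potential_limits \<alpha> \<Longrightarrow> (u :: 'a \<Rightarrow> ennreal) \<in> borel_measurable borel"
  using potential_limits_supermedian by (rule supermedian_measurable)

text \<open>The densities `sweep a` restricted to growing balls have potentials increasing to `ktr a`.\<close>

lemma ktr_in_limits:
  assumes a: "0 < a" shows "(\<lambda>y. ktr a (y - w)) \<in> potential_limits \<alpha>"
proof -
  define h where "h n z = sweep a (z - w) * indicator (cball 0 (real n)) z" for n z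
  define \<mu> where "\<mu> n = density lborel (h n)" for n
  have [measurable]: "cball (0::'a) (real n) \<in> sets borel" for n by simp
  have [measurable]: "h n \<in> borel_measurable borel" for n unfolding h_def[abs_def] by measurable
  have emu: "emeasure (\<mu> n) B = (\<integral>\<^sup>+ z. h n z * indicator B z \<partial>lborel)" if "B \<in> sets borel" for n B
    using that unfolding \<mu>_def by (subst emeasure_density) auto
  have int: "(\<integral>\<^sup>+ z. sweep a (z - w) \<partial>lborel) = 1"
    using sweep_integral'[OF a, of w] by (simp add: sweep_commute)
  have cs: "compactly_supported_measure (\<mu> n)" for n
  proof -
    have "emeasure (\<mu> n) UNIV \<le> (\<integral>\<^sup>+ z. sweep a (z - w) \<partial>lborel)"
      by (subst emu) (auto simp: h_def intro!: nn_integral_mono split: split_indicator)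
    then have "finite_measure (\<mu> n)" using int by (intro finite_measure_of_bound[of _ 1]) (simp add: \<mu>_def)
    moreover have "emeasure (\<mu> n) (- cball 0 (real n)) = 0"
    proof -
      have z: "h n z * indicator (- cball 0 (real n)) z = 0" for z
        by (simp add: h_def split: split_indicator)
      have "emeasure (\<mu> n) (- cball 0 (real n)) = (\<integral>\<^sup>+ z. h n z * indicator (- cball 0 (real n)) z \<partial>lborel)"
        by (rule emu) simp
      also have "\<dots> = 0" unfolding z by simp
      finally show ?thesis .
    qed
    ultimately show ?thesis
      unfolding compactly_supported_measure_def by (auto simp: \<mu>_def intro!: exI[of _ "cball 0 (real n)"])
  qed
  have pot: "pot (\<mu> n) y = (\<integral>\<^sup>+ z. h n z * kern y z \<partial>lborel)" for n y
    unfolding riesz_potential_def \<mu>_def by (rule nn_integral_density) measurable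
  have hmono: "h m z \<le> h n z" if "m \<le> n" for m n z
    using that by (auto simp: h_def split: split_indicator)
  have inc: "incseq (\<lambda>n. pot (\<mu> n))"
    unfolding incseq_def le_fun_def pot by (intro allI impI nn_integral_mono mult_right_mono hmono) auto
  have "(SUP n. pot (\<mu> n) y) = ktr a (y - w)" for y
  proof -
    have "(SUP n. pot (\<mu> n) y) = (\<integral>\<^sup>+ z. (SUP n. h n z * kern y z) \<partial>lborel)"
      unfolding pot by (intro nn_integral_monotone_convergence_SUP[symmetric])
        (auto simp: incseq_def le_fun_def intro!: mult_right_mono hmono)
    also have "(\<lambda>z. SUP n. h n z * kern y z) = (\<lambda>z. sweep a (w - z) * kern z y)"
    proof
      fix z :: 'a
      obtain n where n: "norm z \<le> real n" using real_arch_simple by blast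
      have "(SUP n. h n z * kern y z) = sweep a (z - w) * kern y z"
      proof (rule antisym)
        show "(SUP n. h n z * kern y z) \<le> sweep a (z - w) * kern y z"
          by (intro SUP_least mult_right_mono) (auto simp: h_def split: split_indicator)
        show "sweep a (z - w) * kern y z \<le> (SUP n. h n z * kern y z)"
          using n by (intro SUP_upper2[of n]) (auto simp: h_def)
      qed
      then show "(SUP n. h n z * kern y z) = sweep a (w - z) * kern z y"
        by (simp add: sweep_commute riesz_kernel_commute)
    qed
    also have "(\<integral>\<^sup>+ z. sweep a (w - z) * kern z y \<partial>lborel) = ktr a (w - y)" by (rule sweep_conv_kernel[OF a])
    finally show ?thesis by (simp add: ktr_commute)
  qed
  then show ?thesis using potential_limitsI[OF cs inc] by simp
qed

text \<open>The part of the kernel from times in `(b/2, b]`: a difference of two truncated kernels, which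
  after normalisation is an approximate identity as `b \<rightarrow> 0`. Truncated kernels alone never become
  concentrated near the origin.\<close>

definition window :: "real \<Rightarrow> 'a \<Rightarrow> ennreal" where
  "window b = mix (\<lambda>s. \<kappa> s * indicator {b / 2<..b} s)"

definition window_mass :: "real \<Rightarrow> ennreal" where
  "window_mass b = (\<integral>\<^sup>+ s. \<kappa> s * indicator {b / 2<..b} s \<partial>lborel)"

lemma window_measurable[measurable]: "window b \<in> borel_measurable borel"
  unfolding window_def by measurable

lemma ktr_window: "0 < b \<Longrightarrow> ktr (b / 2) z = ktr b z + window b z"
  unfolding ktr_def window_def
  by (subst mix_add[symmetric]) (auto intro!: mix_cong simp: indicator_def)

lemma window_integral:
  assumes "0 < b" shows "(\<integral>\<^sup>+ z. window b z \<partial>lborel) = window_mass b"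
  unfolding window_def window_mass_def
  using assms by (subst mix_integral) (auto intro!: nn_integral_cong simp: indicator_def)

lemma window_mass_pos: assumes b: "0 < b" shows "0 < window_mass b" "window_mass b < \<infinity>"
proof -
  define c where "c = (b powr (\<beta> - 1)) / norm_const"
  define c' where "c' = ((b / 2) powr (\<beta> - 1)) / norm_const"
  have c: "0 < c" "0 < c'" using b norm_const_pos by (auto simp: c_def c'_def)
  have "ennreal c * emeasure lborel {b / 2<..b} \<le> window_mass b"
    unfolding window_mass_def
  proof (subst nn_integral_cmult_indicator[symmetric])
    show "(\<integral>\<^sup>+ s. ennreal c * indicator {b / 2<..b} s \<partial>lborel) \<le> (\<integral>\<^sup>+ s. \<kappa> s * indicator {b / 2<..b} s \<partial>lborel)"
      using b norm_const_pos beta_less_1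
      by (intro nn_integral_mono) (auto simp: indicator_def \<kappa>_def c_def intro!: ennreal_leI divide_right_mono powr_mono2')
  qed auto
  moreover have "0 < ennreal c * emeasure lborel {b / 2<..b}" using b c by (simp add: ennreal_zero_less_mult_iff)
  ultimately show "0 < window_mass b" by simp
  have "window_mass b \<le> (\<integral>\<^sup>+ s. ennreal c' * indicator {b / 2<..b} s \<partial>lborel)"
    unfolding window_mass_def using b norm_const_pos beta_less_1
    by (intro nn_integral_mono) (auto simp: indicator_def \<kappa>_def c'_def intro!: ennreal_leI divide_right_mono powr_mono2')
  also have "\<dots> < \<infinity>" using b by (simp add: nn_integral_cmult_indicator ennreal_mult[symmetric] ennreal_mult_less_top)
  finally show "window_mass b < \<infinity>" .
qed

text \<open>For `s \<le> b` and `|z| > r` the Gaussian at time `s` is at most `exp (-r^2 / (4 b))` times a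
  multiple of the Gaussian at time `2 s`.\<close>

lemma window_tail:
  assumes b: "0 < b" and r: "0 \<le> r"
  shows "(\<integral>\<^sup>+ z. window b z * indicator {z. r < norm z} z \<partial>lborel) \<le> ennreal (2 powr (real DIM('a) / 2) * exp (- r\<^sup>2 / (4 * b))) * window_mass b"
proof -
  let ?C = "2 powr (real DIM('a) / 2) * exp (- r\<^sup>2 / (4 * b))"
  let ?w = "\<lambda>s. \<kappa> s * indicator {b / 2<..b} s"
  have g: "gauss s z \<le> ?C * gauss (2 * s) z" if s: "0 < s" "s \<le> b" and z: "r < norm z" for s and z :: 'a
  proof -
    have "exp (- (norm z)\<^sup>2 / (2 * s)) = exp (- (norm z)\<^sup>2 / (2 * (2 * s))) * exp (- (norm z)\<^sup>2 / (4 * s))"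
      by (subst exp_add[symmetric]) (use s in \<open>simp add: field_simps\<close>)
    moreover have "exp (- (norm z)\<^sup>2 / (4 * s)) \<le> exp (- r\<^sup>2 / (4 * b))"
    proof -
      have "r\<^sup>2 / (4 * b) \<le> (norm z)\<^sup>2 / (4 * s)" using s z r by (intro frac_le power_mono) auto
      then show ?thesis by simp
    qed
    moreover have "(2 * pi * s) powr (- real DIM('a) / 2) = 2 powr (real DIM('a) / 2) * (2 * pi * (2 * s)) powr (- real DIM('a) / 2)"
    proof -
      have "(2 * pi * (2 * s)) powr (- real DIM('a) / 2) = 2 powr (- real DIM('a) / 2) * (2 * pi * s) powr (- real DIM('a) / 2)"
        using s by (subst powr_mult[symmetric]) (auto simp: ac_simps)
      moreover have "2 powr (real DIM('a) / 2) * 2 powr (- real DIM('a) / 2) = (1::real)"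
        by (subst powr_add[symmetric]) simp
      ultimately show ?thesis by (simp add: mult.assoc[symmetric])
    qed
    ultimately have "gauss s z \<le> (2 powr (real DIM('a) / 2) * (2 * pi * (2 * s)) powr (- real DIM('a) / 2)) * (exp (- (norm z)\<^sup>2 / (2 * (2 * s))) * exp (- r\<^sup>2 / (4 * b)))"
      unfolding gauss_def by (auto intro!: mult_left_mono)
    then show ?thesis by (simp add: gauss_def ac_simps)
  qed
  have "(\<integral>\<^sup>+ z. window b z * indicator {z. r < norm z} z \<partial>lborel) \<le> (\<integral>\<^sup>+ z. (\<integral>\<^sup>+ s. ennreal ?C * (?w s * ennreal (gauss (2 * s) z) * indicator {0<..} s) \<partial>lborel) \<partial>(lborel :: 'a measure))"
  proof (rule nn_integral_mono)
    fix z :: 'a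
    show "window b z * indicator {z. r < norm z} z \<le> (\<integral>\<^sup>+ s. ennreal ?C * (?w s * ennreal (gauss (2 * s) z) * indicator {0<..} s) \<partial>lborel)"
    proof (cases "r < norm z")
      case True
      have "window b z \<le> (\<integral>\<^sup>+ s. ennreal ?C * (?w s * ennreal (gauss (2 * s) z) * indicator {0<..} s) \<partial>lborel)"
        unfolding window_def mix_def
      proof (rule nn_integral_mono)
        fix s :: real
        show "?w s * ennreal (gauss s z) * indicator {0<..} s \<le> ennreal ?C * (?w s * ennreal (gauss (2 * s) z) * indicator {0<..} s)"
        proof (cases "b / 2 < s \<and> s \<le> b")
          case in_w: True
          then have "ennreal (gauss s z) \<le> ennreal ?C * ennreal (gauss (2 * s) z)"
            using b g[of s z] True by (simp add: ennreal_mult[symmetric] ennreal_leI)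
          then have "\<kappa> s * ennreal (gauss s z) \<le> \<kappa> s * (ennreal ?C * ennreal (gauss (2 * s) z))" by (intro mult_left_mono) auto
          then show ?thesis using in_w b by (simp add: ac_simps)
        qed (auto simp: indicator_def)
      qed
      then show ?thesis using True by simp
    qed simp
  qed
  also have "\<dots> = (\<integral>\<^sup>+ s. (\<integral>\<^sup>+ z. ennreal ?C * (?w s * ennreal (gauss (2 * s) z) * indicator {0<..} s) \<partial>(lborel :: 'a measure)) \<partial>lborel)"
    by (rule lborel_pair.Fubini') measurable
  also have "\<dots> = (\<integral>\<^sup>+ s. ennreal ?C * ?w s \<partial>lborel)"
  proof (rule nn_integral_cong)
    fix s :: real
    have "(\<integral>\<^sup>+ z. ennreal ?C * (?w s * ennreal (gauss (2 * s) z) * indicator {0<..} s) \<partial>(lborel :: 'a measure))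
      = (\<integral>\<^sup>+ z. (ennreal ?C * ?w s * indicator {0<..} s) * ennreal (gauss (2 * s) z) \<partial>(lborel :: 'a measure))"
      by (simp add: ac_simps)
    also have "\<dots> = ennreal ?C * ?w s"
      using b by (subst nn_integral_cmult) (auto simp: gauss_integral indicator_def)
    finally show "(\<integral>\<^sup>+ z. ennreal ?C * (?w s * ennreal (gauss (2 * s) z) * indicator {0<..} s) \<partial>(lborel :: 'a measure)) = ennreal ?C * ?w s" .
  qed
  also have "\<dots> = ennreal ?C * window_mass b" unfolding window_mass_def by (rule nn_integral_cmult) measurable
  finally show ?thesis .
qed

lemma window_conv_ktr:
  assumes b: "0 < b" "b \<le> 1 / 2"
  shows "(\<integral>\<^sup>+ y. window b (x - y) * ktr 1 (y - z) \<partial>lborel) \<le> 2 * window_mass b * ktr 1 (x - z)"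
proof -
  let ?w = "\<lambda>s. \<kappa> s * indicator {b / 2<..b} s"
  let ?k = "\<lambda>s. \<kappa> s * indicator {1<..} s"
  have tc: "time_conv ?w ?k r \<le> 2 * window_mass b * ?k r" for r
  proof -
    have "time_conv ?w ?k r \<le> (\<integral>\<^sup>+ s. (2 * ?k r) * ?w s \<partial>lborel)"
      unfolding time_conv_def
    proof (rule nn_integral_mono)
      fix s :: real
      show "?w s * ?k (r - s) * indicator {0<..<r} s \<le> (2 * ?k r) * ?w s"
      proof (cases "b / 2 < s \<and> s \<le> b \<and> 1 < r - s")
        case True
        have rs: "0 < r - s" "0 < r" "1 < r" using True b by auto
        have "(r - s) powr (\<beta> - 1) \<le> (r / 2) powr (\<beta> - 1)"
          using True b beta_less_1 by (intro powr_mono2') auto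
        also have "\<dots> = 2 powr (1 - \<beta>) * r powr (\<beta> - 1)"
          using rs by (simp add: powr_divide powr_diff)
        also have "\<dots> \<le> 2 powr 1 * r powr (\<beta> - 1)"
          using beta_pos by (intro mult_right_mono powr_mono) auto
        finally have "\<kappa> (r - s) \<le> ennreal (2 * (r powr (\<beta> - 1) / norm_const))"
          unfolding \<kappa>_def using norm_const_pos by (intro ennreal_leI) (simp add: divide_right_mono)
        also have "\<dots> = 2 * \<kappa> r" using norm_const_pos by (subst ennreal_mult) (auto simp: \<kappa>_def)
        finally have "\<kappa> s * \<kappa> (r - s) \<le> \<kappa> s * (2 * \<kappa> r)" by (intro mult_left_mono) auto
        then show ?thesis using True rs b by (simp add: ac_simps indicator_def)
      qed (auto simp: indicator_def)
    qed
    also have "\<dots> = (2 * ?k r) * window_mass b" unfolding window_mass_def by (rule nn_integral_cmult) measurable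
    finally show ?thesis by (simp add: ac_simps)
  qed
  have "(\<integral>\<^sup>+ y. window b (x - y) * ktr 1 (y - z) \<partial>lborel) = mix (time_conv ?w ?k) (x - z)"
    unfolding window_def ktr_def by (rule mix_conv) measurable
  also have "\<dots> \<le> mix (\<lambda>r. 2 * window_mass b * ?k r) (x - z)" by (rule mix_mono) (rule tc)
  also have "\<dots> = 2 * window_mass b * ktr 1 (x - z)"
    unfolding mix_def ktr_def by (subst nn_integral_cmult[symmetric]) (auto simp: ac_simps)
  finally show ?thesis .
qed

lemma ktr_pos: assumes "0 < a" shows "0 < ktr a z"
proof -
  have "ktr a z \<noteq> 0"
    unfolding ktr_def mix_def using assms norm_const_pos
    by (intro nn_integral_nonzero[of _ "{a<..<a + 1}"]) (auto simp: \<kappa>_def gauss_pos ennreal_eq_0_iff not_le)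
  then show ?thesis by (simp add: zero_less_iff_neq_zero)
qed

lemma ktr_lower_bound:
  assumes "compact K" "0 < a"
  shows "\<exists>c>0. \<forall>y\<in>K. ennreal c \<le> ktr a (y - w)"
proof (cases "K = {}")
  case False
  have "continuous_on K (\<lambda>y. ktr a (y - w))"
    by (rule continuous_on_compose2[OF ktr_continuous[OF assms(2)]]) (auto intro!: continuous_intros)
  then obtain y0 where y0: "y0 \<in> K" "\<And>y. y \<in> K \<Longrightarrow> ktr a (y0 - w) \<le> ktr a (y - w)"
    using continuous_attains_inf[OF assms(1) False] by blast
  have "ktr a (y0 - w) < \<infinity>" using ktr_le_0[of a "y0 - w"] ktr_0_finite[OF assms(2)] by (rule le_less_trans)
  then have eq: "ktr a (y0 - w) = ennreal (enn2real (ktr a (y0 - w)))" by simp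
  then have "0 < enn2real (ktr a (y0 - w))" using ktr_pos[OF assms(2), of "y0 - w"] by (metis ennreal_less_zero_iff ennreal_0 ennreal_less_iff order.refl)
  with y0 eq show ?thesis by (intro exI[of _ "enn2real (ktr a (y0 - w))"]) auto
qed (auto intro!: exI[of _ 1])

text \<open>Truncated kernels are limits of potentials, so both measures agree on them, hence on the windows
  `ktr (b/2) - ktr b`; the bound `\<nu>1 u \<le> u x` makes the subtraction legitimate. Normalised windows
  form an approximate identity, dominated by a multiple of `ktr 1`, so the measures agree on
  continuous functions of compact support.\<close>

lemma measure_uniqueness:
  fixes \<nu>1 \<nu>2 :: "'a measure"
  assumes sets1[measurable_cong]: "sets \<nu>1 = sets borel" and sets2[measurable_cong]: "sets \<nu>2 = sets borel"
    and eq: "\<And>u. u \<in> potential_limits \<alpha> \<Longrightarrow> (\<integral>\<^sup>+ y. u y \<partial>\<nu>1) = (\<integral>\<^sup>+ y. u y \<partial>\<nu>2)"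
    and le: "\<And>u. u \<in> potential_limits \<alpha> \<Longrightarrow> (\<integral>\<^sup>+ y. u y \<partial>\<nu>1) \<le> u x"
  shows "\<nu>1 = \<nu>2"
proof -
  have ktr_fin: "(\<integral>\<^sup>+ y. ktr a (y - w) \<partial>\<nu>1) < \<infinity>" if a: "0 < a" for a w
    using le[OF ktr_in_limits[OF a, of w]] ktr_le_0[of a "x - w"] ktr_0_finite[OF a] by (auto intro: le_less_trans)
  have ktr_eq: "(\<integral>\<^sup>+ y. ktr a (y - w) \<partial>\<nu>1) = (\<integral>\<^sup>+ y. ktr a (y - w) \<partial>\<nu>2)" if a: "0 < a" for a w
    by (rule eq[OF ktr_in_limits[OF a]])
  have locfin: "emeasure \<nu> (cball 0 R) < \<infinity>" if \<nu>: "\<nu> = \<nu>1 \<or> \<nu> = \<nu>2" for \<nu> R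
  proof -
    have [measurable_cong]: "sets \<nu> = sets borel" using \<nu> sets1 sets2 by auto
    obtain c where c: "0 < c" "\<And>y. y \<in> cball 0 R \<Longrightarrow> ennreal c \<le> ktr 1 (y - 0)" using ktr_lower_bound[of "cball 0 R" 1 0] by auto
    have "ennreal c * emeasure \<nu> (cball 0 R) = (\<integral>\<^sup>+ y. ennreal c * indicator (cball 0 R) y \<partial>\<nu>)"
      by (rule nn_integral_cmult_indicator[symmetric]) measurable
    also have "\<dots> \<le> (\<integral>\<^sup>+ y. ktr 1 (y - 0) \<partial>\<nu>)"
      using c by (intro nn_integral_mono) (auto split: split_indicator)
    also have "\<dots> < \<infinity>" using \<nu> ktr_fin[of 1 0] ktr_eq[of 1 0] by auto
    finally show ?thesis using c(1) by (auto simp: ennreal_mult_less_top)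
  qed
  have sf: "sigma_finite_measure \<nu>" if \<nu>: "\<nu> = \<nu>1 \<or> \<nu> = \<nu>2" for \<nu>
  proof
    have s: "sets \<nu> = sets borel" using \<nu> sets1 sets2 by auto
    show "\<exists>A. countable A \<and> A \<subseteq> sets \<nu> \<and> \<Union> A = space \<nu> \<and> (\<forall>a\<in>A. emeasure \<nu> a \<noteq> \<infinity>)"
    proof (intro exI[of _ "range (\<lambda>n::nat. cball 0 (real n))"] conjI)
      show "\<Union> (range (\<lambda>n::nat. cball (0::'a) (real n))) = space \<nu>"
        using sets_eq_imp_space_eq[OF s] real_arch_simple by (auto simp: set_eq_iff)
    qed (use locfin[OF \<nu>] in \<open>auto simp: s less_top\<close>)
  qed
  have window_eq: "(\<integral>\<^sup>+ y. window b (y - w) \<partial>\<nu>1) = (\<integral>\<^sup>+ y. window b (y - w) \<partial>\<nu>2)" if b: "0 < b" for b w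
  proof -
    have sp: "(\<integral>\<^sup>+ y. ktr (b / 2) (y - w) \<partial>\<nu>) = (\<integral>\<^sup>+ y. ktr b (y - w) \<partial>\<nu>) + (\<integral>\<^sup>+ y. window b (y - w) \<partial>\<nu>)"
      if [measurable_cong]: "sets \<nu> = sets borel" for \<nu>
      by (subst nn_integral_add[symmetric]) (auto simp: ktr_window[OF b])
    have "(\<integral>\<^sup>+ y. ktr b (y - w) \<partial>\<nu>1) + (\<integral>\<^sup>+ y. window b (y - w) \<partial>\<nu>1) = (\<integral>\<^sup>+ y. ktr b (y - w) \<partial>\<nu>1) + (\<integral>\<^sup>+ y. window b (y - w) \<partial>\<nu>2)"
      using sp[OF sets1] sp[OF sets2] ktr_eq[OF b, of w] ktr_eq[OF half_gt_zero[OF b], of w] by metis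
    then show ?thesis using ktr_fin[OF b, of w] by (auto simp: ennreal_add_left_cancel)
  qed
  have smooth: "(\<integral>\<^sup>+ y. ennreal (f y) \<partial>\<nu>1) = (\<integral>\<^sup>+ y. ennreal (f y) \<partial>\<nu>2)"
    if f: "continuous_on UNIV f" "\<And>y. 0 \<le> f y" "\<And>y. f y \<le> 1" "\<And>y. R < norm y \<Longrightarrow> f y = 0" for f :: "'a \<Rightarrow> real" and R
  proof -
    have [measurable]: "f \<in> borel_measurable borel" using f(1) by (rule borel_measurable_continuous_onI)
    define b where "b n = 1 / (2 * real (Suc n))" for n
    have b: "0 < b n" "b n \<le> 1 / 2" for n by (auto simp: b_def divide_simps)
    have blim: "b \<longlonglongrightarrow> 0"
    proof -
      have "(\<lambda>n. 1 / 2 * (1 / real (Suc n))) \<longlonglongrightarrow> 1 / 2 * 0" by (intro tendsto_mult tendsto_const LIMSEQ_Suc[OF lim_1_over_n])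
      then show ?thesis by (simp add: b_def[abs_def])
    qed
    define c where "c n = enn2real (window_mass (b n))" for n
    have c: "window_mass (b n) = ennreal (c n)" "0 < c n" for n
      using window_mass_pos[OF b(1)[of n]] by (auto simp: c_def enn2real_positive_iff)
    define D where "D n z = ennreal (1 / c n) * window (b n) z" for n z
    have [measurable]: "D n \<in> borel_measurable borel" for n unfolding D_def[abs_def] by measurable
    have D1: "(\<integral>\<^sup>+ w. D n (y - w) \<partial>lborel) = 1" for n y
    proof -
      have "(\<integral>\<^sup>+ w. D n (y - w) \<partial>lborel) = (\<integral>\<^sup>+ w. D n w \<partial>lborel)" by (rule nn_integral_lborel_reflect) measurable
      also have "\<dots> = ennreal (1 / c n) * ennreal (c n)"
        unfolding D_def by (subst nn_integral_cmult) (auto simp: window_integral[OF b(1)] c(1))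
      also have "\<dots> = 1" using c(2)[of n] by (simp add: ennreal_mult[symmetric])
      finally show ?thesis .
    qed
    define X where "X n y = (\<integral>\<^sup>+ w. D n (y - w) * ennreal (f w) \<partial>lborel)" for n y
    have [measurable]: "X n \<in> borel_measurable borel" for n unfolding X_def[abs_def] by measurable
    have tail: "(\<integral>\<^sup>+ w. D n (y - w) * indicator {w. r < norm (y - w)} w \<partial>lborel) \<le> ennreal (2 powr (real DIM('a) / 2) * exp (- r\<^sup>2 / (4 * b n)))" if r: "0 \<le> r" for n y r
    proof -
      have "(\<integral>\<^sup>+ w. D n (y - w) * indicator {w. r < norm (y - w)} w \<partial>lborel) = (\<integral>\<^sup>+ w. (\<lambda>z. D n z * indicator {z. r < norm z} z) (y - w) \<partial>lborel)"
        by (intro nn_integral_cong) (auto split: split_indicator)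
      also have "\<dots> = (\<integral>\<^sup>+ z. D n z * indicator {z. r < norm z} z \<partial>lborel)" by (rule nn_integral_lborel_reflect) measurable
      also have "\<dots> = ennreal (1 / c n) * (\<integral>\<^sup>+ z. window (b n) z * indicator {z. r < norm z} z \<partial>lborel)"
        unfolding D_def by (subst nn_integral_cmult[symmetric]) (auto simp: ac_simps)
      also have "\<dots> \<le> ennreal (1 / c n) * (ennreal (2 powr (real DIM('a) / 2) * exp (- r\<^sup>2 / (4 * b n))) * window_mass (b n))"
        by (intro mult_left_mono window_tail b r) auto
      also have "\<dots> = ennreal (2 powr (real DIM('a) / 2) * exp (- r\<^sup>2 / (4 * b n)))"
        using c(2)[of n] by (simp add: c(1) ennreal_mult[symmetric])
      finally show ?thesis .
    qed
    have Xlim: "(\<lambda>n. X n y) \<longlonglongrightarrow> ennreal (f y)" for y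
    proof -
      have X1: "X n y \<le> 1" for n
      proof -
        have "X n y \<le> (\<integral>\<^sup>+ w. D n (y - w) * 1 \<partial>lborel)" unfolding X_def by (intro nn_integral_mono mult_left_mono) (auto simp: f ennreal_le_1)
        then show ?thesis using D1[of n y] by simp
      qed
      define x where "x n = enn2real (X n y)" for n
      have x: "X n y = ennreal (x n)" "0 \<le> x n" for n
        using le_less_trans[OF X1[of n] ennreal_one_less_top] by (auto simp: x_def)
      have "x \<longlonglongrightarrow> f y"
      proof (rule tendstoI)
        fix e :: real assume e: "0 < e"
        have "isCont f y" using f(1) by (simp add: continuous_on_eq_continuous_at)
        then obtain dl where dl: "0 < dl" "\<And>w. dist w y < dl \<Longrightarrow> dist (f w) (f y) < e / 3"
          unfolding continuous_at_eps_delta using e by (metis divide_pos_pos zero_less_numeral)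
        let ?t = "\<lambda>n. 2 powr (real DIM('a) / 2) * exp (- (dl / 2)\<^sup>2 / (4 * b n))"
        have "?t \<longlonglongrightarrow> 2 powr (real DIM('a) / 2) * 0"
        proof (intro tendsto_mult tendsto_const)
          have "filterlim (\<lambda>n. inverse (b n)) at_top sequentially"
            by (rule filterlim_inverse_at_top[OF blim]) (auto intro!: always_eventually b)
          then have "filterlim (\<lambda>n. (dl / 2)\<^sup>2 / 4 * inverse (b n)) at_top sequentially"
            using dl(1) by (intro filterlim_tendsto_pos_mult_at_top[OF tendsto_const]) auto
          then have "filterlim (\<lambda>n. - ((dl / 2)\<^sup>2 / 4 * inverse (b n))) at_bot sequentially"
            by (simp add: filterlim_uminus_at_bot)
          then have "(\<lambda>n. exp (- ((dl / 2)\<^sup>2 / 4 * inverse (b n)))) \<longlonglongrightarrow> 0" by (rule filterlim_compose[OF exp_at_bot])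
          moreover have "- c / (4 * u) = - (c / 4 * inverse u)" for c u :: real by (cases "u = 0") (simp_all add: field_simps)
          ultimately show "(\<lambda>n. exp (- (dl / 2)\<^sup>2 / (4 * b n))) \<longlonglongrightarrow> 0" by (simp only:)
        qed
        then have tl: "?t \<longlonglongrightarrow> 0" by simp
        have e3: "0 < e / 3" using e by simp
        from order_tendstoD(2)[OF tl e3] show "\<forall>\<^sub>F n in sequentially. dist (x n) (f y) < e"
        proof eventually_elim
          fix n assume t: "?t n < e / 3"
          let ?i = "indicator {w. dl / 2 < norm (y - w)} :: 'a \<Rightarrow> ennreal"
          have tl: "(\<integral>\<^sup>+ w. D n (y - w) * ?i w \<partial>lborel) \<le> ennreal (e / 3)"
            using tail[of "dl / 2" n y] dl(1) t by (intro order.trans[OF tail] ennreal_leI) auto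
          have near: "f w \<le> f y + e / 3 \<and> f y \<le> f w + e / 3" if "\<not> dl / 2 < norm (y - w)" for w
          proof -
            have "dist w y < dl" using that dl(1) by (simp add: dist_norm norm_minus_commute)
            from dl(2)[OF this] show ?thesis unfolding dist_real_def by linarith
          qed
          have up: "ennreal (f w) \<le> ennreal (f y + e / 3) + ?i w" for w
          proof (cases "dl / 2 < norm (y - w)")
            case True
            have "ennreal (f w) \<le> 1" by (simp add: ennreal_le_1 f)
            then show ?thesis using True by (simp add: add_increasing)
          next
            case False
            then have "ennreal (f w) \<le> ennreal (f y + e / 3)" using near[of w] by (intro ennreal_leI) simp
            then show ?thesis using False by simp
          qed
          have lo: "ennreal (f y) \<le> ennreal (f w) + (ennreal (e / 3) + ?i w)" for w
          proof (cases "dl / 2 < norm (y - w)")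
            case True
            have "ennreal (f y) \<le> 1" by (simp add: ennreal_le_1 f)
            then show ?thesis using True by (simp add: add_increasing)
          next
            case False
            then show ?thesis using near[of w] f(2) e by (simp add: ennreal_leI flip: ennreal_plus)
          qed
          have "X n y \<le> (\<integral>\<^sup>+ w. D n (y - w) * (ennreal (f y + e / 3) + ?i w) \<partial>lborel)"
            unfolding X_def by (intro nn_integral_mono mult_left_mono up) auto
          also have "\<dots> = ennreal (f y + e / 3) + (\<integral>\<^sup>+ w. D n (y - w) * ?i w \<partial>lborel)"
            by (simp add: distrib_left nn_integral_add nn_integral_multc D1)
          also have "\<dots> \<le> ennreal (f y + e / 3) + ennreal (e / 3)" by (intro add_left_mono tl)
          also have "\<dots> = ennreal (f y + e / 3 + e / 3)" using f(2)[of y] e by (simp flip: ennreal_plus)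
          finally have "X n y \<le> ennreal (f y + e / 3 + e / 3)" .
          then have u: "x n \<le> f y + e / 3 + e / 3"
            unfolding x(1) using f(2)[of y] e by (subst (asm) ennreal_le_iff) auto
          have "ennreal (f y) = (\<integral>\<^sup>+ w. D n (y - w) * ennreal (f y) \<partial>lborel)" by (simp add: nn_integral_multc D1)
          also have "\<dots> \<le> (\<integral>\<^sup>+ w. D n (y - w) * (ennreal (f w) + (ennreal (e / 3) + ?i w)) \<partial>lborel)"
            by (intro nn_integral_mono mult_left_mono lo) auto
          also have "\<dots> = X n y + (ennreal (e / 3) + (\<integral>\<^sup>+ w. D n (y - w) * ?i w \<partial>lborel))"
            by (simp add: distrib_left nn_integral_add nn_integral_multc D1 X_def)
          also have "\<dots> \<le> X n y + (ennreal (e / 3) + ennreal (e / 3))" by (intro add_left_mono tl)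
          also have "\<dots> = ennreal (x n + (e / 3 + e / 3))"
            unfolding x(1)[of n] using x(2)[of n] e by (simp flip: ennreal_plus)
          finally have "ennreal (f y) \<le> ennreal (x n + (e / 3 + e / 3))" .
          then have l: "f y \<le> x n + (e / 3 + e / 3)" using x(2)[of n] e by (subst (asm) ennreal_le_iff) auto
          show "dist (x n) (f y) < e" using u l e by (simp add: dist_real_def abs_less_iff)
        qed
      qed
      then show ?thesis unfolding x(1) by (rule tendsto_ennrealI)
    qed
    obtain cc where cc: "0 < cc" "\<And>y. y \<in> cball 0 R \<Longrightarrow> ennreal cc \<le> ktr 1 (y - 0)" using ktr_lower_bound[of "cball 0 R" 1 0] by auto
    have fdom: "ennreal (f y) \<le> ennreal (1 / cc) * ktr 1 (y - 0)" for y
    proof (cases "R < norm y")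
      case False
      then have "ennreal (1 / cc) * ennreal cc \<le> ennreal (1 / cc) * ktr 1 (y - 0)" by (intro mult_left_mono cc(2)) auto
      moreover have "ennreal (f y) \<le> ennreal (1 / cc) * ennreal cc" using cc(1) f(3)[of y] by (simp add: ennreal_mult[symmetric] ennreal_le_1)
      ultimately show ?thesis by (rule order.trans[rotated])
    qed (simp add: f(4))
    have Xdom: "X n y \<le> ennreal (1 / cc) * (2 * ktr 1 (y - 0))" for n y
    proof -
      have "X n y \<le> (\<integral>\<^sup>+ w. ennreal (1 / c n) * ennreal (1 / cc) * (window (b n) (y - w) * ktr 1 (w - 0)) \<partial>lborel)"
        unfolding X_def D_def
      proof (rule nn_integral_mono)
        fix w
        have "ennreal (1 / c n) * window (b n) (y - w) * ennreal (f w) \<le> ennreal (1 / c n) * window (b n) (y - w) * (ennreal (1 / cc) * ktr 1 (w - 0))"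
          by (intro mult_left_mono fdom) auto
        then show "ennreal (1 / c n) * window (b n) (y - w) * ennreal (f w) \<le> ennreal (1 / c n) * ennreal (1 / cc) * (window (b n) (y - w) * ktr 1 (w - 0))"
          by (simp add: ac_simps)
      qed
      also have "\<dots> = ennreal (1 / c n) * ennreal (1 / cc) * (\<integral>\<^sup>+ w. window (b n) (y - w) * ktr 1 (w - 0) \<partial>lborel)"
        by (rule nn_integral_cmult) measurable
      also have "\<dots> \<le> ennreal (1 / c n) * ennreal (1 / cc) * (2 * window_mass (b n) * ktr 1 (y - 0))"
        by (intro mult_left_mono window_conv_ktr b) auto
      also have "\<dots> = (ennreal (1 / c n) * ennreal (c n)) * (ennreal (1 / cc) * (2 * ktr 1 (y - 0)))"
        unfolding c(1) by (simp only: ac_simps)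
      also have "ennreal (1 / c n) * ennreal (c n) = 1" using c(2)[of n] by (simp add: ennreal_mult[symmetric])
      finally show ?thesis by simp
    qed
    have lim: "(\<lambda>n. \<integral>\<^sup>+ y. X n y \<partial>\<nu>) \<longlonglongrightarrow> (\<integral>\<^sup>+ y. ennreal (f y) \<partial>\<nu>)" if \<nu>: "\<nu> = \<nu>1 \<or> \<nu> = \<nu>2" for \<nu>
    proof (rule nn_integral_dominated_convergence[where w="\<lambda>y. ennreal (1 / cc) * (2 * ktr 1 (y - 0))"])
      have [measurable_cong]: "sets \<nu> = sets borel" using \<nu> sets1 sets2 by auto
      show "X n \<in> borel_measurable \<nu>" "(\<lambda>y. ennreal (f y)) \<in> borel_measurable \<nu>" "(\<lambda>y. ennreal (1 / cc) * (2 * ktr 1 (y - 0))) \<in> borel_measurable \<nu>" for n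
        by measurable
      have "(\<integral>\<^sup>+ y. ennreal (1 / cc) * (2 * ktr 1 (y - 0)) \<partial>\<nu>) = ennreal (1 / cc) * (2 * (\<integral>\<^sup>+ y. ktr 1 (y - 0) \<partial>\<nu>))"
        by (subst nn_integral_cmult, measurable, subst nn_integral_cmult) auto
      also have "(\<integral>\<^sup>+ y. ktr 1 (y - 0) \<partial>\<nu>) < \<infinity>" using \<nu> ktr_fin[of 1 0] ktr_eq[of 1 0] by auto
      then have "ennreal (1 / cc) * (2 * (\<integral>\<^sup>+ y. ktr 1 (y - 0) \<partial>\<nu>)) < \<infinity>" by (simp add: ennreal_mult_less_top)
      finally show "(\<integral>\<^sup>+ y. ennreal (1 / cc) * (2 * ktr 1 (y - 0)) \<partial>\<nu>) < \<infinity>" .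
    qed (use Xdom Xlim in auto)
    have "(\<integral>\<^sup>+ y. X n y \<partial>\<nu>1) = (\<integral>\<^sup>+ y. X n y \<partial>\<nu>2)" for n
    proof -
      have fub: "(\<integral>\<^sup>+ y. X n y \<partial>\<nu>) = (\<integral>\<^sup>+ w. ennreal (1 / c n) * (\<integral>\<^sup>+ y. window (b n) (y - w) \<partial>\<nu>) * ennreal (f w) \<partial>lborel)"
        if \<nu>: "\<nu> = \<nu>1 \<or> \<nu> = \<nu>2" for \<nu>
      proof -
        have [measurable_cong]: "sets \<nu> = sets borel" using \<nu> sets1 sets2 by auto
        interpret sigma_finite_measure \<nu> using \<nu> by (rule sf)
        interpret pair_sigma_finite \<nu> lborel by unfold_locales
        have "(\<integral>\<^sup>+ y. X n y \<partial>\<nu>) = (\<integral>\<^sup>+ w. (\<integral>\<^sup>+ y. D n (y - w) * ennreal (f w) \<partial>\<nu>) \<partial>lborel)"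
          unfolding X_def by (rule Fubini'[symmetric]) measurable
        also have "\<dots> = (\<integral>\<^sup>+ w. ennreal (1 / c n) * (\<integral>\<^sup>+ y. window (b n) (y - w) \<partial>\<nu>) * ennreal (f w) \<partial>lborel)"
          unfolding D_def by (intro nn_integral_cong) (simp add: nn_integral_multc nn_integral_cmult)
        finally show ?thesis .
      qed
      show ?thesis by (simp add: fub window_eq[OF b(1)])
    qed
    then show ?thesis using lim[of \<nu>1] lim[of \<nu>2] LIMSEQ_unique by auto
  qed
  have open_eq: "emeasure \<nu>1 G = emeasure \<nu>2 G" if G: "open G" for G
  proof (cases "G = {}")
    case G_ne: False
    define f where "f n y = min 1 (real n * (if G = UNIV then 1 else infdist y (- G))) * cutoff (real n) y" for n y
    have f0: "0 \<le> f n y" "f n y \<le> 1" for n y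
      using cutoff_range[of "real n" y] by (auto simp: f_def infdist_nonneg intro!: mult_le_one)
    have fc: "continuous_on UNIV (f n)" for n
      unfolding f_def by (cases "G = UNIV") (auto intro!: continuous_intros cutoff_continuous)
    have [measurable]: "f n \<in> borel_measurable borel" for n using fc by (rule borel_measurable_continuous_onI)
    have fz: "f n y = 0" if "real n + 1 < norm y" for n y using that by (auto simp: f_def cutoff_def)
    have inc: "incseq (\<lambda>n y. ennreal (f n y))"
    proof (rule incseq_SucI, rule le_funI, rule ennreal_leI)
      fix n y
      show "f n y \<le> f (Suc n) y"
        unfolding f_def
      proof (rule mult_mono)
        show "min 1 (real n * (if G = UNIV then 1 else infdist y (- G))) \<le> min 1 (real (Suc n) * (if G = UNIV then 1 else infdist y (- G)))"
          by (intro min.mono mult_right_mono) (auto simp: infdist_nonneg)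
        show "cutoff (real n) y \<le> cutoff (real (Suc n)) y" by (auto simp: cutoff_def)
      qed (auto simp: infdist_nonneg cutoff_range)
    qed
    have sup: "(SUP n. ennreal (f n y)) = indicator G y" for y
    proof (cases "y \<in> G")
      case True
      define g where "g = (if G = UNIV then 1 else infdist y (- G))"
      have "0 < g"
        using True G infdist_pos_not_in_closed[of "- G" y] by (auto simp: g_def)
      obtain n1 where n1: "norm y \<le> real n1" using real_arch_simple by blast
      obtain n2 where n2: "1 / g \<le> real n2" using real_arch_simple by blast
      let ?n = "max n1 n2"
      have "1 \<le> real ?n * g" using n2 \<open>0 < g\<close> by (auto simp: divide_le_eq intro: order.trans mult_right_mono)
      then have "f ?n y = 1" using n1 by (simp add: f_def cutoff_one flip: g_def)
      then have "1 \<le> (SUP n. ennreal (f n y))" by (intro SUP_upper2[of ?n]) auto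
      moreover have "(SUP n. ennreal (f n y)) \<le> 1" by (intro SUP_least) (simp add: f0 ennreal_le_1)
      ultimately have "(SUP n. ennreal (f n y)) = 1" by (intro antisym)
      then show ?thesis using True by simp
    next
      case False
      then have "f n y = 0" for n by (auto simp: f_def)
      then show ?thesis using False by simp
    qed
    have em: "emeasure \<nu> G = (SUP n. \<integral>\<^sup>+ y. ennreal (f n y) \<partial>\<nu>)" if [measurable_cong]: "sets \<nu> = sets borel" for \<nu>
    proof -
      have "emeasure \<nu> G = (\<integral>\<^sup>+ y. (SUP n. ennreal (f n y)) \<partial>\<nu>)" using G by (simp add: sup)
      also have "\<dots> = (SUP n. \<integral>\<^sup>+ y. ennreal (f n y) \<partial>\<nu>)" by (rule nn_integral_monotone_convergence_SUP[OF inc]) measurable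
      finally show ?thesis .
    qed
    show ?thesis
      unfolding em[OF sets1] em[OF sets2] using smooth[OF fc f0 fz] by simp
  qed simp
  show ?thesis
  proof (rule measure_eqI_generator_eq[where E="{G. open G}" and \<Omega>=UNIV and A="\<lambda>n::nat. ball 0 (real n)"])
    show "Int_stable {G::'a set. open G}" by (auto simp: Int_stable_def)
    show "sets \<nu>1 = sigma_sets UNIV {G. open G}" "sets \<nu>2 = sigma_sets UNIV {G. open G}"
      using sets1 sets2 by (simp_all add: borel_def)
    show "(\<Union>n::nat. ball (0::'a) (real n)) = UNIV"
      using reals_Archimedean2 by (auto simp: set_eq_iff)
    show "emeasure \<nu>1 (ball 0 (real n)) \<noteq> \<infinity>" for n
    proof -
      have "emeasure \<nu>1 (ball 0 (real n)) \<le> emeasure \<nu>1 (cball 0 (real n))"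
        using sets1 by (intro emeasure_mono) auto
      then show ?thesis using locfin[of \<nu>1 "real n"] by auto
    qed
  qed (use open_eq in auto)
qed


section \<open>Sweeping on increasing unions\<close>

lemma return_carried: "return borel (x::'a) \<in> carried {x}"
  by (auto simp: carried_def intro!: prob_space.finite_measure prob_space_return)

lemma potential_return: "pot (return borel x) y = kern y x"
  unfolding riesz_potential_def by (subst nn_integral_return) auto

lemma kernel_supermedian: "supermedian (kern (x::'a))"
proof -
  have "kern x = pot (return borel x)" by (auto simp: potential_return riesz_kernel_commute)
  then show ?thesis using carriedD[OF return_carried[of x]] by (simp add: supermedian_potential)
qed

lemma mutual_potential:
  assumes "\<nu> \<in> carried K" "\<sigma> \<in> carried L"
  shows "(\<integral>\<^sup>+ y. pot \<nu> y \<partial>\<sigma>) = (\<integral>\<^sup>+ y. pot \<sigma> y \<partial>\<nu>)"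
  using mutual_energy_commute[OF assms] by (simp add: mutual_energy_def)

lemma ktr_potential_finite:
  assumes "\<mu> \<in> carried K" "0 < a" shows "ktr_potential a \<mu> x < \<infinity>"
proof -
  interpret finite_measure \<mu> using assms(1) by (rule carriedD)
  have "ktr_potential a \<mu> x \<le> (\<integral>\<^sup>+ z. ktr a 0 \<partial>\<mu>)" unfolding ktr_potential_def by (intro nn_integral_mono ktr_le_0)
  also have "\<dots> < \<infinity>" using ktr_0_finite[OF assms(2)] by (simp add: emeasure_eq_measure ennreal_mult_less_top)
  finally show ?thesis .
qed

lemma ktr_potential_continuous:
  assumes mu: "\<mu> \<in> carried K" and a: "0 < a" shows "continuous_on UNIV (ktr_potential a \<mu>)"
proof (rule continuous_on_sequentiallyI)
  fix X and x :: 'a assume X: "X \<longlonglongrightarrow> x"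
  interpret finite_measure \<mu> using mu by (rule carriedD)
  have [measurable_cong]: "sets \<mu> = sets borel" using mu by (rule carriedD)
  show "(\<lambda>n. ktr_potential a \<mu> (X n)) \<longlonglongrightarrow> ktr_potential a \<mu> x"
    unfolding ktr_potential_def
  proof (rule nn_integral_dominated_convergence[where w="\<lambda>_. ktr a 0"])
    show "(\<integral>\<^sup>+ z. ktr a 0 \<partial>\<mu>) < \<infinity>"
      using ktr_0_finite[OF a] by (simp add: emeasure_eq_measure ennreal_mult_less_top)
    show "AE z in \<mu>. (\<lambda>n. ktr a (X n - z)) \<longlonglongrightarrow> ktr a (x - z)"
    proof (rule AE_I2)
      fix z
      have "(\<lambda>n. X n - z) \<longlonglongrightarrow> x - z" by (intro tendsto_intros X)
      then show "(\<lambda>n. ktr a (X n - z)) \<longlonglongrightarrow> ktr a (x - z)"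
        using ktr_continuous[OF a] by (auto intro: continuous_on_tendsto_compose)
    qed
  qed (auto simp: ktr_le_0)
qed

definition ktr_real :: "real \<Rightarrow> 'a measure \<Rightarrow> 'a \<Rightarrow> real" where
  "ktr_real a \<mu> x = enn2real (ktr_potential a \<mu> x)"

lemma ktr_real_eq: "\<mu> \<in> carried K \<Longrightarrow> 0 < a \<Longrightarrow> ktr_potential a \<mu> x = ennreal (ktr_real a \<mu> x)"
  using ktr_potential_finite[of \<mu> K a x] by (simp add: ktr_real_def)

lemma ktr_real_continuous:
  assumes mu: "\<mu> \<in> carried K" and a: "0 < a" shows "continuous_on UNIV (ktr_real a \<mu>)"
proof (rule continuous_on_sequentiallyI)
  fix X and x :: 'a assume X: "X \<longlonglongrightarrow> x"
  then have "(\<lambda>n. ktr_potential a \<mu> (X n)) \<longlonglongrightarrow> ktr_potential a \<mu> x"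
    using ktr_potential_continuous[OF mu a] by (auto intro: continuous_on_tendsto_compose)
  then show "(\<lambda>n. ktr_real a \<mu> (X n)) \<longlonglongrightarrow> ktr_real a \<mu> x"
    unfolding ktr_real_def using ktr_potential_finite[OF mu a, of x] by (intro tendsto_enn2real) auto
qed

lemma ktr_potential_le: "ktr_potential a \<mu> x \<le> pot \<mu> (x::'a)"
  unfolding ktr_potential_def riesz_potential_def by (intro nn_integral_mono ktr_le_kernel)

lemma ktr_real_vanishes:
  assumes mu: "\<mu> \<in> carried K" "compact K" and a: "0 < a" shows "(ktr_real a \<mu> \<longlongrightarrow> 0) at_infinity"
proof (rule tendstoI)
  fix e :: real assume e: "0 < e"
  obtain R where R: "\<And>x. R < norm x \<Longrightarrow> pot \<mu> x < ennreal e"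
    using potential_vanishes[OF carriedD(1,2,3)[OF mu(1)] mu(2) e] by blast
  have "dist (ktr_real a \<mu> x) 0 < e" if "R + 1 \<le> norm x" for x
  proof -
    have "ennreal (ktr_real a \<mu> x) < ennreal e"
      using R[of x] that ktr_potential_le[of a \<mu> x] unfolding ktr_real_eq[OF mu(1) a, symmetric] by (auto intro: le_less_trans)
    moreover have "0 \<le> ktr_real a \<mu> x" by (simp add: ktr_real_def)
    ultimately show ?thesis by (simp add: ennreal_less_iff)
  qed
  then show "\<forall>\<^sub>F x in at_infinity. dist (ktr_real a \<mu> x) 0 < e"
    unfolding eventually_at_infinity by blast
qed

lemma ktr_potential_SUP:
  assumes [measurable_cong]: "sets \<mu> = sets (borel :: 'a measure)"
  shows "(SUP n. ktr_potential (1 / real (Suc n)) \<mu> x) = pot \<mu> x"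
proof -
  have "(SUP n. ktr_potential (1 / real (Suc n)) \<mu> x) = (\<integral>\<^sup>+ z. (SUP n. ktr (1 / real (Suc n)) (x - z)) \<partial>\<mu>)"
    unfolding ktr_potential_def
    by (intro nn_integral_monotone_convergence_SUP[symmetric])
       (auto simp: incseq_def le_fun_def intro!: ktr_antimono divide_left_mono)
  then show ?thesis by (simp only: ktr_SUP riesz_potential_def)
qed

text \<open>Domination between potentials passes to the truncated potentials, because these are the averages
  by `sweep a`.\<close>

lemma ktr_potential_mono:
  assumes mu: "sets \<mu> = sets (borel :: 'a measure)" "finite_measure \<mu>" "sets \<nu> = sets (borel :: 'a measure)" "finite_measure \<nu>"
    and le: "\<And>y. pot \<mu> y \<le> pot \<nu> y" and ab: "0 < b" "b \<le> a"
  shows "ktr_potential a \<mu> x \<le> ktr_potential b \<nu> x"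
proof -
  have a: "0 < a" using ab by simp
  have "ktr_potential a \<mu> x \<le> ktr_potential a \<nu> x"
    using sweep_potential[OF mu(1,2) a, of x] sweep_potential[OF mu(3,4) a, of x]
    unfolding ktr_potential_def by (metis (no_types, lifting) le mult_left_mono nn_integral_mono zero_le)
  also have "\<dots> \<le> ktr_potential b \<nu> x"
    unfolding ktr_potential_def by (intro nn_integral_mono ktr_antimono ab)
  finally show ?thesis .
qed

lemma potential_domination:
  assumes K: "compact K" "\<nu> \<in> carried K" and V: "continuous_on UNIV V" "\<And>y. 0 \<le> V y" "\<And>y. pot \<nu> y = ennreal (V y)"
    and u: "supermedian u" "lsc u" and le: "\<And>y. y \<in> K \<Longrightarrow> pot \<nu> y \<le> u y"
  shows "pot \<nu> x \<le> u x"
  using domination_principle[OF carriedD(1,2)[OF K(2)] K(1) carriedD(3)[OF K(2)] V u, of 0 x] le V(3) by simp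

lemma reduced_le: "v \<in> potential_limits \<alpha> \<Longrightarrow> (\<And>y. y \<in> A \<Longrightarrow> u y \<le> v y) \<Longrightarrow> reduced \<alpha> u A x \<le> v (x::'a)"
  unfolding reduced_def by (rule INF_lower) auto

lemma reduced_ge: "(\<And>v. v \<in> potential_limits \<alpha> \<Longrightarrow> (\<And>y. y \<in> A \<Longrightarrow> u y \<le> v y) \<Longrightarrow> c \<le> v (x::'a)) \<Longrightarrow> c \<le> reduced \<alpha> u A x"
  unfolding reduced_def by (rule INF_greatest) auto

lemma swept_measure_eqI:
  assumes sets: "sets \<nu> = sets (borel :: 'a measure)"
    and eq: "\<And>u. u \<in> potential_limits \<alpha> \<Longrightarrow> (\<integral>\<^sup>+ y. u y \<partial>\<nu>) = reduced \<alpha> u A x"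
  shows "swept_measure \<alpha> x A = \<nu>"
  unfolding swept_measure_def
proof (rule the_equality)
  show "sets \<nu> = sets borel \<and> (\<forall>u\<in>potential_limits \<alpha>. (\<integral>\<^sup>+ y. u y \<partial>\<nu>) = reduced \<alpha> u A x)"
    using assms by simp
  fix \<nu>' :: "'a measure"
  assume *: "sets \<nu>' = sets borel \<and> (\<forall>u\<in>potential_limits \<alpha>. (\<integral>\<^sup>+ y. u y \<partial>\<nu>') = reduced \<alpha> u A x)"
  show "\<nu>' = \<nu>"
  proof (rule measure_uniqueness)
    show "(\<integral>\<^sup>+ y. u y \<partial>\<nu>') \<le> u x" if "u \<in> potential_limits \<alpha>" for u
      using * that by (auto intro!: reduced_le)
  qed (use * sets eq in auto)
qed

lemma vague_limit_ktr:
  fixes \<mu> :: "'a measure"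
  assumes nu: "\<And>n. sets (\<nu> n) = sets borel" "\<And>n. finite_measure (\<nu> n)" and mu: "sets \<mu> = sets borel" "finite_measure \<mu>"
    and conv: "\<forall>f :: 'a \<Rightarrow> real. continuous_on UNIV f \<longrightarrow> (f \<longlongrightarrow> 0) at_infinity \<longrightarrow> (\<lambda>n. \<integral>x. f x \<partial>\<nu> n) \<longlonglongrightarrow> (\<integral>x. f x \<partial>\<mu>)"
    and a: "0 < a" and t: "\<tau> \<in> carried K" "compact K"
  shows "(\<lambda>n. \<integral>\<^sup>+ y. ktr_potential a \<tau> y \<partial>\<nu> n) \<longlonglongrightarrow> (\<integral>\<^sup>+ y. ktr_potential a \<tau> y \<partial>\<mu>)"
proof -
  have c: "continuous_on UNIV (ktr_real a \<tau>)" by (rule ktr_real_continuous[OF t(1) a])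
  have [measurable]: "ktr_real a \<tau> \<in> borel_measurable borel" using c by (rule borel_measurable_continuous_onI)
  interpret t: finite_measure \<tau> using t(1) by (rule carriedD)
  have bd: "\<bar>ktr_real a \<tau> y\<bar> \<le> enn2real (ktr a 0 * emeasure \<tau> UNIV)" for y
  proof -
    have "ktr_potential a \<tau> y \<le> (\<integral>\<^sup>+ z. ktr a 0 \<partial>\<tau>)" unfolding ktr_potential_def by (intro nn_integral_mono ktr_le_0)
    also have "\<dots> = ktr a 0 * emeasure \<tau> UNIV" by (simp add: carriedD[OF t(1)])
    finally show ?thesis
      unfolding ktr_real_def using ktr_0_finite[OF a] by (simp add: enn2real_mono ennreal_mult_less_top t.emeasure_eq_measure)
  qed
  have eq: "(\<integral>\<^sup>+ y. ktr_potential a \<tau> y \<partial>M) = ennreal (\<integral>y. ktr_real a \<tau> y \<partial>M)" if "finite_measure M" "sets M = sets borel" for M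
    unfolding ktr_real_eq[OF t(1) a]
  proof (rule nn_integral_eq_integral)
    show "integrable M (ktr_real a \<tau>)" by (rule finite_measure_integrable_bounded[OF that _ bd]) measurable
    show "AE y in M. 0 \<le> ktr_real a \<tau> y" by (simp add: ktr_real_def)
  qed
  show ?thesis
    unfolding eq[OF mu(2,1)] eq[OF nu(2,1)]
    by (intro tendsto_ennrealI conv[rule_format] c ktr_real_vanishes[OF t a])
qed

text \<open>Potentials are lower semicontinuous under vague limits: this holds for the continuous truncated
  kernels, and the full kernel is their supremum.\<close>

lemma vague_limit_potential:
  fixes \<mu> :: "'a measure"
  assumes nu: "\<And>n. sets (\<nu> n) = sets borel" "\<And>n. finite_measure (\<nu> n)" and mu: "sets \<mu> = sets borel" "finite_measure \<mu>"
    and conv: "\<forall>f :: 'a \<Rightarrow> real. continuous_on UNIV f \<longrightarrow> (f \<longlongrightarrow> 0) at_infinity \<longrightarrow> (\<lambda>n. \<integral>x. f x \<partial>\<nu> n) \<longlonglongrightarrow> (\<integral>x. f x \<partial>\<mu>)"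
    and bound: "\<And>n. pot (\<nu> n) y \<le> c"
  shows "pot \<mu> y \<le> c"
proof -
  have kr: "ktr_potential a (return borel y) z = ktr a (y - z)" for a z
    unfolding ktr_potential_def by (subst nn_integral_return) (auto simp: ktr_commute)
  have "ktr_potential (1 / real (Suc n)) \<mu> y \<le> c" for n
  proof (rule LIMSEQ_le_const2)
    have "0 < 1 / real (Suc n)" by simp
    from vague_limit_ktr[OF nu mu conv this return_carried[of y] compact_sing]
    show "(\<lambda>m. \<integral>\<^sup>+ z. ktr (1 / real (Suc n)) (y - z) \<partial>\<nu> m) \<longlonglongrightarrow> ktr_potential (1 / real (Suc n)) \<mu> y"
      by (simp only: kr ktr_potential_def[of _ \<mu>])
    have "(\<integral>\<^sup>+ z. ktr (1 / real (Suc n)) (y - z) \<partial>\<nu> m) \<le> c" for m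
    proof -
      have "(\<integral>\<^sup>+ z. ktr (1 / real (Suc n)) (y - z) \<partial>\<nu> m) \<le> pot (\<nu> m) y"
        unfolding riesz_potential_def by (intro nn_integral_mono ktr_le_kernel)
      then show ?thesis using bound by (rule order.trans)
    qed
    then show "\<exists>N. \<forall>m\<ge>N. (\<integral>\<^sup>+ z. ktr (1 / real (Suc n)) (y - z) \<partial>\<nu> m) \<le> c" by blast
  qed
  then show ?thesis unfolding ktr_potential_SUP[OF mu(1), symmetric] by (rule SUP_least)
qed

text \<open>Let `w` be the increasing limit of the equilibrium potentials of the sets `A n`; the hypothesis
  `low` and domination give `w \<ge> \<delta>` everywhere. The constant `\<delta>` then improves itself: `(1 - \<delta>)
  pot (\<sigma> n) + \<delta> \<le> w` on `A n`, and by the domination principle with added constant everywhere, so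
  `(1 - \<delta>) w + \<delta> \<le> w` and `w = 1`. It remains to exhibit the swept measure. For `x` in the union
  it is the point mass. Otherwise the balayage `\<nu> n` of the kernel at `x` on `A n` has a vague
  limit `\<mu>`, which satisfies the defining identity for each `u`: one inequality comes from `pot \<mu>
  \<le> kern x`, the other from sweeping truncations of `u` on the sets `A n`, which yields an
  admissible competitor.\<close>

theorem swept_mass_one:
  fixes A :: "nat \<Rightarrow> 'a set"
  assumes A: "\<And>n. compact (A n)" "\<And>n. fat (A n)" "incseq A" "closed (\<Union>n. A n)"
    and d: "0 < d"
    and low: "\<And>x. \<exists>n. \<exists>\<tau>\<in>carried (A n). \<exists>V. continuous_on UNIV V \<and> (\<forall>y. 0 \<le> V y \<and> V y \<le> 1 \<and> pot \<tau> y = ennreal (V y)) \<and> d \<le> V x"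
  shows "emeasure (swept_measure \<alpha> x (\<Union>n. A n)) UNIV = 1"
proof -
  let ?A = "\<Union>n. A n"
  have clA: "closed (A n)" for n using A(1) by (rule compact_imp_closed)
  have A_mono: "m \<le> n \<Longrightarrow> A m \<subseteq> A n" for m n using A(3) by (rule incseqD)
  have one: "supermedian (\<lambda>_. 1)" "lsc (\<lambda>_::'a. 1)" by (auto intro: supermedian_const lsc_continuous)
  have "\<exists>\<sigma>\<in>carried (A n). (\<forall>y\<in>A n. pot \<sigma> y = 1) \<and> (\<forall>y. pot \<sigma> y \<le> 1) \<and>
     (\<exists>V. continuous_on UNIV V \<and> (\<forall>y. 0 \<le> V y \<and> pot \<sigma> y = ennreal (V y)))" for n
    using balayage_exists[OF A(1,2) one, of "\<lambda>_. 1" n] by simp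
  then obtain \<sigma> V where sig: "\<And>n. \<sigma> n \<in> carried (A n)" "\<And>n y. y \<in> A n \<Longrightarrow> pot (\<sigma> n) y = 1"
    "\<And>n y. pot (\<sigma> n) y \<le> 1"
    and V: "\<And>n. continuous_on UNIV (V n)" "\<And>n y. 0 \<le> V n y" "\<And>n y. pot (\<sigma> n) y = ennreal (V n y)"
    by metis
  have sig_sm: "supermedian (pot (\<sigma> n))" "lsc (pot (\<sigma> n))" for n
    using carriedD[OF sig(1)[of n]] by (auto intro: supermedian_potential riesz_potential_lsc)
  have sig_inc: "incseq (\<lambda>n. pot (\<sigma> n))"
  proof (rule incseq_SucI, rule le_funI)
    fix n y
    show "pot (\<sigma> n) y \<le> pot (\<sigma> (Suc n)) y"
    proof (rule potential_domination[OF A(1) sig(1) V sig_sm])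
      fix z assume "z \<in> A n"
      then have "z \<in> A (Suc n)" using A_mono[of n "Suc n"] by auto
      then show "pot (\<sigma> n) z \<le> pot (\<sigma> (Suc n)) z" using sig(2,3) by simp
    qed
  qed
  define w where "w y = (SUP n. pot (\<sigma> n) y)" for y
  have w_PL: "w \<in> potential_limits \<alpha>"
    unfolding w_def[abs_def] by (rule potential_limitsI[OF carried_compactly_supported[OF A(1) sig(1)] sig_inc])
  have w_sm: "supermedian w" "lsc w" using w_PL by (auto intro: potential_limits_supermedian potential_limits_lsc)
  have w1: "w y \<le> 1" for y unfolding w_def by (intro SUP_least sig(3))
  have wA: "w y = 1" if "y \<in> A n" for y n
    using w1[of y] sig(2)[OF that] unfolding w_def by (metis SUP_upper UNIV_I antisym)
  \<comment> \<open>The constant must be below 1 for the improvement step.\<close>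
  define dl where "dl = min d (1 / 2)"
  have dl: "0 < dl" "dl < 1" using d by (auto simp: dl_def)
  have w_low: "ennreal dl \<le> w y" for y
  proof -
    obtain n \<tau> V' where t: "\<tau> \<in> carried (A n)" "continuous_on UNIV V'" "\<And>y. 0 \<le> V' y" "\<And>y. V' y \<le> 1"
      "\<And>y. pot \<tau> y = ennreal (V' y)" "d \<le> V' y" using low[of y] by blast
    have "pot \<tau> y \<le> pot (\<sigma> n) y"
    proof (rule potential_domination[OF A(1) t(1,2,3,5) sig_sm])
      fix z assume "z \<in> A n"
      then show "pot \<tau> z \<le> pot (\<sigma> n) z" using sig(2) t(4,5) by (simp add: ennreal_le_1)
    qed
    also have "\<dots> \<le> w y" unfolding w_def by (rule SUP_upper) simp
    finally have "ennreal (V' y) \<le> w y" using t(5) by simp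
    moreover have "ennreal dl \<le> ennreal (V' y)" using t(6) by (intro ennreal_leI) (simp add: dl_def)
    ultimately show ?thesis by (rule order.trans[rotated])
  qed
  have w_eq: "w y = 1" for y
  proof -
    define wr where "wr = enn2real (w y)"
    have wr: "w y = ennreal wr" "0 \<le> wr" "wr \<le> 1"
      using w1[of y] le_less_trans[OF w1[of y] ennreal_one_less_top] by (auto simp: wr_def enn2real_leI)
    have step: "(1 - dl) * V n y + dl \<le> wr" for n
    proof -
      let ?s = "scale_measure (ennreal (1 - dl)) (\<sigma> n)"
      have sc: "?s \<in> carried (A n)" using sig(1) by (intro carried_scale) auto
      have "ennreal ((1 - dl) * V n y + dl) \<le> w y"
      proof (rule domination_principle[OF carriedD(1,2)[OF sc] A(1) carriedD(3)[OF sc] _ _ _ w_sm])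
        show "continuous_on UNIV (\<lambda>y. (1 - dl) * V n y)" by (intro continuous_intros V)
        show "0 \<le> (1 - dl) * V n y" for y using dl V(2) by simp
        show "pot ?s y = ennreal ((1 - dl) * V n y)" for y
          using dl V(2) by (simp add: potential_scale carriedD[OF sig(1)] V(3) ennreal_mult)
        show "0 \<le> dl" using dl by simp
        show "ennreal dl \<le> w y" for y by (rule w_low)
        fix z assume z: "z \<in> A n"
        have "ennreal (V n z) = ennreal 1" using sig(2)[OF z] V(3) by simp
        then have "V n z = 1" using V(2) by (subst (asm) ennreal_inj) auto
        then show "ennreal ((1 - dl) * V n z + dl) \<le> w z" using wA[OF z] by simp
      qed
      then show ?thesis using wr(2) by (simp add: wr(1) ennreal_le_iff)
    qed
    have "V n y \<le> (wr - dl) / (1 - dl)" for n using step[of n] dl by (simp add: le_divide_eq algebra_simps)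
    then have "w y \<le> ennreal ((wr - dl) / (1 - dl))"
      unfolding w_def V(3) by (intro SUP_least ennreal_leI)
    moreover have "0 \<le> (wr - dl) / (1 - dl)"
    proof -
      have "dl \<le> wr" using w_low[of y] dl(1) wr(2) by (simp add: wr(1) ennreal_le_iff)
      then show ?thesis using dl by simp
    qed
    ultimately have "wr \<le> (wr - dl) / (1 - dl)" by (simp add: wr(1) ennreal_le_iff)
    then have "wr * (1 - dl) \<le> wr - dl" using dl by (simp add: le_divide_eq)
    then have "dl * 1 \<le> dl * wr" by (simp add: algebra_simps)
    then have "1 \<le> wr" using dl by simp
    then show ?thesis using wr by simp
  qed
  have "w = (\<lambda>_. 1)" by (rule ext) (rule w_eq)
  then have one_PL: "(\<lambda>_::'a. 1) \<in> potential_limits \<alpha>" using w_PL by simp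
  have red_one: "reduced \<alpha> (\<lambda>_. 1) ?A x = 1"
  proof (rule antisym)
    show "reduced \<alpha> (\<lambda>_. 1) ?A x \<le> 1" by (rule reduced_le[OF one_PL]) simp
    show "1 \<le> reduced \<alpha> (\<lambda>_. 1) ?A x"
    proof (rule reduced_ge)
      fix v :: "'a \<Rightarrow> ennreal" assume v: "v \<in> potential_limits \<alpha>" and ge: "\<And>y. y \<in> ?A \<Longrightarrow> 1 \<le> v y"
      have "pot (\<sigma> n) x \<le> v x" for n
      proof (rule potential_domination[OF A(1) sig(1) V potential_limits_supermedian[OF v] potential_limits_lsc[OF v]])
        fix z assume "z \<in> A n"
        then show "pot (\<sigma> n) z \<le> v z" using sig(2) ge[of z] by auto
      qed
      then have "w x \<le> v x" unfolding w_def by (rule SUP_least)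
      then show "1 \<le> v x" by (simp add: w_eq)
    qed
  qed
  have "\<exists>\<nu>. sets \<nu> = sets (borel :: 'a measure) \<and> (\<forall>u\<in>potential_limits \<alpha>. (\<integral>\<^sup>+ y. u y \<partial>\<nu>) = reduced \<alpha> u ?A x)"
  proof (cases "x \<in> ?A")
    case True
    show ?thesis
    proof (intro exI[of _ "return borel x"] conjI ballI)
      fix u :: "'a \<Rightarrow> ennreal" assume u: "u \<in> potential_limits \<alpha>"
      have [measurable]: "u \<in> borel_measurable borel" using u by (rule potential_limits_measurable)
      have "(\<integral>\<^sup>+ y. u y \<partial>return borel x) = u x" by (subst nn_integral_return) auto
      also have "u x = reduced \<alpha> u ?A x"
      proof (rule antisym)
        show "u x \<le> reduced \<alpha> u ?A x" by (rule reduced_ge) (use True in auto)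
        show "reduced \<alpha> u ?A x \<le> u x" by (rule reduced_le[OF u]) simp
      qed
      finally show "(\<integral>\<^sup>+ y. u y \<partial>return borel x) = reduced \<alpha> u ?A x" .
    qed simp
  next
    case False
    have "\<exists>\<nu>\<in>carried (A n). (\<forall>y\<in>A n. pot \<nu> y = kern x y) \<and> (\<forall>y. pot \<nu> y \<le> kern x y)" for n
    proof -
      have "\<exists>r>0. \<forall>z\<in>A n. r \<le> dist x z"
      proof (cases "A n = {}")
        case ne: False
        have "0 < infdist x (A n)" using False clA[of n] ne by (intro infdist_pos_not_in_closed) auto
        then show ?thesis using infdist_le by blast
      qed (auto intro!: exI[of _ 1])
      then obtain r where r: "0 < r" "\<And>z. z \<in> A n \<Longrightarrow> r \<le> dist x z" by blast
      let ?p = "\<alpha> - real DIM('a)"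
      \<comment> \<open>Near `x` the kernel is levelled off, which does not change it on `A n`.\<close>
      define U where "U y = max r (dist x y) powr ?p" for y
      have "continuous_on UNIV U" unfolding U_def using r(1) by (intro continuous_intros) auto
      moreover have "0 \<le> U y" for y by (simp add: U_def)
      moreover have "kern x y = ennreal (U y)" if "y \<in> A n" for y
        using r(1) r(2)[OF that] by (auto simp: riesz_kernel_def U_def max_def)
      moreover have "lsc (kern x)" by (intro lsc_continuous riesz_kernel_continuous)
      ultimately show ?thesis
        using balayage_exists[OF A(1,2) kernel_supermedian, of x U n] by blast
    qed
    then obtain \<nu> where nu: "\<And>n. \<nu> n \<in> carried (A n)" "\<And>n y. y \<in> A n \<Longrightarrow> pot (\<nu> n) y = kern x y"
      "\<And>n y. pot (\<nu> n) y \<le> kern x y"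
      by metis
    have pair: "(\<integral>\<^sup>+ y. pot \<tau> y \<partial>\<nu> m) = pot \<tau> x" if t: "\<tau> \<in> carried (A n)" "n \<le> m" for \<tau> n m
    proof -
      have "(\<integral>\<^sup>+ y. pot \<tau> y \<partial>\<nu> m) = (\<integral>\<^sup>+ y. pot (\<nu> m) y \<partial>\<tau>)"
        by (rule mutual_potential[OF t(1) nu(1)])
      also have "\<dots> = (\<integral>\<^sup>+ y. kern x y \<partial>\<tau>)"
        using carried_AE[OF t(1) clA]
        by (intro nn_integral_cong_AE, eventually_elim) (use A_mono[OF t(2)] nu(2) in auto)
      finally show ?thesis by (simp add: riesz_potential_def)
    qed
    have mass: "emeasure (\<nu> n) UNIV \<le> ennreal 1" for n
    proof -
      have "emeasure (\<nu> n) UNIV = (\<integral>\<^sup>+ y. 1 \<partial>\<nu> n)" by (simp add: carriedD[OF nu(1)])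
      also have "\<dots> = (\<integral>\<^sup>+ y. pot (\<sigma> n) y \<partial>\<nu> n)"
        using carried_AE[OF nu(1) clA, of n] by (intro nn_integral_cong_AE, eventually_elim) (simp add: sig(2))
      also have "\<dots> = pot (\<sigma> n) x" by (rule pair[OF sig(1)]) simp
      finally show ?thesis using sig(3) by simp
    qed
    obtain r \<mu> where vc: "strict_mono (r :: nat \<Rightarrow> nat) \<and> sets \<mu> = sets borel \<and> emeasure \<mu> UNIV \<le> ennreal (max 1 1) \<and>
      (\<forall>f :: 'a \<Rightarrow> real. continuous_on UNIV f \<longrightarrow> (f \<longlongrightarrow> 0) at_infinity \<longrightarrow> (\<lambda>n. \<integral>x. f x \<partial>\<nu> (r n)) \<longlonglongrightarrow> (\<integral>x. f x \<partial>\<mu>))"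
      using vague_compactness[of \<nu> 1, OF carriedD(1)[OF nu(1)] mass] by (elim exE) (rule that)
    have r: "strict_mono r" and sets_mu[measurable_cong]: "sets \<mu> = sets borel" and mu_mass: "emeasure \<mu> UNIV \<le> 1"
      using vc by simp_all
    note vague = vc[THEN conjunct2, THEN conjunct2, THEN conjunct2]
    have conv: "(\<lambda>n. \<integral>x. f x \<partial>\<nu> (r n)) \<longlonglongrightarrow> (\<integral>x. f x \<partial>\<mu>)"
      if "continuous_on UNIV f" "(f \<longlongrightarrow> 0) at_infinity" for f :: "'a \<Rightarrow> real"
      using vc that by simp
    have fin_mu: "finite_measure \<mu>"
      using mu_mass sets_eq_imp_space_eq[OF sets_mu] by (intro finite_measure_of_bound[of _ 1]) simp
    have nuA: "\<nu> n \<in> carried ?A" for n by (rule carried_subset[OF nu(1) _ clA A(4)]) auto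
    have mu: "\<mu> \<in> carried ?A"
      using vague_limit_support[of "\<lambda>n. \<nu> (r n)" \<mu> ?A] conv fin_mu sets_mu A(4) carriedD[OF nuA] by (auto simp: carried_def)
    note convk = vague_limit_ktr[of "\<lambda>n. \<nu> (r n)", OF carriedD(1,2)[OF nu(1)] sets_mu fin_mu vague]
    have pot_mu: "pot \<mu> y \<le> kern x y" for y
      by (rule vague_limit_potential[of "\<lambda>n. \<nu> (r n)", OF carriedD(1,2)[OF nu(1)] sets_mu fin_mu vague nu(3)])
    show ?thesis
    proof (intro exI[of _ \<mu>] conjI ballI sets_mu)
      fix u :: "'a \<Rightarrow> ennreal" assume u: "u \<in> potential_limits \<alpha>"
      show "(\<integral>\<^sup>+ y. u y \<partial>\<mu>) = reduced \<alpha> u ?A x"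
      proof (rule antisym)
        show "(\<integral>\<^sup>+ y. u y \<partial>\<mu>) \<le> reduced \<alpha> u ?A x"
        proof (rule reduced_ge)
          fix v :: "'a \<Rightarrow> ennreal" assume v: "v \<in> potential_limits \<alpha>" and ge: "\<And>y. y \<in> ?A \<Longrightarrow> u y \<le> v y"
          obtain \<tau> where t: "\<And>n::nat. compactly_supported_measure (\<tau> n)" "incseq (\<lambda>n. pot (\<tau> n))"
            "v = (\<lambda>x. SUP n. pot (\<tau> n) x)" by (rule potential_limitsE[OF v]) (rule that)
          have tc: "\<exists>K. \<tau> n \<in> carried K" for n using t(1)[of n] by (auto elim: compactly_supported_carried)
          have [measurable]: "pot (\<tau> n) \<in> borel_measurable borel" for n using tc[of n] carriedD by auto
          have "(\<integral>\<^sup>+ y. u y \<partial>\<mu>) \<le> (\<integral>\<^sup>+ y. v y \<partial>\<mu>)"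
            using carried_AE[OF mu A(4)] by (intro nn_integral_mono_AE, eventually_elim) (rule ge)
          also have "\<dots> = (SUP n. \<integral>\<^sup>+ y. pot (\<tau> n) y \<partial>\<mu>)"
            unfolding t(3) by (rule nn_integral_monotone_convergence_SUP[OF t(2)]) measurable
          also have "\<dots> \<le> v x"
          proof (rule SUP_least)
            fix n
            obtain K where K: "\<tau> n \<in> carried K" using tc by blast
            have "(\<integral>\<^sup>+ y. pot (\<tau> n) y \<partial>\<mu>) = (\<integral>\<^sup>+ y. pot \<mu> y \<partial>\<tau> n)" by (rule mutual_potential[OF K mu])
            also have "\<dots> \<le> pot (\<tau> n) x" unfolding riesz_potential_def[of _ "\<tau> n"] by (intro nn_integral_mono pot_mu)
            also have "\<dots> \<le> v x" unfolding t(3) by (rule SUP_upper) simp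
            finally show "(\<integral>\<^sup>+ y. pot (\<tau> n) y \<partial>\<mu>) \<le> v x" .
          qed
          finally show "(\<integral>\<^sup>+ y. u y \<partial>\<mu>) \<le> v x" .
        qed
        obtain \<tau> where t: "\<And>n::nat. compactly_supported_measure (\<tau> n)" "incseq (\<lambda>n. pot (\<tau> n))"
          "u = (\<lambda>x. SUP n. pot (\<tau> n) x)" by (rule potential_limitsE[OF u]) (rule that)
        have "\<exists>K. compact K \<and> \<tau> n \<in> carried K" for n using t(1)[of n] by (auto elim: compactly_supported_carried)
        then obtain K where K: "\<And>n. compact (K n)" "\<And>n. \<tau> n \<in> carried (K n)" by metis
        define a where "a n = 1 / real (Suc n)" for n
        have a: "0 < a n" for n by (simp add: a_def)
        \<comment> \<open>Truncating the kernels makes the functions finite and continuous, as balayage requires,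
          and they still increase to `u`.\<close>
        define un where "un n = ktr_potential (a n) (\<tau> n)" for n
        have un_sm: "supermedian (un n)" "lsc (un n)" for n
          unfolding un_def using carriedD[OF K(2)[of n]]
          by (auto intro!: supermedian_ktr_potential lsc_continuous ktr_potential_continuous[OF K(2) a])
        have un_mono: "un m y \<le> un n y" if "m \<le> n" for m n y
          unfolding un_def
        proof (rule ktr_potential_mono)
          show "a n \<le> a m" using that by (simp add: a_def frac_le)
          show "pot (\<tau> m) y \<le> pot (\<tau> n) y" for y using t(2) that by (auto simp: incseq_def le_fun_def)
        qed (use carriedD[OF K(2)] a in auto)
        have un_sup: "(SUP n. un n y) = u y" for y
        proof (rule antisym)
          show "(SUP n. un n y) \<le> u y"
            unfolding t(3) un_def by (intro SUP_mono) (use ktr_potential_le in blast)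
          show "u y \<le> (SUP n. un n y)"
            unfolding t(3)
          proof (rule SUP_least)
            fix m
            have "pot (\<tau> m) y = (SUP n. ktr_potential (a n) (\<tau> m) y)"
              unfolding a_def using ktr_potential_SUP[OF carriedD(1)[OF K(2)]] by simp
            also have "\<dots> \<le> (SUP n. un n y)"
            proof (rule SUP_least)
              fix n
              have "ktr_potential (a n) (\<tau> m) y \<le> ktr_potential (a (max m n)) (\<tau> (max m n)) y"
              proof (rule ktr_potential_mono)
                show "a (max m n) \<le> a n" by (simp add: a_def frac_le)
                show "pot (\<tau> m) y \<le> pot (\<tau> (max m n)) y" for y using t(2) by (auto simp: incseq_def le_fun_def)
              qed (use carriedD[OF K(2)] a in auto)
              also have "\<dots> \<le> (SUP n. un n y)" unfolding un_def[symmetric] by (rule SUP_upper) simp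
              finally show "ktr_potential (a n) (\<tau> m) y \<le> (SUP n. un n y)" .
            qed
            finally show "pot (\<tau> m) y \<le> (SUP n. un n y)" .
          qed
        qed
        have "\<exists>\<sigma>\<in>carried (A n). (\<forall>y\<in>A n. pot \<sigma> y = un n y) \<and> (\<forall>y. pot \<sigma> y \<le> un n y) \<and>
          (\<exists>V. continuous_on UNIV V \<and> (\<forall>y. 0 \<le> V y \<and> pot \<sigma> y = ennreal (V y)))" for n
        proof (rule balayage_exists[OF A(1,2) un_sm ktr_real_continuous[OF K(2)[of n] a[of n]]])
          show "0 \<le> ktr_real (a n) (\<tau> n) y" for y by (simp add: ktr_real_def)
          show "un n y = ennreal (ktr_real (a n) (\<tau> n) y)" for y
            unfolding un_def by (rule ktr_real_eq[OF K(2) a])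
        qed
        then obtain s V where s: "\<And>n. s n \<in> carried (A n)" "\<And>n y. y \<in> A n \<Longrightarrow> pot (s n) y = un n y"
          "\<And>n y. pot (s n) y \<le> un n y"
          and sV: "\<And>n. continuous_on UNIV (V n)" "\<And>n y. 0 \<le> V n y" "\<And>n y. pot (s n) y = ennreal (V n y)"
          by metis
        have s_inc: "incseq (\<lambda>n. pot (s n))"
        proof (rule incseq_SucI, rule le_funI)
          fix n y
          show "pot (s n) y \<le> pot (s (Suc n)) y"
          proof (rule potential_domination[OF A(1) s(1) sV])
            show "supermedian (pot (s (Suc n)))" "lsc (pot (s (Suc n)))"
              using carriedD[OF s(1)[of "Suc n"]] by (auto intro: supermedian_potential riesz_potential_lsc)
            fix z assume z: "z \<in> A n"
            then have "z \<in> A (Suc n)" using A_mono[of n "Suc n"] by auto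
            then show "pot (s n) z \<le> pot (s (Suc n)) z" using s(2) z un_mono[of n "Suc n" z] by simp
          qed
        qed
        define v where "v y = (SUP n. pot (s n) y)" for y
        have v: "v \<in> potential_limits \<alpha>"
          unfolding v_def[abs_def] by (rule potential_limitsI[OF carried_compactly_supported[OF A(1) s(1)] s_inc])
        have "u y \<le> v y" if y: "y \<in> ?A" for y
        proof -
          obtain m where m: "y \<in> A m" using y by blast
          have "un n y \<le> v y" for n
          proof -
            have "un n y \<le> un (max m n) y" by (rule un_mono) simp
            also have "\<dots> = pot (s (max m n)) y"
              using A_mono[of m "max m n"] m by (intro s(2)[symmetric]) auto
            also have "\<dots> \<le> v y" unfolding v_def by (rule SUP_upper) simp
            finally show ?thesis .
          qed
          then show ?thesis unfolding un_sup[symmetric] by (rule SUP_least)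
        qed
        then have "reduced \<alpha> u ?A x \<le> v x" by (rule reduced_le[OF v])
        also have "v x \<le> (\<integral>\<^sup>+ y. u y \<partial>\<mu>)"
          unfolding v_def
        proof (rule SUP_least)
          fix n
          have "pot (s n) x \<le> (\<integral>\<^sup>+ y. un n y \<partial>\<mu>)"
          proof (rule LIMSEQ_le_const)
            show "(\<lambda>m. \<integral>\<^sup>+ y. un n y \<partial>\<nu> (r m)) \<longlonglongrightarrow> (\<integral>\<^sup>+ y. un n y \<partial>\<mu>)"
              unfolding un_def by (rule convk[OF a K(2) K(1)])
            show "\<exists>N. \<forall>m\<ge>N. pot (s n) x \<le> (\<integral>\<^sup>+ y. un n y \<partial>\<nu> (r m))"
            proof (intro exI allI impI)
              fix m assume "n \<le> m"
              then have "n \<le> r m" using seq_suble[OF r, of m] by simp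
              then have "pot (s n) x = (\<integral>\<^sup>+ y. pot (s n) y \<partial>\<nu> (r m))" by (rule pair[OF s(1), symmetric])
              also have "\<dots> \<le> (\<integral>\<^sup>+ y. un n y \<partial>\<nu> (r m))" by (intro nn_integral_mono s(3))
              finally show "pot (s n) x \<le> (\<integral>\<^sup>+ y. un n y \<partial>\<nu> (r m))" .
            qed
          qed
          also have "\<dots> \<le> (\<integral>\<^sup>+ y. u y \<partial>\<mu>)"
            unfolding un_sup[symmetric] by (intro nn_integral_mono SUP_upper) simp
          finally show "pot (s n) x \<le> (\<integral>\<^sup>+ y. u y \<partial>\<mu>)" .
        qed
        finally show "reduced \<alpha> u ?A x \<le> (\<integral>\<^sup>+ y. u y \<partial>\<mu>)" .
      qed
    qed
  qed
  then obtain \<nu> where nu: "sets \<nu> = sets (borel :: 'a measure)" "\<And>u. u \<in> potential_limits \<alpha> \<Longrightarrow> (\<integral>\<^sup>+ y. u y \<partial>\<nu>) = reduced \<alpha> u ?A x"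
    by blast
  have "swept_measure \<alpha> x ?A = \<nu>" by (rule swept_measure_eqI[OF nu])
  moreover have "emeasure \<nu> UNIV = 1"
    using nu(2)[OF one_PL] red_one sets_eq_imp_space_eq[OF nu(1)] by simp
  ultimately show ?thesis by simp
qed

end

section \<open>Hausdorff measures, and null sets are not charged\<close>

lemma hausdorff_content_le:
  fixes x :: "nat \<Rightarrow> 'a::euclidean_space"
  assumes "\<And>n. 0 < r n" "\<And>n. r n < \<rho>" "E \<subseteq> (\<Union>n. ball (x n) (r n))"
  shows "hausdorff_content \<phi> \<rho> E \<le> (\<Sum>n. \<phi> (r n))"
  unfolding hausdorff_content_def using assms by (intro Inf_lower) blast

lemma hausdorff_content_antimono:
  fixes E :: "'a::euclidean_space set"
  assumes "\<rho> \<le> \<rho>'" shows "hausdorff_content \<phi> \<rho>' E \<le> hausdorff_content \<phi> \<rho> E"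
  unfolding hausdorff_content_def[of \<phi> \<rho>]
proof (rule Inf_greatest, clarify)
  fix x :: "nat \<Rightarrow> 'a" and r assume r: "\<forall>n. 0 < r n \<and> r n < \<rho>" "E \<subseteq> (\<Union>n. ball (x n) (r n))"
  have "r n < \<rho>'" for n using r(1) assms by (meson less_le_trans)
  then show "hausdorff_content \<phi> \<rho>' E \<le> (\<Sum>n. \<phi> (r n))" using r by (intro hausdorff_content_le) auto
qed

lemma hausdorff_measure_eq_SUP:
  "hausdorff_measure \<phi> E = (SUP \<rho>\<in>{0<..}. hausdorff_content \<phi> \<rho> E)"
  unfolding hausdorff_measure_def
proof (rule tendsto_Lim)
  let ?L = "SUP \<rho>\<in>{0<..}. hausdorff_content \<phi> \<rho> E"
  show "((\<lambda>\<rho>. hausdorff_content \<phi> \<rho> E) \<longlongrightarrow> ?L) (at_right 0)"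
  proof (rule order_tendstoI)
    fix a assume "a < ?L"
    then obtain \<rho>0 where r: "0 < \<rho>0" "a < hausdorff_content \<phi> \<rho>0 E" by (auto simp: less_SUP_iff)
    show "\<forall>\<^sub>F \<rho> in at_right 0. a < hausdorff_content \<phi> \<rho> E"
      unfolding eventually_at_right_field
    proof (intro exI[of _ \<rho>0] conjI allI impI r(1))
      fix y assume "0 < y" "y < \<rho>0"
      then show "a < hausdorff_content \<phi> y E"
        using hausdorff_content_antimono[of y \<rho>0 \<phi> E] r(2) by simp
    qed
  next
    fix a assume a: "?L < a"
    show "\<forall>\<^sub>F \<rho> in at_right 0. hausdorff_content \<phi> \<rho> E < a"
      unfolding eventually_at_right_field
      by (intro exI[of _ 1]) (auto intro!: le_less_trans[OF SUP_upper a])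
  qed
qed simp

lemma hausdorff_measure_0_iff:
  "hausdorff_measure \<phi> E = 0 \<longleftrightarrow> (\<forall>\<rho>>0. hausdorff_content \<phi> \<rho> E = 0)"
  unfolding hausdorff_measure_eq_SUP by (auto simp: SUP_eq_iff bot_ennreal[symmetric] SUP_bot_conv)

lemma hausdorff_content_lessE:
  fixes E :: "'a::euclidean_space set"
  assumes "hausdorff_content \<phi> \<rho> E < c"
  obtains x :: "nat \<Rightarrow> 'a" and r where "\<And>n. 0 < r n" "\<And>n. r n < \<rho>" "E \<subseteq> (\<Union>n. ball (x n) (r n))" "(\<Sum>n. \<phi> (r n)) < c"
  using assms unfolding hausdorff_content_def Inf_less_iff by blast

lemma hausdorff_content_compare:
  assumes C: "0 < C" and le: "\<And>t. 0 < t \<Longrightarrow> t < \<rho> \<Longrightarrow> \<psi> t \<le> ennreal C * \<phi> t"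
  shows "hausdorff_content \<psi> \<rho> E \<le> ennreal C * hausdorff_content \<phi> \<rho> (E :: 'a::euclidean_space set)"
proof -
  have "ennreal (1 / C) * hausdorff_content \<psi> \<rho> E \<le> hausdorff_content \<phi> \<rho> E"
    unfolding hausdorff_content_def[of \<phi>]
  proof (rule Inf_greatest, clarify)
    fix x :: "nat \<Rightarrow> 'a" and r assume r: "\<forall>n. 0 < r n \<and> r n < \<rho>" "E \<subseteq> (\<Union>n. ball (x n) (r n))"
    have "hausdorff_content \<psi> \<rho> E \<le> (\<Sum>n. \<psi> (r n))" using r by (intro hausdorff_content_le) auto
    also have "\<dots> \<le> (\<Sum>n. ennreal C * \<phi> (r n))" using r by (intro suminf_le le) auto
    also have "\<dots> = ennreal C * (\<Sum>n. \<phi> (r n))" by simp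
    finally have "ennreal (1 / C) * hausdorff_content \<psi> \<rho> E \<le> ennreal (1 / C) * (ennreal C * (\<Sum>n. \<phi> (r n)))"
      by (rule mult_left_mono) simp
    also have "\<dots> = (\<Sum>n. \<phi> (r n))" using C by (simp add: mult.assoc[symmetric] ennreal_mult[symmetric])
    finally show "ennreal (1 / C) * hausdorff_content \<psi> \<rho> E \<le> (\<Sum>n. \<phi> (r n))" .
  qed
  then have "ennreal C * (ennreal (1 / C) * hausdorff_content \<psi> \<rho> E) \<le> ennreal C * hausdorff_content \<phi> \<rho> E"
    by (rule mult_left_mono) simp
  then show ?thesis using C by (simp add: mult.assoc[symmetric] ennreal_mult[symmetric])
qed

lemma hausdorff_null_transfer:
  fixes E :: "'a::euclidean_space set"
  assumes "hausdorff_measure \<phi> E = 0" "0 < C" "0 < t0" "\<And>t. 0 < t \<Longrightarrow> t < t0 \<Longrightarrow> \<psi> t \<le> ennreal C * \<phi> t"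
  shows "hausdorff_measure \<psi> E = 0"
  unfolding hausdorff_measure_0_iff
proof (intro allI impI)
  fix \<rho> :: real assume r: "0 < \<rho>"
  have "hausdorff_content \<psi> \<rho> E \<le> hausdorff_content \<psi> (min \<rho> t0) E" by (rule hausdorff_content_antimono) simp
  also have "\<dots> \<le> ennreal C * hausdorff_content \<phi> (min \<rho> t0) E"
    using assms by (intro hausdorff_content_compare) auto
  also have "hausdorff_content \<phi> (min \<rho> t0) E = 0" using assms(1,3) r unfolding hausdorff_measure_0_iff by simp
  finally show "hausdorff_content \<psi> \<rho> E = 0" by simp
qed

text \<open>A cover by balls of radius below `s` gains the factor `s powr (\<delta> - \<gamma>)`.\<close>

lemma hausdorff_measure_powr_null:
  fixes E :: "'a::euclidean_space set"
  assumes "hausdorff_measure (\<lambda>t. ennreal (t powr \<gamma>)) E < \<infinity>" "\<gamma> < \<delta>"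
  shows "hausdorff_measure (\<lambda>t. ennreal (t powr \<delta>)) E = 0"
  unfolding hausdorff_measure_0_iff
proof (intro allI impI)
  fix \<rho> :: real assume r: "0 < \<rho>"
  let ?H = "hausdorff_measure (\<lambda>t. ennreal (t powr \<gamma>)) E"
  have bound: "hausdorff_content (\<lambda>t. ennreal (t powr \<delta>)) \<rho> E \<le> ennreal (s powr (\<delta> - \<gamma>)) * ?H" if s: "0 < s" "s < \<rho>" for s
  proof -
    have "hausdorff_content (\<lambda>t. ennreal (t powr \<delta>)) \<rho> E \<le> hausdorff_content (\<lambda>t. ennreal (t powr \<delta>)) s E"
      using s by (intro hausdorff_content_antimono) simp
    also have "\<dots> \<le> ennreal (s powr (\<delta> - \<gamma>)) * hausdorff_content (\<lambda>t. ennreal (t powr \<gamma>)) s E"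
    proof (rule hausdorff_content_compare)
      fix t :: real assume t: "0 < t" "t < s"
      have "t powr \<delta> = t powr (\<delta> - \<gamma>) * t powr \<gamma>" by (simp add: powr_add[symmetric])
      also have "\<dots> \<le> s powr (\<delta> - \<gamma>) * t powr \<gamma>" using t assms(2) by (intro mult_right_mono powr_mono2) auto
      finally show "ennreal (t powr \<delta>) \<le> ennreal (s powr (\<delta> - \<gamma>)) * ennreal (t powr \<gamma>)"
        by (simp add: ennreal_mult[symmetric] ennreal_leI)
    qed (use s in simp)
    also have "\<dots> \<le> ennreal (s powr (\<delta> - \<gamma>)) * ?H"
      unfolding hausdorff_measure_eq_SUP using s by (intro mult_left_mono SUP_upper) auto
    finally show ?thesis .
  qed
  obtain H where H: "?H = ennreal H" "0 \<le> H" using assms(1) by (cases ?H rule: ennreal_cases) auto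
  have "((\<lambda>s. s powr (\<delta> - \<gamma>) * H) \<longlongrightarrow> 0 * H) (at_right 0)"
  proof (intro tendsto_mult tendsto_const)
    have "((\<lambda>s::real. s powr (\<delta> - \<gamma>)) \<longlongrightarrow> 0 powr (\<delta> - \<gamma>)) (at_right 0)"
      using assms(2) by (intro tendsto_powr' tendsto_ident_at tendsto_const) (auto simp: eventually_at_right_field intro!: exI[of _ 1])
    then show "((\<lambda>s::real. s powr (\<delta> - \<gamma>)) \<longlongrightarrow> 0) (at_right 0)" by simp
  qed
  then have lim: "((\<lambda>s. ennreal (s powr (\<delta> - \<gamma>) * H)) \<longlongrightarrow> ennreal 0) (at_right 0)"
    by (intro tendsto_ennrealI) simp
  have "hausdorff_content (\<lambda>t. ennreal (t powr \<delta>)) \<rho> E \<le> ennreal 0"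
  proof (rule tendsto_lowerbound[OF lim])
    show "\<forall>\<^sub>F s in at_right 0. hausdorff_content (\<lambda>t. ennreal (t powr \<delta>)) \<rho> E \<le> ennreal (s powr (\<delta> - \<gamma>) * H)"
      unfolding eventually_at_right_field using r bound H
      by (intro exI[of _ \<rho>]) (auto simp: ennreal_mult)
  qed simp
  then show "hausdorff_content (\<lambda>t. ennreal (t powr \<delta>)) \<rho> E = 0" by simp
qed

text \<open>Lebesgue measure is dominated by a multiple of the content.\<close>

lemma hausdorff_null_not_UNIV:
  assumes "0 < \<gamma>" "\<gamma> \<le> real DIM('a)" "hausdorff_measure (\<lambda>t. ennreal (t powr \<gamma>)) (E :: 'a::euclidean_space set) = 0"
  shows "E \<noteq> UNIV"
proof
  assume E: "E = UNIV"
  have "hausdorff_content (\<lambda>t. ennreal (t powr \<gamma>)) 1 E < 1" using assms(3) unfolding hausdorff_measure_0_iff by simp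
  then obtain x :: "nat \<Rightarrow> 'a" and r where r: "\<And>n. 0 < r n" "\<And>n. r n < 1" "E \<subseteq> (\<Union>n. ball (x n) (r n))" "(\<Sum>n. ennreal (r n powr \<gamma>)) < 1"
    by (rule hausdorff_content_lessE) (rule that)
  let ?u = "unit_ball_vol (real DIM('a))"
  have "emeasure lborel (UNIV :: 'a set) \<le> emeasure lborel (\<Union>n. ball (x n) (r n))"
    using r(3) E by (intro emeasure_mono) auto
  also have "\<dots> \<le> (\<Sum>n. emeasure lborel (ball (x n) (r n)))" by (rule emeasure_subadditive_countably) auto
  also have "\<dots> \<le> (\<Sum>n. ennreal ?u * ennreal (r n powr \<gamma>))"
  proof (rule suminf_le)
    fix n
    have "r n ^ DIM('a) = r n powr real DIM('a)" using r(1)[of n] by (simp add: powr_realpow)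
    also have "\<dots> \<le> r n powr \<gamma>" using r(1,2)[of n] assms by (intro powr_mono') auto
    finally show "emeasure lborel (ball (x n) (r n)) \<le> ennreal ?u * ennreal (r n powr \<gamma>)"
      using r(1)[of n] by (simp add: emeasure_ball ennreal_mult[symmetric] ennreal_leI mult_left_mono)
  qed auto
  also have "\<dots> = ennreal ?u * (\<Sum>n. ennreal (r n powr \<gamma>))" by simp
  also have "\<dots> < \<infinity>" using r(4) by (auto simp: ennreal_mult_less_top intro: less_trans[OF _ ennreal_one_less_top])
  finally show False by simp
qed

context riesz
begin

definition point_masses :: "'i set \<Rightarrow> ('i \<Rightarrow> ennreal) \<Rightarrow> ('i \<Rightarrow> 'a) \<Rightarrow> 'a measure" where
  "point_masses I c z = distr (density (count_space I) c) borel z"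

lemma nn_integral_point_masses:
  assumes "finite I" and [measurable]: "f \<in> borel_measurable borel"
  shows "(\<integral>\<^sup>+ y. f y \<partial>point_masses I c z) = (\<Sum>i\<in>I. c i * f (z i))"
  unfolding point_masses_def using assms(1)
  by (subst nn_integral_distr) (auto simp: nn_integral_density nn_integral_count_space_finite)

lemma point_masses_compactly_supported:
  assumes "finite I" "\<And>i. c i < top"
  shows "compactly_supported_measure (point_masses I c z)"
proof -
  have s: "sets (point_masses I c z) = sets borel" by (simp add: point_masses_def)
  have em: "emeasure (point_masses I c z) B = (\<Sum>i\<in>I. c i * indicator B (z i))" if "B \<in> sets borel" for B
    using nn_integral_point_masses[OF assms(1), of "indicator B" c z] that s by simp
  have "(\<Sum>i\<in>I. c i) < top"
    using assms(1) by (induction I rule: finite_induct) (simp_all add: assms(2) ennreal_add_less_top)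
  then have "emeasure (point_masses I c z) UNIV \<noteq> \<infinity>" by (subst em) auto
  then have "finite_measure (point_masses I c z)"
    using sets_eq_imp_space_eq[OF s] by (intro finite_measureI) simp
  moreover have "compact (z ` I)" using assms(1) by (simp add: finite_imp_compact)
  moreover have "emeasure (point_masses I c z) (- (z ` I)) = 0"
    using assms(1) by (subst em) (auto simp: finite_imp_closed)
  ultimately show ?thesis unfolding compactly_supported_measure_def using s by blast
qed

text \<open>A cover of `A` by balls `B(z, r)` supports the measure with mass `r^(d - \<alpha>)` at each centre, whose
  potential is at least 1 on `A` although its total mass is small. Summing countably many such
  covers gives a potential that is infinite on `A` and finite at `x`; its small multiples show
  that every reduced function vanishes at `x`, so the swept measure is 0.\<close>

lemma swept_mass_of_null_set:
  fixes A :: "'a set"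
  assumes A: "closed A" "x \<notin> A" and null: "hausdorff_measure (\<lambda>t. ennreal (t powr (real DIM('a) - \<alpha>))) A = 0"
  shows "emeasure (swept_measure \<alpha> x A) UNIV = 0"
proof -
  let ?p = "real DIM('a) - \<alpha>"
  have p: "0 < ?p" using alpha_dim by simp
  have "\<exists>D>0. \<forall>y\<in>A. D \<le> dist x y"
  proof (cases "A = {}")
    case False
    then have "0 < infdist x A" using A by (intro infdist_pos_not_in_closed) auto
    then show ?thesis using infdist_le by blast
  qed (auto intro!: exI[of _ 1])
  then obtain D where D: "0 < D" "\<And>y. y \<in> A \<Longrightarrow> D \<le> dist x y" by blast
  define Q where "Q k z r \<longleftrightarrow> (\<forall>n::nat. 0 < r n \<and> r n < D / 2) \<and> A \<subseteq> (\<Union>n. ball (z n) (r n)) \<and>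
    (\<Sum>n. ennreal (r n powr ?p)) < ennreal ((D / 2) powr ?p * (1 / 2) ^ Suc k)" for k z r
  have "\<exists>z r. Q k z r" for k
  proof -
    have "hausdorff_content (\<lambda>t. ennreal (t powr ?p)) (D / 2) A < ennreal ((D / 2) powr ?p * (1 / 2) ^ Suc k)"
      using null D(1) unfolding hausdorff_measure_0_iff by (simp add: ennreal_less_zero_iff)
    then obtain z r where "\<And>n. 0 < r n" "\<And>n. r n < D / 2" "A \<subseteq> (\<Union>n. ball (z n) (r n))"
      "(\<Sum>n. ennreal (r n powr ?p)) < ennreal ((D / 2) powr ?p * (1 / 2) ^ Suc k)"
      by (rule hausdorff_content_lessE) (rule that)
    then have "Q k z r" unfolding Q_def by simp
    then show ?thesis by blast
  qed
  then obtain z r where Q: "\<And>k. Q k (z k) (r k)" by metis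
  have r: "\<And>k n. 0 < r k n" "\<And>k n. r k n < D / 2" "\<And>k. A \<subseteq> (\<Union>n::nat. ball (z k n) (r k n))"
    "\<And>k::nat. (\<Sum>n. ennreal (r k n powr ?p)) < ennreal ((D / 2) powr ?p * (1 / 2) ^ Suc k)"
    using Q unfolding Q_def by simp_all
  \<comment> \<open>Balls that miss `A` are dropped, since their centres might be close to `x`.\<close>
  define c where "c k n = (if ball (z k n) (r k n) \<inter> A = {} then 0 else r k n powr ?p)" for k n
  have c0: "0 \<le> c k n" for k n by (simp add: c_def)
  have red0: "reduced \<alpha> u A x \<le> ennreal t" if t: "0 < t" for t u
  proof -
    define I where "I N = {..<N} \<times> {..<N::nat}" for N
    define \<mu> where "\<mu> N = point_masses (I N) (\<lambda>(k, n). ennreal (t * c k n)) (\<lambda>(k, n). z k n)" for N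
    have pot: "pot (\<mu> N) y = (\<Sum>k<N. \<Sum>n<N. ennreal (t * c k n) * kern y (z k n))" for N y
      unfolding riesz_potential_def \<mu>_def I_def
      by (subst nn_integral_point_masses) (auto simp: sum.cartesian_product split_beta)
    have cs: "compactly_supported_measure (\<mu> N)" for N
      unfolding \<mu>_def by (rule point_masses_compactly_supported) (auto simp: I_def)
    have inc: "incseq (\<lambda>N. pot (\<mu> N))"
    proof (rule incseq_SucI, rule le_funI)
      fix N y
      have "pot (\<mu> N) y \<le> (\<Sum>k<N. \<Sum>n<Suc N. ennreal (t * c k n) * kern y (z k n))"
        unfolding pot by (intro sum_mono sum_mono2) auto
      also have "\<dots> \<le> pot (\<mu> (Suc N)) y" unfolding pot by (intro sum_mono2) auto
      finally show "pot (\<mu> N) y \<le> pot (\<mu> (Suc N)) y" .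
    qed
    \<comment> \<open>Each cover contributes at least `t` at every point of `A`.\<close>
    define v where "v y = (SUP N. pot (\<mu> N) y)" for y
    have v: "v \<in> potential_limits \<alpha>" unfolding v_def[abs_def] by (rule potential_limitsI[OF cs inc])
    have vA: "v y = \<infinity>" if y: "y \<in> A" for y
    proof -
      have "\<forall>k. \<exists>n. y \<in> ball (z k n) (r k n)" using r(3) y by blast
      then obtain n where n: "\<And>k. y \<in> ball (z k (n k)) (r k (n k))" by metis
      have tm: "ennreal t \<le> ennreal (t * c k (n k)) * kern y (z k (n k))" for k
      proof -
        have ck: "c k (n k) = r k (n k) powr ?p" using n[of k] y by (auto simp: c_def)
        have dist: "dist y (z k (n k)) < r k (n k)" using n[of k] by (simp add: dist_commute)
        have "ennreal (r k (n k) powr (\<alpha> - real DIM('a))) \<le> kern y (z k (n k))"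
          using dist alpha_dim by (auto simp: riesz_kernel_def intro!: ennreal_leI powr_mono2')
        then have "ennreal (t * c k (n k)) * ennreal (r k (n k) powr (\<alpha> - real DIM('a))) \<le> ennreal (t * c k (n k)) * kern y (z k (n k))"
          by (rule mult_left_mono) simp
        moreover have "t * c k (n k) * r k (n k) powr (\<alpha> - real DIM('a)) = t"
          using r(1)[of k "n k"] by (simp add: ck powr_add[symmetric])
        ultimately show ?thesis using t c0 by (simp add: ennreal_mult[symmetric])
      qed
      have "of_nat K * ennreal t \<le> v y" for K :: nat
      proof -
        define N where "N = max K (Suc (Max (n ` {..<K})))"
        have N: "n k < N" if "k < K" for k
          using that by (auto simp: N_def less_max_iff_disj less_Suc_eq_le intro!: Max_ge)
        have "of_nat K * ennreal t = (\<Sum>k<K. ennreal t)" by simp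
        also have "\<dots> \<le> (\<Sum>k<K. \<Sum>n<N. ennreal (t * c k n) * kern y (z k n))"
        proof (rule sum_mono)
          fix k assume "k \<in> {..<K}"
          then have "n k \<in> {..<N}" using N by simp
          then have "ennreal (t * c k (n k)) * kern y (z k (n k)) \<le> (\<Sum>n<N. ennreal (t * c k n) * kern y (z k n))"
            by (intro member_le_sum) auto
          with tm[of k] show "ennreal t \<le> (\<Sum>n<N. ennreal (t * c k n) * kern y (z k n))" by (rule order.trans)
        qed
        also have "\<dots> \<le> pot (\<mu> N) y" unfolding pot by (intro sum_mono2) (auto simp: N_def)
        also have "\<dots> \<le> v y" unfolding v_def by (rule SUP_upper) simp
        finally show ?thesis .
      qed
      then have "(SUP K. of_nat K * ennreal t) \<le> v y" by (rule SUP_least)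
      moreover have "(SUP K::nat. of_nat K * ennreal t) = top"
        using t by (simp add: SUP_mult_right_ennreal[symmetric] ennreal_SUP_of_nat_eq_top ennreal_top_mult)
      ultimately show ?thesis by (simp add: top_unique)
    qed
    have "v x \<le> ennreal t"
      unfolding v_def
    proof (rule SUP_least)
      fix N
      have "pot (\<mu> N) x \<le> (\<Sum>k<N. ennreal t * ennreal ((1 / 2) ^ Suc k))"
        unfolding pot
      proof (rule sum_mono)
        fix k
        have "(\<Sum>n<N. ennreal (t * c k n) * kern x (z k n)) \<le> (\<Sum>n<N. ennreal (t * (D / 2) powr - ?p) * ennreal (r k n powr ?p))"
        proof (rule sum_mono)
          fix n
          show "ennreal (t * c k n) * kern x (z k n) \<le> ennreal (t * (D / 2) powr - ?p) * ennreal (r k n powr ?p)"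
          proof (cases "ball (z k n) (r k n) \<inter> A = {}")
            case False
            then obtain a where a: "a \<in> A" "dist (z k n) a < r k n" by auto
            have "D / 2 \<le> dist x (z k n)" using D(2)[OF a(1)] a(2) r(2)[of k n] dist_triangle[of x a "z k n"] by linarith
            then have "kern x (z k n) \<le> ennreal ((D / 2) powr (\<alpha> - real DIM('a)))" using D(1) by (intro riesz_kernel_far) auto
            then have "ennreal (t * c k n) * kern x (z k n) \<le> ennreal (t * r k n powr ?p) * ennreal ((D / 2) powr - ?p)"
              using False by (simp add: c_def mult_left_mono)
            also have "\<dots> = ennreal (t * (D / 2) powr - ?p) * ennreal (r k n powr ?p)"
              using t by (subst (1 2) ennreal_mult[symmetric]) (auto simp: ac_simps)
            finally show ?thesis .
          qed (simp add: c_def)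
        qed
        also have "\<dots> = ennreal (t * (D / 2) powr - ?p) * (\<Sum>n<N. ennreal (r k n powr ?p))" by (rule sum_distrib_left[symmetric])
        also have "\<dots> \<le> ennreal (t * (D / 2) powr - ?p) * ennreal ((D / 2) powr ?p * (1 / 2) ^ Suc k)"
          by (intro mult_left_mono order.trans[OF sum_le_suminf less_imp_le[OF r(4)]]) auto
        also have "\<dots> = ennreal t * ennreal ((1 / 2) ^ Suc k)"
        proof -
          have "(D / 2) powr - ?p * (D / 2) powr ?p = 1" using D(1) by (subst powr_add[symmetric]) simp
          then have "t * (D / 2) powr - ?p * ((D / 2) powr ?p * (1 / 2) ^ Suc k) = t * (1 / 2) ^ Suc k"
            by (simp add: mult.assoc[symmetric]) 
          then show ?thesis using t by (subst (1 2) ennreal_mult[symmetric]) auto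
        qed
        finally show "(\<Sum>n<N. ennreal (t * c k n) * kern x (z k n)) \<le> ennreal t * ennreal ((1 / 2) ^ Suc k)" .
      qed
      also have "\<dots> = ennreal t * ennreal (\<Sum>k<N. (1 / 2) ^ Suc k)" by (subst sum_ennreal[symmetric]) (simp_all only: sum_distrib_left zero_le_power divide_nonneg_nonneg zero_le_one zero_le_numeral)
      also have "\<dots> \<le> ennreal t * ennreal 1"
      proof (intro mult_left_mono ennreal_leI)
        have "(\<Sum>k<N. (1 / 2 :: real) ^ Suc k) \<le> (\<Sum>k. (1 / 2) ^ Suc k)"
          using power_half_series by (intro sum_le_suminf sums_summable) auto
        then show "(\<Sum>k<N. (1 / 2 :: real) ^ Suc k) \<le> 1" using sums_unique[OF power_half_series] by simp
      qed simp
      finally show "pot (\<mu> N) x \<le> ennreal t" by simp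
    qed
    moreover have "reduced \<alpha> u A x \<le> v x" by (rule reduced_le[OF v]) (simp add: vA)
    ultimately show ?thesis by (rule order.trans[rotated])
  qed
  have "reduced \<alpha> u A x = 0" for u
  proof -
    have "reduced \<alpha> u A x \<le> 0 + ennreal t" if "0 < t" for t using red0[OF that, of u] by simp
    then have "reduced \<alpha> u A x \<le> 0" by (rule ennreal_le_epsilon)
    then show ?thesis by simp
  qed
  then have "swept_measure \<alpha> x A = null_measure borel"
    by (intro swept_measure_eqI) auto
  then show ?thesis by simp
qed

theorem unavoidable_imp_not_null:
  fixes A :: "'a set"
  assumes A: "closed A" "\<And>x. emeasure (swept_measure \<alpha> x A) UNIV = 1"
  shows "hausdorff_measure (\<lambda>t. ennreal (t powr (real DIM('a) - \<alpha>))) A \<noteq> 0"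
proof
  assume null: "hausdorff_measure (\<lambda>t. ennreal (t powr (real DIM('a) - \<alpha>))) A = 0"
  have "A \<noteq> UNIV" using alpha_pos alpha_dim by (intro hausdorff_null_not_UNIV[OF _ _ null]) auto
  then obtain x where "x \<notin> A" by blast
  then show False using swept_mass_of_null_set[OF A(1) _ null] A(2)[of x] by simp
qed

end

section \<open>Periodic Cantor sets\<close>

lemma emeasure_lborel_product:
  assumes [measurable]: "\<And>b. b \<in> Basis \<Longrightarrow> S b \<in> sets borel"
  shows "{x::'a::euclidean_space. \<forall>b\<in>Basis. x \<bullet> b \<in> S b} \<in> sets borel"
    and "emeasure lborel {x::'a. \<forall>b\<in>Basis. x \<bullet> b \<in> S b} = (\<Prod>b\<in>Basis. emeasure lborel (S b))"
proof -
  have eq: "{x::'a. \<forall>b\<in>Basis. x \<bullet> b \<in> S b} = (\<Inter>b\<in>Basis. (\<lambda>x. x \<bullet> b) -` S b \<inter> space borel)" by auto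
  show m: "{x::'a. \<forall>b\<in>Basis. x \<bullet> b \<in> S b} \<in> sets borel"
    unfolding eq by (intro sets.finite_INT measurable_sets[of _ borel borel]) auto
  have "emeasure lborel {x::'a. \<forall>b\<in>Basis. x \<bullet> b \<in> S b} = (\<integral>\<^sup>+ x. indicator {x::'a. \<forall>b\<in>Basis. x \<bullet> b \<in> S b} x \<partial>lborel)"
    using m by simp
  also have "\<dots> = (\<integral>\<^sup>+ x. (\<Prod>b\<in>Basis. indicator (S b) (x \<bullet> b)) \<partial>(lborel :: 'a measure))"
    by (intro nn_integral_cong) (auto simp: indicator_def prod_eq_1_iff split: if_splits)
  also have "\<dots> = (\<Prod>b\<in>Basis. \<integral>\<^sup>+ u. indicator (S b) u \<partial>lborel)"
    by (rule nn_integral_lborel_prod) auto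
  also have "\<dots> = (\<Prod>b\<in>Basis. emeasure lborel (S b))" by (intro prod.cong) auto
  finally show "emeasure lborel {x::'a. \<forall>b\<in>Basis. x \<bullet> b \<in> S b} = (\<Prod>b\<in>Basis. emeasure lborel (S b))" .
qed

lemma ennreal_of_nat_times: "0 \<le> x \<Longrightarrow> of_nat n * ennreal x = ennreal (real n * x)"
  by (simp add: ennreal_mult ennreal_of_nat_eq_real_of_nat)

text \<open>At level `l` the line is divided into blocks of length `s l = M l * t l`, and each block contains
  one closed interval of length `t l`. Each of these intervals consists of `N l` blocks of level
  `l + 1`. So an interval of level 0 contains `cnt l` intervals of level `l`. The condition
  `growth` makes the `d`-dimensional number of subcells exceed twice the one of a set of dimension
  `d - \<alpha>`. The set is the `d`-fold product, periodic with period 3.\<close>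

locale cantor = riesz \<alpha> TA for \<alpha> and TA :: "'a::euclidean_space itself" +
  fixes N M :: "nat \<Rightarrow> nat" and t :: "nat \<Rightarrow> real" and cnt :: "nat \<Rightarrow> nat"
  assumes M3: "\<And>l. 3 \<le> M l" and M0: "M 0 = 3" and N1: "\<And>l. 1 \<le> N l"
    and t0: "t 0 = 1" and tS: "\<And>l. t (Suc l) = t l / (real (N l) * real (M (Suc l)))"
    and cnt0: "cnt 0 = 1" and cntS: "\<And>l. cnt (Suc l) = cnt l * N l"
    and growth: "\<And>l. 2 * (real (N l) * real (M (Suc l))) powr (real DIM('a) - \<alpha>) \<le> real (N l) ^ DIM('a)"
begin

definition s :: "nat \<Rightarrow> real" where "s l = real (M l) * t l"

lemma tpos: "0 < t l"
proof (induction l)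
  case (Suc l)
  have "0 < real (N l)" "0 < real (M (Suc l))" using N1[of l] M3[of "Suc l"] by simp_all
  with Suc show ?case by (simp add: tS)
qed (simp add: t0)

lemma spos: "0 < s l" and s3: "3 * t l \<le> s l"
  using tpos[of l] M3[of l] by (auto simp: s_def)

lemma sS: "t l = real (N l) * s (Suc l)"
proof -
  have "0 < real (N l)" "0 < real (M (Suc l))" using N1[of l] M3[of "Suc l"] by simp_all
  then show ?thesis by (simp add: s_def tS)
qed

lemma cnt_pos: "0 < cnt l"
  by (induction l) (use N1 in \<open>auto simp: cnt0 cntS Suc_le_eq\<close>)

text \<open>The interval sits off both ends of its block: as `M l \<ge> 3`, a gap of length at least `t l` remains
  on each side.\<close>

definition J :: "nat \<Rightarrow> int \<Rightarrow> real set" where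
  "J l k = {real_of_int k * s l + t l .. real_of_int k * s l + 2 * t l}"

definition C :: "nat \<Rightarrow> real set" where "C l = (\<Union>k. J l k)"

lemma CE: assumes "x \<in> C l" obtains k where "x \<in> J l k"
  using assms by (auto simp: C_def)

lemma J_unique: assumes "x \<in> J l k" "x \<in> J l k'" shows "k = k'"
proof -
  have "real_of_int k * s l < (real_of_int k' + 1) * s l" "real_of_int k' * s l < (real_of_int k + 1) * s l"
    using assms s3[of l] tpos[of l] by (auto simp: J_def algebra_simps)
  then have "real_of_int k < real_of_int k' + 1" "real_of_int k' < real_of_int k + 1"
    using spos[of l] by (simp_all add: mult_less_cancel_right_pos)
  then show ?thesis by linarith
qed

definition child :: "nat \<Rightarrow> int \<Rightarrow> int set" where
  "child l k = {(k * int (M l) + 1) * int (N l) ..< (k * int (M l) + 1) * int (N l) + int (N l)}"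

lemma child_left: "real_of_int ((k * int (M l) + 1) * int (N l)) * s (Suc l) = real_of_int k * s l + t l"
proof -
  have "real_of_int ((k * int (M l) + 1) * int (N l)) * s (Suc l) = (real_of_int k * real (M l) + 1) * (real (N l) * s (Suc l))"
    by (simp add: ac_simps)
  also have "\<dots> = (real_of_int k * real (M l) + 1) * t l" by (simp add: sS[symmetric])
  finally show ?thesis by (simp add: s_def algebra_simps)
qed

lemma child_subset: assumes "k' \<in> child l k" shows "J (Suc l) k' \<subseteq> J l k"
proof
  fix x assume x: "x \<in> J (Suc l) k'"
  let ?c = "(k * int (M l) + 1) * int (N l)"
  have "real_of_int ?c * s (Suc l) \<le> real_of_int k' * s (Suc l)"
    using assms spos[of "Suc l"] by (intro mult_right_mono) (simp_all only: child_def atLeastLessThan_iff of_int_le_iff less_imp_le)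
  moreover have "(real_of_int k' + 1) * s (Suc l) \<le> (real_of_int ?c + real (N l)) * s (Suc l)"
  proof (rule mult_right_mono)
    have "k' + 1 \<le> ?c + int (N l)" using assms unfolding child_def by simp
    then show "real_of_int k' + 1 \<le> real_of_int ?c + real (N l)" by linarith
  qed (use spos[of "Suc l"] in simp)
  moreover have "(real_of_int ?c + real (N l)) * s (Suc l) = real_of_int k * s l + 2 * t l"
    using child_left[of k l] sS[of l] by (simp add: distrib_right)
  ultimately show "x \<in> J l k"
    using x child_left[of k l] s3[of "Suc l"] tpos[of "Suc l"] unfolding J_def atLeastAtMost_iff distrib_right by linarith
qed

lemma child_mem: assumes "x \<in> J l k" "x \<in> J (Suc l) k'" shows "k' \<in> child l k"
proof -
  let ?c = "(k * int (M l) + 1) * int (N l)"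
  have up: "(real_of_int ?c + real (N l)) * s (Suc l) = real_of_int k * s l + 2 * t l"
    using child_left[of k l] sS[of l] by (simp add: distrib_right)
  have "real_of_int ?c * s (Suc l) < (real_of_int k' + 1) * s (Suc l)"
    using assms child_left[of k l] s3[of "Suc l"] tpos[of "Suc l"] unfolding J_def atLeastAtMost_iff distrib_right by linarith
  moreover have "real_of_int k' * s (Suc l) < (real_of_int ?c + real (N l)) * s (Suc l)"
    using assms up tpos[of "Suc l"] unfolding J_def atLeastAtMost_iff by linarith
  ultimately have "real_of_int ?c < real_of_int k' + 1" "real_of_int k' < real_of_int ?c + real (N l)"
    using spos[of "Suc l"] by (simp_all only: mult_less_cancel_right_pos)
  then have "?c < k' + 1" "k' < ?c + int (N l)" by linarith+
  then show ?thesis unfolding child_def by simp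
qed

lemma C_closed: "closed (C l)"
proof -
  have "- C l = (\<Union>k::int. {real_of_int k * s l + 2 * t l <..< (real_of_int k + 1) * s l + t l})"
  proof safe
    fix x assume x: "x \<notin> C l"
    define k where "k = \<lfloor>(x - t l) / s l\<rfloor>"
    have "real_of_int k \<le> (x - t l) / s l" "(x - t l) / s l < real_of_int k + 1" by (auto simp: k_def)
    then have 1: "real_of_int k * s l + t l \<le> x" "x < (real_of_int k + 1) * s l + t l"
      using spos[of l] by (simp_all add: field_simps)
    moreover have "x \<notin> J l k" using x by (auto simp: C_def)
    ultimately show "x \<in> (\<Union>k::int. {real_of_int k * s l + 2 * t l <..< (real_of_int k + 1) * s l + t l})"
      by (auto simp: J_def intro!: exI[of _ k])
  next
    fix x k assume x: "x \<in> {real_of_int k * s l + 2 * t l <..< (real_of_int k + 1) * s l + t l}" "x \<in> C l"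
    then obtain k' where k': "x \<in> J l k'" by (auto elim: CE)
    have "real_of_int k * s l < real_of_int k' * s l" "real_of_int k' * s l < (real_of_int k + 1) * s l"
      using x(1) k' by (auto simp: J_def)
    then have "real_of_int k < real_of_int k'" "real_of_int k' < real_of_int k + 1"
      using spos[of l] by (simp_all add: mult_less_cancel_right_pos)
    then have "k < k'" "k' < k + 1" by linarith+
    then show False by simp
  qed
  then have "open (- C l)" by (simp add: open_UN)
  then show ?thesis by (simp add: closed_def)
qed

definition S :: "nat \<Rightarrow> nat \<Rightarrow> real set" where
  "S l i = {x. \<forall>l'. l < l' \<and> l' \<le> i \<longrightarrow> x \<in> C l'}"

lemma S_eq_INT: "S l i = (\<Inter>l'\<in>{l<..i}. C l')" by (auto simp: S_def)

lemma S_closed: "closed (S l i)" unfolding S_eq_INT by (intro closed_INT ballI C_closed)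

lemma J_closed: "closed (J l k)" by (simp add: J_def)

lemma S_measurable[measurable]: "S l i \<in> sets borel" "J l k \<in> sets borel"
  using S_closed[of l i] by (auto simp: J_def)

lemma J_mass: "l \<le> i \<Longrightarrow> emeasure lborel (J l k \<inter> S l i) = ennreal (real (cnt i) * t i / real (cnt l))"
proof (induction l arbitrary: k rule: inc_induct)
  case base
  have "S i i = UNIV" by (auto simp: S_def)
  then show ?case using cnt_pos[of i] tpos[of i] by (simp add: J_def)
next
  case (step l)
  have eq: "J l k \<inter> S l i = (\<Union>k'\<in>child l k. J (Suc l) k' \<inter> S (Suc l) i)"
  proof (intro equalityI subsetI)
    fix x assume x: "x \<in> J l k \<inter> S l i"
    then have "x \<in> C (Suc l)" using step.hyps by (auto simp: S_def)
    then obtain k' where k': "x \<in> J (Suc l) k'" by (rule CE)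
    then have "k' \<in> child l k" using x child_mem by blast
    moreover have "x \<in> S (Suc l) i" using x by (auto simp: S_def)
    ultimately show "x \<in> (\<Union>k'\<in>child l k. J (Suc l) k' \<inter> S (Suc l) i)" using k' by blast
  next
    fix x assume "x \<in> (\<Union>k'\<in>child l k. J (Suc l) k' \<inter> S (Suc l) i)"
    then obtain k' where k': "k' \<in> child l k" "x \<in> J (Suc l) k'" "x \<in> S (Suc l) i" by blast
    have "x \<in> C l'" if "l < l'" "l' \<le> i" for l'
    proof (cases "l' = Suc l")
      case True then show ?thesis using k'(2) by (auto simp: C_def)
    qed (use that k'(3) in \<open>auto simp: S_def\<close>)
    then show "x \<in> J l k \<inter> S l i" using child_subset[OF k'(1)] k'(2) by (auto simp: S_def)
  qed
  have fin: "finite (child l k)" by (simp add: child_def)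
  have card: "card (child l k) = N l" by (simp add: child_def)
  have "emeasure lborel (J l k \<inter> S l i) = (\<Sum>k'\<in>child l k. emeasure lborel (J (Suc l) k' \<inter> S (Suc l) i))"
    unfolding eq
    by (rule sum_emeasure[symmetric]) (use fin in \<open>auto simp: disjoint_family_on_def dest: J_unique\<close>)
  also have "\<dots> = (\<Sum>k'\<in>child l k. ennreal (real (cnt i) * t i / real (cnt (Suc l))))"
    by (intro sum.cong refl step.IH)
  also have "\<dots> = ennreal (real (N l) * (real (cnt i) * t i / real (cnt (Suc l))))"
    using tpos[of i] by (simp only: card sum_constant, intro ennreal_of_nat_times) simp
  also have "real (N l) * (real (cnt i) * t i / real (cnt (Suc l))) = real (cnt i) * t i / real (cnt l)"
    using N1[of l] by (simp add: cntS)
  finally show ?case .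
qed

text \<open>An interval of length `2 r` meets at most `2 + 2 r / s l` intervals of level `l`.\<close>

lemma interval_mass:
  assumes l: "j < l" "l \<le> i" and r: "0 \<le> r"
  shows "emeasure lborel ({y - r .. y + r} \<inter> (J j k \<inter> S j i)) \<le> ennreal ((2 + 2 * r / s l) * (real (cnt i) * t i / real (cnt l)))"
proof -
  define a where "a = (y - r - 2 * t l) / s l"
  define b where "b = (y + r - t l) / s l"
  define K where "K = {\<lceil>a\<rceil>..\<lfloor>b\<rfloor>}"
  have sub: "{y - r .. y + r} \<inter> (J j k \<inter> S j i) \<subseteq> (\<Union>k'\<in>K. J l k' \<inter> S l i)"
  proof
    fix x assume x: "x \<in> {y - r .. y + r} \<inter> (J j k \<inter> S j i)"
    then have "x \<in> C l" using l by (auto simp: S_def)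
    then obtain k' where k': "x \<in> J l k'" by (rule CE)
    have "a \<le> real_of_int k'" "real_of_int k' \<le> b"
      using x k' spos[of l] by (auto simp: a_def b_def J_def divide_le_eq le_divide_eq)
    then have "k' \<in> K" by (simp add: K_def ceiling_le_iff le_floor_iff)
    moreover have "x \<in> S l i" using x l by (auto simp: S_def)
    ultimately show "x \<in> (\<Union>k'\<in>K. J l k' \<inter> S l i)" using k' by blast
  qed
  have card: "real (card K) \<le> 2 + 2 * r / s l"
  proof -
    have "b - a = (2 * r + t l) / s l" by (simp add: a_def b_def diff_divide_distrib[symmetric])
    also have "\<dots> \<le> (2 * r + s l) / s l" using s3[of l] tpos[of l] spos[of l] by (intro divide_right_mono) auto
    also have "\<dots> = 2 * r / s l + 1" using spos[of l] by (simp add: add_divide_distrib)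
    finally have ba: "b - a \<le> 2 * r / s l + 1" .
    have "0 \<le> 2 * r / s l" using r spos[of l] by simp
    moreover have "real (card K) \<le> max 0 (b - a + 1)" unfolding K_def by (simp, linarith)
    ultimately show ?thesis using ba by linarith
  qed
  have "emeasure lborel ({y - r .. y + r} \<inter> (J j k \<inter> S j i)) \<le> emeasure lborel (\<Union>k'\<in>K. J l k' \<inter> S l i)"
    by (intro emeasure_mono sub) (auto intro!: sets.finite_UN simp: K_def)
  also have "\<dots> \<le> (\<Sum>k'\<in>K. emeasure lborel (J l k' \<inter> S l i))"
    by (intro emeasure_subadditive_finite) (auto simp: K_def)
  also have "\<dots> = ennreal (real (card K) * (real (cnt i) * t i / real (cnt l)))"
    using l tpos[of i] by (simp only: J_mass sum_constant, intro ennreal_of_nat_times) simp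
  also have "\<dots> \<le> ennreal ((2 + 2 * r / s l) * (real (cnt i) * t i / real (cnt l)))"
    using tpos[of i] by (intro ennreal_leI mult_right_mono card) auto
  finally show ?thesis .
qed

definition cell :: "nat \<Rightarrow> ('a \<Rightarrow> int) \<Rightarrow> 'a set" where
  "cell l k = {x. \<forall>b\<in>Basis. x \<bullet> b \<in> J l (k b)}"

definition Q :: "nat \<Rightarrow> ('a \<Rightarrow> int) \<Rightarrow> nat \<Rightarrow> 'a set" where
  "Q j k i = {x. \<forall>b\<in>Basis. x \<bullet> b \<in> J j (k b) \<inter> S j i}"

definition A :: "'a set" where
  "A = {x. \<forall>l. \<forall>b\<in>Basis. x \<bullet> b \<in> C l}"

lemma coord_closed: "(\<And>b. b \<in> Basis \<Longrightarrow> closed (F b)) \<Longrightarrow> closed {x::'a. \<forall>b\<in>Basis. x \<bullet> b \<in> F b}"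
proof -
  assume F: "\<And>b. b \<in> Basis \<Longrightarrow> closed (F b)"
  have "{x::'a. \<forall>b\<in>Basis. x \<bullet> b \<in> F b} = (\<Inter>b\<in>Basis. (\<lambda>x. x \<bullet> b) -` F b)" by auto
  also have "closed \<dots>" using F by (intro closed_INT ballI closed_vimage continuous_intros) auto
  finally show ?thesis .
qed

lemma Q_closed: "closed (Q j k i)"
  unfolding Q_def by (intro coord_closed closed_Int J_closed S_closed)

lemma cell_closed: "closed (cell l k)"
  unfolding cell_def by (intro coord_closed J_closed)

lemma A_closed: "closed A"
proof -
  have "A = (\<Inter>l. {x. \<forall>b\<in>Basis. x \<bullet> b \<in> C l})" by (auto simp: A_def)
  also have "closed \<dots>" by (intro closed_INT ballI coord_closed C_closed)
  finally show ?thesis .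
qed

lemma Q_decreasing: "i \<le> i' \<Longrightarrow> Q j k i' \<subseteq> Q j k i"
  by (auto simp: Q_def S_def)

lemma Q_mass:
  assumes "j \<le> i" shows "emeasure lborel (Q j k i) = ennreal ((real (cnt i) * t i / real (cnt j)) ^ DIM('a))"
  unfolding Q_def using assms tpos[of i]
  by (subst emeasure_lborel_product(2)) (auto simp: J_mass ennreal_power)

lemma cell_dist: assumes "x \<in> cell l k" "y \<in> cell l k" shows "dist x y \<le> real DIM('a) * t l"
proof -
  have "dist x y \<le> (\<Sum>b\<in>Basis. \<bar>(x - y) \<bullet> b\<bar>)" unfolding dist_norm by (rule norm_le_l1)
  also have "\<dots> \<le> (\<Sum>b\<in>(Basis::'a set). t l)"
    using assms by (intro sum_mono) (force simp: cell_def J_def inner_diff_left abs_le_iff)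
  finally show ?thesis by simp
qed

lemma cell_compact: "compact (cell l k)"
proof (cases "cell l k = {}")
  case False
  then obtain x where "x \<in> cell l k" by blast
  then have "cell l k \<subseteq> cball x (real DIM('a) * t l)" using cell_dist by auto
  then show ?thesis using cell_closed bounded_subset[OF bounded_cball] by (simp add: compact_eq_bounded_closed)
qed simp

lemma nested_cell:
  assumes a: "a \<in> J j k" "\<And>l. l \<le> j \<Longrightarrow> a \<in> C l" and l: "l \<le> j"
  shows "\<exists>k'. a \<in> J l k' \<and> J j k \<subseteq> J l k'"
  using l
proof (induction l rule: inc_induct)
  case (step l)
  then obtain k' where k': "a \<in> J (Suc l) k'" "J j k \<subseteq> J (Suc l) k'" by blast
  obtain k'' where k'': "a \<in> J l k''" using a(2)[of l] step.hyps by (auto elim: CE)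
  have "J (Suc l) k' \<subseteq> J l k''" by (rule child_subset[OF child_mem[OF k'' k'(1)]])
  then show ?case using k' k'' by blast
qed (use a in blast)

text \<open>The order of magnitude of the potential that one cell of level `l`, with its share `cnt l ^ (-d)`
  of a unit mass, produces near itself. By `growth` it at least halves from level to level.\<close>

definition T :: "nat \<Rightarrow> real" where
  "T l = t l powr (\<alpha> - real DIM('a)) / real (cnt l) ^ DIM('a)"

lemma T_pos: "0 < T l" using tpos[of l] cnt_pos[of l] by (simp add: T_def)

lemma T_halves: "2 * T (Suc l) \<le> T l"
proof -
  let ?p = "real DIM('a) - \<alpha>"
  define R where "R = real (N l) * real (M (Suc l))"
  have R: "0 < R" using N1[of l] M3[of "Suc l"] by (simp add: R_def)
  have "t (Suc l) powr (- ?p) = t l powr (- ?p) * R powr ?p"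
    using R tpos[of l] powr_minus_divide[of R "- ?p"] by (simp add: tS R_def[symmetric] powr_divide del: powr_minus)
  then have "2 * T (Suc l) = t l powr (- ?p) * (2 * R powr ?p) / (real (cnt l) ^ DIM('a) * real (N l) ^ DIM('a))"
    by (simp add: T_def cntS power_mult_distrib)
  also have "\<dots> \<le> t l powr (- ?p) * real (N l) ^ DIM('a) / (real (cnt l) ^ DIM('a) * real (N l) ^ DIM('a))"
    using growth[of l] by (intro divide_right_mono mult_left_mono) (auto simp: R_def)
  also have "\<dots> = T l" using N1[of l] by (simp add: T_def)
  finally show ?thesis .
qed

lemma T_decay: "T (j + n) \<le> T j * (1 / 2) ^ n"
proof (induction n)
  case (Suc n)
  have "T (j + Suc n) \<le> T (j + n) / 2" using T_halves[of "j + n"] by simp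
  also have "\<dots> \<le> T j * (1 / 2) ^ n / 2" using Suc by (intro divide_right_mono) auto
  finally show ?case by simp
qed simp

lemma T_sum: "(\<Sum>l\<in>{j..<i}. T l) \<le> 2 * T j"
proof (cases "j \<le> i")
  case True
  have "(\<Sum>l\<in>{j..<i}. T l) = (\<Sum>n<i - j. T (j + n))"
    using sum.shift_bounds_nat_ivl[of T 0 j "i - j"] True by (simp add: atLeast0LessThan add.commute)
  also have "\<dots> \<le> (\<Sum>n<i - j. T j * (1 / 2) ^ n)" by (intro sum_mono T_decay)
  also have "\<dots> = T j * (\<Sum>n<i - j. (1 / 2) ^ n)" by (simp add: sum_distrib_left)
  also have "\<dots> \<le> T j * 2"
  proof (rule mult_left_mono)
    have "(\<Sum>n<i - j. (1 / 2 :: real) ^ n) \<le> (\<Sum>n. (1 / 2) ^ n)" by (intro sum_le_suminf summable_geometric) auto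
    also have "\<dots> = 2" by (subst suminf_geometric) auto
    finally show "(\<Sum>n<i - j. (1 / 2 :: real) ^ n) \<le> 2" .
  qed (use T_pos[of j] in simp)
  finally show ?thesis by simp
qed (use T_pos[of j] in simp)

end

section \<open>Potentials of uniform measures on Cantor cells\<close>

lemma nn_integral_powr_tail':
  fixes q c :: real
  assumes "0 < q" "0 < c"
  shows "(\<integral>\<^sup>+ r. ennreal (r powr (- q - 1)) * indicator {c..} r \<partial>lborel) = ennreal (c powr (- q) / q)"
  using assms by (subst nn_integral_powr_tail) auto

context cantor
begin

lemma codim_pos: "0 < (real DIM('a) - \<alpha>)" using alpha_dim by simp

lemma t_small: "t l \<le> (1 / 3) ^ l"
proof (induction l)
  case (Suc l)
  have "1 * 3 \<le> real (N l) * real (M (Suc l))" using N1[of l] M3[of "Suc l"] by (intro mult_mono) auto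
  then have "t (Suc l) \<le> t l / 3" using tpos[of l] unfolding tS by (intro divide_left_mono) auto
  with Suc show ?case by simp
qed (simp add: t0)

text \<open>Two bounds for the mass in a ball of radius `r`, up to constants: a single cell of level `l`,
  relevant if `r` exceeds `t l` but not the spacing `s l`, and the mass of one cell spread
  uniformly, relevant if `r` is between `s (Suc l)` and `t l`. Extending them to all `r \<ge> t l` and
  all `r \<le> t l` makes the integral in `g_integral` explicit.\<close>

definition g :: "nat \<Rightarrow> real \<Rightarrow> real" where
  "g l r = indicator {t l..} r / real (cnt l) ^ DIM('a) + indicator {0..t l} r * (r / (real (cnt l) * t l)) ^ DIM('a)"

lemma g_nonneg: "0 \<le> g l r"
  using tpos[of l] by (auto simp: g_def indicator_def)

lemma g_measurable[measurable]: "g l \<in> borel_measurable borel"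
  unfolding g_def[abs_def] by measurable

text \<open>The weight in the layer-cake formula `dist^(\<alpha> - d) = \<integral> w(r) [dist \<le> r] dr`.\<close>

definition w :: "real \<Rightarrow> ennreal" where
  "w r = ennreal ((real DIM('a) - \<alpha>) * r powr (- (real DIM('a) - \<alpha>) - 1)) * indicator {0<..} r"

lemma w_measurable[measurable]: "w \<in> borel_measurable borel"
  unfolding w_def[abs_def] by measurable

lemma g_integral: "(\<integral>\<^sup>+ r. w r * ennreal (g l r) \<partial>lborel) = ennreal (real DIM('a) / \<alpha> * T l)"
proof -
  let ?a = "(real DIM('a) - \<alpha>) / real (cnt l) ^ DIM('a)" and ?b = "(real DIM('a) - \<alpha>) / (real (cnt l) * t l) ^ DIM('a)"
  have ab: "0 \<le> ?a" "0 \<le> ?b" using codim_pos tpos[of l] by (auto intro!: divide_nonneg_nonneg)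
  have eq: "w r * ennreal (g l r) =
      ennreal ?a * (ennreal (r powr (- (real DIM('a) - \<alpha>) - 1)) * indicator {t l..} r) + ennreal ?b * (ennreal (r powr (\<alpha> - 1)) * indicator {0..t l} r)" for r
  proof (cases "0 < r")
    case True
    have "r powr (- (real DIM('a) - \<alpha>) - 1) * r ^ DIM('a) = r powr (\<alpha> - 1)"
      using True by (simp add: powr_realpow[of r "DIM('a)", symmetric] powr_add[symmetric])
    then have pw: "(real DIM('a) - \<alpha>) * r powr (- (real DIM('a) - \<alpha>) - 1) * (r / (real (cnt l) * t l)) ^ DIM('a) = ?b * r powr (\<alpha> - 1)"
      by (simp add: power_divide mult.assoc)
    have "(real DIM('a) - \<alpha>) * r powr (- (real DIM('a) - \<alpha>) - 1) * g l r = ?a * r powr (- (real DIM('a) - \<alpha>) - 1) * indicator {t l..} r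
        + ?b * r powr (\<alpha> - 1) * indicator {0..t l} r"
      unfolding g_def distrib_left pw[symmetric] by simp
    then show ?thesis
      using True codim_pos ab g_nonneg[of l r]
      by (auto simp: w_def ennreal_mult[symmetric] ennreal_plus[symmetric] indicator_def simp del: ennreal_plus)
  next
    case False
    then show ?thesis using tpos[of l] by (cases "r = 0") (auto simp: w_def)
  qed
  have e2: "ennreal a * ennreal u + ennreal b * ennreal v = ennreal (a * u + b * v)" if "0 \<le> a" "0 \<le> u" "0 \<le> b" "0 \<le> v" for a b u v
    using that by (simp add: ennreal_mult)
  have "(\<integral>\<^sup>+ r. w r * ennreal (g l r) \<partial>lborel)
      = ennreal ?a * ennreal (t l powr (- (real DIM('a) - \<alpha>)) / (real DIM('a) - \<alpha>)) + ennreal ?b * ennreal (t l powr (\<alpha> - 1 + 1) / (\<alpha> - 1 + 1))"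
    unfolding eq using codim_pos alpha_pos tpos[of l]
    by (simp add: nn_integral_add nn_integral_cmult nn_integral_powr_tail'[OF codim_pos tpos, simplified minus_diff_eq] nn_integral_powr_head)
  also have "\<dots> = ennreal (?a * (t l powr (- (real DIM('a) - \<alpha>)) / (real DIM('a) - \<alpha>)) + ?b * (t l powr \<alpha> / \<alpha>))"
    unfolding diff_add_cancel using ab codim_pos alpha_pos tpos[of l] by (intro e2) auto
  also have "?a * (t l powr (- (real DIM('a) - \<alpha>)) / (real DIM('a) - \<alpha>)) + ?b * (t l powr \<alpha> / \<alpha>) = real DIM('a) / \<alpha> * T l"
  proof -
    have "t l powr \<alpha> = t l powr (\<alpha> - real DIM('a)) * t l ^ DIM('a)"
      using tpos[of l] by (simp add: powr_realpow[of "t l" "DIM('a)", symmetric] powr_add[symmetric])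
    then have "?b * (t l powr \<alpha> / \<alpha>) = (real DIM('a) - \<alpha>) / \<alpha> * T l"
      unfolding T_def power_mult_distrib minus_diff_eq using tpos[of l] by simp
    moreover have "?a * (t l powr (- (real DIM('a) - \<alpha>)) / (real DIM('a) - \<alpha>)) = T l" using codim_pos by (simp add: T_def)
    moreover have "T l + (real DIM('a) - \<alpha>) / \<alpha> * T l = real DIM('a) / \<alpha> * T l" using alpha_pos by (simp add: field_simps)
    ultimately show ?thesis by simp
  qed
  finally show ?thesis .
qed

text \<open>Bounds the fraction of a cell of level `j`, approximated to level `i`, that lies in a ball of
  radius `r`.\<close>

definition H :: "nat \<Rightarrow> nat \<Rightarrow> real \<Rightarrow> real" where
  "H j i r = 4 ^ DIM('a) * real (cnt j) ^ DIM('a) * (\<Sum>l\<in>{j..<Suc i}. g l r)"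

lemma H_ge:
  assumes "j \<le> l" "l \<le> i" "x ^ DIM('a) \<le> 4 ^ DIM('a) * real (cnt j) ^ DIM('a) * g l r"
  shows "x ^ DIM('a) \<le> H j i r"
proof -
  have "g l r \<le> (\<Sum>l\<in>{j..<Suc i}. g l r)" using assms by (intro member_le_sum g_nonneg) auto
  then have "4 ^ DIM('a) * real (cnt j) ^ DIM('a) * g l r \<le> H j i r"
    unfolding H_def by (intro mult_left_mono) auto
  with assms(3) show ?thesis by simp
qed

lemma scale_between:
  assumes "j \<le> i" "t i < r" "r < t j"
  obtains l where "j \<le> l" "Suc l \<le> i" "t (Suc l) \<le> r" "r \<le> t l"
  using assms
proof (induction i arbitrary: thesis rule: dec_induct)
  case (step i)
  show ?case
  proof (cases "t i < r")
    case True then show ?thesis using step by (metis Suc_leD le_Suc_eq)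
  next
    case False then show ?thesis using step by (intro step.prems(1)[of i]) auto
  qed
qed simp

text \<open>Three one-dimensional estimates for the mass in `[u - r, u + r]` cover all radii: length for `r \<le>
  t i`, total mass for `r \<ge> t j`, and otherwise the count of intervals of the level with `t (Suc
  l) \<le> r \<le> t l`.\<close>

lemma ball_mass:
  assumes ij: "j \<le> i" and r: "0 < r"
  shows "emeasure lborel (Q j k i \<inter> cball y r) \<le> ennreal (H j i r) * emeasure lborel (Q j k i)"
proof -
  define X where "X = real (cnt i) * t i / real (cnt j)"
  have X: "0 \<le> X" using tpos[of i] by (simp add: X_def)
  have "\<exists>\<rho>\<ge>0. \<rho> ^ DIM('a) \<le> H j i r \<and> (\<forall>u v. emeasure lborel ({u - r .. u + r} \<inter> (J j v \<inter> S j i)) \<le> ennreal (\<rho> * X))"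
  proof -
    consider "r \<le> t i" | "t j \<le> r" | "t i < r" "r < t j" by linarith
    then show ?thesis
    proof cases
      case 1
      let ?\<rho> = "real (cnt j) * (2 * r / (real (cnt i) * t i))"
      have "emeasure lborel ({u - r .. u + r} \<inter> (J j v \<inter> S j i)) \<le> ennreal (?\<rho> * X)" for u v
      proof -
        have "emeasure lborel ({u - r .. u + r} \<inter> (J j v \<inter> S j i)) \<le> emeasure lborel {u - r .. u + r}"
          by (intro emeasure_mono) auto
        also have "\<dots> = ennreal (2 * r)" using r by simp
        also have "2 * r = ?\<rho> * X" using tpos[of i] cnt_pos[of i] cnt_pos[of j] by (simp add: X_def)
        finally show ?thesis .
      qed
      moreover have "?\<rho> ^ DIM('a) \<le> H j i r"
      proof (rule H_ge[OF ij order_refl])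
        let ?q = "r / (real (cnt i) * t i)"
        have q: "0 \<le> ?q" using r tpos[of i] by simp
        have "?\<rho> = real (cnt j) * (2 * ?q)" by simp
        then have "?\<rho> ^ DIM('a) = real (cnt j) ^ DIM('a) * (2 * ?q) ^ DIM('a)" by (simp only: power_mult_distrib)
        also have "\<dots> \<le> real (cnt j) ^ DIM('a) * (4 * ?q) ^ DIM('a)" using q by (intro mult_left_mono power_mono mult_right_mono) auto
        also have "\<dots> = 4 ^ DIM('a) * real (cnt j) ^ DIM('a) * ?q ^ DIM('a)" by (simp only: power_mult_distrib ac_simps)
        also have "\<dots> \<le> 4 ^ DIM('a) * real (cnt j) ^ DIM('a) * g i r"
          using 1 r by (intro mult_left_mono) (auto simp: g_def)
        finally show "?\<rho> ^ DIM('a) \<le> 4 ^ DIM('a) * real (cnt j) ^ DIM('a) * g i r" .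
      qed
      moreover have "0 \<le> ?\<rho>" using r tpos[of i] by simp
      ultimately show ?thesis by blast
    next
      case 2
      have "emeasure lborel ({u - r .. u + r} \<inter> (J j v \<inter> S j i)) \<le> ennreal (1 * X)" for u v
        unfolding X_def mult_1 J_mass[OF ij, of v, symmetric] by (intro emeasure_mono) auto
      moreover have "1 ^ DIM('a) \<le> H j i r"
      proof (rule H_ge[OF order_refl ij])
        have "1 \<le> (4::real) ^ DIM('a)" by simp
        also have "\<dots> \<le> 4 ^ DIM('a) * real (cnt j) ^ DIM('a) * g j r"
          using 2 tpos[of j] r cnt_pos[of j] by (auto simp: g_def indicator_def distrib_left)
        finally show "1 ^ DIM('a) \<le> 4 ^ DIM('a) * real (cnt j) ^ DIM('a) * g j r" by simp
      qed
      ultimately show ?thesis by (intro exI[of _ 1]) auto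
    next
      case 3
      then obtain l where l: "j \<le> l" "Suc l \<le> i" "t (Suc l) \<le> r" "r \<le> t l" using scale_between[OF ij] by blast
      let ?\<rho> = "(2 + 2 * r / s (Suc l)) * (real (cnt j) / real (cnt (Suc l)))"
      have "emeasure lborel ({u - r .. u + r} \<inter> (J j v \<inter> S j i)) \<le> ennreal (?\<rho> * X)" for u v
      proof -
        have "?\<rho> * X = (2 + 2 * r / s (Suc l)) * (real (cnt i) * t i / real (cnt (Suc l)))"
          using cnt_pos[of j] by (simp add: X_def)
        then show ?thesis using interval_mass[of j "Suc l" i r u v] l r by (simp only: Suc_le_eq less_Suc_eq_le less_imp_le)
      qed
      moreover have "?\<rho> ^ DIM('a) \<le> H j i r"
      proof (cases "r \<le> s (Suc l)")
        case True
        show ?thesis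
        proof (rule H_ge[of _ "Suc l"])
          have "?\<rho> \<le> 4 * (real (cnt j) / real (cnt (Suc l)))"
            using True spos[of "Suc l"] by (intro mult_right_mono) (auto simp: pos_divide_le_eq)
          then have "?\<rho> ^ DIM('a) \<le> (4 * (real (cnt j) / real (cnt (Suc l)))) ^ DIM('a)"
            using r spos[of "Suc l"] by (intro power_mono) auto
          also have "\<dots> = 4 ^ DIM('a) * real (cnt j) ^ DIM('a) * (1 / real (cnt (Suc l)) ^ DIM('a))"
            by (simp add: power_mult_distrib power_divide)
          also have "\<dots> \<le> 4 ^ DIM('a) * real (cnt j) ^ DIM('a) * g (Suc l) r"
            using l r tpos[of "Suc l"] by (intro mult_left_mono) (auto simp: g_def)
          finally show "?\<rho> ^ DIM('a) \<le> 4 ^ DIM('a) * real (cnt j) ^ DIM('a) * g (Suc l) r" .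
        qed (use l in auto)
      next
        case False
        show ?thesis
        proof (rule H_ge[of _ l])
          have "2 + 2 * r / s (Suc l) \<le> 4 * (r / s (Suc l))"
            using False spos[of "Suc l"] by (simp add: field_simps)
          then have "?\<rho> \<le> 4 * (r / s (Suc l)) * (real (cnt j) / real (cnt (Suc l)))" by (intro mult_right_mono) auto
          also have "\<dots> = 4 * real (cnt j) * (r / (real (cnt l) * t l))" by (simp add: cntS sS[of l] ac_simps)
          finally have "?\<rho> ^ DIM('a) \<le> (4 * real (cnt j) * (r / (real (cnt l) * t l))) ^ DIM('a)"
            using r spos[of "Suc l"] by (intro power_mono) auto
          also have "\<dots> = 4 ^ DIM('a) * real (cnt j) ^ DIM('a) * (r / (real (cnt l) * t l)) ^ DIM('a)"
            by (simp only: power_mult_distrib)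
          also have "\<dots> \<le> 4 ^ DIM('a) * real (cnt j) ^ DIM('a) * g l r"
            using l r by (intro mult_left_mono) (auto simp: g_def)
          finally show "?\<rho> ^ DIM('a) \<le> 4 ^ DIM('a) * real (cnt j) ^ DIM('a) * g l r" .
        qed (use l in auto)
      qed
      moreover have "0 \<le> ?\<rho>" using r spos[of "Suc l"] by simp
      ultimately show ?thesis by blast
    qed
  qed
  then obtain \<rho> where rho: "0 \<le> \<rho>" "\<rho> ^ DIM('a) \<le> H j i r"
    and le: "\<And>u v. emeasure lborel ({u - r .. u + r} \<inter> (J j v \<inter> S j i)) \<le> ennreal (\<rho> * X)" by blast
  let ?F = "\<lambda>b. {y \<bullet> b - r .. y \<bullet> b + r} \<inter> (J j (k b) \<inter> S j i)"
  have "Q j k i \<inter> cball y r \<subseteq> {x. \<forall>b\<in>Basis. x \<bullet> b \<in> ?F b}"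
  proof (intro subsetI CollectI ballI)
    fix x b assume x: "x \<in> Q j k i \<inter> cball y r" and b: "(b :: 'a) \<in> Basis"
    have "\<bar>(y - x) \<bullet> b\<bar> \<le> r" using Basis_le_norm[OF b, of "y - x"] x by (simp add: dist_norm)
    then show "x \<bullet> b \<in> ?F b" using x b by (auto simp: Q_def inner_diff_left)
  qed
  then have "emeasure lborel (Q j k i \<inter> cball y r) \<le> emeasure lborel {x. \<forall>b\<in>Basis. x \<bullet> b \<in> ?F b}"
    by (intro emeasure_mono) (simp_all add: emeasure_lborel_product(1))
  also have "\<dots> = (\<Prod>b\<in>Basis. emeasure lborel (?F b))" by (rule emeasure_lborel_product(2)) auto
  also have "\<dots> \<le> (\<Prod>b\<in>(Basis::'a set). ennreal (\<rho> * X))" by (intro prod_mono_ennreal le)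
  also have "\<dots> = ennreal (\<rho> ^ DIM('a)) * ennreal (X ^ DIM('a))"
    using rho X by (simp add: ennreal_power power_mult_distrib ennreal_mult)
  also have "\<dots> \<le> ennreal (H j i r) * ennreal (X ^ DIM('a))" using rho by (intro mult_right_mono ennreal_leI) auto
  also have "ennreal (X ^ DIM('a)) = emeasure lborel (Q j k i)" using Q_mass[OF ij, of k] by (simp add: X_def)
  finally show ?thesis .
qed

definition C0 :: real where "C0 = 2 * 4 ^ DIM('a) * (real DIM('a) / \<alpha>)"

lemma C0_pos: "0 < C0" using alpha_pos by (simp add: C0_def)

text \<open>By the layer-cake formula the potential is the integral of the ball masses against `w`, hence at
  most a multiple of the sum of the `T l` from `j` on. This sum is dominated by its first term.\<close>

lemma uniform_potential:
  assumes ij: "j \<le> i"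
  shows "pot (uniform_measure lborel (Q j k i)) y \<le> ennreal (C0 * t j powr (\<alpha> - real DIM('a)))"
proof -
  let ?Q = "Q j k i"
  have Qm[measurable]: "?Q \<in> sets borel" using Q_closed by (rule borel_closed)
  have Q: "emeasure lborel ?Q \<noteq> 0" "emeasure lborel ?Q < \<infinity>"
    using Q_mass[OF ij, of k] tpos[of i] cnt_pos[of i] cnt_pos[of j] by auto
  have kern: "kern y x \<le> (\<integral>\<^sup>+ r. w r * indicator {dist y x..} r \<partial>lborel)" if "x \<noteq> y" for x
  proof -
    have d: "0 < dist y x" using that by simp
    have "(\<integral>\<^sup>+ r. w r * indicator {dist y x..} r \<partial>lborel) = (\<integral>\<^sup>+ r. ennreal (real DIM('a) - \<alpha>) * (ennreal (r powr (- (real DIM('a) - \<alpha>) - 1)) * indicator {dist y x..} r) \<partial>lborel)"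
      using codim_pos less_le_trans[OF d] by (intro nn_integral_cong) (simp add: w_def indicator_def ennreal_mult)
    also have "\<dots> = ennreal (real DIM('a) - \<alpha>) * ennreal (dist y x powr (- (real DIM('a) - \<alpha>)) / (real DIM('a) - \<alpha>))"
      using d codim_pos by (simp add: nn_integral_cmult nn_integral_powr_tail'[OF codim_pos d, simplified minus_diff_eq])
    also have "\<dots> = ennreal (dist y x powr (- (real DIM('a) - \<alpha>)))" using codim_pos by (simp add: ennreal_mult[symmetric])
    finally show ?thesis using that by (simp add: riesz_kernel_def)
  qed
  have "(\<integral>\<^sup>+ x. kern y x * indicator ?Q x \<partial>lborel) \<le> (\<integral>\<^sup>+ x. (\<integral>\<^sup>+ r. w r * indicator {dist y x..} r * indicator ?Q x \<partial>lborel) \<partial>lborel)"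
  proof (rule nn_integral_mono_AE)
    show "AE x in lborel. kern y x * indicator ?Q x \<le> (\<integral>\<^sup>+ r. w r * indicator {dist y x..} r * indicator ?Q x \<partial>lborel)"
      using AE_lborel_singleton[of y]
    proof eventually_elim
      case (elim x) then show ?case using kern[of x] by (cases "x \<in> ?Q") simp_all
    qed
  qed
  also have "\<dots> = (\<integral>\<^sup>+ x. (\<integral>\<^sup>+ r. w r * indicator {x'. dist y x' \<le> r} x * indicator ?Q x \<partial>lborel) \<partial>lborel)"
    by (intro nn_integral_cong) (auto simp: indicator_def)
  also have "\<dots> = (\<integral>\<^sup>+ r. (\<integral>\<^sup>+ x. w r * indicator {x'. dist y x' \<le> r} x * indicator ?Q x \<partial>lborel) \<partial>lborel)"
    by (intro lborel_pair.Fubini') (unfold indicator_def, measurable)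
  also have "\<dots> \<le> (\<integral>\<^sup>+ r. w r * ennreal (H j i r) * emeasure lborel ?Q \<partial>lborel)"
  proof (rule nn_integral_mono)
    fix r
    have "(\<integral>\<^sup>+ x. w r * indicator {x'. dist y x' \<le> r} x * indicator ?Q x \<partial>lborel) = (\<integral>\<^sup>+ x. w r * indicator (?Q \<inter> cball y r) x \<partial>lborel)"
      by (intro nn_integral_cong) (auto simp: indicator_def)
    also have "\<dots> = w r * emeasure lborel (?Q \<inter> cball y r)" by (subst nn_integral_cmult_indicator) auto
    also have "\<dots> \<le> w r * (ennreal (H j i r) * emeasure lborel ?Q)"
    proof (cases "0 < r")
      case True then show ?thesis by (intro mult_left_mono ball_mass[OF ij]) auto
    qed (simp add: w_def)
    finally show "(\<integral>\<^sup>+ x. w r * indicator {x'. dist y x' \<le> r} x * indicator ?Q x \<partial>lborel) \<le> w r * ennreal (H j i r) * emeasure lborel ?Q"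
      by (simp add: mult.assoc)
  qed
  also have "\<dots> = (\<integral>\<^sup>+ r. w r * ennreal (H j i r) \<partial>lborel) * emeasure lborel ?Q"
    unfolding H_def[abs_def] by (rule nn_integral_multc) measurable
  also have "(\<integral>\<^sup>+ r. w r * ennreal (H j i r) \<partial>lborel) \<le> ennreal (C0 * t j powr (\<alpha> - real DIM('a)))"
  proof -
    let ?c = "4 ^ DIM('a) * real (cnt j) ^ DIM('a)"
    have "(\<integral>\<^sup>+ r. w r * ennreal (H j i r) \<partial>lborel) = (\<integral>\<^sup>+ r. ennreal ?c * (\<Sum>l\<in>{j..<Suc i}. w r * ennreal (g l r)) \<partial>lborel)"
      unfolding H_def by (intro nn_integral_cong) (simp add: ennreal_mult sum_nonneg g_nonneg sum_ennreal[symmetric] sum_distrib_left ac_simps del: sum_ennreal sum.op_ivl_Suc)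
    also have "\<dots> = ennreal ?c * (\<Sum>l\<in>{j..<Suc i}. ennreal (real DIM('a) / \<alpha> * T l))"
      by (subst nn_integral_cmult) (auto simp: nn_integral_sum g_integral simp del: sum.op_ivl_Suc)
    also have "\<dots> = ennreal (?c * (\<Sum>l\<in>{j..<Suc i}. real DIM('a) / \<alpha> * T l))"
      using T_pos alpha_pos by (subst sum_ennreal) (auto simp: ennreal_mult sum_nonneg less_imp_le simp del: sum.op_ivl_Suc)
    also have "\<dots> \<le> ennreal (?c * (real DIM('a) / \<alpha> * (2 * T j)))"
      unfolding sum_distrib_left[symmetric] using alpha_pos T_sum[of j "Suc i"]
      by (intro ennreal_leI mult_left_mono) auto
    also have "?c * (real DIM('a) / \<alpha> * (2 * T j)) = C0 * t j powr (\<alpha> - real DIM('a))"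
      using cnt_pos[of j] by (simp add: C0_def T_def)
    finally show ?thesis .
  qed
  finally have "(\<integral>\<^sup>+ x. kern y x * indicator ?Q x \<partial>lborel) \<le> ennreal (C0 * t j powr (\<alpha> - real DIM('a))) * emeasure lborel ?Q"
    by (simp add: mult_right_mono)
  then have "(\<integral>\<^sup>+ x. kern y x * indicator ?Q x \<partial>lborel) / emeasure lborel ?Q \<le> ennreal (C0 * t j powr (\<alpha> - real DIM('a)))"
    using Q by (intro divide_le_posI_ennreal) (auto simp: ac_simps zero_less_iff_neq_zero)
  then show ?thesis
    unfolding riesz_potential_def by (subst nn_integral_uniform_measure) auto
qed


section \<open>Unavoidability of the Cantor sets\<close>

lemma Q_limit_subset: "(\<Inter>i. Q j k i) \<subseteq> cell j k"
  by (auto simp: Q_def cell_def)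

text \<open>A vague limit of the uniform measures on the approximations to a cell; the cells are compact, so
  no mass is lost.\<close>

lemma cell_measure:
  obtains \<sigma> where "\<sigma> \<in> carried (\<Inter>i. Q j k i)" "emeasure \<sigma> UNIV = 1"
    "\<And>y. pot \<sigma> y \<le> ennreal (C0 * t j powr (\<alpha> - real DIM('a)))"
proof -
  define \<nu> where "\<nu> n = uniform_measure lborel (Q j k (j + n))" for n
  have Qm[measurable]: "Q j k i \<in> sets borel" for i using Q_closed by (rule borel_closed)
  have Q: "emeasure lborel (Q j k (j + n)) \<noteq> 0" "emeasure lborel (Q j k (j + n)) \<noteq> \<infinity>" for n
    using Q_mass[of j "j + n" k] tpos[of "j + n"] cnt_pos[of "j + n"] cnt_pos[of j] by auto
  have nu_sets[measurable_cong]: "sets (\<nu> n) = sets borel" for n by (simp add: \<nu>_def)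
  have nu_prob: "prob_space (\<nu> n)" for n unfolding \<nu>_def by (rule prob_space_uniform_measure[OF Q])
  have nu_space: "space (\<nu> n) = UNIV" for n by (simp add: \<nu>_def)
  have nu1: "emeasure (\<nu> n) UNIV = 1" for n using prob_space.emeasure_space_1[OF nu_prob[of n]] by (simp add: nu_space)
  have nu_fin: "finite_measure (\<nu> n)" for n using nu_prob by (rule prob_space.finite_measure)
  have nu_supp: "emeasure (\<nu> n) (- Q j k i) = 0" if "i \<le> j + n" for n i
  proof -
    have "Q j k (j + n) \<inter> - Q j k i = {}" using Q_decreasing[OF that, of j k] by blast
    then show ?thesis unfolding \<nu>_def by (subst emeasure_uniform_measure) auto
  qed
  have vcx: "\<exists>r \<mu>. strict_mono (r :: nat \<Rightarrow> nat) \<and> sets \<mu> = sets borel \<and> emeasure \<mu> UNIV \<le> ennreal (max 1 1) \<and>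
      (\<forall>f :: 'a \<Rightarrow> real. continuous_on UNIV f \<longrightarrow> (f \<longlongrightarrow> 0) at_infinity \<longrightarrow> (\<lambda>n. \<integral>x. f x \<partial>\<nu> (r n)) \<longlonglongrightarrow> (\<integral>x. f x \<partial>\<mu>))"
    by (rule vague_compactness) (simp_all add: nu_sets nu1)
  then obtain r \<mu> where r: "strict_mono (r :: nat \<Rightarrow> nat)" and sets_mu[measurable_cong]: "sets \<mu> = sets borel" and mass: "emeasure \<mu> UNIV \<le> 1"
    and vague: "\<forall>f :: 'a \<Rightarrow> real. continuous_on UNIV f \<longrightarrow> (f \<longlongrightarrow> 0) at_infinity \<longrightarrow> (\<lambda>n. \<integral>x. f x \<partial>\<nu> (r n)) \<longlonglongrightarrow> (\<integral>x. f x \<partial>\<mu>)"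
    by (elim exE conjE) (rule that, simp_all)
  have fin: "finite_measure \<mu>"
    using mass sets_eq_imp_space_eq[OF sets_mu] by (intro finite_measure_of_bound[of _ 1]) simp
  interpret mu: finite_measure \<mu> by (rule fin)
  have space_mu: "space \<mu> = UNIV" using sets_eq_imp_space_eq[OF sets_mu] by simp
  have supp: "emeasure \<mu> (- Q j k i) = 0" for i
  proof (rule vague_limit_support[of "\<lambda>n. \<nu> (r (n + i))", OF nu_sets sets_mu fin _ Q_closed])
    show "(\<lambda>n. \<integral>x. f x \<partial>\<nu> (r (n + i))) \<longlonglongrightarrow> (\<integral>x. f x \<partial>\<mu>)" if "continuous_on UNIV f" "(f \<longlongrightarrow> 0) at_infinity" for f :: "'a \<Rightarrow> real"
      using vague that by (intro LIMSEQ_ignore_initial_segment[of "\<lambda>n. \<integral>x. f x \<partial>\<nu> (r n)"]) blast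
    show "emeasure (\<nu> (r (n + i))) (- Q j k i) = 0" for n
      using seq_suble[OF r, of "n + i"] by (intro nu_supp) simp
  qed
  have "emeasure \<mu> (- (\<Inter>i. Q j k i)) = emeasure \<mu> (\<Union>i. - Q j k i)" by simp
  also have "\<dots> = 0" using supp by (intro emeasure_UN_eq_0) (auto simp: sets_mu)
  finally have carr: "\<mu> \<in> carried (\<Inter>i. Q j k i)" using sets_mu fin by (simp add: carried_def)
  obtain R where R: "\<And>x. x \<in> cell j k \<Longrightarrow> norm x \<le> R"
    using compact_imp_bounded[OF cell_compact[of j k]] by (auto simp: bounded_iff)
  have AEint: "(\<integral>x. cutoff R x \<partial>M) = measure M UNIV" if M: "sets M = sets borel" "space M = UNIV" "emeasure M (- cell j k) = 0" for M
  proof -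
    have ae: "AE x in M. x \<in> cell j k" using M borel_closed[OF cell_closed[of j k]] by (intro AE_I[of _ _ "- cell j k"]) auto
    have "(\<integral>x. cutoff R x \<partial>M) = (\<integral>x. 1 \<partial>M)"
    proof (rule integral_cong_AE)
      have "cutoff R \<in> borel_measurable borel" by (rule borel_measurable_continuous_onI[OF cutoff_continuous])
      then show "cutoff R \<in> borel_measurable M" by (simp add: measurable_cong_sets[OF M(1) refl])
      show "AE x in M. cutoff R x = 1" using ae by eventually_elim (simp add: cutoff_one R)
    qed simp
    then show ?thesis by (simp add: M(2))
  qed
  have "(\<lambda>n. \<integral>x. cutoff R x \<partial>\<nu> (r n)) \<longlonglongrightarrow> (\<integral>x. cutoff R x \<partial>\<mu>)"
    by (rule vague[rule_format, OF cutoff_continuous]) (use cutoff_vanishes[of "\<lambda>_. 1" R] in simp)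
  moreover have "(\<integral>x. cutoff R x \<partial>\<nu> n) = 1" for n
  proof -
    have "emeasure (\<nu> n) (- cell j k) \<le> emeasure (\<nu> n) (- Q j k j)"
      by (intro emeasure_mono) (auto simp: nu_sets Q_def cell_def)
    then have "emeasure (\<nu> n) (- cell j k) = 0" using nu_supp[of j n] by simp
    from AEint[OF nu_sets nu_space this] show ?thesis by (simp add: measure_def nu1)
  qed
  moreover have "(\<integral>x. cutoff R x \<partial>\<mu>) = measure \<mu> UNIV"
  proof (rule AEint[OF sets_mu space_mu])
    have "emeasure \<mu> (- cell j k) \<le> emeasure \<mu> (- Q j k j)"
      by (intro emeasure_mono) (auto simp: sets_mu Q_def cell_def)
    then show "emeasure \<mu> (- cell j k) = 0" using supp[of j] by simp
  qed
  ultimately have "measure \<mu> UNIV = 1" by (simp add: LIMSEQ_const_iff)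
  then have one: "emeasure \<mu> UNIV = 1" by (simp add: mu.emeasure_eq_measure)
  have "pot \<mu> y \<le> ennreal (C0 * t j powr (\<alpha> - real DIM('a)))" for y
  proof (rule vague_limit_potential[of "\<lambda>n. \<nu> (r n)", OF nu_sets nu_fin sets_mu fin vague])
    show "pot (\<nu> (r n)) y \<le> ennreal (C0 * t j powr (\<alpha> - real DIM('a)))" for n
      unfolding \<nu>_def by (rule uniform_potential) simp
  qed
  with carr one show ?thesis by (rule that)
qed

lemma Q_limit_in_A:
  assumes "a \<in> A" "\<And>b. b \<in> Basis \<Longrightarrow> a \<bullet> b \<in> J j (k b)" "x \<in> (\<Inter>i. Q j k i)"
  shows "x \<in> A"
  unfolding A_def
proof (intro CollectI allI ballI)
  fix l and b :: 'a assume b: "b \<in> Basis"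
  show "x \<bullet> b \<in> C l"
  proof (cases "l \<le> j")
    case True
    have "a \<bullet> b \<in> C l" for l using assms(1) b by (auto simp: A_def)
    from nested_cell[OF assms(2)[OF b] this True] obtain k' where "J j (k b) \<subseteq> J l k'" by blast
    moreover have "x \<bullet> b \<in> J j (k b)" using assms(3) b by (auto simp: Q_def)
    ultimately show ?thesis by (auto simp: C_def)
  next
    case False
    have "x \<in> Q j k l" using assms(3) by blast
    then show ?thesis using False b by (auto simp: Q_def S_def)
  qed
qed

text \<open>The measures carried by the part of the set in a small cell witness fatness, with radius `d * t
  j`. The set `Y` must not cut cells of level 0.\<close>

lemma fat_section:
  assumes Y: "\<And>a k. a \<in> A \<inter> Y \<Longrightarrow> a \<in> cell 0 k \<Longrightarrow> cell 0 k \<subseteq> Y"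
  shows "fat (A \<inter> Y)"
  unfolding fat_def
proof (rule ballI, rule exI[of _ "C0 * real DIM('a) powr (real DIM('a) - \<alpha>)"], intro allI impI)
  fix a and e :: real assume a: "a \<in> A \<inter> Y" and e: "0 < e"
  obtain j where "(1 / 3 :: real) ^ j < e / real DIM('a)" using real_arch_pow_inv[of "e / real DIM('a)" "1 / 3"] e by auto
  then have "real DIM('a) * (1 / 3) ^ j < e" by (simp add: less_divide_eq mult.commute)
  moreover have "real DIM('a) * t j \<le> real DIM('a) * (1 / 3) ^ j" by (intro mult_left_mono t_small) simp
  ultimately have j: "real DIM('a) * t j < e" by linarith
  have "\<exists>k. \<forall>b\<in>Basis. a \<bullet> b \<in> J l (k b)" for l
    using a by (intro bchoice) (auto simp: A_def C_def)
  then obtain K where K: "\<And>l b. b \<in> Basis \<Longrightarrow> a \<bullet> b \<in> J l (K l b)" by metis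
  have aC: "a \<bullet> b \<in> C l" if "b \<in> Basis" for b l using a that by (auto simp: A_def)
  have sub: "(\<Inter>i. Q j (K j) i) \<subseteq> (A \<inter> Y) \<inter> cball a (real DIM('a) * t j)"
  proof (intro subsetI IntI)
    fix x assume x: "x \<in> (\<Inter>i. Q j (K j) i)"
    show "x \<in> A" using a K x by (intro Q_limit_in_A[of a j "K j" x]) auto
    have cells: "x \<in> cell j (K j)" "a \<in> cell j (K j)" using x K Q_limit_subset[of j "K j"] by (auto simp: cell_def)
    then show "x \<in> cball a (real DIM('a) * t j)" using cell_dist[of a j "K j" x] by auto
    have "x \<bullet> b \<in> J 0 (K 0 b)" if b: "b \<in> Basis" for b
    proof -
      obtain k' where k': "a \<bullet> b \<in> J 0 k'" "J j (K j b) \<subseteq> J 0 k'" using nested_cell[OF K[OF b] aC[OF b]] by blast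
      have "k' = K 0 b" using J_unique[OF k'(1) K[OF b]] .
      then show ?thesis using k'(2) cells(1) b by (auto simp: cell_def)
    qed
    then have "x \<in> cell 0 (K 0)" by (auto simp: cell_def)
    moreover have "a \<in> cell 0 (K 0)" using K by (auto simp: cell_def)
    ultimately show "x \<in> Y" using Y[OF a] by blast
  qed
  obtain \<sigma> where sg: "\<sigma> \<in> carried (\<Inter>i. Q j (K j) i)" "emeasure \<sigma> UNIV = 1"
    "\<And>y. pot \<sigma> y \<le> ennreal (C0 * t j powr (\<alpha> - real DIM('a)))" by (rule cell_measure[of j "K j"]) (rule that)
  have Qcl: "closed (\<Inter>i. Q j (K j) i)" using Q_closed by auto
  have "emeasure \<sigma> (- ((A \<inter> Y) \<inter> cball a (real DIM('a) * t j))) \<le> emeasure \<sigma> (- (\<Inter>i. Q j (K j) i))"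
  proof (rule emeasure_mono)
    show "- (\<Inter>i. Q j (K j) i) \<in> sets \<sigma>"
      unfolding carriedD(1)[OF sg(1)] by (intro borel_open open_Compl Qcl)
  qed (use sub in blast)
  then have supp: "emeasure \<sigma> (- ((A \<inter> Y) \<inter> cball a (real DIM('a) * t j))) = 0" using carriedD(3)[OF sg(1)] by simp
  have "t j powr (\<alpha> - real DIM('a)) = real DIM('a) powr (real DIM('a) - \<alpha>) * (real DIM('a) * t j) powr (\<alpha> - real DIM('a))"
    using tpos[of j] by (simp add: powr_mult powr_add[symmetric] mult.assoc[symmetric])
  then have pot: "pot \<sigma> y \<le> ennreal (C0 * real DIM('a) powr (real DIM('a) - \<alpha>) * (real DIM('a) * t j) powr (\<alpha> - real DIM('a)))" for y
    using sg(3)[of y] by (simp add: mult.assoc)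
  show "\<exists>r \<sigma>. 0 < r \<and> r < e \<and> sets \<sigma> = sets borel \<and> emeasure \<sigma> UNIV = 1 \<and> emeasure \<sigma> (- (A \<inter> Y \<inter> cball a r)) = 0 \<and>
     (\<forall>y. pot \<sigma> y \<le> ennreal (C0 * real DIM('a) powr (real DIM('a) - \<alpha>) * r powr (\<alpha> - real DIM('a))))"
    using tpos[of j] j sg(2) supp pot carriedD(1)[OF sg(1)]
    by (intro exI[of _ "real DIM('a) * t j"] exI[of _ \<sigma>]) simp
qed

definition low :: real where "low = (2 * real DIM('a)) powr (\<alpha> - real DIM('a)) / C0"

lemma low_pos: "0 < low" using C0_pos by (simp add: low_def)

text \<open>The total mass of the equilibrium measure `\<tau>` is bounded below by pairing it with the measure `\<sigma>`
  of `cell_measure`: `1 = \<integral> pot \<tau> d\<sigma> = \<integral> pot \<sigma> d\<tau> \<le> C0 * mass \<tau>`. Each point `x` lies within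
  distance `2 d` of a whole cell of level 0, so the potential of `\<tau>` at `x` is at least `low`,
  whatever `x` is.\<close>

lemma cell_equilibrium:
  "\<exists>k. \<exists>\<tau>\<in>carried (A \<inter> cell 0 k). \<exists>V. continuous_on UNIV V \<and>
     (\<forall>y. 0 \<le> V y \<and> V y \<le> 1 \<and> pot \<tau> y = ennreal (V y)) \<and> low \<le> V x"
proof -
  \<comment> \<open>The block of length 3 that contains `x`.\<close>
  define k where "k b = \<lfloor>x \<bullet> b / 3\<rfloor>" for b
  let ?K = "A \<inter> cell 0 k"
  have s0: "s 0 = 3" by (simp add: s_def M0 t0)
  have Kc: "compact ?K" by (intro closed_Int_compact A_closed cell_compact)
  have Kf: "fat ?K"
  proof (rule fat_section)
    fix a k' assume "a \<in> A \<inter> cell 0 k" "a \<in> cell 0 k'"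
    then have "k b = k' b" if "b \<in> Basis" for b using that by (auto simp: cell_def intro: J_unique)
    then show "cell 0 k' \<subseteq> cell 0 k" by (auto simp: cell_def)
  qed
  have one: "supermedian (\<lambda>_. 1)" "lsc (\<lambda>_::'a. 1)" by (auto intro: supermedian_const lsc_continuous)
  have "\<exists>\<tau>\<in>carried ?K. (\<forall>y\<in>?K. pot \<tau> y = 1) \<and> (\<forall>y. pot \<tau> y \<le> 1) \<and>
     (\<exists>V. continuous_on UNIV V \<and> (\<forall>y. 0 \<le> V y \<and> pot \<tau> y = ennreal (V y)))"
    by (rule balayage_exists[OF Kc Kf one, of "\<lambda>_. 1"]) auto
  then obtain \<tau> V where tau: "\<tau> \<in> carried ?K" "\<And>y. y \<in> ?K \<Longrightarrow> pot \<tau> y = 1" "\<And>y. pot \<tau> y \<le> 1"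
    and V: "continuous_on UNIV V" "\<And>y. 0 \<le> V y" "\<And>y. pot \<tau> y = ennreal (V y)"
    by blast
  obtain \<sigma> where sg: "\<sigma> \<in> carried (\<Inter>i. Q 0 k i)" "emeasure \<sigma> UNIV = 1"
    "\<And>y. pot \<sigma> y \<le> ennreal (C0 * t 0 powr (\<alpha> - real DIM('a)))" by (rule cell_measure[of 0 k]) (rule that)
  have Qcl: "closed (\<Inter>i. Q 0 k i)" using Q_closed by auto
  have sub: "(\<Inter>i. Q 0 k i) \<subseteq> ?K"
  proof
    fix x assume x: "x \<in> (\<Inter>i. Q 0 k i)"
    have "x \<bullet> b \<in> C l" if b: "b \<in> Basis" for b l
    proof (cases "l = 0")
      case True then show ?thesis using x b by (auto simp: Q_def C_def)
    next
      case False
      have "x \<in> Q 0 k l" using x by blast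
      then show ?thesis using False b by (auto simp: Q_def S_def)
    qed
    then show "x \<in> ?K" using x Q_limit_subset[of 0 k] by (auto simp: A_def)
  qed
  have "(1::ennreal) = (\<integral>\<^sup>+ y. 1 \<partial>\<sigma>)" using sg(2) carriedD(4)[OF sg(1)] by simp
  also have "\<dots> = (\<integral>\<^sup>+ y. pot \<tau> y \<partial>\<sigma>)"
    using carried_AE[OF sg(1) Qcl]
  proof (intro nn_integral_cong_AE, eventually_elim)
    case (elim y)
    then have "y \<in> ?K" using sub by blast
    then show ?case by (simp add: tau(2))
  qed
  also have "\<dots> = (\<integral>\<^sup>+ y. pot \<sigma> y \<partial>\<tau>)" by (rule mutual_potential[OF tau(1) sg(1)])
  also have "\<dots> \<le> (\<integral>\<^sup>+ y. ennreal C0 \<partial>\<tau>)" using sg(3) by (intro nn_integral_mono) (simp add: t0)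
  also have "\<dots> = ennreal C0 * emeasure \<tau> UNIV" using carriedD(4)[OF tau(1)] by simp
  finally have mass: "1 \<le> ennreal C0 * emeasure \<tau> UNIV" .
  have near: "ennreal ((2 * real DIM('a)) powr (\<alpha> - real DIM('a))) \<le> kern x z" if z: "z \<in> cell 0 k" for z
  proof -
    have "\<bar>(x - z) \<bullet> b\<bar> \<le> 2" if b: "b \<in> Basis" for b
    proof -
      have "real_of_int (k b) * 3 + 1 \<le> z \<bullet> b" "z \<bullet> b \<le> real_of_int (k b) * 3 + 2"
        using z b by (auto simp: cell_def J_def s0 t0)
      moreover have "real_of_int (k b) * 3 \<le> x \<bullet> b" "x \<bullet> b < real_of_int (k b) * 3 + 3"
        unfolding k_def by linarith+
      ultimately show ?thesis by (simp add: inner_diff_left abs_le_iff)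
    qed
    then have "(\<Sum>b\<in>Basis. \<bar>(x - z) \<bullet> b\<bar>) \<le> (\<Sum>b\<in>(Basis::'a set). 2)" by (rule sum_mono)
    then have "dist x z \<le> 2 * real DIM('a)" using norm_le_l1[of "x - z"] by (simp add: dist_norm)
    then show ?thesis
      using alpha_dim by (auto simp: riesz_kernel_def intro!: ennreal_leI powr_mono2')
  qed
  have "ennreal low * 1 \<le> ennreal low * (ennreal C0 * emeasure \<tau> UNIV)" using mass by (rule mult_left_mono) simp
  also have "\<dots> = ennreal (low * C0) * emeasure \<tau> UNIV" using low_pos C0_pos by (simp add: ennreal_mult mult.assoc)
  also have "\<dots> = (\<integral>\<^sup>+ z. ennreal ((2 * real DIM('a)) powr (\<alpha> - real DIM('a))) \<partial>\<tau>)"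
    using C0_pos carriedD(4)[OF tau(1)] by (simp add: low_def)
  also have "\<dots> \<le> pot \<tau> x"
    unfolding riesz_potential_def using carried_AE[OF tau(1) compact_imp_closed[OF Kc]]
    by (intro nn_integral_mono_AE, eventually_elim) (simp add: near)
  finally have "low \<le> V x" using V(2)[of x] by (simp add: V(3) ennreal_le_iff)
  moreover have "V y \<le> 1" for y using tau(3)[of y] V(2)[of y] by (simp add: V(3) ennreal_le_1)
  ultimately show ?thesis using tau(1) V by blast
qed

theorem swept_mass_A: "emeasure (swept_measure \<alpha> x A) UNIV = 1"
proof -
  define Y where "Y n = cbox (- (3 * real n) *\<^sub>R One) ((3 * real n) *\<^sub>R One :: 'a)" for n :: nat
  have Y: "y \<in> Y n \<longleftrightarrow> (\<forall>b\<in>Basis. - 3 * real n \<le> y \<bullet> b \<and> y \<bullet> b \<le> 3 * real n)" for y n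
    by (auto simp: Y_def mem_box)
  have big: "\<exists>n. B \<subseteq> Y n" if B: "bounded B" for B
  proof -
    obtain R where R: "\<And>y. y \<in> B \<Longrightarrow> norm y \<le> R" using B by (auto simp: bounded_iff)
    have "y \<in> Y (nat \<lceil>R\<rceil>)" if y: "y \<in> B" for y
      unfolding Y
    proof
      fix b :: 'a assume "b \<in> Basis"
      then have "\<bar>y \<bullet> b\<bar> \<le> real (nat \<lceil>R\<rceil>)" using Basis_le_norm[of b y] R[OF y] by linarith
      then show "- 3 * real (nat \<lceil>R\<rceil>) \<le> y \<bullet> b \<and> y \<bullet> b \<le> 3 * real (nat \<lceil>R\<rceil>)" by linarith
    qed
    then show ?thesis by blast
  qed
  have un: "(\<Union>n. A \<inter> Y n) = A" using big[of "{y}" for y] by auto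
  have cpt: "compact (A \<inter> Y n)" for n unfolding Y_def by (intro closed_Int_compact A_closed compact_cbox)
  have "emeasure (swept_measure \<alpha> x (\<Union>n. A \<inter> Y n)) UNIV = 1"
  proof (rule swept_mass_one[OF cpt _ _ _ low_pos])
    show "fat (A \<inter> Y n)" for n
    proof (rule fat_section)
      fix a k assume a: "a \<in> A \<inter> Y n" "a \<in> cell 0 k"
      have s0: "s 0 = 3" by (simp add: s_def M0 t0)
      show "cell 0 k \<subseteq> Y n"
        unfolding subset_iff Y
      proof (intro allI impI ballI)
        fix z and b :: 'a assume z: "z \<in> cell 0 k" and b: "b \<in> Basis"
        have "- 3 * real n \<le> a \<bullet> b" "a \<bullet> b \<le> 3 * real n" using a(1) b by (auto simp: Y)
        moreover have "real_of_int (k b) * 3 + 1 \<le> a \<bullet> b" "a \<bullet> b \<le> real_of_int (k b) * 3 + 2"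
          using a(2) b by (auto simp: cell_def J_def s0 t0)
        ultimately have "real_of_int (k b) * 3 + 1 \<le> 3 * real n" "- 3 * real n \<le> real_of_int (k b) * 3 + 2" by linarith+
        then have "k b < int n" "- int n \<le> k b" by linarith+
        then have "real_of_int (k b) + 1 \<le> real n" "- real n \<le> real_of_int (k b)" by linarith+
        moreover have "real_of_int (k b) * 3 + 1 \<le> z \<bullet> b" "z \<bullet> b \<le> real_of_int (k b) * 3 + 2"
          using z b by (auto simp: cell_def J_def s0 t0)
        ultimately show "- 3 * real n \<le> z \<bullet> b \<and> z \<bullet> b \<le> 3 * real n" by linarith
      qed
    qed
    show "incseq (\<lambda>n. A \<inter> Y n)"
      unfolding incseq_def by (force simp: Y)
    show "closed (\<Union>n. A \<inter> Y n)" unfolding un by (rule A_closed)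
    fix z
    obtain k \<tau> V where \<tau>: "\<tau> \<in> carried (A \<inter> cell 0 k)" and V: "continuous_on UNIV V"
       "\<forall>y. 0 \<le> V y \<and> V y \<le> 1 \<and> pot \<tau> y = ennreal (V y)" "low \<le> V z"
      using cell_equilibrium[of z] by blast
    obtain n where n: "cell 0 k \<subseteq> Y n" using big[OF compact_imp_bounded[OF cell_compact]] by blast
    have "\<tau> \<in> carried (A \<inter> Y n)"
      by (rule carried_subset[OF \<tau> _ _ compact_imp_closed[OF cpt]]) (use n in \<open>auto intro!: closed_Int A_closed cell_closed\<close>)
    then show "\<exists>n. \<exists>\<tau>\<in>carried (A \<inter> Y n). \<exists>V. continuous_on UNIV V \<and>
       (\<forall>y. 0 \<le> V y \<and> V y \<le> 1 \<and> pot \<tau> y = ennreal (V y)) \<and> low \<le> V z"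
      using V by blast
  qed
  then show ?thesis unfolding un .
qed

end

section \<open>Hausdorff measure and complement of the Cantor sets\<close>

text \<open>The definition asks for infinitely many balls of positive radius. Since `\<phi>` tends to 0,
  superfluous balls can be made to contribute less than any `e`.\<close>

lemma hausdorff_content_finite_cover:
  fixes E :: "'a::euclidean_space set"
  assumes phi: "(\<phi> \<longlongrightarrow> 0) (at_right 0)" and F: "finite F" "E \<subseteq> (\<Union>x\<in>F. ball x r)" and r: "0 < r" "r < \<rho>"
  shows "hausdorff_content \<phi> \<rho> E \<le> of_nat (card F) * \<phi> r"
proof (rule ennreal_le_epsilon)
  fix e :: real assume e: "0 < e"
  have "\<exists>u. 0 < u \<and> u < \<rho> \<and> \<phi> u < ennreal (e * (1 / 2) ^ Suc n)" for n
  proof -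
    have "\<forall>\<^sub>F u in at_right 0. \<phi> u < ennreal (e * (1 / 2) ^ Suc n)"
      using e by (intro order_tendstoD(2)[OF phi]) simp
    moreover have "\<forall>\<^sub>F u in at_right (0::real). 0 < u \<and> u < \<rho>"
      using r by (auto simp: eventually_at_right intro!: exI[of _ \<rho>])
    ultimately have "\<forall>\<^sub>F u in at_right 0. 0 < u \<and> u < \<rho> \<and> \<phi> u < ennreal (e * (1 / 2) ^ Suc n)"
      by eventually_elim auto
    then show ?thesis by (rule eventually_happens'[rotated]) simp
  qed
  then obtain u where u: "\<And>n. 0 < u n" "\<And>n. u n < \<rho>" "\<And>n. \<phi> (u n) < ennreal (e * (1 / 2) ^ Suc n)" by metis
  obtain f where f: "bij_betw f {0..<card F} F" using ex_bij_betw_nat_finite[OF F(1)] by blast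
  define R where "R n = (if n < card F then r else u n)" for n
  have "hausdorff_content \<phi> \<rho> E \<le> (\<Sum>n. \<phi> (R n))"
  proof (rule hausdorff_content_le)
    show "E \<subseteq> (\<Union>n. ball (f n) (R n))"
    proof
      fix y assume "y \<in> E"
      then obtain x where x: "x \<in> F" "y \<in> ball x r" using F(2) by blast
      then have "x \<in> f ` {0..<card F}" using bij_betw_imp_surj_on[OF f] by simp
      then obtain n where "n < card F" "x = f n" by auto
      with x show "y \<in> (\<Union>n. ball (f n) (R n))" by (intro UN_I[of n]) (auto simp: R_def)
    qed
  qed (auto simp: R_def u r)
  also have "\<dots> \<le> (\<Sum>n. (if n < card F then \<phi> r else 0) + ennreal (e * (1 / 2) ^ Suc n))"
    by (intro suminf_le) (use u(3) in \<open>auto simp: R_def intro: less_imp_le\<close>)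
  also have "\<dots> = (\<Sum>n. if n < card F then \<phi> r else 0) + (\<Sum>n. ennreal (e * (1 / 2) ^ Suc n))"
    by (rule suminf_add[symmetric]) auto
  also have "(\<Sum>n. if n < card F then \<phi> r else 0) = (\<Sum>n<card F. if n < card F then \<phi> r else 0)"
    by (rule suminf_finite) auto
  also have "\<dots> = of_nat (card F) * \<phi> r" by simp
  also have "(\<Sum>n. ennreal (e * (1 / 2) ^ Suc n)) = ennreal e"
  proof -
    have "(\<lambda>n. e * (1 / 2) ^ Suc n) sums (e * 1)" by (intro sums_mult power_half_series)
    then show ?thesis using e by (intro suminf_ennreal_eq) auto
  qed
  finally show "hausdorff_content \<phi> \<rho> E \<le> of_nat (card F) * \<phi> r + ennreal e" .
qed

lemma hausdorff_content_UN_null: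
  fixes E :: "nat \<Rightarrow> 'a::euclidean_space set"
  assumes null: "\<And>m. hausdorff_content \<phi> \<rho> (E m) = 0"
  shows "hausdorff_content \<phi> \<rho> (\<Union>m. E m) = 0"
proof -
  have "hausdorff_content \<phi> \<rho> (\<Union>m. E m) \<le> 0"
  proof (rule ennreal_le_epsilon)
    fix e :: real assume e: "0 < e"
    have "\<exists>x :: nat \<Rightarrow> 'a. \<exists>r. (\<forall>n. 0 < r n \<and> r n < \<rho>) \<and> E m \<subseteq> (\<Union>n. ball (x n) (r n)) \<and> (\<Sum>n. \<phi> (r n)) < ennreal (e * (1 / 2) ^ Suc m)" for m
    proof -
      have "hausdorff_content \<phi> \<rho> (E m) < ennreal (e * (1 / 2) ^ Suc m)" using null e by simp
      then show ?thesis by (rule hausdorff_content_lessE) blast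
    qed
    then obtain x :: "nat \<Rightarrow> nat \<Rightarrow> 'a" and r where r: "\<And>m n. 0 < r m n \<and> r m n < \<rho>" "\<And>m. E m \<subseteq> (\<Union>n. ball (x m n) (r m n))"
      "\<And>m. (\<Sum>n. \<phi> (r m n)) < ennreal (e * (1 / 2) ^ Suc m)" by metis
    let ?x = "\<lambda>i. x (fst (prod_decode i)) (snd (prod_decode i))" and ?r = "\<lambda>i. r (fst (prod_decode i)) (snd (prod_decode i))"
    have "hausdorff_content \<phi> \<rho> (\<Union>m. E m) \<le> (\<Sum>i. \<phi> (?r i))"
    proof (rule hausdorff_content_le)
      show "(\<Union>m. E m) \<subseteq> (\<Union>i. ball (?x i) (?r i))"
      proof
        fix y assume "y \<in> (\<Union>m. E m)"
        then obtain m n where "y \<in> ball (x m n) (r m n)" using r(2) by blast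
        then show "y \<in> (\<Union>i. ball (?x i) (?r i))" by (intro UN_I[of "prod_encode (m, n)"]) simp_all
      qed
    qed (use r(1) in auto)
    also have "\<dots> = (\<Sum>m. \<Sum>n. \<phi> (r m n))"
      using suminf_ennreal_2dimen[of "\<lambda>m. \<Sum>n. \<phi> (r m n)" "\<lambda>(m, n). \<phi> (r m n)"] by (simp add: case_prod_beta)
    also have "\<dots> \<le> (\<Sum>m. ennreal (e * (1 / 2) ^ Suc m))" by (intro suminf_le less_imp_le[OF r(3)]) auto
    also have "\<dots> = ennreal e"
    proof -
      have "(\<lambda>n. e * (1 / 2) ^ Suc n) sums (e * 1)" by (intro sums_mult power_half_series)
      then show ?thesis using e by (intro suminf_ennreal_eq) auto
    qed
    finally show "hausdorff_content \<phi> \<rho> (\<Union>m. E m) \<le> 0 + ennreal e" by simp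
  qed
  then show ?thesis by simp
qed

context cantor
begin

text \<open>The indices of the intervals of level `l` inside the interval of level 0 with index `k`.\<close>

primrec descendants :: "int \<Rightarrow> nat \<Rightarrow> int set" where
  "descendants k 0 = {k}"
| "descendants k (Suc l) = (\<Union>k'\<in>descendants k l. child l k')"

lemma card_descendants: "finite (descendants k l) \<and> card (descendants k l) \<le> cnt l"
proof (induction l)
  case (Suc l)
  have "card (\<Union>k'\<in>descendants k l. child l k') \<le> (\<Sum>k'\<in>descendants k l. card (child l k'))"
    using Suc by (intro card_UN_le) simp
  also have "\<dots> = card (descendants k l) * N l" by (simp add: child_def)
  also have "\<dots> \<le> cnt (Suc l)" using Suc by (simp add: cntS)
  finally show ?case using Suc by (auto simp: child_def)
qed (simp add: cnt0)

lemma descendants_cover: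
  assumes "x \<in> J 0 k" "\<And>l. x \<in> C l"
  shows "\<exists>k'\<in>descendants k l. x \<in> J l k'"
proof (induction l)
  case (Suc l)
  then obtain k' where k': "k' \<in> descendants k l" "x \<in> J l k'" by blast
  obtain k'' where k'': "x \<in> J (Suc l) k''" using assms(2)[of "Suc l"] by (auto elim: CE)
  show ?case using child_mem[OF k'(2) k''] k'(1) k'' by auto
qed (use assms in simp)

lemma cell_cover:
  "\<exists>F. finite F \<and> card F \<le> cnt l ^ DIM('a) \<and> A \<inter> cell 0 k \<subseteq> (\<Union>x\<in>F. ball x (2 * real DIM('a) * t l))"
proof -
  let ?P = "PiE (Basis :: 'a set) (\<lambda>b. descendants (k b) l)"
  define c :: "('a \<Rightarrow> int) \<Rightarrow> 'a" where "c \<kappa> = (\<Sum>b\<in>Basis. (real_of_int (\<kappa> b) * s l + t l) *\<^sub>R b)" for \<kappa>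
  have c: "c \<kappa> \<in> cell l \<kappa>" for \<kappa> using tpos[of l] by (simp add: c_def cell_def J_def)
  have fin: "finite ?P" using card_descendants by (intro finite_PiE) auto
  have "card (c ` ?P) \<le> card ?P" by (rule card_image_le[OF fin])
  also have "\<dots> = (\<Prod>b\<in>(Basis::'a set). card (descendants (k b) l))" by (rule card_PiE) simp
  also have "\<dots> \<le> (\<Prod>b\<in>(Basis::'a set). cnt l)" using card_descendants by (intro prod_mono) auto
  also have "\<dots> = cnt l ^ DIM('a)" by simp
  finally have card: "card (c ` ?P) \<le> cnt l ^ DIM('a)" .
  have "A \<inter> cell 0 k \<subseteq> (\<Union>x\<in>c ` ?P. ball x (2 * real DIM('a) * t l))"
  proof
    fix a assume a: "a \<in> A \<inter> cell 0 k"
    have "\<exists>k'\<in>descendants (k b) l. a \<bullet> b \<in> J l k'" if "b \<in> Basis" for b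
      using a that by (intro descendants_cover) (auto simp: A_def cell_def)
    then obtain \<kappa> where \<kappa>: "\<And>b. b \<in> Basis \<Longrightarrow> \<kappa> b \<in> descendants (k b) l \<and> a \<bullet> b \<in> J l (\<kappa> b)" by metis
    let ?\<kappa> = "restrict \<kappa> Basis"
    have "a \<in> cell l ?\<kappa>" using \<kappa> by (auto simp: cell_def)
    then have "dist (c ?\<kappa>) a \<le> real DIM('a) * t l" using c by (intro cell_dist)
    moreover have "0 < real DIM('a) * t l" using tpos[of l] by simp
    ultimately have "a \<in> ball (c ?\<kappa>) (2 * real DIM('a) * t l)" by simp
    moreover have "?\<kappa> \<in> ?P" using \<kappa> by auto
    ultimately show "a \<in> (\<Union>x\<in>c ` ?P. ball x (2 * real DIM('a) * t l))" by blast
  qed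
  then show ?thesis using card fin by (intro exI[of _ "c ` ?P"]) auto
qed

text \<open>The part of the set in one cell of level 0 is covered by `cnt l ^ d` balls of radius `2 d * t l`,
  whose contribution tends to 0. There are countably many cells of level 0.\<close>

theorem hausdorff_null_A:
  assumes phi: "(\<phi> \<longlongrightarrow> 0) (at_right 0)"
    and small: "\<And>l. of_nat (cnt (Suc l) ^ DIM('a)) * \<phi> (2 * real DIM('a) * t (Suc l)) \<le> ennreal ((1 / 2) ^ Suc l)"
  shows "hausdorff_measure \<phi> A = 0"
  unfolding hausdorff_measure_0_iff
proof (intro allI impI)
  fix \<rho> :: real assume \<rho>: "0 < \<rho>"
  have cell0: "hausdorff_content \<phi> \<rho> (A \<inter> cell 0 k) = 0" for k
  proof -
    have ev: "\<forall>\<^sub>F l in sequentially. hausdorff_content \<phi> \<rho> (A \<inter> cell 0 k) \<le> ennreal ((1 / 2) ^ Suc l)"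
    proof -
      have "(\<lambda>l. 2 * real DIM('a) * (1 / 3) ^ Suc l) \<longlonglongrightarrow> 2 * real DIM('a) * 0"
        by (intro tendsto_mult tendsto_const LIMSEQ_Suc LIMSEQ_power_zero) simp
      then have "\<forall>\<^sub>F l in sequentially. 2 * real DIM('a) * (1 / 3) ^ Suc l < \<rho>"
        using \<rho> by (intro order_tendstoD(2)) auto
      then show ?thesis
      proof eventually_elim
        case (elim l)
        have "2 * real DIM('a) * t (Suc l) \<le> 2 * real DIM('a) * (1 / 3) ^ Suc l" by (intro mult_left_mono t_small) simp
        with elim have r: "2 * real DIM('a) * t (Suc l) < \<rho>" by linarith
        obtain F where F: "finite F" "card F \<le> cnt (Suc l) ^ DIM('a)" "A \<inter> cell 0 k \<subseteq> (\<Union>x\<in>F. ball x (2 * real DIM('a) * t (Suc l)))"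
          using cell_cover by blast
        have "hausdorff_content \<phi> \<rho> (A \<inter> cell 0 k) \<le> of_nat (card F) * \<phi> (2 * real DIM('a) * t (Suc l))"
          using tpos[of "Suc l"] by (intro hausdorff_content_finite_cover[OF phi F(1,3)] r) simp
        also have "\<dots> \<le> of_nat (cnt (Suc l) ^ DIM('a)) * \<phi> (2 * real DIM('a) * t (Suc l))"
          using F(2) by (intro mult_right_mono) (simp_all only: of_nat_le_iff zero_le)
        finally show ?case using small[of l] by simp
      qed
    qed
    have "(\<lambda>l. ennreal ((1 / 2) ^ Suc l)) \<longlonglongrightarrow> ennreal 0"
      by (intro tendsto_ennrealI LIMSEQ_Suc LIMSEQ_power_zero) simp
    then have "hausdorff_content \<phi> \<rho> (A \<inter> cell 0 k) \<le> ennreal 0"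
      using ev by (intro tendsto_lowerbound) auto
    then show ?thesis by simp
  qed
  define P where "P = PiE (Basis :: 'a set) (\<lambda>_. UNIV :: int set)"
  have P: "countable P" "P \<noteq> {}" unfolding P_def by (auto intro: countable_PiE simp: PiE_eq_empty_iff)
  have "A \<subseteq> (\<Union>m. A \<inter> cell 0 (from_nat_into P m))"
  proof
    fix a assume a: "a \<in> A"
    then have "\<forall>b\<in>Basis. \<exists>k. a \<bullet> b \<in> J 0 k" by (auto simp: A_def C_def)
    then obtain \<kappa> where "\<And>b. b \<in> Basis \<Longrightarrow> a \<bullet> b \<in> J 0 (\<kappa> b)" by metis
    then have "a \<in> cell 0 (restrict \<kappa> Basis)" by (simp add: cell_def)
    moreover have "restrict \<kappa> Basis \<in> P" by (simp add: P_def)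
    then obtain m where "from_nat_into P m = restrict \<kappa> Basis" using from_nat_into_surj[OF P(1)] by blast
    ultimately show "a \<in> (\<Union>m. A \<inter> cell 0 (from_nat_into P m))" using a by (metis IntI UN_I UNIV_I)
  qed
  then have "A = (\<Union>m. A \<inter> cell 0 (from_nat_into P m))" by blast
  then show "hausdorff_content \<phi> \<rho> A = 0" using hausdorff_content_UN_null[OF cell0] by metis
qed

text \<open>A point outside the set has some coordinate `b` outside the one-dimensional set, which stays there
  while all other coordinates are moved to 0. Now another coordinate is 0, which is outside as
  well, and coordinate `b` can be moved to 0. This needs two coordinates.\<close>

theorem connected_complement_A:
  assumes dim: "2 \<le> DIM('a)" shows "connected (- A)"
proof -
  have seg: "connected_component (- A) x y" if "b \<in> Basis" "x \<bullet> b \<notin> C l" "y \<bullet> b = x \<bullet> b" for x y b l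
    unfolding connected_component_def
  proof (intro exI conjI)
    show "closed_segment x y \<subseteq> - A"
    proof
      fix z assume "z \<in> closed_segment x y"
      then obtain u where "z = (1 - u) *\<^sub>R x + u *\<^sub>R y" by (auto simp: closed_segment_def)
      then have "z \<bullet> b = (1 - u) * (x \<bullet> b) + u * (y \<bullet> b)" by (simp add: inner_add_left)
      also have "\<dots> = x \<bullet> b" unfolding that(3) by (simp add: left_diff_distrib)
      finally have "z \<bullet> b = x \<bullet> b" .
      then show "z \<in> - A" using that(1,2) unfolding A_def by (intro ComplI notI, clarsimp) metis
    qed
  qed (auto intro: connected_segment)
  have z: "(0::real) \<notin> C 0"
  proof
    assume "0 \<in> C 0"
    then obtain k where "0 \<in> J 0 k" by (rule CE)
    then have "real_of_int k * 3 + 1 \<le> 0" "0 \<le> real_of_int k * 3 + 2" by (auto simp: J_def s_def M0 t0)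
    then have "k < 0" "- 1 < k" by linarith+
    then show False by simp
  qed
  have zero: "connected_component (- A) x 0" if x: "x \<in> - A" for x
  proof -
    obtain l b where b: "b \<in> Basis" "x \<bullet> b \<notin> C l" using x by (auto simp: A_def)
    have "\<not> (Basis :: 'a set) \<subseteq> {b}"
    proof
      assume "(Basis :: 'a set) \<subseteq> {b}"
      then have "card (Basis :: 'a set) \<le> card {b}" by (intro card_mono) auto
      then show False using dim by simp
    qed
    then obtain b' :: 'a where b': "b' \<in> Basis" "b' \<noteq> b" by blast
    let ?y = "(x \<bullet> b) *\<^sub>R b"
    have "connected_component (- A) x ?y" by (rule seg[OF b]) (use b in simp)
    also have "connected_component (- A) ?y 0" by (rule seg[OF b'(1), of _ 0]) (use b b' z in \<open>auto simp: inner_Basis\<close>)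
    finally (connected_component_trans) show ?thesis .
  qed
  show ?thesis
    unfolding connected_iff_connected_component
    using zero connected_component_sym connected_component_trans by blast
qed

end

section \<open>Choice of the parameters and conclusion\<close>

text \<open>With `x = R^(\<alpha>/n)` and `y = R^(1 - \<alpha>/n)`, so that `x y = R`, take `M` near `x / 4` and `N` near `R
  / M`. Then `N` lies between `4 y` and `16 y` while `y^n = R^(n - \<alpha>)`. The lower bound absorbs
  the factor 2 and the rounding `N M \<le> 2 R`; the upper bound keeps the covering number under
  control.\<close>

lemma branching_numbers:
  fixes \<alpha> R :: real and n :: nat
  assumes \<alpha>: "0 < \<alpha>" "\<alpha> < real n" and R: "16 powr (real n / \<alpha>) \<le> R"
  obtains N M :: nat where "1 \<le> N" "3 \<le> M" "R \<le> real N * real M"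
    "2 * (real N * real M) powr (real n - \<alpha>) \<le> real N ^ n" "real N ^ n \<le> 16 ^ n * R powr (real n - \<alpha>)"
proof -
  have n: "0 < real n" "1 \<le> n" using \<alpha> by (auto simp: Suc_le_eq)
  have "1 \<le> 16 powr (real n / \<alpha>)" using \<alpha> by (intro ge_one_powr_ge_zero) auto
  then have R1: "1 \<le> R" using R by simp
  define x y where "x = R powr (\<alpha> / real n)" and "y = R powr (1 - \<alpha> / real n)"
  have xy: "x * y = R" using R1 by (simp add: x_def y_def powr_add[symmetric])
  have yn: "y ^ n = R powr (real n - \<alpha>)"
  proof -
    have "y ^ n = y powr real n" using R1 by (simp add: powr_realpow y_def)
    also have "\<dots> = R powr ((1 - \<alpha> / real n) * real n)" by (simp add: y_def powr_powr)
    also have "(1 - \<alpha> / real n) * real n = real n - \<alpha>" using n by (simp add: left_diff_distrib)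
    finally show ?thesis .
  qed
  have "(16 powr (real n / \<alpha>)) powr (\<alpha> / real n) \<le> x"
    unfolding x_def using R \<alpha> by (intro powr_mono2) auto
  then have x16: "16 \<le> x" using \<alpha> n by (simp add: powr_powr)
  have y1: "1 \<le> y" unfolding y_def using R1 \<alpha> n by (intro ge_one_powr_ge_zero) auto
  define M where "M = nat \<lfloor>x / 4\<rfloor>"
  have M: "real M \<le> x / 4" "x / 4 < real M + 1" using x16 unfolding M_def by linarith+
  then have M8: "x / 8 \<le> real M" "3 < real M" using x16 by linarith+
  then have M3: "3 \<le> M" by linarith
  define N where "N = nat \<lceil>R / real M\<rceil>"
  have N: "R / real M \<le> real N" "real N < R / real M + 1"
    using R1 M8 zero_le_divide_iff[of R "real M"] unfolding N_def by linarith+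
  have "x * 1 \<le> x * y" using x16 y1 by (intro mult_left_mono) auto
  then have "real M \<le> R" using M x16 xy by linarith
  then have q1: "1 \<le> R / real M" using M8 by (simp add: le_divide_eq)
  have N1: "1 \<le> N" using N q1 by linarith
  have RNM: "R \<le> real N * real M" using N(1) M8 by (simp add: divide_le_eq)
  have NM2: "real N * real M \<le> 2 * R"
  proof -
    have "real N \<le> 2 * (R / real M)" using N(2) q1 by linarith
    then have "real N * real M \<le> 2 * (R / real M) * real M" by (rule mult_right_mono) simp
    then show ?thesis using M8 by simp
  qed
  have y4: "4 * y \<le> real N"
  proof -
    have "4 * y = R / (x / 4)" using x16 by (simp add: xy[symmetric])
    also have "\<dots> \<le> R / real M" using M M8 R1 by (intro divide_left_mono) auto
    finally show ?thesis using N(1) by simp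
  qed
  have y16: "real N \<le> 16 * y"
  proof -
    have "R / real M \<le> R / (x / 8)" using M8 R1 x16 by (intro divide_left_mono) auto
    also have "\<dots> = 8 * y" using x16 by (simp add: xy[symmetric])
    finally show ?thesis using N(2) q1 by linarith
  qed
  have "real N ^ n \<le> (16 * y) ^ n" using y16 by (intro power_mono) auto
  then have up: "real N ^ n \<le> 16 ^ n * R powr (real n - \<alpha>)" by (simp add: power_mult_distrib yn)
  have "2 * (real N * real M) powr (real n - \<alpha>) \<le> 2 * (2 * R) powr (real n - \<alpha>)"
    using NM2 \<alpha> by (intro mult_left_mono powr_mono2) auto
  also have "\<dots> = 2 * 2 powr (real n - \<alpha>) * y ^ n" using R1 by (simp add: powr_mult yn)
  also have "\<dots> \<le> 4 ^ n * y ^ n"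
  proof (rule mult_right_mono)
    have "2 powr (real n - \<alpha>) \<le> 2 powr real n" using \<alpha> by (intro powr_mono) auto
    then have "2 powr (real n - \<alpha>) \<le> 2 ^ n" by (simp add: powr_realpow)
    moreover have "(2::real) ^ 1 \<le> 2 ^ n" using n by (intro power_increasing) auto
    ultimately have "2 * 2 powr (real n - \<alpha>) \<le> 2 ^ n * 2 ^ n" by (intro mult_mono) auto
    then show "2 * 2 powr (real n - \<alpha>) \<le> 4 ^ n" by (simp add: power_mult_distrib[symmetric])
  qed (use y1 in simp)
  also have "\<dots> = (4 * y) ^ n" by (simp add: power_mult_distrib)
  also have "\<dots> \<le> real N ^ n" using y4 y1 by (intro power_mono) auto
  finally show ?thesis using that N1 M3 RNM up by blast
qed

lemma Liminf_zero_small: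
  fixes f :: "real \<Rightarrow> ennreal"
  assumes "Liminf (at_right 0) f = 0" "0 < \<eta>" "0 < \<delta>"
  obtains r where "0 < r" "r < \<delta>" "f r < \<eta>"
proof -
  have "\<exists>r. 0 < r \<and> r < \<delta> \<and> f r < \<eta>"
  proof (rule ccontr)
    assume *: "\<nexists>r. 0 < r \<and> r < \<delta> \<and> f r < \<eta>"
    have "\<forall>\<^sub>F r in at_right 0. \<eta> \<le> f r"
      unfolding eventually_at_right[OF zero_less_one] using * assms(3) by (intro exI[of _ \<delta>]) (simp add: not_less, metis not_le)
    then have "\<eta> \<le> Liminf (at_right 0) f" by (rule Liminf_bounded)
    then show False using assms by simp
  qed
  then show ?thesis using that by blast
qed

context riesz
begin

text \<open>The radius `r` is chosen with `\<phi> r` tiny compared with `r^(d - \<alpha>)`, and the next level is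
  made so fine that its covering radius is at most `r`. The number of cells is then at most a
  constant times `r^(\<alpha> - d)`. The constants depend on the levels already constructed, which are
  fixed before `r` is chosen.\<close>

lemma scale_step:
  assumes phi: "measure_function \<phi>" "Liminf (at_right 0) (\<lambda>t. \<phi> t * ennreal (t powr (\<alpha> - real DIM('a)))) = 0"
    and t: "0 < t" and c: "0 < c" and e: "0 < \<epsilon>"
  shows "\<exists>N M. 1 \<le> N \<and> 3 \<le> M \<and> 2 * (real N * real M) powr (real DIM('a) - \<alpha>) \<le> real N ^ DIM('a) \<and>
    of_nat ((c * N) ^ DIM('a)) * \<phi> (2 * real DIM('a) * (t / (real N * real M))) \<le> ennreal \<epsilon>"
proof -
  define D where "D = 2 * real DIM('a) * t"
  have D: "0 < D" using t by (simp add: D_def)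
  define K where "K = real c ^ DIM('a) * 16 ^ DIM('a) * D powr (real DIM('a) - \<alpha>)"
  have K: "0 < K" using c D by (simp add: K_def)
  have B: "0 < D / 16 powr (real DIM('a) / \<alpha>)" using D by simp
  have "0 < ennreal (\<epsilon> / K)" using e K by simp
  from Liminf_zero_small[OF phi(2) this B] obtain r
    where r: "0 < r" "r < D / 16 powr (real DIM('a) / \<alpha>)" "\<phi> r * ennreal (r powr (\<alpha> - real DIM('a))) < ennreal (\<epsilon> / K)" by blast
  have "16 powr (real DIM('a) / \<alpha>) \<le> D / r" using r by (simp add: less_divide_eq le_divide_eq mult.commute)
  from branching_numbers[OF alpha_pos alpha_dim this] obtain N M :: nat where NM: "1 \<le> N" "3 \<le> M" "D / r \<le> real N * real M"
    "2 * (real N * real M) powr (real DIM('a) - \<alpha>) \<le> real N ^ DIM('a)"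
    "real N ^ DIM('a) \<le> 16 ^ DIM('a) * (D / r) powr (real DIM('a) - \<alpha>)" by blast
  have pos: "0 < real N * real M" using NM by simp
  have small: "2 * real DIM('a) * (t / (real N * real M)) \<le> r" "0 < 2 * real DIM('a) * (t / (real N * real M))"
    using NM(3) pos r t by (simp_all add: D_def divide_le_eq mult.commute)
  have "of_nat ((c * N) ^ DIM('a)) * \<phi> (2 * real DIM('a) * (t / (real N * real M))) \<le> of_nat ((c * N) ^ DIM('a)) * \<phi> r"
    using phi(1) small r by (intro mult_left_mono) (auto simp: measure_function_def mono_on_def)
  also have "\<dots> \<le> ennreal (K * r powr (\<alpha> - real DIM('a))) * \<phi> r"
  proof (rule mult_right_mono)
    have "(real c * real N) ^ DIM('a) \<le> real c ^ DIM('a) * (16 ^ DIM('a) * (D / r) powr (real DIM('a) - \<alpha>))"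
      unfolding power_mult_distrib using NM(5) by (intro mult_left_mono) auto
    also have "(D / r) powr (real DIM('a) - \<alpha>) = D powr (real DIM('a) - \<alpha>) * r powr (\<alpha> - real DIM('a))"
      using D r powr_minus_divide[of r "real DIM('a) - \<alpha>"] by (simp add: powr_divide)
    finally have "real ((c * N) ^ DIM('a)) \<le> K * r powr (\<alpha> - real DIM('a))" by (simp add: K_def mult.assoc)
    then show "of_nat ((c * N) ^ DIM('a)) \<le> ennreal (K * r powr (\<alpha> - real DIM('a)))"
      unfolding ennreal_of_nat_eq_real_of_nat by (rule ennreal_leI)
  qed simp
  also have "\<dots> = ennreal K * (\<phi> r * ennreal (r powr (\<alpha> - real DIM('a))))" using K by (simp add: ennreal_mult ac_simps)
  also have "\<dots> \<le> ennreal K * ennreal (\<epsilon> / K)" using r(3) by (intro mult_left_mono) auto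
  also have "\<dots> = ennreal \<epsilon>" using K e by (simp add: ennreal_mult[symmetric])
  finally show ?thesis using NM by blast
qed

text \<open>The numbers of each level depend on the preceding levels; `scale_step` is iterated with error
  `(1/2)^(l + 1)` at level `l`.\<close>

theorem exists_null_unavoidable:
  assumes phi: "measure_function \<phi>" "Liminf (at_right 0) (\<lambda>t. \<phi> t * ennreal (t powr (\<alpha> - real DIM('a)))) = 0"
  obtains A :: "'a set" where "closed A" "2 \<le> DIM('a) \<Longrightarrow> connected (- A)" "hausdorff_measure \<phi> A = 0"
    "\<And>x. emeasure (swept_measure \<alpha> x A) UNIV = 1"
proof -
  define good where "good t c l NM \<longleftrightarrow> 1 \<le> fst NM \<and> 3 \<le> snd NM \<and>
      2 * (real (fst NM) * real (snd NM)) powr (real DIM('a) - \<alpha>) \<le> real (fst NM) ^ DIM('a) \<and>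
      of_nat ((c * fst NM) ^ DIM('a)) * \<phi> (2 * real DIM('a) * (t / (real (fst NM) * real (snd NM)))) \<le> ennreal ((1 / 2) ^ Suc l)"
    for t :: real and c l :: nat and NM :: "nat \<times> nat"
  define f where "f t c l = (SOME NM. good t c l NM)" for t c l
  have f: "good t c l (f t c l)" if "0 < t" "0 < c" for t c l
    unfolding f_def
  proof (rule someI_ex)
    have "0 < (1 / 2 :: real) ^ Suc l" by simp
    from scale_step[OF phi that this] show "\<exists>NM. good t c l NM" by (auto simp: good_def)
  qed
  \<comment> \<open>The state consists of the current length `t l` and count `cnt l`.\<close>
  define st where "st = rec_nat (1 :: real, 1 :: nat)
    (\<lambda>l (t, c). (t / (real (fst (f t c l)) * real (snd (f t c l))), c * fst (f t c l)))"
  define t c where "t l = fst (st l)" and "c l = snd (st l)" for l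
  define N where "N l = fst (f (t l) (c l) l)" for l
  define M where "M l = (case l of 0 \<Rightarrow> 3 | Suc l' \<Rightarrow> snd (f (t l') (c l') l'))" for l
  have tc0: "t 0 = 1" "c 0 = 1" by (simp_all add: t_def c_def st_def)
  have tS: "t (Suc l) = t l / (real (N l) * real (M (Suc l)))" and cS: "c (Suc l) = c l * N l" for l
    by (simp_all add: t_def c_def st_def N_def M_def split_beta)
  have pos: "0 < t l \<and> 0 < c l" for l
  proof (induction l)
    case (Suc l)
    then have "good (t l) (c l) l (f (t l) (c l) l)" by (intro f) auto
    then have "1 \<le> N l" "3 \<le> M (Suc l)" by (auto simp: good_def N_def M_def)
    then show ?case using Suc by (simp add: tS cS)
  qed (simp add: tc0)
  have good: "good (t l) (c l) l (N l, M (Suc l))" for l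
    using f[of "t l" "c l" l] pos[of l] by (simp add: N_def M_def)
  interpret K: cantor \<alpha> TA N M t c
  proof
    show "3 \<le> M l" for l using good[of "l - 1"] by (cases l) (auto simp: good_def M_def)
    show "M 0 = 3" by (simp add: M_def)
    show "1 \<le> N l" "2 * (real (N l) * real (M (Suc l))) powr (real DIM('a) - \<alpha>) \<le> real (N l) ^ DIM('a)" for l
      using good[of l] by (auto simp: good_def)
  qed (rule tc0 tS cS)+
  have "(\<phi> \<longlongrightarrow> 0) (at_right 0)" using phi(1) by (simp add: measure_function_def)
  moreover have "of_nat (c (Suc l) ^ DIM('a)) * \<phi> (2 * real DIM('a) * t (Suc l)) \<le> ennreal ((1 / 2) ^ Suc l)" for l
    using good[of l] unfolding good_def fst_conv snd_conv cS tS by blast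
  ultimately have "hausdorff_measure \<phi> K.A = 0" by (rule K.hausdorff_null_A)
  with K.A_closed K.connected_complement_A show ?thesis using K.swept_mass_A by (rule that)
qed

text \<open>If the lower limit is positive, then `t^(d - \<alpha>)` is dominated by a multiple of `\<phi>` near 0. A
  `\<phi>`-null set is then null in dimension `d - \<alpha>`, and such sets have swept mass 0 somewhere.\<close>

theorem null_unavoidable_imp_Liminf:
  fixes A :: "'a set"
  assumes A: "closed A" "\<And>x. emeasure (swept_measure \<alpha> x A) UNIV = 1" and null: "hausdorff_measure \<phi> A = 0"
  shows "Liminf (at_right 0) (\<lambda>t. \<phi> t * ennreal (t powr (\<alpha> - real DIM('a)))) = 0"
proof (rule ccontr)
  let ?L = "Liminf (at_right 0) (\<lambda>t. \<phi> t * ennreal (t powr (\<alpha> - real DIM('a))))"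
  assume "?L \<noteq> 0"
  then have "0 < ?L" by (simp add: zero_less_iff_neq_zero)
  then obtain y where y: "0 < y" "y < ?L" using dense by blast
  then have "y < top" by (meson less_le_trans top_greatest)
  define C where "C = enn2real y"
  have C: "y = ennreal C" "0 < C" using y \<open>y < top\<close> by (auto simp: C_def enn2real_positive_iff)
  have "\<forall>\<^sub>F t in at_right 0. y < \<phi> t * ennreal (t powr (\<alpha> - real DIM('a)))" using y(2) by (rule less_LiminfD)
  then obtain t0 where t0: "0 < t0" "\<And>t. 0 < t \<Longrightarrow> t < t0 \<Longrightarrow> y < \<phi> t * ennreal (t powr (\<alpha> - real DIM('a)))"
    unfolding eventually_at_right[OF zero_less_one] by blast
  have "hausdorff_measure (\<lambda>t. ennreal (t powr (real DIM('a) - \<alpha>))) A = 0"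
  proof (rule hausdorff_null_transfer[OF null _ t0(1)])
    show "0 < 1 / C" using C by simp
    fix t assume t: "0 < t" "t < t0"
    let ?q = "t powr (real DIM('a) - \<alpha>)"
    have "ennreal ?q = ennreal (1 / C) * (y * ennreal ?q)"
      using C by (simp add: ennreal_mult[symmetric])
    also have "\<dots> \<le> ennreal (1 / C) * (\<phi> t * ennreal (t powr (\<alpha> - real DIM('a))) * ennreal ?q)"
      using t0(2)[OF t] by (intro mult_left_mono mult_right_mono) auto
    also have "\<phi> t * ennreal (t powr (\<alpha> - real DIM('a))) * ennreal ?q = \<phi> t"
      using t by (simp add: mult.assoc ennreal_mult[symmetric] powr_add[symmetric])
    finally show "ennreal ?q \<le> ennreal (1 / C) * \<phi> t" .
  qed
  then show False using unavoidable_imp_not_null[OF A] by simp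
qed

text \<open>The first part is applied to `t^(d - \<alpha>)` divided by `1 + max 0 (- ln t)`: the logarithm makes the
  lower limit zero, yet it is too weak to be felt by any exponent above `d - \<alpha>`. Exponents below
  `d - \<alpha>` are excluded, since an unavoidable set is not null in dimension `d - \<alpha>`.\<close>

theorem exists_unavoidable_critical_dimension:
  obtains A :: "'a set" where "closed A" "2 \<le> DIM('a) \<Longrightarrow> connected (- A)" "hausdorff_dimension A = real DIM('a) - \<alpha>"
    "\<And>x. emeasure (swept_measure \<alpha> x A) UNIV = 1"
proof -
  let ?p = "real DIM('a) - \<alpha>"
  have p: "0 < ?p" using alpha_dim by simp
  define lam where "lam t = 1 + max 0 (- ln t)" for t :: real
  have lam1: "1 \<le> lam t" for t by (simp add: lam_def)
  define \<phi> where "\<phi> t = ennreal (t powr ?p / lam t)" for t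
  have mf: "measure_function \<phi>"
    unfolding measure_function_def
  proof (intro conjI allI impI)
    show "mono_on {0<..} \<phi>"
    proof (rule mono_onI)
      fix r s :: real assume rs: "r \<in> {0<..}" "s \<in> {0<..}" "r \<le> s"
      have "r powr ?p / lam r \<le> s powr ?p / lam s"
      proof (rule frac_le)
        show "r powr ?p \<le> s powr ?p" using rs p by (intro powr_mono2) auto
        show "0 < lam s" using lam1[of s] by simp
        have "ln r \<le> ln s" using rs by (subst ln_le_cancel_iff) auto
        then show "lam s \<le> lam r" unfolding lam_def by linarith
      qed simp
      then show "\<phi> r \<le> \<phi> s" unfolding \<phi>_def by (rule ennreal_leI)
    qed
    show "0 < \<phi> t" if "0 < t" for t
      using that less_le_trans[OF zero_less_one lam1[of t]] by (simp add: \<phi>_def)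
    have "((\<lambda>t::real. t powr ?p) \<longlongrightarrow> 0 powr ?p) (at_right 0)"
      using p by (intro tendsto_powr2 tendsto_intros) (auto simp: eventually_at_right_less intro!: eventually_at_rightI[of 0 1])
    then have "((\<lambda>t. ennreal (t powr ?p)) \<longlongrightarrow> 0) (at_right 0)"
      using tendsto_ennrealI by fastforce
    then show "(\<phi> \<longlongrightarrow> 0) (at_right 0)"
    proof (rule tendsto_sandwich[OF _ _ tendsto_const, rotated 2])
      show "\<forall>\<^sub>F t in at_right 0. \<phi> t \<le> ennreal (t powr ?p)"
      proof (rule always_eventually, intro allI)
        fix t :: real
        have "t powr ?p / lam t \<le> t powr ?p / 1" using lam1[of t] by (intro divide_left_mono) auto
        then show "\<phi> t \<le> ennreal (t powr ?p)" unfolding \<phi>_def by (intro ennreal_leI) simp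
      qed
    qed simp
  qed
  have liminf: "Liminf (at_right 0) (\<lambda>t. \<phi> t * ennreal (t powr (\<alpha> - real DIM('a)))) = 0"
  proof (rule lim_imp_Liminf)
    have "filterlim (\<lambda>t::real. - ln t) at_top (at_right 0)"
      by (rule filterlim_compose[OF filterlim_uminus_at_top_at_bot ln_at_0])
    then have "filterlim lam at_top (at_right 0)"
      by (rule filterlim_at_top_mono) (auto simp: lam_def intro!: always_eventually)
    then have "((\<lambda>t. inverse (lam t)) \<longlongrightarrow> 0) (at_right 0)" by (rule tendsto_inverse_0_at_top)
    then have "((\<lambda>t. ennreal (inverse (lam t))) \<longlongrightarrow> 0) (at_right 0)" using tendsto_ennrealI by fastforce
    moreover have "\<forall>\<^sub>F t in at_right 0. ennreal (inverse (lam t)) = \<phi> t * ennreal (t powr (\<alpha> - real DIM('a)))"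
    proof (rule eventually_at_rightI[of 0 1])
      fix t :: real assume "t \<in> {0<..<1}"
      then have "t powr ?p / lam t * t powr (\<alpha> - real DIM('a)) = inverse (lam t)"
        by (simp add: powr_add[symmetric] inverse_eq_divide)
      then show "ennreal (inverse (lam t)) = \<phi> t * ennreal (t powr (\<alpha> - real DIM('a)))"
        unfolding \<phi>_def using lam1[of t] by (subst ennreal_mult[symmetric]) auto
    qed simp
    ultimately show "((\<lambda>t. \<phi> t * ennreal (t powr (\<alpha> - real DIM('a)))) \<longlongrightarrow> 0) (at_right 0)"
      by (rule Lim_transform_eventually)
  qed simp
  obtain A :: "'a set" where A: "closed A" "2 \<le> DIM('a) \<Longrightarrow> connected (- A)" "hausdorff_measure \<phi> A = 0"
    "\<And>x. emeasure (swept_measure \<alpha> x A) UNIV = 1" by (rule exists_null_unavoidable[OF mf liminf]) (rule that)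
  define G where "G = {\<gamma>. 0 < \<gamma> \<and> hausdorff_measure (\<lambda>t. ennreal (t powr \<gamma>)) A < \<infinity>}"
  have above: "\<gamma> \<in> G" if g: "?p < \<gamma>" for \<gamma>
  proof -
    define \<delta> where "\<delta> = \<gamma> - ?p"
    have d: "0 < \<delta>" using g by (simp add: \<delta>_def)
    have "hausdorff_measure (\<lambda>t. ennreal (t powr \<gamma>)) A = 0"
    proof (rule hausdorff_null_transfer[OF A(3) _ zero_less_one])
      show "0 < 1 + 1 / \<delta>" using d by (simp add: add_pos_pos)
      fix t :: real assume t: "0 < t" "t < 1"
      have "- ln t * \<delta> = ln (t powr (- \<delta>))" using t by (simp add: ln_powr)
      also have "\<dots> \<le> t powr (- \<delta>)" using t ln_le_minus_one[of "t powr (- \<delta>)"] by simp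
      \<comment> \<open>The logarithm is dominated by every negative power.\<close>
      finally have l: "- ln t \<le> t powr (- \<delta>) / \<delta>" using d by (simp add: le_divide_eq)
      have "t powr \<delta> * lam t = t powr \<delta> + t powr \<delta> * (- ln t)" using t by (simp add: lam_def right_diff_distrib)
      also have "\<dots> \<le> t powr \<delta> + t powr \<delta> * (t powr (- \<delta>) / \<delta>)" using l by (intro add_left_mono mult_left_mono) auto
      also have "t powr \<delta> * (t powr (- \<delta>) / \<delta>) = 1 / \<delta>" using t by (simp add: powr_add[symmetric])
      also have "t powr \<delta> \<le> 1 powr \<delta>" using t d by (intro powr_mono2) auto
      finally have b: "t powr \<delta> * lam t \<le> 1 + 1 / \<delta>" by simp
      have "t powr \<gamma> = (t powr \<delta> * lam t) * (t powr ?p / lam t)"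
        using less_le_trans[OF zero_less_one lam1[of t]] by (simp add: \<delta>_def powr_add[symmetric])
      also have "\<dots> \<le> (1 + 1 / \<delta>) * (t powr ?p / lam t)" using b lam1[of t] by (intro mult_right_mono) auto
      finally have "ennreal (t powr \<gamma>) \<le> ennreal ((1 + 1 / \<delta>) * (t powr ?p / lam t))" by (rule ennreal_leI)
      also have "\<dots> = ennreal (1 + 1 / \<delta>) * \<phi> t"
        unfolding \<phi>_def using d lam1[of t] by (intro ennreal_mult) auto
      finally show "ennreal (t powr \<gamma>) \<le> ennreal (1 + 1 / \<delta>) * \<phi> t" .
    qed
    then show ?thesis using g p by (simp add: G_def)
  qed
  have below: "?p \<le> \<gamma>" if "\<gamma> \<in> G" for \<gamma>
  proof (rule ccontr)
    assume "\<not> ?p \<le> \<gamma>"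
    then have "hausdorff_measure (\<lambda>t. ennreal (t powr ?p)) A = 0"
      using that by (intro hausdorff_measure_powr_null[of \<gamma>]) (auto simp: G_def)
    then show False using unavoidable_imp_not_null[OF A(1,4)] by simp
  qed
  have "Inf G = ?p"
  proof (rule antisym)
    show "Inf G \<le> ?p"
    proof (rule dense_ge)
      fix \<gamma> assume "?p < \<gamma>"
      then show "Inf G \<le> \<gamma>" using below by (intro cInf_lower above bdd_belowI)
    qed
    show "?p \<le> Inf G" using above[of "?p + 1"] below by (intro cInf_greatest) auto
  qed
  then have "hausdorff_dimension A = ?p" by (simp add: hausdorff_dimension_def G_def)
  with A(1,2) show ?thesis using A(4) by (rule that)
qed

end

theorem theorem4p1:
  fixes \<alpha> :: real
  assumes "0 < \<alpha>" and "\<alpha> < min (real DIM('a::euclidean_space)) 2"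
  shows "(\<forall>\<phi>. measure_function \<phi> \<longrightarrow>
            (Liminf (at_right 0) (\<lambda>t. \<phi> t * ennreal (t powr (\<alpha> - real DIM('a)))) = 0
             \<longleftrightarrow>
             (\<exists>A :: 'a set. closed A \<and> (2 \<le> DIM('a) \<longrightarrow> connected (- A)) \<and>
                hausdorff_measure \<phi> A = 0 \<and>
                (\<forall>x. emeasure (swept_measure \<alpha> x A) UNIV = 1))))
         \<and>
         (\<exists>A :: 'a set. closed A \<and> (2 \<le> DIM('a) \<longrightarrow> connected (- A)) \<and>
            hausdorff_dimension A = real DIM('a) - \<alpha> \<and>
            (\<forall>x. emeasure (swept_measure \<alpha> x A) UNIV = 1))"
proof -
  interpret riesz \<alpha> "TYPE('a)" by unfold_locales (use assms in auto)
  show ?thesis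
  proof (intro conjI allI impI iffI)
    fix \<phi> assume mf: "measure_function \<phi>"
    show "\<exists>A :: 'a set. closed A \<and> (2 \<le> DIM('a) \<longrightarrow> connected (- A)) \<and> hausdorff_measure \<phi> A = 0 \<and>
        (\<forall>x. emeasure (swept_measure \<alpha> x A) UNIV = 1)"
      if "Liminf (at_right 0) (\<lambda>t. \<phi> t * ennreal (t powr (\<alpha> - real DIM('a)))) = 0"
      using exists_null_unavoidable[OF mf that] by metis
    show "Liminf (at_right 0) (\<lambda>t. \<phi> t * ennreal (t powr (\<alpha> - real DIM('a)))) = 0"
      if "\<exists>A :: 'a set. closed A \<and> (2 \<le> DIM('a) \<longrightarrow> connected (- A)) \<and> hausdorff_measure \<phi> A = 0 \<and>
        (\<forall>x. emeasure (swept_measure \<alpha> x A) UNIV = 1)"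
      using that null_unavoidable_imp_Liminf by blast
  next
    show "\<exists>A :: 'a set. closed A \<and> (2 \<le> DIM('a) \<longrightarrow> connected (- A)) \<and> hausdorff_dimension A = real DIM('a) - \<alpha> \<and>
        (\<forall>x. emeasure (swept_measure \<alpha> x A) UNIV = 1)"
      using exists_unavoidable_critical_dimension by metis
  qed
qed

end
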